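(* Consider the factor model $X=\Lambda^0F^{0\top}+E$ with principal components (PC) estimators $\hat\lambda_i,\hat f_t,\hat m_{it}$ and matching matrix $H$ as defined in the context. Assume: (A) (i) $T^{-1}\sum_{t=1}^T f_t^0f_t^{0\top}\to_p\Sigma_F$ with $\Sigma_F$ an $r\times r$ positive definite matrix; (ii) $N^{-\alpha}\sum_{i=1}^N\lambda_i^0\lambda_i^{0\top}\to\Sigma_\Lambda$ for some $\alpha\in(0,1]$ with $\Sigma_\Lambda$ an $r\times r$ positive definite matrix; (iii) the eigenvalues of $\Sigma_\Lambda\Sigma_F$ are distinct; (iv) for some constant $C>0$, $\mathbb E\|f_t^0\|^2\le C$ for all $t$, and there is a constant $C'>0$ such that for each $i$ there is a parameter $\alpha_i\le1$ with $\|\lambda_i^0\|\le C'N^{(\alpha_i-1)/2}$. (B) (i) $\mathbb E[\epsilon_{it}\mid M^0]=0$ and $\mathbb E[\epsilon_{it}^2\mid M^0]=\mathbb E[\epsilon_{it}^2]\le C$ for some constant $C>0$, and $(\epsilon_{it})_{i\le N,t\le T}$ is independent across $i$ and $t$; (ii) with probability converging to 1, $\|E\|\lesssim\max\{\sqrt N,\sqrt T\}$. If $\max\{N,T\}=o(N^\alpha T)$, then for each $i$ and $t$, as $N,T\to\infty$, $$\|\hat f_t-H^\top f_t^0\|=O_p\Big(\frac1{\sqrt{N^\alpha}}+\frac{\max\{N,T\}}{N^\alpha T}\Big),$$ $$\|\hat\lambda_i-H^{-1}\lambda_i^0\|=O_p\Big(\frac1{\sqrt T}+\sqrt{\frac{N^{\alpha_i}}{N}}\,\frac{\max\{N,T\}}{N^\alpha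 T}\Big),$$ $$|\hat m_{it}-m_{it}^0|=O_p\Big(\frac1{\sqrt T}+\sqrt{\frac{N^{\alpha_i}}{N}}\frac1{\sqrt{N^\alpha}}+\sqrt{\frac{N^{\alpha_i}}{N}}\frac{\max\{N,T\}}{N^\alpha T}+\frac{\max\{\sqrt N,\sqrt T\}}{\sqrt{N^\alpha}\,T}\Big).$$
   Context: Asymptotics are as $N,T\to\infty$ jointly; the number of factors $r$ is fixed. $\|\cdot\|$ is the spectral norm of matrices and the $\ell_2$ norm of vectors; $a\lesssim b$ means $|a|\le C|b|$ for a constant $C>0$. Model: $x_{it}=\lambda_i^{0\top}f_t^0+\epsilon_{it}$, $1\le i\le N$, $1\le t\le T$, i.e. $X=\Lambda^0F^{0\top}+E$ with $X=(x_{it})$, $E=(\epsilon_{it})\in\mathbb R^{N\times T}$, $\Lambda^0=(\lambda_1^0,\dots,\lambda_N^0)^\top\in\mathbb R^{N\times r}$, $F^0=(f_1^0,\dots,f_T^0)^\top\in\mathbb R^{T\times r}$, $M^0=(m^0_{it})=\Lambda^0F^{0\top}$. PC estimator: let $U_rD_rV_r^\top$ be the top-$r$ part of the singular value decomposition of $X$ ($D_r$ diagonal with the $r$ largest singular values in decreasing order, $U_r,V_r$ the corresponding left and right singular vectors). Put $\hat\Lambda=T^{-1/2}U_rD_r$ and $\hat F=\sqrt T\,V_r$; $\hat\lambda_i^\top$ is the $i$-th row of $\hat\Lambda$, $\hat f_t^\top$ the $t$-th row of $\hat F$, and $\hat m_{it}=\hat\lambda_i^\top\hat f_t$. Matching matrix: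 let $Y_r=U_rD_r^{1/2}$, $Z_r=V_rD_r^{1/2}$. Let $M^0=U_r^0D_r^0V_r^{0\top}$ be the reduced SVD, $Y_r^0=U_r^0(D_r^0)^{1/2}$, $Z_r^0=V_r^0(D_r^0)^{1/2}$. Let $H^0\in\mathbb R^{r\times r}$ be the invertible matrix with $F^0=T^{1/2}Z_r^0H^0$ and $\Lambda^0=T^{-1/2}Y_r^0(H^0)^{-\top}$. Let $O=\arg\min_{R}\left\|\begin{bmatrix}Y_r\\Z_r\end{bmatrix}R-\begin{bmatrix}Y_r^0\\Z_r^0\end{bmatrix}\right\|_{\rm F}^2$ over $r\times r$ orthogonal matrices $R$. Then $H=(D_r^{1/2}OH^0)^{-1}$.
   Formalization: The independence of the errors across i and t is assumed conditionally on M^0, like the moments in (B)(i); with unconditional independence only, the claim fails (r=1, N=T, lambda_i=1, random-sign errors, f_t = 2 + eps_1t eps_11). *)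

theory Defs
  imports
    "HOL-Probability.Probability"
    "HOL-Library.Landau_Symbols"
    "Jordan_Normal_Form.Char_Poly"
    "Jordan_Normal_Form.Gauss_Jordan_Elimination"
begin

definition vnorm :: "real vec \<Rightarrow> real" where
  "vnorm v = sqrt (scalar_prod v v)"

definition spectral_norm :: "real mat \<Rightarrow> real" where
  "spectral_norm A =
     (SUP v\<in>{v \<in> carrier_vec (dim_col A). vnorm v \<le> 1}. vnorm (A *\<^sub>v v))"

definition frob_norm_sq :: "real mat \<Rightarrow> real" where
  "frob_norm_sq A = (\<Sum>i<dim_row A. \<Sum>j<dim_col A. (A $$ (i, j))\<^sup>2)"

definition pos_def_mat :: "nat \<Rightarrow> real mat \<Rightarrow> bool" where
  "pos_def_mat r A \<longleftrightarrow> A \<in> carrier_mat r r \<and> A\<^sup>T = A \<and>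
     (\<forall>v\<in>carrier_vec r. v \<noteq> 0\<^sub>v r \<longrightarrow> 0 < scalar_prod v (A *\<^sub>v v))"

definition orthogonal_matrices :: "nat \<Rightarrow> real mat set" where
  "orthogonal_matrices n = {Q \<in> carrier_mat n n. Q\<^sup>T * Q = 1\<^sub>m n \<and> Q * Q\<^sup>T = 1\<^sub>m n}"

(* The value is unspecified if A is not invertible. *)
definition mat_inv :: "real mat \<Rightarrow> real mat" where
  "mat_inv A = the (mat_inverse A)"

definition is_svd :: "nat \<Rightarrow> nat \<Rightarrow> real mat \<Rightarrow> real mat \<Rightarrow> real mat \<Rightarrow> real mat \<Rightarrow> bool" where
  "is_svd n m A P S Q \<longleftrightarrow>
     P \<in> orthogonal_matrices n \<and> Q \<in> orthogonal_matrices m \<and> S \<in> carrier_mat n m \<and>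
     (\<forall>i<n. \<forall>j<m. i \<noteq> j \<longrightarrow> S $$ (i, j) = 0) \<and>
     (\<forall>i<min n m. 0 \<le> S $$ (i, i)) \<and>
     (\<forall>i j. i \<le> j \<and> j < min n m \<longrightarrow> S $$ (j, j) \<le> S $$ (i, i)) \<and>
     A = P * S * Q\<^sup>T"

(* (U, D, V) is the top-r part of some singular value decomposition of A; singular vectors
   are not unique, so this is a relation. If A has rank r, then A = U * D * V\<^sup>T is
   a reduced singular value decomposition of A. *)
definition top_svd ::
  "nat \<Rightarrow> nat \<Rightarrow> nat \<Rightarrow> real mat \<Rightarrow> real mat \<Rightarrow> real mat \<Rightarrow> real mat \<Rightarrow> bool" where
  "top_svd n m r A U D V \<longleftrightarrow> r \<le> n \<and> r \<le> m \<and>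
     (\<exists>P S Q. is_svd n m A P S Q \<and>
        U = Matrix.mat n r (\<lambda>(i, k). P $$ (i, k)) \<and>
        D = Matrix.mat r r (\<lambda>(k, l). S $$ (k, l)) \<and>
        V = Matrix.mat m r (\<lambda>(t, k). Q $$ (t, k)))"

(* Only applied to nonnegative diagonal matrices; the entrywise root is then the matrix root. *)
abbreviation diag_sqrt :: "real mat \<Rightarrow> real mat" where
  "diag_sqrt D \<equiv> map_mat sqrt D"

definition procrustes_minimizer ::
  "nat \<Rightarrow> real mat \<Rightarrow> real mat \<Rightarrow> real mat \<Rightarrow> real mat \<Rightarrow> real mat \<Rightarrow> bool" where
  "procrustes_minimizer r Y Z Y0 Z0 R \<longleftrightarrow>
     is_arg_min (\<lambda>R. frob_norm_sq ((Y @\<^sub>r Z) * R - (Y0 @\<^sub>r Z0)))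
       (\<lambda>R. R \<in> orthogonal_matrices r) R"

(* The matrix exists and is unique precisely when L * F\<^sup>T has rank r, where Y0 and Z0 come
   from a reduced singular value decomposition of L * F\<^sup>T. *)
definition balancing_matrix ::
  "nat \<Rightarrow> nat \<Rightarrow> real mat \<Rightarrow> real mat \<Rightarrow> real mat \<Rightarrow> real mat \<Rightarrow> real mat" where
  "balancing_matrix r T L F Y0 Z0 =
     (THE K. K \<in> carrier_mat r r \<and> invertible_mat K \<and>
        F = sqrt (real T) \<cdot>\<^sub>m (Z0 * K) \<and>
        L = (1 / sqrt (real T)) \<cdot>\<^sub>m (Y0 * (mat_inv K)\<^sup>T))"

definition random_matrix :: "'a measure \<Rightarrow> nat \<Rightarrow> nat \<Rightarrow> ('a \<Rightarrow> real mat) \<Rightarrow> bool" where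
  "random_matrix M n m A \<longleftrightarrow> (\<forall>\<omega>\<in>space M. A \<omega> \<in> carrier_mat n m) \<and>
     (\<forall>i<n. \<forall>j<m. (\<lambda>\<omega>. A \<omega> $$ (i, j)) \<in> borel_measurable M)"

definition sigma_of_matrix :: "'a measure \<Rightarrow> nat \<Rightarrow> nat \<Rightarrow> ('a \<Rightarrow> real mat) \<Rightarrow> 'a measure" where
  "sigma_of_matrix M n m A =
     vimage_algebra (space M) (\<lambda>\<omega>. \<lambda>p\<in>{..<n} \<times> {..<m}. A \<omega> $$ p)
       (\<Pi>\<^sub>M p\<in>{..<n} \<times> {..<m}. borel)"

definition cond_indep_vars ::
  "'a measure \<Rightarrow> 'a measure \<Rightarrow> ('i \<Rightarrow> 'a \<Rightarrow> real) \<Rightarrow> 'i set \<Rightarrow> bool" where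
  "cond_indep_vars M G X I \<longleftrightarrow>
     (\<forall>i\<in>I. X i \<in> borel_measurable M) \<and>
     (\<forall>J B. J \<subseteq> I \<longrightarrow> finite J \<longrightarrow> (\<forall>i\<in>J. B i \<in> sets borel) \<longrightarrow>
        (AE \<omega> in M. real_cond_exp M G (\<lambda>\<omega>. \<Prod>i\<in>J. indicator (B i) (X i \<omega>)) \<omega> =
                    (\<Prod>i\<in>J. real_cond_exp M G (\<lambda>\<omega>. indicator (B i) (X i \<omega>)) \<omega>)))"

definition tendsto_in_prob :: "'a measure \<Rightarrow> (nat \<Rightarrow> 'a \<Rightarrow> real) \<Rightarrow> real \<Rightarrow> bool" where
  "tendsto_in_prob M Z c \<longleftrightarrow>
     (\<forall>e>0. (\<lambda>n. measure M {\<omega> \<in> space M. e < \<bar>Z n \<omega> - c\<bar>}) \<longlonglongrightarrow> 0)"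

(* For measurable Z n this is: for every d > 0 there is K with
   P(\<bar>Z n\<bar> > K * a n) \<le> d for all large n. The event A makes the notion meaningful also when Z n
   is not measurable, as can happen for an arbitrary choice of singular vectors. *)
definition bigO_in_prob :: "'a measure \<Rightarrow> (nat \<Rightarrow> 'a \<Rightarrow> real) \<Rightarrow> (nat \<Rightarrow> real) \<Rightarrow> bool" where
  "bigO_in_prob M Z a \<longleftrightarrow>
     (\<forall>d>0. \<exists>K>0. \<forall>\<^sub>F n in sequentially.
        \<exists>A\<in>sets M. 1 - d \<le> measure M A \<and> (\<forall>\<omega>\<in>A. \<bar>Z n \<omega>\<bar> \<le> K * a n))"

end

theory Submission
  imports Defs
begin

text \<open>
  Write \<open>u\<^sub>j, v\<^sub>j, d\<^sub>j\<close> and \<open>u\<^sup>0\<^sub>j, v\<^sup>0\<^sub>j, d\<^sup>0\<^sub>j\<close> for the leading singular vectors and values of \<open>X\<close> and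
  of the common component, \<open>a\<close> and \<open>b\<close> for the matrices of inner products of the \<open>u\<close>'s and of the
  \<open>v\<close>'s, and let \<open>\<sigma> = sqrt (N\<^sup>\<alpha> T)\<close> and \<open>e = O(max (sqrt N) (sqrt T))\<close> bound the noise, so that \<open>e = o(\<sigma>)\<close>
  and all leading singular values are of order \<open>\<sigma>\<close>.

  The singular vector equations give \<open>D b - a D\<^sup>0 = U\<^sup>T E V\<^sup>0\<close> and \<open>D a - b D\<^sup>0 = V\<^sup>T E\<^sup>T U\<^sup>0\<close>. Both right-hand
  sides are \<open>O(1 + e\<^sup>2 / \<sigma>)\<close>: replacing \<open>U\<close> by its projection to the columns of \<open>U\<^sup>0\<close> costs \<open>e\<^sup>2 / \<sigma>\<close>, and
  the bilinear forms of \<open>E\<close> in \<open>\<Lambda>\<^sup>0\<close> and \<open>F\<^sup>0\<close> have bounded variance after scaling. Optimality of the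
  Procrustes rotation \<open>O\<close> makes \<open>S = D\<^bsup>1/2\<^esup> (a + b) (D\<^sup>0)\<^bsup>1/2\<^esup> O\<^sup>T\<close> symmetric and positive semidefinite, and
  \<open>S\<^sup>2\<close> is close to \<open>4 D\<^sup>2\<close>; hence \<open>O\<close> agrees with \<open>a\<close> and \<open>b\<close> up to the relative error
  \<open>1 / \<sigma> + e\<^sup>2 / \<sigma>\<^sup>2\<close>. The quadratic gain over the naive \<open>e / \<sigma>\<close> is what the rates require.

  Row \<open>t\<close> of \<open>V\<close> is \<open>D\<inverse> U\<^sup>T\<close> applied to column \<open>t\<close> of \<open>X\<close>, so it remains to bound \<open>u\<^sub>j\<^sup>T E\<^sub>t\<close>. Solving the
  singular vector equation for \<open>u\<^sub>j\<close> by a Neumann series in the noise without column \<open>t\<close> expresses this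
  product through terms linear in \<open>E\<^sub>t\<close>, with coefficients that depend only on the common component and
  on the other columns; these are \<open>O(1)\<close> by conditional independence and Chebyshev's inequality. The
  loadings are the same statement for the transposed model.
\<close>

section \<open>Vectors and matrices as functions\<close>

text \<open>The matrix inequalities are deterministic and are applied pointwise on one measurable
  event, so no singular vector or rotation has to be a measurable function of the sample. All
  constants are collected in one number \<open>\<kappa>\<close>, at least 2 and at least
  \<open>r\<close>; numerical factors are traded for powers of it.

  Subtracting and adding the two identities for \<open>D b\<close> and \<open>D a\<close> shows that
  \<open>a - b\<close> and the commutator of \<open>a + b\<close> with the singular values are
  small. Hence square roots of singular values can be moved past \<open>a\<close>.

  In the Neumann series the power h may exceed its typical size by 2^h: Chebyshev then costs 4^-h,
  which is summable, while a singular value of at least 2 e still lets the series decay like 2^-h.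
  The product of the column with itself is not small, but its weight contains the unknown again,
  with a factor that can be absorbed.

  Conditioning is on the common component. The loadings are deterministic and have a left inverse,
  so the factors are functions of it and may serve as coefficients.\<close>

definition ip :: "nat \<Rightarrow> (nat \<Rightarrow> real) \<Rightarrow> (nat \<Rightarrow> real) \<Rightarrow> real" where
  "ip n x y = (\<Sum>i<n. x i * y i)"

definition nrm :: "nat \<Rightarrow> (nat \<Rightarrow> real) \<Rightarrow> real" where
  "nrm n x = sqrt (ip n x x)"

text \<open>Matrices and vectors are total functions and only the summation range is passed, so
  there are no dimension side conditions. Entries outside the range are never read, which is why
  vectors are compared through \<open>ip_cong\<close> and \<open>nrm_cong\<close>.\<close>

definition mv :: "nat \<Rightarrow> (nat \<Rightarrow> nat \<Rightarrow> real) \<Rightarrow> (nat \<Rightarrow> real) \<Rightarrow> nat \<Rightarrow> real" where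
  "mv m A x = (\<lambda>i. \<Sum>j<m. A i j * x j)"

definition mtr :: "(nat \<Rightarrow> nat \<Rightarrow> real) \<Rightarrow> nat \<Rightarrow> nat \<Rightarrow> real" where
  "mtr A = (\<lambda>i j. A j i)"

lemma mtr_mtr [simp]: "mtr (mtr A) = A"
  by (simp add: mtr_def)

lemma mtr_apply [simp]: "mtr A i j = A j i"
  by (simp add: mtr_def)

lemma ip_commute: "ip n x y = ip n y x"
  by (simp add: ip_def mult.commute)

lemma ip_cong: "(\<And>i. i < n \<Longrightarrow> x i = x' i) \<Longrightarrow> (\<And>i. i < n \<Longrightarrow> y i = y' i) \<Longrightarrow> ip n x y = ip n x' y'"
  by (simp add: ip_def)

lemma nrm_cong: "(\<And>i. i < n \<Longrightarrow> x i = x' i) \<Longrightarrow> nrm n x = nrm n x'"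
  by (simp add: nrm_def ip_def)

lemma mv_cong: "(\<And>j. j < m \<Longrightarrow> x j = x' j) \<Longrightarrow> mv m A x = mv m A x'"
  by (simp add: mv_def)

lemma ip_add_left: "ip n (\<lambda>i. x i + y i) z = ip n x z + ip n y z"
  by (simp add: ip_def distrib_right sum.distrib)

lemma ip_add_right: "ip n z (\<lambda>i. x i + y i) = ip n z x + ip n z y"
  by (simp add: ip_def distrib_left sum.distrib)

lemma ip_diff_left: "ip n (\<lambda>i. x i - y i) z = ip n x z - ip n y z"
  by (simp add: ip_def left_diff_distrib sum_subtractf)

lemma ip_diff_right: "ip n z (\<lambda>i. x i - y i) = ip n z x - ip n z y"
  by (simp add: ip_def right_diff_distrib sum_subtractf)

lemma ip_scale_left: "ip n (\<lambda>i. c * x i) z = c * ip n x z"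
  by (simp add: ip_def sum_distrib_left mult.assoc)

lemma ip_scale_right: "ip n z (\<lambda>i. c * x i) = c * ip n z x"
  by (simp add: ip_def sum_distrib_left mult.left_commute)

lemma ip_sum_left: "ip n (\<lambda>i. \<Sum>k\<in>K. c k * x k i) z = (\<Sum>k\<in>K. c k * ip n (x k) z)"
proof -
  have "ip n (\<lambda>i. \<Sum>k\<in>K. c k * x k i) z = (\<Sum>i<n. \<Sum>k\<in>K. c k * (x k i * z i))"
    by (simp add: ip_def sum_distrib_right mult.assoc)
  also have "\<dots> = (\<Sum>k\<in>K. \<Sum>i<n. c k * (x k i * z i))"
    by (rule sum.swap)
  finally show ?thesis
    by (simp add: ip_def sum_distrib_left)
qed

lemma ip_sum_right: "ip n z (\<lambda>i. \<Sum>k\<in>K. c k * x k i) = (\<Sum>k\<in>K. c k * ip n z (x k))"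
  using ip_sum_left[of n c x K z] by (simp add: ip_commute)

lemma ip_zero [simp]: "ip n (\<lambda>i. 0) x = 0" "ip n x (\<lambda>i. 0) = 0"
  by (simp_all add: ip_def)

lemma ip_ge_0 [simp]: "0 \<le> ip n x x"
  by (simp add: ip_def sum_nonneg)

lemma nrm_ge_0 [simp]: "0 \<le> nrm n x"
  by (simp add: nrm_def)

lemma nrm_sq: "(nrm n x)\<^sup>2 = ip n x x"
  by (simp add: nrm_def)

lemma nrm_L2: "nrm n x = L2_set x {..<n}"
  by (simp add: nrm_def ip_def L2_set_def power2_eq_square)

lemma ip_abs_le: "\<bar>ip n x y\<bar> \<le> nrm n x * nrm n y"
proof -
  have "\<bar>ip n x y\<bar> \<le> (\<Sum>i<n. \<bar>x i\<bar> * \<bar>y i\<bar>)"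
    unfolding ip_def by (rule order_trans[OF sum_abs]) (simp add: abs_mult)
  also have "\<dots> \<le> nrm n x * nrm n y"
    unfolding nrm_L2 by (rule L2_set_mult_ineq)
  finally show ?thesis .
qed

lemma nrm_triangle: "nrm n (\<lambda>i. x i + y i) \<le> nrm n x + nrm n y"
  unfolding nrm_L2 by (rule L2_set_triangle_ineq)

lemma nrm_scale: "nrm n (\<lambda>i. c * x i) = \<bar>c\<bar> * nrm n x"
  by (simp add: nrm_def ip_scale_left ip_scale_right real_sqrt_mult flip: mult.assoc)

lemma nrm_minus: "nrm n (\<lambda>i. - x i) = nrm n x"
  by (simp add: nrm_def ip_def)

lemma nrm_diff_ge: "nrm n x - nrm n y \<le> nrm n (\<lambda>i. x i + y i)"
  using nrm_triangle[of n "\<lambda>i. x i + y i" "\<lambda>i. - y i"] by (simp add: nrm_minus)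

lemma comp_le_nrm: "i < n \<Longrightarrow> \<bar>x i\<bar> \<le> nrm n x"
  using member_le_L2_set[of "{..<n}" i "\<lambda>i. \<bar>x i\<bar>"] by (simp add: nrm_L2 L2_set_def)

lemma nrm_le_sum: "nrm n x \<le> (\<Sum>i<n. \<bar>x i\<bar>)"
  using L2_set_le_sum_abs[of x "{..<n}"] by (simp add: nrm_L2)

lemma nrm_le_const:
  assumes "\<And>i. i < n \<Longrightarrow> \<bar>x i\<bar> \<le> c"
  shows "nrm n x \<le> real n * c"
  using order_trans[OF nrm_le_sum sum_bounded_above[of "{..<n}" "\<lambda>i. \<bar>x i\<bar>" c]] assms by simp

lemma nrm_zero [simp]: "nrm n (\<lambda>i. 0) = 0"
  by (simp add: nrm_def)

lemma nrm_eq_0: "nrm n x = 0 \<Longrightarrow> i < n \<Longrightarrow> x i = 0"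
  using comp_le_nrm[of i n x] by simp

lemma ip_unit: "t < n \<Longrightarrow> ip n x (\<lambda>i. if i = t then 1 else 0) = x t"
  by (simp add: ip_def if_distrib cong: if_cong)

lemma nrm_unit: "t < n \<Longrightarrow> nrm n (\<lambda>i. if i = t then 1 else 0) = 1"
  by (simp add: nrm_def ip_unit)

lemma mv_unit: "t < m \<Longrightarrow> mv m A (\<lambda>i. if i = t then 1 else 0) = (\<lambda>i. A i t)"
  by (simp add: mv_def if_distrib cong: if_cong)

lemma mv_add: "mv m A (\<lambda>j. x j + y j) = (\<lambda>i. mv m A x i + mv m A y i)"
  by (simp add: mv_def distrib_left sum.distrib)

lemma mv_scale: "mv m A (\<lambda>j. c * x j) = (\<lambda>i. c * mv m A x i)"
  by (simp add: mv_def sum_distrib_left mult.left_commute)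

lemma mv_sum: "mv m A (\<lambda>j. \<Sum>k\<in>K. c k * x k j) = (\<lambda>i. \<Sum>k\<in>K. c k * mv m A (x k) i)"
proof
  fix i
  show "mv m A (\<lambda>j. \<Sum>k\<in>K. c k * x k j) i = (\<Sum>k\<in>K. c k * mv m A (x k) i)"
    using ip_sum_right[of m "A i" c x K] by (simp add: mv_def ip_def)
qed

lemma mv_ip: "mv m A x i = ip m (A i) x"
  by (simp add: mv_def ip_def)

lemma ip_mv: "ip n (mv m A x) y = ip m x (mv n (mtr A) y)"
proof -
  have "ip n (mv m A x) y = (\<Sum>i<n. \<Sum>j<m. A i j * x j * y i)"
    by (simp add: ip_def mv_def sum_distrib_right)
  also have "\<dots> = (\<Sum>j<m. \<Sum>i<n. A i j * x j * y i)"
    by (rule sum.swap)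
  also have "\<dots> = ip m x (mv n (mtr A) y)"
    by (simp add: ip_def mv_def sum_distrib_left mult.assoc mult.left_commute)
  finally show ?thesis .
qed

text \<open>The operator norm enters as a relation: such a bound passes to transposes and to deleted
  columns without handling a supremum.\<close>

definition op_bound :: "nat \<Rightarrow> nat \<Rightarrow> (nat \<Rightarrow> nat \<Rightarrow> real) \<Rightarrow> real \<Rightarrow> bool" where
  "op_bound n m A e \<longleftrightarrow> (\<forall>x. nrm n (mv m A x) \<le> e * nrm m x)"

lemma op_boundD: "op_bound n m A e \<Longrightarrow> nrm n (mv m A x) \<le> e * nrm m x"
  by (simp add: op_bound_def)

text \<open>With z the image of y under the transpose, |z|^2 = <A z, y> <= e |z| |y|. Dividing by
  |z| requires the case z = 0 apart.\<close>

lemma op_bound_tr: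
  assumes "op_bound n m A e" "0 \<le> e"
  shows "op_bound m n (mtr A) e"
  unfolding op_bound_def
proof
  fix y
  let ?z = "mv n (mtr A) y"
  have "(nrm m ?z)\<^sup>2 = ip n (mv m A ?z) y"
    by (simp add: nrm_sq ip_mv)
  also have "\<dots> \<le> nrm n (mv m A ?z) * nrm n y"
    using ip_abs_le[of n "mv m A ?z" y] by linarith
  also have "\<dots> \<le> e * nrm m ?z * nrm n y"
    by (intro mult_right_mono op_boundD assms) simp
  finally have le: "nrm m ?z * nrm m ?z \<le> (e * nrm n y) * nrm m ?z"
    by (simp add: power2_eq_square mult_ac)
  show "nrm m ?z \<le> e * nrm n y"
  proof (cases "nrm m ?z = 0")
    case True
    then show ?thesis using assms by simp
  next
    case False
    then have "0 < nrm m ?z"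
      using nrm_ge_0[of m ?z] by linarith
    then show ?thesis
      using le by simp
  qed
qed

lemma op_bound_col:
  assumes "op_bound n m A e" "t < m"
  shows "nrm n (\<lambda>i. A i t) \<le> e"
  using op_boundD[OF assms(1), of "\<lambda>i. if i = t then 1 else 0"] assms(2)
  by (simp add: mv_unit nrm_unit)

text \<open>Deleting a column of the matrix amounts to deleting the matching entry of the argument,
  which does not increase its norm.\<close>

lemma op_bound_zero_col:
  assumes "op_bound n m A e" "0 \<le> e"
  shows "op_bound n m (\<lambda>i j. if j = t then 0 else A i j) e"
  unfolding op_bound_def
proof
  fix x :: "nat \<Rightarrow> real"
  let ?x = "\<lambda>j. if j = t then 0 else x j"
  have "nrm n (mv m (\<lambda>i j. if j = t then 0 else A i j) x) = nrm n (mv m A ?x)"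
    unfolding mv_def by (intro arg_cong[where f = "nrm n"] ext sum.cong) auto
  also have "\<dots> \<le> e * nrm m ?x"
    by (rule op_boundD[OF assms(1)])
  also have "\<dots> \<le> e * nrm m x"
    unfolding nrm_def ip_def
    by (intro mult_left_mono real_sqrt_le_mono sum_mono assms) auto
  finally show "nrm n (mv m (\<lambda>i j. if j = t then 0 else A i j) x) \<le> e * nrm m x" .
qed

section \<open>Leave-one-out bound\<close>

text \<open>This is the map A A^T, kept as an operator so that its powers in the Neumann series are
  plain iterates.\<close>

definition gram_op :: "nat \<Rightarrow> nat \<Rightarrow> (nat \<Rightarrow> nat \<Rightarrow> real) \<Rightarrow> (nat \<Rightarrow> real) \<Rightarrow> nat \<Rightarrow> real" where
  "gram_op n m A x = mv m A (mv n (mtr A) x)"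

text \<open>The column is zeroed and not removed, so the index set stays the same and sums over
  columns need no reindexing.\<close>

definition zero_col :: "nat \<Rightarrow> (nat \<Rightarrow> nat \<Rightarrow> real) \<Rightarrow> nat \<Rightarrow> nat \<Rightarrow> real" where
  "zero_col t A = (\<lambda>i j. if j = t then 0 else A i j)"

lemma gram_op_ip: "ip n (gram_op n m A x) y = ip n x (gram_op n m A y)"
  by (simp add: gram_op_def ip_mv ip_commute[of n x])

text \<open>In \<open>leave_one_out\<close> the operator is built without column t. Moving its
  powers off that column leaves the column paired linearly with vectors in which it does not
  occur.\<close>

lemma gram_op_pow_ip: "ip n ((gram_op n m A ^^ k) x) y = ip n x ((gram_op n m A ^^ k) y)"
proof (induction k arbitrary: y)
  case (Suc k)
  have "ip n ((gram_op n m A ^^ Suc k) x) y = ip n ((gram_op n m A ^^ k) x) (gram_op n m A y)"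
    by (simp add: gram_op_ip)
  then show ?case
    by (simp add: Suc.IH funpow_swap1)
qed simp

lemma gram_op_nrm:
  assumes "op_bound n m A e" "0 \<le> e"
  shows "nrm n (gram_op n m A x) \<le> e\<^sup>2 * nrm n x"
proof -
  have "nrm n (gram_op n m A x) \<le> e * nrm m (mv n (mtr A) x)"
    unfolding gram_op_def by (rule op_boundD[OF assms(1)])
  also have "\<dots> \<le> e * (e * nrm n x)"
    by (intro mult_left_mono op_boundD[OF op_bound_tr] assms)
  finally show ?thesis
    by (simp add: power2_eq_square mult.assoc)
qed

lemma gram_op_pow_nrm:
  assumes "op_bound n m A e" "0 \<le> e"
  shows "nrm n ((gram_op n m A ^^ k) x) \<le> (e\<^sup>2) ^ k * nrm n x"
proof (induction k)
  case (Suc k)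
  have "nrm n ((gram_op n m A ^^ Suc k) x) \<le> e\<^sup>2 * nrm n ((gram_op n m A ^^ k) x)"
    by (simp add: gram_op_nrm[OF assms])
  also have "\<dots> \<le> e\<^sup>2 * ((e\<^sup>2) ^ k * nrm n x)"
    by (intro mult_left_mono Suc.IH) simp
  finally show ?case
    by (simp add: mult.assoc)
qed simp

text \<open>A Neumann series in disguise: \<open>z 0\<close> is the sum of the \<open>y k / s ^ (k + 1)\<close>.\<close>

lemma neumann_bound:
  fixes y z :: "nat \<Rightarrow> real"
  assumes s: "0 < s"
    and rec: "\<And>k. s * z k = y k + z (Suc k)"
    and y: "\<And>k. \<bar>y k\<bar> \<le> c * (s / 2) ^ k"
    and z: "\<And>k. \<bar>z k\<bar> \<le> g * (s / 2) ^ k"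
  shows "\<bar>z 0\<bar> \<le> 2 * c / s"
proof -
  \<comment> \<open>The recursion is unrolled K times. The a priori bound on the remaining term is
    halved at each step, so it disappears as K tends to infinity.\<close>
  have *: "\<bar>z k\<bar> \<le> (2 * c / s + g * (1 / 2) ^ K) * (s / 2) ^ k" for K k
  proof (induction K arbitrary: k)
    case 0
    have "0 \<le> c"
      using y[of 0] by simp
    then have "0 \<le> 2 * c / s"
      using s by simp
    then have "g * (s / 2) ^ k \<le> (2 * c / s + g * (1 / 2) ^ 0) * (s / 2) ^ k"
      using s by (intro mult_right_mono) simp_all
    then show ?case
      using z[of k] by linarith
  next
    case (Suc K)
    have "s * \<bar>z k\<bar> = \<bar>y k + z (Suc k)\<bar>"
      using rec[of k] s by (metis abs_mult abs_of_pos)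
    also have "\<dots> \<le> c * (s / 2) ^ k + (2 * c / s + g * (1 / 2) ^ K) * (s / 2) ^ Suc k"
      using y[of k] Suc.IH[of "Suc k"] by linarith
    also have "\<dots> = s * ((2 * c / s + g * (1 / 2) ^ Suc K) * (s / 2) ^ k)"
      using s by (simp add: field_simps)
    finally show ?case
      using s by simp
  qed
  have "(\<lambda>K. 2 * c / s + g * (1 / 2) ^ K) \<longlonglongrightarrow> 2 * c / s + g * 0"
    by (intro tendsto_intros LIMSEQ_realpow_zero) simp_all
  then have "\<bar>z 0\<bar> \<le> 2 * c / s + g * 0"
    by (rule LIMSEQ_le_const) (use *[of 0] in simp)
  then show ?thesis by simp
qed

lemma sum_zero_col:
  assumes "t < m"
  shows "(\<Sum>j<m. A i j * g j) = A i t * g t + (\<Sum>j<m. zero_col t A i j * g j)"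
proof -
  have "(\<Sum>j<m. A i j * g j) = (\<Sum>j<m. (if j = t then A i t * g t else 0) + zero_col t A i j * g j)"
    by (intro sum.cong) (auto simp: zero_col_def)
  also have "\<dots> = A i t * g t + (\<Sum>j<m. zero_col t A i j * g j)"
    using assms by (simp add: sum.distrib)
  finally show ?thesis .
qed

text \<open>Leave-one-out bound. Solving the singular vector equations for \<open>u\<close> with column \<open>t\<close> of the
  noise removed expresses the product of \<open>u\<close> with that column through quantities in which the
  column appears linearly, plus a small multiple of the product itself.\<close>

lemma leave_one_out:
  fixes L F E X :: "nat \<Rightarrow> nat \<Rightarrow> real"
  assumes E: "op_bound n m E e" "0 \<le> e" and t: "t < m" and s: "0 < s" "2 * e \<le> s"
    and Xv: "\<And>i. i < n \<Longrightarrow> mv m X v i = s * u i"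
    and Xu: "\<And>j. j < m \<Longrightarrow> mv n (mtr X) u j = s * v j"
    and X: "\<And>i j. i < n \<Longrightarrow> j < m \<Longrightarrow> X i j = (\<Sum>k<r. L i k * F j k) + E i j"
    and u: "nrm n u = 1" and v: "nrm m v = 1"
    and L: "\<And>k. k < r \<Longrightarrow> nrm n (\<lambda>i. L i k) \<le> l"
    and F: "\<And>k. k < r \<Longrightarrow> nrm m (\<lambda>j. F j k) \<le> f"
    and p: "0 \<le> p" "\<And>\<kappa> k. k < r \<Longrightarrow>
      \<bar>ip n (\<lambda>i. E i t) ((gram_op n m (zero_col t E) ^^ \<kappa>) (\<lambda>i. L i k))\<bar> \<le> p * (2 * e\<^sup>2) ^ \<kappa>"
    and q: "0 \<le> q" "\<And>\<kappa> k. k < r \<Longrightarrow>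
      \<bar>ip n (\<lambda>i. E i t) ((gram_op n m (zero_col t E) ^^ \<kappa>) (mv m (zero_col t E) (\<lambda>j. F j k)))\<bar>
        \<le> q * (2 * e\<^sup>2) ^ \<kappa>"
  shows "\<bar>ip n (\<lambda>i. E i t) u\<bar> \<le>
    4 * e\<^sup>2 / s\<^sup>2 * \<bar>ip r (F t) (mv n (mtr L) u)\<bar> + 4 * (real r * (p * (s * f) + q * l)) / s\<^sup>2"
proof -
  define E' where "E' = zero_col t E"
  define B where "B = gram_op n m E'"
  define et where "et = (\<lambda>i. E i t)"
  define a where "a = mv n (mtr L) u"
  define b where "b k = ip m (\<lambda>j. F j k) (\<lambda>j. s * v j)" for k
  define w where "w i = (s * v t) * et i + ((\<Sum>k<r. b k * L i k)
      + (\<Sum>k<r. a k * mv m E' (\<lambda>j. F j k) i))" for i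
  have E': "op_bound n m E' e"
    unfolding E'_def zero_col_def by (rule op_bound_zero_col[OF E])
  \<comment> \<open>The transposed singular vector equation at column j: a factor part plus the
    product of \<open>u\<close> with the noise in that column.\<close>
  have g: "s * v j = ip r (F j) a + ip n (\<lambda>i. E i j) u" if j: "j < m" for j
  proof -
    have "s * v j = ip n (\<lambda>i. (\<Sum>k<r. F j k * L i k) + E i j) u"
      using Xu[OF j] X j by (simp add: mv_def ip_def mult.commute)
    also have "\<dots> = (\<Sum>k<r. F j k * ip n (\<lambda>i. L i k) u) + ip n (\<lambda>i. E i j) u"
      by (simp add: ip_add_left ip_sum_left)
    finally show ?thesis
      by (simp add: ip_def a_def mv_def)
  qed
  \<comment> \<open>In \<open>X (s v)\<close> the identity \<open>g\<close> is inserted for all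
    columns except t. The noise then acts on \<open>u\<close> through \<open>B\<close>, which is
    built from the other columns, and column t remains only as the explicit term \<open>et\<close>
    in \<open>w\<close>.\<close>
  have eq: "s\<^sup>2 * u i = w i + B u i" if i: "i < n" for i
  proof -
    have "s\<^sup>2 * u i = s * mv m X v i"
      using Xv[OF i] by (simp add: power2_eq_square)
    also have "\<dots> = (\<Sum>j<m. X i j * (s * v j))"
      by (simp add: mv_def sum_distrib_left mult.left_commute)
    also have "\<dots> = (\<Sum>j<m. (\<Sum>k<r. L i k * F j k) * (s * v j)) + (\<Sum>j<m. E i j * (s * v j))"
      using X i by (simp add: distrib_right sum.distrib)
    also have "(\<Sum>j<m. (\<Sum>k<r. L i k * F j k) * (s * v j)) = (\<Sum>k<r. b k * L i k)"
      using ip_sum_left[of m "\<lambda>k. L i k" "\<lambda>k j. F j k" "{..<r}" "\<lambda>j. s * v j"]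
      by (simp add: ip_def b_def mult.commute)
    also have "(\<Sum>j<m. E i j * (s * v j)) = et i * (s * v t) + (\<Sum>j<m. E' i j * (s * v j))"
      unfolding E'_def et_def by (rule sum_zero_col[OF t])
    also have "(\<Sum>j<m. E' i j * (s * v j))
        = (\<Sum>j<m. E' i j * (\<Sum>k<r. a k * F j k) + E' i j * mv n (mtr E') u j)"
    proof (rule sum.cong)
      fix j assume "j \<in> {..<m}"
      then have "E' i j * (s * v j) = E' i j * (ip r (F j) a + ip n (\<lambda>i. E i j) u)"
        using g by simp
      \<comment> \<open>For j = t the prefactor vanishes, so the noise column inside may be replaced
        by its zeroed version.\<close>
      also have "\<dots> = E' i j * (ip r (F j) a + ip n (\<lambda>i. E' i j) u)"
        by (auto simp: E'_def zero_col_def)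
      finally show "E' i j * (s * v j) = E' i j * (\<Sum>k<r. a k * F j k) + E' i j * mv n (mtr E') u j"
        by (simp add: ip_def mv_def distrib_left mult.commute)
    qed simp
    also have "\<dots> = mv m E' (\<lambda>j. \<Sum>k<r. a k * F j k) i + B u i"
      by (simp add: sum.distrib mv_def B_def gram_op_def)
    finally show ?thesis
      by (simp add: w_def mv_sum algebra_simps)
  qed
  define \<xi> where "\<xi> = ip n et u"
  define c where "c = e\<^sup>2 * \<bar>s * v t\<bar> + real r * (p * (s * f) + q * l)"
  have a_le: "\<bar>a k\<bar> \<le> l" if "k < r" for k
  proof -
    have "\<bar>a k\<bar> \<le> nrm n (\<lambda>i. L i k) * nrm n u"
      unfolding a_def mv_ip using ip_abs_le[of n "mtr L k" u] by (simp add: mtr_def)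
    then show ?thesis
      using L[OF that] u by simp
  qed
  have b_le: "\<bar>b k\<bar> \<le> s * f" if "k < r" for k
  proof -
    have "\<bar>b k\<bar> \<le> nrm m (\<lambda>j. F j k) * nrm m (\<lambda>j. s * v j)"
      unfolding b_def by (rule ip_abs_le)
    also have "\<dots> \<le> f * s"
      using F[OF that] s v by (simp add: nrm_scale)
    finally show ?thesis by (simp add: mult.commute)
  qed
  have et: "nrm n et \<le> e"
    unfolding et_def by (rule op_bound_col[OF E(1) t])
  \<comment> \<open>The hypotheses grow like \<open>(2 * e\<^sup>2) ^ k\<close>. This bound turns
    them into the rate that \<open>neumann_bound\<close> admits, with the square of the singular
    value in the place of its \<open>s\<close>.\<close>
  have half: "2 * e\<^sup>2 \<le> s\<^sup>2 / 2"
    using power_mono[OF s(2), of 2] E(2) by (simp add: power_mult_distrib)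
  \<comment> \<open>Pairing \<open>eq\<close> with the k-th iterate of \<open>et\<close> gives the
    recursion of \<open>neumann_bound\<close>; the quantity sought is its term at k = 0.\<close>
  have z_rec: "s\<^sup>2 * ip n ((B ^^ k) et) u = ip n ((B ^^ k) et) w + ip n ((B ^^ Suc k) et) u" for k
  proof -
    have "s\<^sup>2 * ip n ((B ^^ k) et) u = ip n ((B ^^ k) et) (\<lambda>i. w i + B u i)"
      unfolding ip_scale_right[symmetric] by (intro ip_cong eq) simp_all
    then show ?thesis
      by (simp add: ip_add_right B_def gram_op_ip)
  qed
  have y_le: "\<bar>ip n ((B ^^ k) et) w\<bar> \<le> c * (s\<^sup>2 / 2) ^ k" for k
  proof -
    let ?x = "(B ^^ k) et"
    let ?h = "(2 * e\<^sup>2) ^ k"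
    \<comment> \<open>The column meets itself here and nothing cancels, so only the operator bound
      is available for this term.\<close>
    have "\<bar>ip n ?x et\<bar> \<le> nrm n ?x * nrm n et"
      by (rule ip_abs_le)
    also have "\<dots> \<le> ((e\<^sup>2) ^ k * e) * e"
    proof (rule mult_mono[OF _ et])
      have "nrm n ?x \<le> (e\<^sup>2) ^ k * nrm n et"
        unfolding B_def by (rule gram_op_pow_nrm[OF E' E(2)])
      also have "\<dots> \<le> (e\<^sup>2) ^ k * e"
        by (rule mult_left_mono[OF et]) simp
      finally show "nrm n ?x \<le> (e\<^sup>2) ^ k * e" .
    qed (use E(2) in simp_all)
    also have "\<dots> = e\<^sup>2 * (e\<^sup>2) ^ k"
      by (simp add: power2_eq_square)
    also have "\<dots> \<le> e\<^sup>2 * ?h"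
      by (intro mult_left_mono power_mono) simp_all
    finally have y1: "\<bar>s * v t * ip n ?x et\<bar> \<le> \<bar>s * v t\<bar> * (e\<^sup>2 * ?h)"
      unfolding abs_mult[of "s * v t"] by (rule mult_left_mono) simp
    have y2: "\<bar>b j * ip n ?x (\<lambda>i. L i j)\<bar> \<le> s * f * (p * ?h)" if j: "j < r" for j
    proof -
      have "\<bar>ip n ?x (\<lambda>i. L i j)\<bar> \<le> p * ?h"
        using p(2)[OF j, of k] unfolding B_def E'_def et_def gram_op_pow_ip .
      then show ?thesis
        unfolding abs_mult using b_le[OF j] by (intro mult_mono) auto
    qed
    have y3: "\<bar>a j * ip n ?x (mv m E' (\<lambda>l. F l j))\<bar> \<le> l * (q * ?h)" if j: "j < r" for j
    proof -
      have "\<bar>ip n ?x (mv m E' (\<lambda>l. F l j))\<bar> \<le> q * ?h"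
        using q(2)[OF j, of k] unfolding B_def E'_def et_def gram_op_pow_ip .
      then show ?thesis
        unfolding abs_mult using a_le[OF j] by (intro mult_mono) auto
    qed
    have "\<bar>ip n ?x w\<bar> = \<bar>s * v t * ip n ?x et + ((\<Sum>j<r. b j * ip n ?x (\<lambda>i. L i j))
        + (\<Sum>j<r. a j * ip n ?x (mv m E' (\<lambda>l. F l j))))\<bar>"
      unfolding w_def by (simp add: ip_add_right ip_sum_right ip_scale_right)
    also have "\<dots> \<le> \<bar>s * v t * ip n ?x et\<bar> + ((\<Sum>j<r. \<bar>b j * ip n ?x (\<lambda>i. L i j)\<bar>)
        + (\<Sum>j<r. \<bar>a j * ip n ?x (mv m E' (\<lambda>l. F l j))\<bar>))"
      by (rule order_trans[OF abs_triangle_ineq], rule add_left_mono,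
          rule order_trans[OF abs_triangle_ineq], rule add_mono[OF sum_abs sum_abs])
    also have "\<dots> \<le> \<bar>s * v t\<bar> * (e\<^sup>2 * ?h) + ((\<Sum>j<r. s * f * (p * ?h)) + (\<Sum>j<r. l * (q * ?h)))"
      by (rule add_mono[OF y1 add_mono[OF sum_mono sum_mono]]) (simp_all only: y2 y3 lessThan_iff)
    also have "\<dots> = c * ?h"
      by (simp add: c_def algebra_simps)
    also have "\<dots> \<le> c * (s\<^sup>2 / 2) ^ k"
    proof (intro mult_left_mono power_mono half)
      have "0 \<le> real r * (p * (s * f) + q * l)"
      proof (cases "r = 0")
        case False
        then have "0 \<le> f" "0 \<le> l"
          using order_trans[OF nrm_ge_0 F[of 0]] order_trans[OF nrm_ge_0 L[of 0]] by simp_all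
        then show ?thesis
          using p(1) q(1) s by simp
      qed simp
      then show "0 \<le> c"
        by (simp add: c_def)
    qed simp
    finally show ?thesis .
  qed
  have z_le: "\<bar>ip n ((B ^^ k) et) u\<bar> \<le> e * (s\<^sup>2 / 2) ^ k" for k
  proof -
    have "\<bar>ip n ((B ^^ k) et) u\<bar> \<le> nrm n ((B ^^ k) et)"
      using ip_abs_le[of n "(B ^^ k) et" u] u by simp
    also have "\<dots> \<le> (e\<^sup>2) ^ k * nrm n et"
      using gram_op_pow_nrm[OF E' E(2), of k et] by (simp add: B_def)
    also have "\<dots> \<le> (s\<^sup>2 / 2) ^ k * e"
    proof (intro mult_mono power_mono et)
      show "e\<^sup>2 \<le> s\<^sup>2 / 2"
        using half zero_le_power2[of e] by linarith
    qed simp_all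
    finally show ?thesis by (simp add: mult.commute)
  qed
  have "\<bar>ip n ((B ^^ 0) et) u\<bar> \<le> 2 * c / s\<^sup>2"
    by (rule neumann_bound[OF _ z_rec y_le z_le]) (use s in simp)
  then have "\<bar>\<xi>\<bar> \<le> 2 * c / s\<^sup>2"
    by (simp add: \<xi>_def)
  \<comment> \<open>The identity \<open>g\<close> at column t splits \<open>s * v t\<close> into the
    factor part and \<open>\<xi>\<close>: the unknown reappears on the right.\<close>
  also have "2 * c / s\<^sup>2 \<le> 2 * (e\<^sup>2 * (\<bar>ip r (F t) a\<bar> + \<bar>\<xi>\<bar>) + real r * (p * (s * f) + q * l)) / s\<^sup>2"
    unfolding c_def g[OF t] \<xi>_def et_def
    by (intro divide_right_mono mult_left_mono add_right_mono abs_triangle_ineq) simp_all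
  finally have "\<bar>\<xi>\<bar> * s\<^sup>2 \<le> 2 * (e\<^sup>2 * (\<bar>ip r (F t) a\<bar> + \<bar>\<xi>\<bar>) + real r * (p * (s * f) + q * l))"
    using s by (simp add: pos_le_divide_eq)
  \<comment> \<open>The reappearing term is at most half of the left-hand side and is absorbed
    there, which doubles the remaining constants.\<close>
  moreover have "2 * e\<^sup>2 * \<bar>\<xi>\<bar> \<le> s\<^sup>2 / 2 * \<bar>\<xi>\<bar>"
    by (rule mult_right_mono[OF half]) simp
  ultimately have "\<bar>\<xi>\<bar> * s\<^sup>2 \<le> 4 * e\<^sup>2 * \<bar>ip r (F t) a\<bar> + 4 * (real r * (p * (s * f) + q * l))"
    by (simp add: algebra_simps)
  then show ?thesis
    using s by (simp add: \<xi>_def et_def a_def field_simps)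
qed

section \<open>Perturbation of the Procrustes solution\<close>

text \<open>Perturbation of the square root of a positive definite diagonal matrix: if \<open>S S\<close> is close to
  \<open>(2 D)\<^sup>2\<close>, then \<open>K = S - 2 D\<close> solves \<open>K S + 2 D K = S S - 4 D\<^sup>2\<close>, and pairing with \<open>K\<close>
  bounds it.\<close>

lemma psd_root_close:
  fixes S :: "nat \<Rightarrow> nat \<Rightarrow> real" and d :: "nat \<Rightarrow> real"
  assumes lo: "0 < lo" "\<And>j. j < r \<Longrightarrow> lo \<le> d j"
    and sym: "\<And>j l. j < r \<Longrightarrow> l < r \<Longrightarrow> S j l = S l j"
    and psd: "\<And>x. 0 \<le> ip r x (mv r S x)"
    and Q: "\<And>j l. j < r \<Longrightarrow> l < r \<Longrightarrow>
      \<bar>(\<Sum>k<r. S j k * S k l) - (if j = l then 4 * (d j)\<^sup>2 else 0)\<bar> \<le> q"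
    and j: "j < r"
  shows "nrm r (\<lambda>l. S j l - (if j = l then 2 * d j else 0)) \<le> real r * q / (2 * lo)"
proof -
  define K where "K j l = S j l - (if j = l then 2 * d j else 0)" for j l
  define x where "x = (\<Sum>j<r. \<Sum>l<r. (K j l)\<^sup>2)"
  define R where "R j l = (\<Sum>k<r. S j k * S k l) - (if j = l then 4 * (d j)\<^sup>2 else 0)" for j l
  have x0: "0 \<le> x"
    unfolding x_def by (intro sum_nonneg) simp
  have R_eq: "(\<Sum>k<r. K j k * S k l) + 2 * d j * K j l = R j l" if "j < r" "l < r" for j l
  proof -
    have "(\<Sum>k<r. K j k * S k l)
        = (\<Sum>k<r. S j k * S k l - (if j = k then 2 * d j * S j l else 0))"
      by (intro sum.cong) (auto simp: K_def algebra_simps)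
    also have "\<dots> = (\<Sum>k<r. S j k * S k l) - 2 * d j * S j l"
      using that by (simp add: sum_subtractf)
    finally show ?thesis
      by (simp add: R_def K_def algebra_simps power2_eq_square)
  qed
  have "2 * lo * x = (\<Sum>j<r. \<Sum>l<r. 2 * lo * (K j l)\<^sup>2)"
    by (simp add: x_def sum_distrib_left)
  also have "\<dots> \<le> (\<Sum>j<r. \<Sum>l<r. 2 * d j * (K j l)\<^sup>2)"
    using lo(2) by (intro sum_mono mult_right_mono) auto
  \<comment> \<open>For every row of \<open>K\<close> a nonnegative quadratic form of
    \<open>S\<close> is added. The sum is then the pairing of \<open>K\<close> with the residual
    \<open>R\<close> of the matrix equation.\<close>
  also have "\<dots> \<le> (\<Sum>j<r. ip r (K j) (mv r S (K j)) + (\<Sum>l<r. 2 * d j * (K j l)\<^sup>2))"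
    by (intro sum_mono) (use psd in simp)
  also have "\<dots> = (\<Sum>j<r. \<Sum>l<r. K j l * R j l)"
  proof (rule sum.cong)
    fix j assume "j \<in> {..<r}"
    then have j: "j < r" by simp
    have "ip r (K j) (mv r S (K j)) = (\<Sum>l<r. K j l * (\<Sum>k<r. K j k * S k l))"
      unfolding ip_def mv_def
    proof (intro sum.cong refl)
      fix l assume "l \<in> {..<r}"
      then have "(\<Sum>k<r. S l k * K j k) = (\<Sum>k<r. K j k * S k l)"
        using sym by (intro sum.cong) auto
      then show "K j l * (\<Sum>k<r. S l k * K j k) = K j l * (\<Sum>k<r. K j k * S k l)"
        by simp
    qed
    then have "ip r (K j) (mv r S (K j)) + (\<Sum>l<r. 2 * d j * (K j l)\<^sup>2)
        = (\<Sum>l<r. K j l * ((\<Sum>k<r. K j k * S k l) + 2 * d j * K j l))"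
      by (simp add: sum.distrib[symmetric] distrib_left power2_eq_square mult_ac)
    then show "ip r (K j) (mv r S (K j)) + (\<Sum>l<r. 2 * d j * (K j l)\<^sup>2) = (\<Sum>l<r. K j l * R j l)"
      using R_eq j by simp
  qed simp
  also have "\<dots> \<le> (\<Sum>j<r. \<Sum>l<r. \<bar>K j l\<bar> * q)"
  proof (intro sum_mono)
    fix j l assume "j \<in> {..<r}" "l \<in> {..<r}"
    then have "\<bar>R j l\<bar> \<le> q"
      using Q unfolding R_def by simp
    then have "\<bar>K j l * R j l\<bar> \<le> \<bar>K j l\<bar> * q"
      unfolding abs_mult by (rule mult_left_mono) simp
    then show "K j l * R j l \<le> \<bar>K j l\<bar> * q"
      by linarith
  qed
  \<comment> \<open>Cauchy-Schwarz over all index pairs bounds the sum by \<open>r * q\<close> times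
    the Frobenius norm \<open>sqrt x\<close>; one factor \<open>sqrt x\<close> cancels against the
    left-hand side.\<close>
  also have "\<dots> = (\<Sum>z\<in>{..<r} \<times> {..<r}. \<bar>case_prod K z\<bar> * \<bar>1\<bar>) * q"
    by (simp add: sum.cartesian_product sum_distrib_right case_prod_beta)
  also have "\<dots> \<le> L2_set (case_prod K) ({..<r} \<times> {..<r}) * L2_set (\<lambda>z. 1) ({..<r} \<times> {..<r}) * q"
    by (rule mult_right_mono[OF L2_set_mult_ineq]) (use Q[OF j j] in linarith)
  also have "\<dots> = sqrt x * real r * q"
    by (simp add: L2_set_def x_def sum.cartesian_product case_prod_beta real_sqrt_mult)
  finally have le: "2 * lo * (sqrt x * sqrt x) \<le> sqrt x * (real r * q)"
    using x0 by (simp add: mult_ac)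
  have "sqrt x \<le> real r * q / (2 * lo)"
  proof (cases "x = 0")
    case True
    have "0 \<le> q"
      using Q[OF j j] by linarith
    then show ?thesis
      using True lo by simp
  next
    case False
    then have "0 < sqrt x"
      using x0 by simp
    moreover have "sqrt x * (2 * lo * sqrt x) \<le> sqrt x * (real r * q)"
      using le by (simp only: mult_ac)
    ultimately have "2 * lo * sqrt x \<le> real r * q"
      by (rule mult_left_le_imp_le[rotated 1])
    then show ?thesis
      using lo by (simp add: field_simps)
  qed
  moreover have "nrm r (K j) \<le> sqrt x"
    unfolding nrm_def ip_def x_def power2_eq_square[symmetric]
    using j by (intro real_sqrt_le_mono member_le_sum[where f = "\<lambda>j. \<Sum>l<r. (K j l)\<^sup>2"]) (auto intro: sum_nonneg)
  ultimately show ?thesis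
    unfolding K_def by linarith
qed

lemma sqrt_diff_mult_bound:
  fixes x y :: real
  assumes "0 < lo" "lo \<le> x" "lo \<le> y"
  shows "\<bar>sqrt x - sqrt y\<bar> * sqrt y \<le> \<bar>x - y\<bar>" "\<bar>sqrt x / sqrt y - 1\<bar> \<le> \<bar>x - y\<bar> / lo"
proof -
  have "\<bar>x - y\<bar> = \<bar>sqrt x - sqrt y\<bar> * (sqrt x + sqrt y)"
  proof -
    have "x - y = (sqrt x - sqrt y) * (sqrt x + sqrt y)"
      using assms by (simp add: algebra_simps)
    then have "\<bar>x - y\<bar> = \<bar>sqrt x - sqrt y\<bar> * \<bar>sqrt x + sqrt y\<bar>"
      by (metis abs_mult)
    then show ?thesis
      using assms by simp
  qed
  moreover have "\<bar>sqrt x - sqrt y\<bar> * sqrt y \<le> \<bar>sqrt x - sqrt y\<bar> * (sqrt x + sqrt y)"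
    using assms by (intro mult_left_mono) simp_all
  ultimately show *: "\<bar>sqrt x - sqrt y\<bar> * sqrt y \<le> \<bar>x - y\<bar>"
    by simp
  have "0 < y" using assms by linarith
  have "\<bar>sqrt x / sqrt y - 1\<bar> = \<bar>(sqrt x - sqrt y) / sqrt y\<bar>"
    using \<open>0 < y\<close> by (simp add: diff_divide_distrib)
  also have "\<dots> = \<bar>sqrt x - sqrt y\<bar> * sqrt y / y"
    using \<open>0 < y\<close> by (simp add: real_div_sqrt field_simps)
  also have "\<dots> \<le> \<bar>x - y\<bar> / lo"
    using * assms by (intro frac_le) simp_all
  finally show "\<bar>sqrt x / sqrt y - 1\<bar> \<le> \<bar>x - y\<bar> / lo" .
qed

text \<open>The rotation problem is reduced to r by r arrays. \<open>a\<close> and \<open>b\<close>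
  stand for the inner products of left and of right singular vectors, \<open>\<gamma>\<close> bounds
  the errors in the two singular vector identities, and all singular values lie between
  \<open>lo\<close> and \<open>\<rho> * lo\<close>. The last two assumptions are the optimality of
  the rotation \<open>Q\<close>.\<close>

locale procrustes_pert =
  fixes r :: nat and a b Q :: "nat \<Rightarrow> nat \<Rightarrow> real" and d d0 :: "nat \<Rightarrow> real" and lo \<rho> \<gamma> :: real
  assumes lo: "0 < lo" "\<And>j. j < r \<Longrightarrow> lo \<le> d j" "\<And>j. j < r \<Longrightarrow> lo \<le> d0 j"
    and hi: "\<And>j. j < r \<Longrightarrow> d j \<le> \<rho> * lo" "\<And>j. j < r \<Longrightarrow> d0 j \<le> \<rho> * lo"
    and \<rho>: "1 \<le> \<rho>" and r: "0 < r"
    and a1: "\<And>j k. j < r \<Longrightarrow> k < r \<Longrightarrow> \<bar>a j k\<bar> \<le> 1"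
    and b1: "\<And>j k. j < r \<Longrightarrow> k < r \<Longrightarrow> \<bar>b j k\<bar> \<le> 1"
    and G1: "\<And>j k. j < r \<Longrightarrow> k < r \<Longrightarrow> \<bar>d j * b j k - a j k * d0 k\<bar> \<le> \<gamma>"
    and G2: "\<And>j k. j < r \<Longrightarrow> k < r \<Longrightarrow> \<bar>d j * a j k - b j k * d0 k\<bar> \<le> \<gamma>"
    and aa: "\<And>j l. j < r \<Longrightarrow> l < r \<Longrightarrow> \<bar>(\<Sum>k<r. a j k * a l k) - (if j = l then 1 else 0)\<bar> \<le> \<gamma> / lo"
    and Q: "\<And>j l. j < r \<Longrightarrow> l < r \<Longrightarrow> (\<Sum>k<r. Q k j * Q k l) = (if j = l then 1 else 0)"
    and S_sym: "\<And>j l. j < r \<Longrightarrow> l < r \<Longrightarrow>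
        (\<Sum>k<r. sqrt (d j) * (a j k + b j k) * sqrt (d0 k) * Q l k)
      = (\<Sum>k<r. sqrt (d l) * (a l k + b l k) * sqrt (d0 k) * Q j k)"
    and S_psd: "\<And>x. 0 \<le> ip r x (mv r
        (\<lambda>j l. \<Sum>k<r. sqrt (d j) * (a j k + b j k) * sqrt (d0 k) * Q l k) x)"
begin

lemma dpos: "j < r \<Longrightarrow> 0 < d j" "j < r \<Longrightarrow> 0 < d0 j"
  using lo by fastforce+

lemma \<gamma>0: "0 \<le> \<gamma>"
  using G1[OF r r] by linarith

text \<open>The difference of the two identities is \<open>(d j + d0 k) * (a j k - b j k)\<close>,
  and the sum of singular values is at least \<open>2 * lo\<close>.\<close>

lemma h_bound:
  assumes "j < r" "k < r"
  shows "\<bar>a j k - b j k\<bar> \<le> \<gamma> / lo"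
proof -
  have "(d j + d0 k) * (a j k - b j k) = (d j * a j k - b j k * d0 k) - (d j * b j k - a j k * d0 k)"
    by (simp add: algebra_simps)
  then have "\<bar>(d j + d0 k) * (a j k - b j k)\<bar> \<le> 2 * \<gamma>"
    using G1[OF assms] G2[OF assms] by linarith
  moreover have "2 * lo * \<bar>a j k - b j k\<bar> \<le> \<bar>(d j + d0 k) * (a j k - b j k)\<bar>"
    unfolding abs_mult using lo(1) lo(2)[OF assms(1)] lo(3)[OF assms(2)] by (intro mult_right_mono) simp_all
  ultimately have "2 * lo * \<bar>a j k - b j k\<bar> \<le> 2 * \<gamma>"
    by linarith
  then show ?thesis
    using lo by (simp add: field_simps)
qed

text \<open>The sum of the two identities is the commutator of \<open>a + b\<close> with the
  singular values. So \<open>a\<close> can only connect indices whose singular values nearly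
  agree.\<close>

lemma comm_bound:
  assumes "j < r" "k < r"
  shows "\<bar>d0 k - d j\<bar> * \<bar>a j k + b j k\<bar> \<le> 2 * \<gamma>" "\<bar>d0 k - d j\<bar> * \<bar>a j k\<bar> \<le> 2 * \<rho> * \<gamma>"
proof -
  have "(d0 k - d j) * (a j k + b j k) = - (d j * b j k - a j k * d0 k) - (d j * a j k - b j k * d0 k)"
    by (simp add: algebra_simps)
  then show "\<bar>d0 k - d j\<bar> * \<bar>a j k + b j k\<bar> \<le> 2 * \<gamma>"
    unfolding abs_mult[symmetric] using G1[OF assms] G2[OF assms] by linarith
  have "d0 k * \<bar>a j k - b j k\<bar> \<le> \<rho> * lo * (\<gamma> / lo)"
    using h_bound[OF assms] hi assms \<rho> lo by (intro mult_mono) auto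
  then have "\<bar>d0 k * (a j k - b j k)\<bar> \<le> \<rho> * \<gamma>"
    using lo dpos(2)[OF assms(2)] by (simp add: abs_mult)
  moreover have "(d0 k - d j) * a j k = d0 k * (a j k - b j k) - (d j * a j k - b j k * d0 k)"
    by (simp add: algebra_simps)
  moreover have "\<gamma> \<le> \<rho> * \<gamma>"
    using \<rho> \<gamma>0 by (simp add: mult_le_cancel_right1)
  ultimately show "\<bar>d0 k - d j\<bar> * \<bar>a j k\<bar> \<le> 2 * \<rho> * \<gamma>"
    unfolding abs_mult[symmetric] using G2[OF assms] by linarith
qed

text \<open>The cross product matrix of the two stacked, root-weighted families of singular vectors,
  that is, the matrix whose trace against the rotation is maximized.\<close>

definition C where "C j k = sqrt (d j) * (a j k + b j k) * sqrt (d0 k)"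

definition S where "S j l = (\<Sum>k<r. C j k * Q l k)"

text \<open>Replacing the root of \<open>d0 k\<close> by that of \<open>d j\<close> costs the
  commutator, \<open>2 * \<gamma>\<close>; replacing \<open>b\<close> by \<open>a\<close> costs
  \<open>\<rho> * \<gamma>\<close>.\<close>

lemma C_close:
  assumes "j < r" "k < r"
  shows "\<bar>C j k - 2 * d j * a j k\<bar> \<le> 3 * \<rho> * \<gamma>" "\<bar>C j k\<bar> \<le> 2 * (\<rho> * lo)"
proof -
  have "C j k - 2 * d j * a j k
      = (sqrt (d0 k) - sqrt (d j)) * sqrt (d j) * (a j k + b j k) - d j * (a j k - b j k)"
    using dpos(1)[OF assms(1)] by (simp add: C_def algebra_simps)
  then have "\<bar>C j k - 2 * d j * a j k\<bar>
      \<le> \<bar>(sqrt (d0 k) - sqrt (d j)) * sqrt (d j) * (a j k + b j k)\<bar> + \<bar>d j * (a j k - b j k)\<bar>"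
    by simp
  also have "\<bar>(sqrt (d0 k) - sqrt (d j)) * sqrt (d j) * (a j k + b j k)\<bar>
      \<le> \<bar>d0 k - d j\<bar> * \<bar>a j k + b j k\<bar>"
    unfolding abs_mult
    using sqrt_diff_mult_bound(1)[OF lo(1) lo(3)[OF assms(2)] lo(2)[OF assms(1)]] dpos(1)[OF assms(1)]
    by (intro mult_right_mono) simp_all
  also have "\<dots> \<le> 2 * \<gamma>"
    by (rule comm_bound[OF assms])
  also have "\<bar>d j * (a j k - b j k)\<bar> \<le> \<rho> * lo * (\<gamma> / lo)"
    unfolding abs_mult using h_bound[OF assms] hi assms \<rho> lo dpos(1)[OF assms(1)] by (intro mult_mono) auto
  also have "\<dots> = \<rho> * \<gamma>"
    using lo by simp
  also have "2 * \<gamma> + \<rho> * \<gamma> \<le> 3 * \<rho> * \<gamma>"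
  proof -
    have "1 * \<gamma> \<le> \<rho> * \<gamma>"
      using \<rho> \<gamma>0 by (intro mult_right_mono)
    then show ?thesis by (simp add: mult_ac)
  qed
  finally show "\<bar>C j k - 2 * d j * a j k\<bar> \<le> 3 * \<rho> * \<gamma>"
    by simp
  have "\<bar>C j k\<bar> = sqrt (d j) * sqrt (d0 k) * \<bar>a j k + b j k\<bar>"
    using dpos(1)[OF assms(1)] dpos(2)[OF assms(2)] by (simp add: C_def abs_mult less_imp_le mult_ac)
  also have "\<dots> \<le> sqrt (\<rho> * lo) * sqrt (\<rho> * lo) * 2"
    using hi assms dpos \<rho> lo a1[OF assms] b1[OF assms] by (intro mult_mono) (auto intro: less_imp_le)
  also have "\<dots> = 2 * (\<rho> * lo)"
    using \<rho> lo by simp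
  finally show "\<bar>C j k\<bar> \<le> 2 * (\<rho> * lo)" .
qed

text \<open>C C^T is close to 4 D a a^T D, and a a^T is close to the identity. The
  near-orthogonality of \<open>a\<close> contributes 4 and the errors from \<open>C_close\<close>
  contribute 12; the constant 28 leaves slack.\<close>

lemma CC_close:
  assumes "j < r" "l < r"
  shows "\<bar>(\<Sum>k<r. C j k * C l k) - (if j = l then 4 * (d j)\<^sup>2 else 0)\<bar> \<le> 28 * (real r * (\<rho>\<^sup>2 * lo * \<gamma>))"
proof -
  define \<theta> where "\<theta> j k = C j k - 2 * d j * a j k" for j k
  let ?e = "(\<Sum>k<r. a j k * a l k) - (if j = l then 1 else 0)"
  have "(\<Sum>k<r. C j k * C l k)
      = (\<Sum>k<r. 4 * d j * d l * (a j k * a l k) + (\<theta> j k * C l k + 2 * d j * a j k * \<theta> l k))"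
    by (intro sum.cong) (simp_all add: \<theta>_def algebra_simps)
  also have "\<dots> = 4 * d j * d l * (\<Sum>k<r. a j k * a l k) + (\<Sum>k<r. \<theta> j k * C l k + 2 * d j * a j k * \<theta> l k)"
    by (simp only: sum.distrib sum_distrib_left)
  finally have eq: "(\<Sum>k<r. C j k * C l k) - (if j = l then 4 * (d j)\<^sup>2 else 0)
      = 4 * d j * d l * ?e + (\<Sum>k<r. \<theta> j k * C l k + 2 * d j * a j k * \<theta> l k)"
    by (simp add: algebra_simps power2_eq_square)
  have "\<bar>4 * d j * d l * ?e\<bar> \<le> 4 * (\<rho> * lo) * (\<rho> * lo) * (\<gamma> / lo)"
    unfolding abs_mult using aa[OF assms] hi assms dpos \<rho> lo
    by (intro mult_mono) (auto simp: less_imp_le)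
  also have "\<dots> = 4 * (\<rho>\<^sup>2 * lo * \<gamma>)"
    using lo by (simp add: power2_eq_square)
  also have "\<dots> \<le> 4 * (real r * (\<rho>\<^sup>2 * lo * \<gamma>))"
  proof -
    have "1 * (\<rho>\<^sup>2 * lo * \<gamma>) \<le> real r * (\<rho>\<^sup>2 * lo * \<gamma>)"
      using lo \<rho> \<gamma>0 r by (intro mult_right_mono) simp_all
    then show ?thesis by simp
  qed
  finally have 1: "\<bar>4 * d j * d l * ?e\<bar> \<le> 4 * (real r * (\<rho>\<^sup>2 * lo * \<gamma>))" .
  have summand: "\<bar>\<theta> j k * C l k + 2 * d j * a j k * \<theta> l k\<bar> \<le> 12 * (\<rho>\<^sup>2 * lo * \<gamma>)" if k: "k < r" for k
  proof -
    have "\<bar>\<theta> j k * C l k\<bar> \<le> (3 * \<rho> * \<gamma>) * (2 * (\<rho> * lo))"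
      unfolding abs_mult \<theta>_def using C_close assms k \<rho> \<gamma>0 by (intro mult_mono) auto
    moreover have "\<bar>2 * d j * a j k * \<theta> l k\<bar> \<le> (2 * (\<rho> * lo) * 1) * (3 * \<rho> * \<gamma>)"
      unfolding abs_mult \<theta>_def using C_close assms k \<rho> \<gamma>0 hi dpos(1)[OF assms(1)] a1 lo
      by (intro mult_mono) auto
    ultimately show ?thesis
      by (simp add: power2_eq_square algebra_simps)
  qed
  have "\<bar>\<Sum>k<r. \<theta> j k * C l k + 2 * d j * a j k * \<theta> l k\<bar> \<le> (\<Sum>k<r. 12 * (\<rho>\<^sup>2 * lo * \<gamma>))"
    using summand by (intro order_trans[OF sum_abs sum_mono]) simp
  then have 2: "\<bar>\<Sum>k<r. \<theta> j k * C l k + 2 * d j * a j k * \<theta> l k\<bar> \<le> 12 * (real r * (\<rho>\<^sup>2 * lo * \<gamma>))"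
    by simp
  have "0 \<le> real r * (\<rho>\<^sup>2 * lo * \<gamma>)"
    using lo \<rho> \<gamma>0 by simp
  then show ?thesis
    unfolding eq using 1 2 by linarith
qed

lemma C_eq:
  assumes "j < r" "k < r"
  shows "(\<Sum>l<r. S j l * Q l k) = C j k"
proof -
  have "(\<Sum>l<r. S j l * Q l k) = (\<Sum>l<r. \<Sum>p<r. C j p * (Q l p * Q l k))"
    by (simp add: S_def sum_distrib_right mult.assoc)
  also have "\<dots> = (\<Sum>p<r. C j p * (\<Sum>l<r. Q l p * Q l k))"
    by (subst sum.swap) (simp add: sum_distrib_left)
  also have "\<dots> = (\<Sum>p<r. if p = k then C j k else 0)"
    using assms by (intro sum.cong) (auto simp: Q)
  finally show ?thesis
    using assms by simp
qed

text \<open>S = C Q^T is symmetric and Q is orthogonal, so S S = S S^T = C C^T.\<close>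

lemma S_sq:
  assumes "j < r" "l < r"
  shows "(\<Sum>k<r. S j k * S k l) = (\<Sum>k<r. C j k * C l k)"
proof -
  have S_sym': "S k l = S l k" if "k < r" for k
    using S_sym[OF that assms(2)] by (simp add: S_def C_def)
  have "(\<Sum>k<r. S j k * S k l) = (\<Sum>k<r. S j k * (\<Sum>p<r. C l p * Q k p))"
    using S_sym' by (simp add: S_def)
  also have "\<dots> = (\<Sum>k<r. \<Sum>p<r. C l p * (S j k * Q k p))"
    by (simp add: sum_distrib_left mult_ac)
  also have "\<dots> = (\<Sum>p<r. C l p * (\<Sum>k<r. S j k * Q k p))"
    by (subst sum.swap) (simp add: sum_distrib_left)
  also have "\<dots> = (\<Sum>p<r. C l p * C j p)"
    using C_eq[OF assms(1)] by simp
  finally show ?thesis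
    by (simp add: mult.commute)
qed

text \<open>By \<open>psd_root_close\<close>, S is close to 2 D. Multiplying by Q compares C = S Q
  with 2 D Q, while \<open>C_close\<close> compares the same C with 2 D a.\<close>

lemma Q_close:
  assumes "j < r" "k < r"
  shows "\<bar>a j k - Q j k\<bar> \<le> 9 * (real r)\<^sup>2 * \<rho>\<^sup>2 * \<gamma> / lo"
proof -
  let ?K = "\<lambda>l. S j l - (if j = l then 2 * d j else 0)"
  let ?W = "(real r)\<^sup>2 * \<rho>\<^sup>2 * \<gamma>"
  have "nrm r ?K \<le> real r * (28 * (real r * (\<rho>\<^sup>2 * lo * \<gamma>))) / (2 * lo)"
  proof (rule psd_root_close[OF lo(1,2) _ _ _ assms(1)])
    show "S j l = S l j" if "j < r" "l < r" for j l
      using S_sym[OF that] by (simp add: S_def C_def)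
    show "0 \<le> ip r x (mv r S x)" for x
      using S_psd[of x] unfolding S_def C_def .
    show "\<bar>(\<Sum>k<r. S j k * S k l) - (if j = l then 4 * (d j)\<^sup>2 else 0)\<bar> \<le> 28 * (real r * (\<rho>\<^sup>2 * lo * \<gamma>))"
      if "j < r" "l < r" for j l
      using CC_close[OF that] S_sq[OF that] by simp
  qed
  also have "\<dots> = 14 * ?W"
    using lo by (simp add: power2_eq_square)
  finally have K: "nrm r ?K \<le> 14 * ?W" .
  have "C j k = (\<Sum>l<r. ?K l * Q l k) + 2 * d j * Q j k"
  proof -
    have "(\<Sum>l<r. ?K l * Q l k) = (\<Sum>l<r. S j l * Q l k - (if j = l then 2 * d j * Q j k else 0))"
      by (intro sum.cong) (auto simp: algebra_simps)
    then show ?thesis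
      using C_eq[OF assms] assms by (simp add: sum_subtractf)
  qed
  then have "2 * d j * (a j k - Q j k) = (\<Sum>l<r. ?K l * Q l k) - (C j k - 2 * d j * a j k)"
    by (simp add: algebra_simps)
  moreover have "\<bar>\<Sum>l<r. ?K l * Q l k\<bar> \<le> nrm r ?K * nrm r (\<lambda>l. Q l k)"
    using ip_abs_le[of r ?K "\<lambda>l. Q l k"] by (simp add: ip_def)
  moreover have "nrm r (\<lambda>l. Q l k) = 1"
    using Q[OF assms(2,2)] by (simp add: nrm_def ip_def)
  ultimately have "\<bar>2 * d j * (a j k - Q j k)\<bar> \<le> 14 * ?W + 3 * \<rho> * \<gamma>"
    using K C_close(1)[OF assms] by simp
  also have "\<dots> \<le> 18 * ?W"
  proof -
    have "1 * \<rho> \<le> (real r)\<^sup>2 * \<rho>\<^sup>2"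
      using r \<rho> by (intro mult_mono) (simp_all add: self_le_power)
    then have "\<rho> * \<gamma> \<le> ?W"
      using \<gamma>0 by (simp add: mult_right_mono)
    moreover have "0 \<le> ?W" using \<gamma>0 by simp
    ultimately show ?thesis by (simp only: mult.assoc)
  qed
  finally have "\<bar>2 * d j * (a j k - Q j k)\<bar> \<le> 18 * ?W" .
  moreover have "2 * lo * \<bar>a j k - Q j k\<bar> \<le> \<bar>2 * d j * (a j k - Q j k)\<bar>"
    unfolding abs_mult using lo(2)[OF assms(1)] lo(1) by (intro mult_right_mono) simp_all
  ultimately show ?thesis
    using lo(1) by (simp add: field_simps)
qed

text \<open>Rows of the estimated singular vectors carry the coefficients
  \<open>a j k / d j\<close>, the rotated true ones
  \<open>Q j k / (sqrt (d j) * sqrt (d0 k))\<close>; this is their comparison after rescaling. Where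
  \<open>a j k\<close> is not small the two singular values nearly agree, so the ratio of roots is
  near 1.\<close>

lemma close:
  assumes "j < r" "k < r"
  shows "\<bar>a j k * sqrt (d0 k) / sqrt (d j) - Q j k\<bar> \<le> 12 * (real r)\<^sup>2 * \<rho>\<^sup>2 * \<gamma> / lo"
    "\<bar>b j k * sqrt (d0 k) / sqrt (d j) - Q j k\<bar> \<le> 12 * (real r)\<^sup>2 * \<rho>\<^sup>2 * \<gamma> / lo"
proof -
  let ?W = "(real r)\<^sup>2 * \<rho>\<^sup>2 * \<gamma> / lo" and ?s = "sqrt (d0 k) / sqrt (d j)"
  have "1 * \<rho> \<le> (real r)\<^sup>2 * \<rho>\<^sup>2"
    using r \<rho> by (intro mult_mono) (simp_all add: self_le_power)
  then have W: "\<rho> * \<gamma> / lo \<le> ?W"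
    using \<gamma>0 lo by (intro divide_right_mono mult_right_mono) simp_all
  have "\<bar>a j k * (?s - 1)\<bar> \<le> \<bar>a j k\<bar> * (\<bar>d0 k - d j\<bar> / lo)"
    unfolding abs_mult using sqrt_diff_mult_bound(2)[OF lo(1) lo(3)[OF assms(2)] lo(2)[OF assms(1)]]
    by (rule mult_left_mono) simp
  also have "\<dots> \<le> 2 * \<rho> * \<gamma> / lo"
    using comm_bound(2)[OF assms] lo by (simp add: divide_right_mono mult.commute)
  finally have 1: "\<bar>a j k * (?s - 1)\<bar> \<le> 2 * ?W"
    using W by simp
  have "\<bar>(b j k - a j k) * ?s\<bar> \<le> (\<gamma> / lo) * \<rho>"
    unfolding abs_mult
  proof (rule mult_mono)
    show "\<bar>b j k - a j k\<bar> \<le> \<gamma> / lo"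
      using h_bound[OF assms] by linarith
    have "?s \<le> sqrt (\<rho>\<^sup>2)"
    proof -
      have "d0 k / d j \<le> \<rho> * lo / lo"
        using hi lo assms \<rho> dpos by (intro frac_le) (auto intro: less_imp_le)
      also have "\<dots> \<le> \<rho>\<^sup>2"
        using lo \<rho> by (simp add: power2_eq_square)
      finally show ?thesis
        unfolding real_sqrt_divide[symmetric] by (rule real_sqrt_le_mono)
    qed
    then show "\<bar>?s\<bar> \<le> \<rho>"
      using \<rho> dpos assms by (simp add: less_imp_le)
  qed (use \<gamma>0 lo in simp_all)
  then have 2: "\<bar>(b j k - a j k) * ?s\<bar> \<le> ?W"
    using W by (simp add: mult.commute)
  have 3: "\<bar>a j k - Q j k\<bar> \<le> 9 * ?W"
    using Q_close[OF assms] by simp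
  have eq: "a j k * sqrt (d0 k) / sqrt (d j) - Q j k = a j k * (?s - 1) + (a j k - Q j k)"
    "b j k * sqrt (d0 k) / sqrt (d j) - Q j k = (b j k - a j k) * ?s + a j k * (?s - 1) + (a j k - Q j k)"
    by (simp_all add: algebra_simps diff_divide_distrib)
  have W_eq: "12 * (real r)\<^sup>2 * \<rho>\<^sup>2 * \<gamma> / lo = 2 * ?W + 9 * ?W + ?W"
    by simp
  have W0: "0 \<le> ?W" using \<gamma>0 lo by simp
  show "\<bar>a j k * sqrt (d0 k) / sqrt (d j) - Q j k\<bar> \<le> 12 * (real r)\<^sup>2 * \<rho>\<^sup>2 * \<gamma> / lo"
    unfolding W_eq eq(1)
    by (rule order_trans[OF abs_triangle_ineq order_trans[OF add_mono[OF 1 3]]]) (use W0 in linarith)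
  show "\<bar>b j k * sqrt (d0 k) / sqrt (d j) - Q j k\<bar> \<le> 12 * (real r)\<^sup>2 * \<rho>\<^sup>2 * \<gamma> / lo"
    unfolding W_eq eq(2)
    by (rule order_trans[OF abs_triangle_ineq order_trans[OF add_mono[OF order_trans[OF abs_triangle_ineq add_mono[OF 2 1]] 3]]]) simp
qed

end

section \<open>Deterministic perturbation bounds\<close>

abbreviation (input) nth_col :: "(nat \<Rightarrow> nat \<Rightarrow> real) \<Rightarrow> nat \<Rightarrow> nat \<Rightarrow> real" where
  "nth_col A k \<equiv> (\<lambda>i. A i k)"

lemma add_le_double: "b \<le> a \<Longrightarrow> 0 \<le> c \<Longrightarrow> a + (b + c) \<le> 2 * (a + c)" for a b c :: real
  by simp

definition orthonormal :: "nat \<Rightarrow> nat \<Rightarrow> (nat \<Rightarrow> nat \<Rightarrow> real) \<Rightarrow> bool" where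
  "orthonormal n r U \<longleftrightarrow> (\<forall>j<r. \<forall>k<r. ip n (nth_col U j) (nth_col U k) = (if j = k then 1 else 0))"

lemma orthonormalD:
  "orthonormal n r U \<Longrightarrow> j < r \<Longrightarrow> k < r \<Longrightarrow> ip n (nth_col U j) (nth_col U k) = (if j = k then 1 else 0)"
  by (simp add: orthonormal_def)

lemma orthonormal_nrm: "orthonormal n r U \<Longrightarrow> j < r \<Longrightarrow> nrm n (nth_col U j) = 1"
  by (simp add: nrm_def orthonormalD)

lemma residual_orthogonal:
  assumes U: "orthonormal n r U" and j: "j < r"
  shows "ip n (nth_col U j) (\<lambda>i. x i - (\<Sum>k<r. ip n (nth_col U k) x * U i k)) = 0"
proof -
  have "ip n (nth_col U j) (\<lambda>i. \<Sum>k<r. ip n (nth_col U k) x * U i k)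
      = (\<Sum>k<r. ip n (nth_col U k) x * ip n (nth_col U j) (nth_col U k))"
    by (rule ip_sum_right)
  also have "\<dots> = (\<Sum>k<r. if j = k then ip n (nth_col U k) x else 0)"
    using j by (intro sum.cong) (auto simp: orthonormalD[OF U])
  finally show ?thesis
    using j by (simp add: ip_diff_right)
qed

text \<open>The residual is orthogonal to the part that was subtracted, so its squared norm equals
  its product with \<open>x\<close>.\<close>

lemma residual_le:
  assumes U: "orthonormal n r U"
  shows "nrm n (\<lambda>i. x i - (\<Sum>k<r. ip n (nth_col U k) x * U i k)) \<le> nrm n x"
proof -
  let ?w = "\<lambda>i. x i - (\<Sum>k<r. ip n (nth_col U k) x * U i k)"
  have "ip n ?w ?w = ip n x ?w - (\<Sum>k<r. ip n (nth_col U k) x * ip n (nth_col U k) ?w)"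
    unfolding ip_diff_left[of n x] ip_sum_left ..
  also have "\<dots> = ip n x ?w"
    using residual_orthogonal[OF U] by simp
  finally have "(nrm n ?w)\<^sup>2 \<le> nrm n x * nrm n ?w"
    using ip_abs_le[of n x ?w] by (simp add: nrm_sq)
  then have "nrm n ?w * nrm n ?w \<le> nrm n x * nrm n ?w"
    by (simp add: power2_eq_square)
  moreover have "0 < nrm n ?w" if "nrm n ?w \<noteq> 0"
    using that nrm_ge_0[of n ?w] by linarith
  ultimately show ?thesis
    by (cases "nrm n ?w = 0") (simp, blast intro: mult_right_le_imp_le)
qed

text \<open>If the orthonormal columns of \<open>U\<close> are combinations of the \<open>r\<close> columns of \<open>L\<close>, the two column
  spaces coincide: a left inverse of a square matrix is a right inverse.\<close>

lemma column_space_eq: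
  assumes U: "orthonormal n r U" and UL: "\<And>i k. i < n \<Longrightarrow> k < r \<Longrightarrow> U i k = (\<Sum>p<r. L i p * Y p k)"
    and "i < n" "p < r"
  shows "L i p = (\<Sum>k<r. ip n (nth_col U k) (nth_col L p) * U i k)"
proof -
  let ?Y = "Matrix.mat r r (\<lambda>(p, k). Y p k)"
  let ?G = "Matrix.mat r r (\<lambda>(k, p). ip n (nth_col U k) (nth_col L p))"
  have "?G * ?Y = 1\<^sub>m r"
  proof (rule eq_matI)
    fix j k assume jk: "j < dim_row (1\<^sub>m r)" "k < dim_col (1\<^sub>m r)"
    have "ip n (nth_col U j) (nth_col U k) = ip n (nth_col U j) (\<lambda>i. \<Sum>p<r. Y p k * L i p)"
      using jk UL by (intro ip_cong) (simp_all add: mult.commute)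
    also have "\<dots> = (\<Sum>p<r. ip n (nth_col U j) (nth_col L p) * Y p k)"
      unfolding ip_sum_right by (simp add: mult.commute)
    finally show "(?G * ?Y) $$ (j, k) = 1\<^sub>m r $$ (j, k)"
      using jk orthonormalD[OF U, of j k] by (simp add: scalar_prod_def atLeast0LessThan)
  qed simp_all
  then have YG: "?Y * ?G = 1\<^sub>m r"
    by (intro mat_mult_left_right_inverse[where A = ?G]) simp_all
  have YG': "(\<Sum>k<r. Y q k * ip n (nth_col U k) (nth_col L p)) = (if q = p then 1 else 0)" if "q < r" for q
    using that assms(4) arg_cong[OF YG, of "\<lambda>A. A $$ (q, p)"]
    by (simp add: scalar_prod_def atLeast0LessThan)
  have "(\<Sum>k<r. ip n (nth_col U k) (nth_col L p) * U i k)
      = (\<Sum>k<r. \<Sum>q<r. L i q * (Y q k * ip n (nth_col U k) (nth_col L p)))"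
    using UL assms(3) by (simp add: sum_distrib_left mult_ac)
  also have "\<dots> = (\<Sum>q<r. L i q * (\<Sum>k<r. Y q k * ip n (nth_col U k) (nth_col L p)))"
    by (subst sum.swap) (simp add: sum_distrib_left)
  also have "\<dots> = (\<Sum>q<r. if q = p then L i p else 0)"
    by (intro sum.cong) (auto simp: YG')
  finally show ?thesis
    using assms(4) by simp
qed

lemma frame_col_le:
  assumes "\<And>y. nrm n (mv r L y) \<le> c * nrm r y" "k < r"
  shows "nrm n (nth_col L k) \<le> c"
  using assms(1)[of "\<lambda>i. if i = k then 1 else 0"] assms(2) by (simp add: mv_unit nrm_unit)

text \<open>\<open>A\<close> and \<open>B\<close> are the sizes of loadings and factors, so their
  product is the order of the singular values. \<open>LEF\<close> is the bilinear noise bound, of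
  the size of its standard deviation. The assumptions are symmetric in the two sides of the model,
  and \<open>2 * e \<le> d j\<close> is the condition of \<open>leave_one_out\<close>.\<close>

locale factor_pert =
  fixes n m r :: nat and L F E U V U0 V0 :: "nat \<Rightarrow> nat \<Rightarrow> real" and d d0 :: "nat \<Rightarrow> real"
    and Q :: "nat \<Rightarrow> nat \<Rightarrow> real" and A B e \<kappa> :: real
  assumes r: "0 < r" and \<kappa>: "2 \<le> \<kappa>" "real r \<le> \<kappa>" and A: "0 < A" and B: "0 < B" and e: "0 \<le> e"
    and Lu: "\<And>y. nrm n (mv r L y) \<le> \<kappa> * A * nrm r y"
    and Fu: "\<And>y. nrm m (mv r F y) \<le> \<kappa> * B * nrm r y"
    and E: "op_bound n m E e"
    and U: "orthonormal n r U" and V: "orthonormal m r V"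
    and U0: "orthonormal n r U0" and V0: "orthonormal m r V0"
    and XV: "\<And>i j. i < n \<Longrightarrow> j < r \<Longrightarrow> mv r L (mv m (mtr F) (nth_col V j)) i + mv m E (nth_col V j) i = d j * U i j"
    and XU: "\<And>t j. t < m \<Longrightarrow> j < r \<Longrightarrow> mv r F (mv n (mtr L) (nth_col U j)) t + mv n (mtr E) (nth_col U j) t = d j * V t j"
    and MV: "\<And>i j. i < n \<Longrightarrow> j < r \<Longrightarrow> mv r L (mv m (mtr F) (nth_col V0 j)) i = d0 j * U0 i j"
    and MU: "\<And>t j. t < m \<Longrightarrow> j < r \<Longrightarrow> mv r F (mv n (mtr L) (nth_col U0 j)) t = d0 j * V0 t j"
    and d_lo: "\<And>j. j < r \<Longrightarrow> A * B / \<kappa> ^ 3 \<le> d j" "\<And>j. j < r \<Longrightarrow> 2 * e \<le> d j"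
    and d0_lo: "\<And>j. j < r \<Longrightarrow> A * B / \<kappa> ^ 3 \<le> d0 j"
    and LEF: "\<And>p q. p < r \<Longrightarrow> q < r \<Longrightarrow> \<bar>ip n (nth_col L p) (mv m E (nth_col F q))\<bar> \<le> \<kappa> * A * B"
    and Q: "\<And>j l. j < r \<Longrightarrow> l < r \<Longrightarrow> (\<Sum>k<r. Q k j * Q k l) = (if j = l then 1 else 0)"
    and S_sym: "\<And>j l. j < r \<Longrightarrow> l < r \<Longrightarrow>
        (\<Sum>k<r. sqrt (d j) * (ip n (nth_col U j) (nth_col U0 k) + ip m (nth_col V j) (nth_col V0 k)) * sqrt (d0 k) * Q l k)
      = (\<Sum>k<r. sqrt (d l) * (ip n (nth_col U l) (nth_col U0 k) + ip m (nth_col V l) (nth_col V0 k)) * sqrt (d0 k) * Q j k)"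
    and S_psd: "\<And>x. 0 \<le> ip r x (mv r (\<lambda>j l. \<Sum>k<r.
        sqrt (d j) * (ip n (nth_col U j) (nth_col U0 k) + ip m (nth_col V j) (nth_col V0 k)) * sqrt (d0 k) * Q l k) x)"
begin

text \<open>Because of this symmetry every estimate for factors yields one for loadings.\<close>

lemma transposed: "factor_pert m n r F L (mtr E) V U V0 U0 d d0 Q B A e \<kappa>"
proof
  fix p q assume "p < r" "q < r"
  then show "\<bar>ip m (nth_col F p) (mv n (mtr E) (nth_col L q))\<bar> \<le> \<kappa> * B * A"
    using LEF[of q p] unfolding ip_mv[symmetric] by (simp add: ip_commute[of n "mv m E _"] mult_ac)
qed (use r \<kappa> A B e Lu Fu E U V U0 V0 XV XU MV MU d_lo d0_lo Q S_sym S_psd op_bound_tr in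
      \<open>simp_all add: add.commute mult.commute[of B A]\<close>)

definition lo where "lo = A * B / \<kappa> ^ 3"

text \<open>\<open>\<kappa> ^ 12\<close> comes from the bilinear forms of the noise between true
  singular vectors, \<open>e\<^sup>2 / lo\<close> from the part of an estimated vector outside their
  span.\<close>

definition \<gamma> where "\<gamma> = \<kappa> ^ 12 + e\<^sup>2 / lo"

lemma \<kappa>0: "0 < \<kappa>" using \<kappa> by linarith

lemma lo0: "0 < lo" using A B \<kappa>0 by (simp add: lo_def)

lemma \<gamma>0: "0 < \<gamma>" using \<kappa>0 lo0 by (simp add: \<gamma>_def add_pos_nonneg)

lemma dpos: "j < r \<Longrightarrow> 0 < d j" "j < r \<Longrightarrow> 0 < d0 j"
  using d_lo(1) d0_lo lo0 unfolding lo_def by (auto intro: less_le_trans)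

lemma d0_hi:
  assumes j: "j < r"
  shows "d0 j \<le> \<kappa> ^ 6 * lo"
proof -
  have "d0 j = d0 j * nrm n (nth_col U0 j)"
    using orthonormal_nrm[OF U0 j] by simp
  also have "\<dots> = nrm n (mv r L (mv m (mtr F) (nth_col V0 j)))"
    using dpos(2)[OF j] MV j by (simp cong: nrm_cong add: nrm_scale)
  also have "\<dots> \<le> \<kappa> * A * nrm r (mv m (mtr F) (nth_col V0 j))"
    by (rule Lu)
  also have "\<dots> \<le> \<kappa> * A * (\<kappa> * B * nrm m (nth_col V0 j))"
    using A B \<kappa>0 Fu by (intro mult_left_mono op_boundD[OF op_bound_tr]) (auto simp: op_bound_def)
  also have "\<dots> = \<kappa>\<^sup>2 * (A * B)"
    using orthonormal_nrm[OF V0 j] by (simp add: power2_eq_square)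
  also have "\<dots> \<le> \<kappa> ^ 3 * (A * B)"
    using A B \<kappa> by (intro mult_right_mono power_increasing) auto
  also have "\<dots> = \<kappa> ^ 6 * lo"
    using \<kappa>0 by (simp add: lo_def power_diff[symmetric] field_simps flip: power_add)
  finally show ?thesis .
qed

text \<open>The noise contributes at most half of the singular value and is absorbed; the resulting
  factor 2 is bounded by one more \<open>\<kappa>\<close>.\<close>

lemma d_hi:
  assumes j: "j < r"
  shows "d j \<le> \<kappa> ^ 6 * lo"
proof -
  have "d j = d j * nrm n (nth_col U j)"
    using orthonormal_nrm[OF U j] by simp
  also have "\<dots> = nrm n (\<lambda>i. mv r L (mv m (mtr F) (nth_col V j)) i + mv m E (nth_col V j) i)"
    using dpos(1)[OF j] XV j by (simp cong: nrm_cong add: nrm_scale)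
  also have "\<dots> \<le> nrm n (mv r L (mv m (mtr F) (nth_col V j))) + nrm n (mv m E (nth_col V j))"
    by (rule nrm_triangle)
  also have "nrm n (mv m E (nth_col V j)) \<le> e"
    using op_boundD[OF E, of "nth_col V j"] orthonormal_nrm[OF V j] by simp
  also have "nrm n (mv r L (mv m (mtr F) (nth_col V j))) \<le> \<kappa> * A * nrm r (mv m (mtr F) (nth_col V j))"
    by (rule Lu)
  also have "\<dots> \<le> \<kappa> * A * (\<kappa> * B * nrm m (nth_col V j))"
    using A B \<kappa>0 Fu by (intro mult_left_mono op_boundD[OF op_bound_tr]) (auto simp: op_bound_def)
  also have "\<dots> = \<kappa>\<^sup>2 * (A * B)"
    using orthonormal_nrm[OF V j] by (simp add: power2_eq_square)
  finally have "d j \<le> 2 * (\<kappa>\<^sup>2 * (A * B))"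
    using d_lo(2)[OF j] by linarith
  also have "\<dots> \<le> \<kappa> * (\<kappa>\<^sup>2 * (A * B))"
    using A B \<kappa> by (intro mult_right_mono) auto
  also have "\<dots> = \<kappa> ^ 6 * lo"
    using \<kappa>0 by (simp add: lo_def field_simps flip: power_add power_Suc)
  finally show ?thesis .
qed

text \<open>Dividing \<open>MV\<close> by the nonzero \<open>d0 k\<close> writes the columns of
  \<open>U0\<close> as combinations of those of \<open>L\<close>, so \<open>column_space_eq\<close>
  applies.\<close>

lemma L_proj:
  assumes "i < n"
  shows "mv r L y i = (\<Sum>k<r. ip n (nth_col U0 k) (mv r L y) * U0 i k)"
proof -
  have U0_eq: "U0 i k = (\<Sum>p<r. L i p * (mv m (mtr F) (nth_col V0 k) p / d0 k))" if "i < n" "k < r" for i k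
  proof -
    have "d0 k * U0 i k = d0 k * (\<Sum>p<r. L i p * (mv m (mtr F) (nth_col V0 k) p / d0 k))"
      using MV[OF that] dpos(2)[OF that(2)] by (simp add: mv_def[of r] sum_distrib_left)
    then show ?thesis
      using dpos(2)[OF that(2)] by simp
  qed
  have "mv r L y i = (\<Sum>p<r. (\<Sum>k<r. ip n (nth_col U0 k) (nth_col L p) * U0 i k) * y p)"
    unfolding mv_def
    using column_space_eq[OF U0 U0_eq assms] by (intro sum.cong arg_cong2[where f = "(*)"]) auto
  also have "\<dots> = (\<Sum>p<r. \<Sum>k<r. U0 i k * (y p * ip n (nth_col U0 k) (nth_col L p)))"
    by (simp add: sum_distrib_right sum_distrib_left mult_ac)
  also have "\<dots> = (\<Sum>k<r. U0 i k * (\<Sum>p<r. y p * ip n (nth_col U0 k) (nth_col L p)))"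
    by (subst sum.swap) (simp add: sum_distrib_left)
  also have "\<dots> = (\<Sum>k<r. ip n (nth_col U0 k) (mv r L y) * U0 i k)"
  proof -
    have "ip n (nth_col U0 k) (mv r L y) = (\<Sum>p<r. y p * ip n (nth_col U0 k) (nth_col L p))" for k
      using ip_sum_right[of n "nth_col U0 k" y "nth_col L" "{..<r}"] by (simp add: mv_def mult.commute)
    then show ?thesis
      by (simp add: mult.commute)
  qed
  finally show ?thesis .
qed

text \<open>\<open>d0 j\<close> times column j of \<open>U0\<close> is \<open>L\<close> applied to a
  vector of size \<open>\<kappa> * B\<close>, and similarly on the right, so the form reduces to the
  entries bounded in \<open>LEF\<close>. The exponent is 5 from the numerator and 6 from expressing
  \<open>A * B\<close> twice through \<open>lo\<close>.\<close>

lemma U0_E_V0: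
  assumes "j < r" "k < r"
  shows "\<bar>ip n (nth_col U0 j) (mv m E (nth_col V0 k))\<bar> \<le> \<kappa> ^ 11"
proof -
  define y where "y = mv m (mtr F) (nth_col V0 j)"
  define z where "z = mv n (mtr L) (nth_col U0 k)"
  have y: "\<bar>y p\<bar> \<le> \<kappa> * B" if "p < r" for p
    using ip_abs_le[of m "nth_col F p" "nth_col V0 j"] frame_col_le[OF Fu that] orthonormal_nrm[OF V0 assms(1)]
    by (simp add: y_def mv_ip mtr_def)
  have z: "\<bar>z p\<bar> \<le> \<kappa> * A" if "p < r" for p
    using ip_abs_le[of n "nth_col L p" "nth_col U0 k"] frame_col_le[OF Lu that] orthonormal_nrm[OF U0 assms(2)]
    by (simp add: z_def mv_ip mtr_def)
  have "d0 j * d0 k * ip n (nth_col U0 j) (mv m E (nth_col V0 k))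
      = ip n (\<lambda>i. d0 j * U0 i j) (mv m E (\<lambda>t. d0 k * V0 t k))"
    by (simp add: mv_scale ip_scale_left ip_scale_right)
  also have "mv m E (\<lambda>t. d0 k * V0 t k) = mv m E (mv r F z)"
    by (intro mv_cong) (simp add: MU assms z_def)
  also have "\<dots> = (\<lambda>i. \<Sum>q<r. z q * mv m E (nth_col F q) i)"
    by (subst mv_def) (simp add: mv_sum[symmetric] mult.commute)
  also have "ip n (\<lambda>i. d0 j * U0 i j) (\<lambda>i. \<Sum>q<r. z q * mv m E (nth_col F q) i)
      = ip n (\<lambda>i. \<Sum>p<r. y p * L i p) (\<lambda>i. \<Sum>q<r. z q * mv m E (nth_col F q) i)"
    by (intro ip_cong) (simp_all add: MV[OF _ assms(1), symmetric] y_def[symmetric] mv_def[of r] mult.commute)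
  also have "\<dots> = (\<Sum>p<r. y p * (\<Sum>q<r. z q * ip n (nth_col L p) (mv m E (nth_col F q))))"
    by (simp only: ip_sum_left ip_sum_right)
  finally have eq: "d0 j * d0 k * ip n (nth_col U0 j) (mv m E (nth_col V0 k))
      = (\<Sum>p<r. y p * (\<Sum>q<r. z q * ip n (nth_col L p) (mv m E (nth_col F q))))" .
  have "\<bar>\<Sum>p<r. y p * (\<Sum>q<r. z q * ip n (nth_col L p) (mv m E (nth_col F q)))\<bar>
      \<le> (\<Sum>p<r. (\<kappa> * B) * (\<Sum>q<r. (\<kappa> * A) * (\<kappa> * A * B)))"
  proof (rule order_trans[OF sum_abs sum_mono])
    fix p assume "p \<in> {..<r}"
    then have p: "p < r" by simp
    have "\<bar>\<Sum>q<r. z q * ip n (nth_col L p) (mv m E (nth_col F q))\<bar> \<le> (\<Sum>q<r. (\<kappa> * A) * (\<kappa> * A * B))"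
    proof (rule order_trans[OF sum_abs sum_mono])
      fix q assume "q \<in> {..<r}"
      then show "\<bar>z q * ip n (nth_col L p) (mv m E (nth_col F q))\<bar> \<le> (\<kappa> * A) * (\<kappa> * A * B)"
        unfolding abs_mult using z LEF[OF p] A B \<kappa>0 by (intro mult_mono) auto
    qed
    then show "\<bar>y p * (\<Sum>q<r. z q * ip n (nth_col L p) (mv m E (nth_col F q)))\<bar>
        \<le> (\<kappa> * B) * (\<Sum>q<r. (\<kappa> * A) * (\<kappa> * A * B))"
      unfolding abs_mult using y[OF p] B \<kappa>0 by (intro mult_mono) auto
  qed
  also have "\<dots> = real r * real r * (\<kappa> ^ 3 * (A * B)\<^sup>2)"
    by (simp add: power2_eq_square power3_eq_cube)
  also have "\<dots> \<le> \<kappa> * \<kappa> * (\<kappa> ^ 3 * (A * B)\<^sup>2)"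
    using \<kappa> by (intro mult_mono) auto
  also have "\<dots> = \<kappa> ^ 11 * (lo * lo)"
    using \<kappa>0 by (simp add: lo_def field_simps flip: power_add power_Suc power2_eq_square)
  finally have "\<bar>d0 j * d0 k * ip n (nth_col U0 j) (mv m E (nth_col V0 k))\<bar> \<le> \<kappa> ^ 11 * (lo * lo)"
    by (simp only: eq)
  moreover have "lo * lo * \<bar>ip n (nth_col U0 j) (mv m E (nth_col V0 k))\<bar>
      \<le> \<bar>d0 j * d0 k * ip n (nth_col U0 j) (mv m E (nth_col V0 k))\<bar>"
    unfolding abs_mult using d0_lo assms lo0 unfolding lo_def[symmetric]
    by (intro mult_right_mono mult_mono) (auto intro: order_trans[OF _ abs_ge_self])
  ultimately have "lo * lo * \<bar>ip n (nth_col U0 j) (mv m E (nth_col V0 k))\<bar> \<le> lo * lo * \<kappa> ^ 11"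
    by (simp add: mult.commute)
  then show ?thesis
    using lo0 by simp
qed

definition res where
  "res j = (\<lambda>i. U i j - (\<Sum>k<r. ip n (nth_col U0 k) (nth_col U j) * U0 i k))"

text \<open>Projecting the singular vector equation off the columns of \<open>U0\<close> removes the
  common component by \<open>L_proj\<close>; only the noise remains, divided by a singular
  value.\<close>

lemma res_le:
  assumes j: "j < r"
  shows "nrm n (res j) \<le> e / lo"
proof -
  let ?P = "\<lambda>x i. x i - (\<Sum>k<r. ip n (nth_col U0 k) x * U0 i k)"
  let ?y = "mv m (mtr F) (nth_col V j)"
  have "d j * nrm n (res j) = nrm n (?P (\<lambda>i. d j * U i j))"
    using dpos(1)[OF j] unfolding res_def
    by (simp add: ip_scale_right mult.assoc sum_distrib_left[symmetric] right_diff_distrib[symmetric] nrm_scale)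
  also have "\<dots> = nrm n (?P (\<lambda>i. mv r L ?y i + mv m E (nth_col V j) i))"
    by (intro nrm_cong arg_cong2[where f = "(-)"] sum.cong arg_cong2[where f = "(*)"] ip_cong refl)
       (simp_all add: XV j)
  also have "\<dots> = nrm n (?P (mv m E (nth_col V j)))"
    by (intro nrm_cong) (subst L_proj, assumption, simp add: ip_add_right distrib_right sum.distrib)
  also have "\<dots> \<le> nrm n (mv m E (nth_col V j))"
    by (rule residual_le[OF U0])
  also have "\<dots> \<le> e"
    using op_boundD[OF E, of "nth_col V j"] orthonormal_nrm[OF V j] by simp
  finally have "d j * nrm n (res j) \<le> e" .
  moreover have "lo * nrm n (res j) \<le> d j * nrm n (res j)"
    using d_lo(1)[OF j] by (intro mult_right_mono) (simp_all add: lo_def)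
  ultimately have "lo * nrm n (res j) \<le> e"
    by linarith
  then show ?thesis
    using lo0 by (simp add: field_simps)
qed

lemma U_split: "U i j = (\<Sum>k<r. ip n (nth_col U j) (nth_col U0 k) * U0 i k) + res j i"
  by (simp add: res_def ip_commute[of n "nth_col U j"])

lemma a_le: "j < r \<Longrightarrow> k < r \<Longrightarrow> \<bar>ip n (nth_col U j) (nth_col U0 k)\<bar> \<le> 1"
  using ip_abs_le[of n "nth_col U j" "nth_col U0 k"] by (simp add: orthonormal_nrm[OF U] orthonormal_nrm[OF U0])

text \<open>Moving the matrices across the inner products leaves exactly the bilinear form of the
  noise in an estimated and a true singular vector.\<close>

lemma G1:
  assumes "j < r" "k < r"
  shows "\<bar>d j * ip m (nth_col V j) (nth_col V0 k) - ip n (nth_col U j) (nth_col U0 k) * d0 k\<bar> \<le> \<gamma>"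
proof -
  let ?x = "mv m E (nth_col V0 k)"
  have "d j * ip m (nth_col V j) (nth_col V0 k)
      = ip m (\<lambda>t. mv r F (mv n (mtr L) (nth_col U j)) t + mv n (mtr E) (nth_col U j) t) (nth_col V0 k)"
    unfolding ip_scale_left[symmetric] by (intro ip_cong) (simp_all add: XU assms)
  also have "\<dots> = ip n (nth_col U j) (mv r L (mv m (mtr F) (nth_col V0 k))) + ip n (nth_col U j) ?x"
    by (simp add: ip_add_left ip_mv)
  also have "ip n (nth_col U j) (mv r L (mv m (mtr F) (nth_col V0 k))) = ip n (nth_col U j) (\<lambda>i. d0 k * U0 i k)"
    by (intro ip_cong) (simp_all add: MV assms)
  finally have eq: "d j * ip m (nth_col V j) (nth_col V0 k) - ip n (nth_col U j) (nth_col U0 k) * d0 k = ip n (nth_col U j) ?x"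
    by (simp add: ip_scale_right)
  \<comment> \<open>The component in the span of \<open>U0\<close> meets only true vectors and stays
    bounded; the residual is of size \<open>e / lo\<close> and meets the noise once more.\<close>
  also have "\<dots> = (\<Sum>l<r. ip n (nth_col U j) (nth_col U0 l) * ip n (nth_col U0 l) ?x) + ip n (res j) ?x"
    by (subst U_split) (simp add: ip_add_left ip_sum_left)
  also have "\<bar>\<dots>\<bar> \<le> \<kappa> ^ 12 + e\<^sup>2 / lo"
  proof (rule order_trans[OF abs_triangle_ineq add_mono])
    have "\<bar>\<Sum>l<r. ip n (nth_col U j) (nth_col U0 l) * ip n (nth_col U0 l) ?x\<bar> \<le> (\<Sum>l<r. 1 * \<kappa> ^ 11)"
    proof (rule order_trans[OF sum_abs sum_mono])
      fix l assume "l \<in> {..<r}"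
      then show "\<bar>ip n (nth_col U j) (nth_col U0 l) * ip n (nth_col U0 l) ?x\<bar> \<le> 1 * \<kappa> ^ 11"
        unfolding abs_mult using a_le U0_E_V0 assms by (intro mult_mono) auto
    qed
    also have "\<dots> \<le> \<kappa> * \<kappa> ^ 11"
      using \<kappa> by (simp add: mult_right_mono)
    finally show "\<bar>\<Sum>l<r. ip n (nth_col U j) (nth_col U0 l) * ip n (nth_col U0 l) ?x\<bar> \<le> \<kappa> ^ 12"
      by (simp flip: power_Suc)
    have "\<bar>ip n (res j) ?x\<bar> \<le> nrm n (res j) * nrm n ?x"
      by (rule ip_abs_le)
    also have "\<dots> \<le> e / lo * e"
      using op_boundD[OF E, of "nth_col V0 k"] orthonormal_nrm[OF V0 assms(2)] res_le[OF assms(1)] e lo0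
      by (intro mult_mono) simp_all
    finally show "\<bar>ip n (res j) ?x\<bar> \<le> e\<^sup>2 / lo"
      by (simp add: power2_eq_square)
  qed
  finally show ?thesis
    by (simp add: \<gamma>_def)
qed

text \<open>Orthonormality of the estimated vectors turns the defect of a a^T into the Gram matrix
  of the residuals, which is quadratic in \<open>e / lo\<close>.\<close>

lemma aa_close:
  assumes "j < r" "l < r"
  shows "\<bar>(\<Sum>k<r. ip n (nth_col U j) (nth_col U0 k) * ip n (nth_col U l) (nth_col U0 k)) - (if j = l then 1 else 0)\<bar> \<le> \<gamma> / lo"
proof -
  have "ip n (res j) (nth_col U0 k) = 0" if "k < r" for k
    using residual_orthogonal[OF U0 that, of "nth_col U j"] by (simp add: res_def ip_commute)
  then have "ip n (res j) (nth_col U l) = ip n (res j) (res l)"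
    by (subst U_split) (simp add: ip_add_right ip_sum_right)
  moreover have "ip n (nth_col U j) (nth_col U l)
      = (\<Sum>k<r. ip n (nth_col U j) (nth_col U0 k) * ip n (nth_col U0 k) (nth_col U l)) + ip n (res j) (nth_col U l)"
    by (subst U_split[of _ j]) (simp add: ip_add_left ip_sum_left)
  ultimately have eq: "(\<Sum>k<r. ip n (nth_col U j) (nth_col U0 k) * ip n (nth_col U l) (nth_col U0 k)) - (if j = l then 1 else 0)
      = - ip n (res j) (res l)"
    using orthonormalD[OF U assms] by (simp add: ip_commute[of n "nth_col U l"])
  have "\<bar>- ip n (res j) (res l)\<bar> \<le> nrm n (res j) * nrm n (res l)"
    using ip_abs_le by simp
  also have "\<dots> \<le> (e / lo) * (e / lo)"
    using res_le assms e lo0 by (intro mult_mono) auto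
  also have "\<dots> = (e\<^sup>2 / lo) / lo"
    by (simp add: power2_eq_square)
  also have "\<dots> \<le> \<gamma> / lo"
    using lo0 \<kappa>0 by (intro divide_right_mono) (simp_all add: \<gamma>_def)
  finally show ?thesis
    unfolding eq .
qed

end

context factor_pert
begin

interpretation T: factor_pert m n r F L "mtr E" V U V0 U0 d d0 Q B A e \<kappa>
  by (rule transposed)

lemma transposed_consts: "T.lo = lo" "T.\<gamma> = \<gamma>"
  by (simp_all add: T.lo_def lo_def T.\<gamma>_def \<gamma>_def mult.commute)

text \<open>The assumptions on \<open>b\<close> and the second identity come from the transposed
  copy \<open>T\<close>; \<open>\<kappa> ^ 6\<close> is the ratio between the upper and the lower
  bound on singular values.\<close>

lemma procrustes: "procrustes_pert r (\<lambda>j k. ip n (nth_col U j) (nth_col U0 k)) (\<lambda>j k. ip m (nth_col V j) (nth_col V0 k))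
  Q d d0 lo (\<kappa> ^ 6) \<gamma>"
proof
  show "1 \<le> \<kappa> ^ 6"
    using \<kappa> by (simp add: one_le_power)
qed (use r lo0 d_lo(1) d0_lo d_hi d0_hi G1 T.G1 a_le T.a_le aa_close Q S_sym S_psd transposed_consts
      in \<open>simp_all add: lo_def[symmetric]\<close>)

text \<open>Entry (t, j) of \<open>V\<close> times \<open>d j\<close> is the product of column j of
  \<open>U\<close> with the common part of column t plus its product with the noise there. The
  first, expanded in \<open>U0\<close>, is compared with the rotation by
  \<open>procrustes_pert.close\<close>; the second is bounded by \<open>leave_one_out\<close>. The
  subtracted sum is the rotated true factor up to the scale \<open>B\<close>, see
  \<open>Ginv_T_entry\<close>.\<close>

lemma right_factor_bound:
  assumes t: "t < m" and j: "j < r"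
    and P: "\<And>h k. k < r \<Longrightarrow>
      \<bar>ip n (nth_col E t) ((gram_op n m (zero_col t E) ^^ h) (nth_col L k))\<bar> \<le> \<kappa> * A * (2 * e\<^sup>2) ^ h"
    and P': "\<And>h k. k < r \<Longrightarrow>
      \<bar>ip n (nth_col E t) ((gram_op n m (zero_col t E) ^^ h) (mv m (zero_col t E) (nth_col F k)))\<bar>
        \<le> \<kappa> * e * B * (2 * e\<^sup>2) ^ h"
  shows "\<bar>V t j - (\<Sum>k<r. Q j k * ip n (nth_col U0 k) (mv r L (F t)) / (sqrt (d j) * sqrt (d0 k)))\<bar>
    \<le> \<kappa> ^ 39 * ((1 / (A * B) + (e / (A * B))\<^sup>2) * nrm r (F t) / B + 1 / (A * B))"
proof -
  define x where "x = nrm r (F t)"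
  define c where "c k = ip n (nth_col U0 k) (mv r L (F t))" for k
  define a where "a k = ip n (nth_col U j) (nth_col U0 k)" for k
  define \<xi> where "\<xi> = ip n (nth_col E t) (nth_col U j)"
  define D where "D = A * B"
  have D: "0 < D" using A B by (simp add: D_def)
  have x: "0 \<le> x" by (simp add: x_def)
  note dj = dpos(1)[OF j]
  have LF_le: "nrm n (mv r L (F t)) \<le> \<kappa> * A * x"
    unfolding x_def by (rule Lu)
  have c_le: "\<bar>c k\<bar> \<le> \<kappa> * A * x" if "k < r" for k
    using ip_abs_le[of n "nth_col U0 k" "mv r L (F t)"] LF_le orthonormal_nrm[OF U0 that]
    by (simp add: c_def)
  have ULF_le: "\<bar>ip n (nth_col U j) (mv r L (F t))\<bar> \<le> \<kappa> * A * x"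
    using ip_abs_le[of n "nth_col U j" "mv r L (F t)"] LF_le orthonormal_nrm[OF U j] by simp
  have ip_eq: "ip r (F t) (mv n (mtr L) (nth_col U j)) = ip n (nth_col U j) (mv r L (F t))"
    by (simp add: ip_mv[symmetric] ip_commute)
  have "d j * V t j = ip n (nth_col U j) (mv r L (F t)) + \<xi>"
    using XU[OF t j] unfolding ip_eq[symmetric] \<xi>_def mv_ip by (simp add: mtr_def)
  also have "ip n (nth_col U j) (mv r L (F t)) = ip n (nth_col U j) (\<lambda>i. \<Sum>k<r. c k * U0 i k)"
    by (intro ip_cong refl) (subst L_proj, simp_all add: c_def)
  also have "\<dots> = (\<Sum>k<r. c k * a k)"
    by (simp add: ip_sum_right a_def)
  finally have V_eq: "V t j = (\<Sum>k<r. c k * a k / d j) + \<xi> / d j"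
    using dj by (simp add: eq_divide_eq mult.commute flip: sum_divide_distrib add_divide_distrib)
  have "V t j - (\<Sum>k<r. Q j k * c k / (sqrt (d j) * sqrt (d0 k)))
      = (\<Sum>k<r. c k * a k / d j - Q j k * c k / (sqrt (d j) * sqrt (d0 k))) + \<xi> / d j"
    unfolding V_eq by (simp add: sum_subtractf)
  also have "(\<Sum>k<r. c k * a k / d j - Q j k * c k / (sqrt (d j) * sqrt (d0 k)))
      = (\<Sum>k<r. c k * (a k * sqrt (d0 k) / sqrt (d j) - Q j k) / (sqrt (d j) * sqrt (d0 k)))"
  proof (rule sum.cong)
    fix k assume "k \<in> {..<r}"
    then have "0 < d0 k" using dpos(2) by simp
    moreover have "d j = sqrt (d j) * sqrt (d j)" using dj by simp
    ultimately show "c k * a k / d j - Q j k * c k / (sqrt (d j) * sqrt (d0 k))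
        = c k * (a k * sqrt (d0 k) / sqrt (d j) - Q j k) / (sqrt (d j) * sqrt (d0 k))"
      using dj by (simp add: diff_divide_distrib right_diff_distrib mult.commute)
  qed simp
  finally have eq: "V t j - (\<Sum>k<r. Q j k * c k / (sqrt (d j) * sqrt (d0 k)))
      = (\<Sum>k<r. c k * (a k * sqrt (d0 k) / sqrt (d j) - Q j k) / (sqrt (d j) * sqrt (d0 k))) + \<xi> / d j" .
  \<comment> \<open>Exponent 33: 18 from the constant in front of \<open>\<gamma>\<close>, 12 from
    \<open>\<gamma>\<close> itself and 3 from \<open>1 / lo\<close>.\<close>
  define g where "g = \<kappa> ^ 33 * (1 / D + (e / D)\<^sup>2)"
  have g: "12 * (real r)\<^sup>2 * (\<kappa> ^ 6)\<^sup>2 * \<gamma> / lo \<le> g"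
  proof -
    have "12 * (real r)\<^sup>2 * (\<kappa> ^ 6)\<^sup>2 \<le> \<kappa> ^ 4 * \<kappa>\<^sup>2 * (\<kappa> ^ 6)\<^sup>2"
    proof (intro mult_mono power_mono)
      have "2 ^ 4 \<le> \<kappa> ^ 4"
        using \<kappa> by (intro power_mono) auto
      then show "12 \<le> \<kappa> ^ 4" by simp
    qed (use \<kappa> in auto)
    also have "\<dots> = \<kappa> ^ 18"
      by (simp flip: power_mult power_add)
    finally have 1: "12 * (real r)\<^sup>2 * (\<kappa> ^ 6)\<^sup>2 \<le> \<kappa> ^ 18" .
    have "e\<^sup>2 / lo = \<kappa> ^ 3 * (e\<^sup>2 / D)"
      by (simp add: lo_def D_def)
    also have "\<dots> \<le> \<kappa> ^ 12 * (e\<^sup>2 / D)"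
      using \<kappa> D by (intro mult_right_mono power_increasing) auto
    finally have "\<gamma> \<le> \<kappa> ^ 12 * (1 + e\<^sup>2 / D)"
      by (simp add: \<gamma>_def distrib_left)
    then have "12 * (real r)\<^sup>2 * (\<kappa> ^ 6)\<^sup>2 * \<gamma> / lo \<le> \<kappa> ^ 18 * (\<kappa> ^ 12 * (1 + e\<^sup>2 / D)) / lo"
      using 1 \<gamma>0 lo0 \<kappa>0 by (intro divide_right_mono mult_mono) auto
    also have "\<dots> = g"
      using D by (simp add: lo_def g_def D_def[symmetric] power_divide field_simps power2_eq_square flip: power_add)
    finally show ?thesis .
  qed
  have g0: "0 \<le> g"
    using \<kappa>0 D by (simp add: g_def)
  have "\<bar>\<Sum>k<r. c k * (a k * sqrt (d0 k) / sqrt (d j) - Q j k) / (sqrt (d j) * sqrt (d0 k))\<bar>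
      \<le> (\<Sum>k<r. \<kappa> * A * x * g / lo)"
  proof (rule order_trans[OF sum_abs sum_mono])
    fix k assume "k \<in> {..<r}"
    then have k: "k < r" by simp
    have "sqrt lo * sqrt lo \<le> sqrt (d j) * sqrt (d0 k)"
      using d_lo(1)[OF j] d0_lo[OF k] lo0 by (intro mult_mono) (simp_all add: lo_def)
    then have "lo \<le> sqrt (d j) * sqrt (d0 k)"
      using lo0 by simp
    moreover have "\<bar>a k * sqrt (d0 k) / sqrt (d j) - Q j k\<bar> \<le> g"
      using order_trans[OF procrustes_pert.close(1)[OF procrustes j k] g] by (simp add: a_def)
    ultimately have "\<bar>c k\<bar> * \<bar>a k * sqrt (d0 k) / sqrt (d j) - Q j k\<bar> / (sqrt (d j) * sqrt (d0 k))
        \<le> (\<kappa> * A * x) * g / lo"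
      using c_le[OF k] g0 x A \<kappa>0 lo0 by (intro frac_le mult_mono) auto
    then show "\<bar>c k * (a k * sqrt (d0 k) / sqrt (d j) - Q j k) / (sqrt (d j) * sqrt (d0 k))\<bar> \<le> \<kappa> * A * x * g / lo"
      using dj dpos(2)[OF k] by (simp add: abs_mult abs_divide less_imp_le)
  qed
  also have "\<dots> = real r * (\<kappa> * A * x * g / lo)"
    by simp
  also have "\<dots> \<le> \<kappa> * (\<kappa> * A * x * g / lo)"
    using \<kappa> x g0 A lo0 by (intro mult_right_mono) auto
  also have "\<dots> = (\<kappa> * (\<kappa> * (\<kappa> ^ 33 * \<kappa> ^ 3))) * ((1 / D + (e / D)\<^sup>2) * x * (A / D))"
    by (simp add: lo_def g_def D_def[symmetric] mult_ac)
  also have "\<kappa> * (\<kappa> * (\<kappa> ^ 33 * \<kappa> ^ 3)) = \<kappa> ^ 38"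
    by (simp flip: power_Suc power_add)
  also have "A / D = 1 / B"
    using A B by (simp add: D_def)
  also have "\<kappa> ^ 38 * ((1 / D + (e / D)\<^sup>2) * x * (1 / B)) = \<kappa> ^ 38 * ((1 / D + (e / D)\<^sup>2) * x / B)"
    by simp
  finally have part1: "\<bar>\<Sum>k<r. c k * (a k * sqrt (d0 k) / sqrt (d j) - Q j k) / (sqrt (d j) * sqrt (d0 k))\<bar>
      \<le> \<kappa> ^ 38 * ((1 / D + (e / D)\<^sup>2) * x / B)" .
  \<comment> \<open>The second summand is of order \<open>A * B / d j\<close>, hence bounded, and
    division by \<open>d j\<close> makes it \<open>1 / (A * B)\<close>. The first is again a
    multiple of the rotation error.\<close>
  have "\<bar>\<xi>\<bar> \<le> 4 * e\<^sup>2 / (d j)\<^sup>2 * \<bar>ip r (F t) (mv n (mtr L) (nth_col U j))\<bar>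
      + 4 * (real r * (\<kappa> * A * (d j * (\<kappa> * B)) + \<kappa> * e * B * (\<kappa> * A))) / (d j)\<^sup>2"
    unfolding \<xi>_def
  proof (rule leave_one_out[where v = "nth_col V j" and X = "\<lambda>i t. (\<Sum>k<r. L i k * F t k) + E i t"])
    fix i assume i: "i < n"
    have "mv m (\<lambda>i t. (\<Sum>k<r. L i k * F t k) + E i t) (nth_col V j) i
        = (\<Sum>t<m. (\<Sum>k<r. L i k * F t k) * V t j) + mv m E (nth_col V j) i"
      by (simp add: mv_def distrib_right sum.distrib)
    also have "(\<Sum>t<m. (\<Sum>k<r. L i k * F t k) * V t j) = mv r L (mv m (mtr F) (nth_col V j)) i"
      using ip_sum_left[of m "L i" "\<lambda>k t. F t k" "{..<r}" "nth_col V j"] by (simp add: ip_def mv_def)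
    finally show "mv m (\<lambda>i t. (\<Sum>k<r. L i k * F t k) + E i t) (nth_col V j) i = d j * U i j"
      using XV[OF i j] by simp
  next
    fix s assume s: "s < m"
    have "mv n (mtr (\<lambda>i t. (\<Sum>k<r. L i k * F t k) + E i t)) (nth_col U j) s
        = (\<Sum>i<n. (\<Sum>k<r. F s k * L i k) * U i j) + mv n (mtr E) (nth_col U j) s"
      by (simp add: mv_def distrib_right sum.distrib mult.commute[of "L _ _"])
    also have "(\<Sum>i<n. (\<Sum>k<r. F s k * L i k) * U i j) = mv r F (mv n (mtr L) (nth_col U j)) s"
      using ip_sum_left[of n "F s" "\<lambda>k i. L i k" "{..<r}" "nth_col U j"] by (simp add: ip_def mv_def)
    finally show "mv n (mtr (\<lambda>i t. (\<Sum>k<r. L i k * F t k) + E i t)) (nth_col U j) s = d j * V s j"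
      by (simp only: XU[OF s j])
  qed (use E e t dj d_lo(2)[OF j] orthonormal_nrm[OF U j] orthonormal_nrm[OF V j] A B \<kappa>0 P P'
        frame_col_le[OF Lu] frame_col_le[OF Fu] in simp_all)
  also have "\<dots> \<le> 4 * e\<^sup>2 / (d j)\<^sup>2 * (\<kappa> * A * x) + 4 * (\<kappa> * (2 * \<kappa>\<^sup>2 * D * d j)) / (d j)\<^sup>2"
  proof (intro add_mono mult_left_mono divide_right_mono)
    show "\<bar>ip r (F t) (mv n (mtr L) (nth_col U j))\<bar> \<le> \<kappa> * A * x"
      unfolding ip_eq by (rule ULF_le)
    have "\<kappa> * A * (d j * (\<kappa> * B)) + \<kappa> * e * B * (\<kappa> * A) = \<kappa>\<^sup>2 * D * (d j + e)"
      by (simp add: D_def power2_eq_square algebra_simps)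
    also have "\<dots> \<le> \<kappa>\<^sup>2 * D * (d j + d j)"
      using d_lo(2)[OF j] e D by (intro mult_left_mono) simp_all
    finally show "real r * (\<kappa> * A * (d j * (\<kappa> * B)) + \<kappa> * e * B * (\<kappa> * A)) \<le> \<kappa> * (2 * \<kappa>\<^sup>2 * D * d j)"
      using \<kappa> A B e dj by (intro mult_mono) (simp_all add: mult_ac)
  qed (use dj in simp_all)
  finally have "\<bar>\<xi> / d j\<bar> \<le> (4 * e\<^sup>2 / (d j)\<^sup>2 * (\<kappa> * A * x) + 4 * (\<kappa> * (2 * \<kappa>\<^sup>2 * D * d j)) / (d j)\<^sup>2) / d j"
    unfolding abs_divide using dj by (simp add: divide_right_mono)
  also have "\<dots> = 4 * e\<^sup>2 * \<kappa> * A * x / (d j) ^ 3 + 8 * \<kappa> ^ 3 * D / (d j)\<^sup>2"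
    using dj by (simp add: field_simps power2_eq_square power3_eq_cube)
  also have "\<dots> \<le> 4 * e\<^sup>2 * \<kappa> * A * x / lo ^ 3 + 8 * \<kappa> ^ 3 * D / lo\<^sup>2"
    using d_lo(1)[OF j] lo0 \<kappa>0 A x D unfolding lo_def[symmetric]
    by (intro add_mono divide_left_mono power_mono mult_pos_pos zero_less_power dj) auto
  also have "\<dots> = 4 * \<kappa> ^ 10 * ((e / D)\<^sup>2 * x / B) + 8 * \<kappa> ^ 9 * (1 / D)"
    unfolding lo_def D_def using A B \<kappa>0
    by (simp add: field_simps power2_eq_square power3_eq_cube eval_nat_numeral)
  also have "\<dots> \<le> \<kappa> ^ 38 * ((e / D)\<^sup>2 * x / B) + \<kappa> ^ 38 * (1 / D)"
  proof (intro add_mono mult_right_mono)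
    have "2\<^sup>2 * \<kappa> ^ 10 \<le> \<kappa>\<^sup>2 * \<kappa> ^ 10" "2 ^ 3 * \<kappa> ^ 9 \<le> \<kappa> ^ 3 * \<kappa> ^ 9"
      using \<kappa> by (intro mult_right_mono power_mono; simp)+
    moreover have "\<kappa> ^ 12 \<le> \<kappa> ^ 38"
      using \<kappa> by (intro power_increasing) auto
    ultimately show "4 * \<kappa> ^ 10 \<le> \<kappa> ^ 38" "8 * \<kappa> ^ 9 \<le> \<kappa> ^ 38"
      by (simp_all flip: power_add)
  qed (use x B D in simp_all)
  finally have part2: "\<bar>\<xi> / d j\<bar> \<le> \<kappa> ^ 38 * ((e / D)\<^sup>2 * x / B) + \<kappa> ^ 38 * (1 / D)" .
  have "\<bar>V t j - (\<Sum>k<r. Q j k * c k / (sqrt (d j) * sqrt (d0 k)))\<bar>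
      \<le> \<kappa> ^ 38 * ((1 / D + (e / D)\<^sup>2) * x / B) + (\<kappa> ^ 38 * ((e / D)\<^sup>2 * x / B) + \<kappa> ^ 38 * (1 / D))"
    unfolding eq by (rule order_trans[OF abs_triangle_ineq add_mono[OF part1 part2]])
  \<comment> \<open>The second part repeats terms of the first, so together they are at most twice
    the common bound; \<open>2 \<le> \<kappa>\<close> then gives the exponent 39.\<close>
  also have "\<dots> \<le> \<kappa> ^ 38 * (2 * ((1 / D + (e / D)\<^sup>2) * x / B + 1 / D))"
  proof -
    have "(e / D)\<^sup>2 * x / B \<le> (1 / D + (e / D)\<^sup>2) * x / B"
      using D x B by (intro divide_right_mono mult_right_mono) simp_all
    moreover have "0 \<le> 1 / D" using D by simp
    ultimately have "(1 / D + (e / D)\<^sup>2) * x / B + ((e / D)\<^sup>2 * x / B + 1 / D)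
        \<le> 2 * ((1 / D + (e / D)\<^sup>2) * x / B + 1 / D)"
      by (rule add_le_double)
    from mult_left_mono[OF this, of "\<kappa> ^ 38"] show ?thesis
      using \<kappa>0 by (simp only: distrib_left zero_le_power less_imp_le)
  qed
  also have "\<dots> \<le> \<kappa> ^ 38 * (\<kappa> * ((1 / D + (e / D)\<^sup>2) * x / B + 1 / D))"
    using \<kappa> D x B by (intro mult_left_mono mult_right_mono) (simp_all add: add_nonneg_nonneg)
  also have "\<dots> = \<kappa> ^ 39 * ((1 / D + (e / D)\<^sup>2) * x / B + 1 / D)"
    by (simp only: mult.assoc[symmetric] power_Suc2[symmetric]) simp
  finally show ?thesis
    unfolding c_def x_def D_def .
qed

end

section \<open>Singular value decompositions\<close>

abbreviation (input) ent :: "real mat \<Rightarrow> nat \<Rightarrow> nat \<Rightarrow> real" where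
  "ent A i j \<equiv> A $$ (i, j)"

lemma mat_mult_entry:
  fixes A B :: "real mat"
  assumes "A \<in> carrier_mat n k" "B \<in> carrier_mat k m" "i < n" "j < m"
  shows "(A * B) $$ (i, j) = (\<Sum>l<k. A $$ (i, l) * B $$ (l, j))"
  using assms by (simp add: scalar_prod_def atLeast0LessThan)

lemma mult_mat_vec_entry:
  fixes A :: "real mat"
  assumes "A \<in> carrier_mat n k" "v \<in> carrier_vec k" "i < n"
  shows "vec_index (A *\<^sub>v v) i = mv k (ent A) (vec_index v) i"
  using assms by (simp add: mv_def scalar_prod_def atLeast0LessThan)

lemma vnorm_eq_nrm: "vnorm v = nrm (dim_vec v) (vec_index v)"
  by (simp add: vnorm_def nrm_def ip_def scalar_prod_def atLeast0LessThan)

lemma mv_mv: "mv k A (mv m B x) i = mv m (\<lambda>i j. \<Sum>l<k. A i l * B l j) x i"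
proof -
  have "mv k A (mv m B x) i = (\<Sum>l<k. \<Sum>j<m. A i l * B l j * x j)"
    by (simp add: mv_def sum_distrib_left mult.assoc)
  then show ?thesis
    by (subst (asm) sum.swap) (simp add: mv_def sum_distrib_right)
qed

lemma orthogonal_entries:
  assumes "P \<in> orthogonal_matrices n" "j < n" "k < n"
  shows "(\<Sum>i<n. P $$ (i, j) * P $$ (i, k)) = (if j = k then 1 else 0)"
    "(\<Sum>i<n. P $$ (j, i) * P $$ (k, i)) = (if j = k then 1 else 0)"
proof -
  have P: "P \<in> carrier_mat n n" and PP: "P\<^sup>T * P = 1\<^sub>m n" "P * P\<^sup>T = 1\<^sub>m n"
    using assms(1) by (auto simp: orthogonal_matrices_def)
  have "(P\<^sup>T * P) $$ (j, k) = (\<Sum>i<n. P $$ (i, j) * P $$ (i, k))"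
    using P assms by (subst mat_mult_entry[where n = n and k = n and m = n]) auto
  then show "(\<Sum>i<n. P $$ (i, j) * P $$ (i, k)) = (if j = k then 1 else 0)"
    using PP(1) assms by simp
  have "(P * P\<^sup>T) $$ (j, k) = (\<Sum>i<n. P $$ (j, i) * P $$ (k, i))"
    using P assms by (subst mat_mult_entry[where n = n and k = n and m = n]) auto
  then show "(\<Sum>i<n. P $$ (j, i) * P $$ (k, i)) = (if j = k then 1 else 0)"
    using PP(2) assms by simp
qed

lemma nrm_orthonormal_mv:
  assumes "\<And>j k. j < n \<Longrightarrow> k < n \<Longrightarrow> (\<Sum>i<n. P i j * P i k) = (if j = k then 1 else 0)"
  shows "nrm n (mv n P x) = nrm n x"
proof -
  have "mv n (mtr P) (mv n P x) j = x j" if "j < n" for j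
  proof -
    have "mv n (mtr P) (mv n P x) j = (\<Sum>k<n. if j = k then x k else 0)"
      unfolding mv_mv unfolding mv_def using assms that by (intro sum.cong) auto
    then show ?thesis using that by simp
  qed
  then have "ip n (mv n P x) (mv n P x) = ip n x x"
    unfolding ip_mv by (intro ip_cong) auto
  then show ?thesis
    by (simp add: nrm_def)
qed

text \<open>Truncated decompositions are used only through these facts, so the full orthogonal
  factors are unpacked once. Indices start at 0: position \<open>r - 1\<close> holds the r-th
  singular value, the smallest one retained.\<close>

lemma
  assumes svd: "top_svd n m r A U D V" and A: "A \<in> carrier_mat n m"
  shows top_svd_carrier: "U \<in> carrier_mat n r" "D \<in> carrier_mat r r" "V \<in> carrier_mat m r"
    and top_svd_orthonormal: "orthonormal n r (ent U)" "orthonormal m r (ent V)"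
    and top_svd_diag: "\<And>j k. j < r \<Longrightarrow> k < r \<Longrightarrow> j \<noteq> k \<Longrightarrow> D $$ (j, k) = 0"
    and top_svd_antimono: "\<And>j. j < r \<Longrightarrow> D $$ (r - 1, r - 1) \<le> D $$ (j, j)"
    and top_svd_right: "\<And>i j. i < n \<Longrightarrow> j < r \<Longrightarrow> mv m (ent A) (nth_col (ent V) j) i = D $$ (j, j) * U $$ (i, j)"
    and top_svd_left: "\<And>t j. t < m \<Longrightarrow> j < r \<Longrightarrow> mv n (mtr (ent A)) (nth_col (ent U) j) t = D $$ (j, j) * V $$ (t, j)"
    and top_svd_variational: "\<And>x. 0 < r \<Longrightarrow> (\<And>k. k < r - 1 \<Longrightarrow> ip m (nth_col (ent V) k) x = 0) \<Longrightarrow>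
      nrm n (mv m (ent A) x) \<le> D $$ (r - 1, r - 1) * nrm m x"
proof -
  from svd obtain P S Q where rn: "r \<le> n" "r \<le> m" and svd': "is_svd n m A P S Q"
    and U: "U = Matrix.mat n r (\<lambda>(i, k). P $$ (i, k))"
    and D: "D = Matrix.mat r r (\<lambda>(k, l). S $$ (k, l))"
    and V: "V = Matrix.mat m r (\<lambda>(t, k). Q $$ (t, k))"
    by (auto simp: top_svd_def)
  from svd' have P: "P \<in> orthogonal_matrices n" and Q: "Q \<in> orthogonal_matrices m"
    and S: "S \<in> carrier_mat n m" and S0: "\<And>i j. i < n \<Longrightarrow> j < m \<Longrightarrow> i \<noteq> j \<Longrightarrow> S $$ (i, j) = 0"
    and Spos: "\<And>i. i < min n m \<Longrightarrow> 0 \<le> S $$ (i, i)"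
    and Smono: "\<And>i j. i \<le> j \<Longrightarrow> j < min n m \<Longrightarrow> S $$ (j, j) \<le> S $$ (i, i)"
    and A_eq: "A = P * S * Q\<^sup>T"
    by (auto simp: is_svd_def)
  have Pc: "P \<in> carrier_mat n n" and Qc: "Q \<in> carrier_mat m m"
    using P Q by (auto simp: orthogonal_matrices_def)
  show "U \<in> carrier_mat n r" "D \<in> carrier_mat r r" "V \<in> carrier_mat m r"
    by (simp_all add: U D V)
  show "orthonormal n r (ent U)" "orthonormal m r (ent V)"
    using orthogonal_entries(1)[OF P] orthogonal_entries(1)[OF Q] rn
    by (simp_all add: orthonormal_def U V ip_def)
  show "\<And>j k. j < r \<Longrightarrow> k < r \<Longrightarrow> j \<noteq> k \<Longrightarrow> D $$ (j, k) = 0"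
    using S0 rn by (simp add: D)
  show "D $$ (r - 1, r - 1) \<le> D $$ (j, j)" if "j < r" for j
  proof -
    have "j \<le> r - 1" "r - 1 < min n m"
      using that rn by auto
    then show ?thesis
      using Smono[of j "r - 1"] that by (simp add: D)
  qed
  have PS: "(P * S) $$ (i, l) = (if l < n then P $$ (i, l) * S $$ (l, l) else 0)" if "i < n" "l < m" for i l
  proof -
    have "(P * S) $$ (i, l) = (\<Sum>k<n. if k = l then P $$ (i, l) * S $$ (l, l) else 0)"
      unfolding mat_mult_entry[OF Pc S that] using S0 that by (intro sum.cong) auto
    then show ?thesis by simp
  qed
  \<comment> \<open>\<open>S\<close> is rectangular: when \<open>n < m\<close>, the columns from
    \<open>n\<close> on carry no singular value, which the guard expresses.\<close>
  have A_ent: "A $$ (i, t) = (\<Sum>l<m. (if l < n then P $$ (i, l) * S $$ (l, l) else 0) * Q $$ (t, l))"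
    if "i < n" "t < m" for i t
  proof -
    have "A $$ (i, t) = (\<Sum>l<m. (P * S) $$ (i, l) * Q\<^sup>T $$ (l, t))"
      unfolding A_eq using Pc S Qc that by (intro mat_mult_entry) auto
    then show ?thesis
      using PS that Qc by (simp cong: sum.cong_simp)
  qed
  have A_mv: "mv m (ent A) x i = (\<Sum>l<m. (if l < n then P $$ (i, l) * S $$ (l, l) else 0) * ip m (nth_col (ent Q) l) x)"
    if "i < n" for x i
  proof -
    have "mv m (ent A) x i = (\<Sum>t<m. \<Sum>l<m. (if l < n then P $$ (i, l) * S $$ (l, l) else 0) * (Q $$ (t, l) * x t))"
      using A_ent[OF that] by (simp add: mv_def sum_distrib_right mult.assoc cong: sum.cong_simp)
    also have "\<dots> = (\<Sum>l<m. (if l < n then P $$ (i, l) * S $$ (l, l) else 0) * ip m (nth_col (ent Q) l) x)"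
      by (subst sum.swap) (simp only: ip_def sum_distrib_left)
    finally show ?thesis .
  qed
  show "mv m (ent A) (nth_col (ent V) j) i = D $$ (j, j) * U $$ (i, j)" if "i < n" "j < r" for i j
  proof -
    have "mv m (ent A) (nth_col (ent V) j) i = mv m (ent A) (nth_col (ent Q) j) i"
      using that by (intro fun_cong[OF mv_cong]) (simp add: V)
    also have "\<dots> = (\<Sum>l<m. if l = j then P $$ (i, j) * S $$ (j, j) else 0)"
      unfolding A_mv[OF that(1)] using orthogonal_entries(1)[OF Q] that rn
      by (intro sum.cong) (auto simp: ip_def)
    finally show ?thesis
      using that rn by (simp add: U D)
  qed
  show "mv n (mtr (ent A)) (nth_col (ent U) j) t = D $$ (j, j) * V $$ (t, j)" if "t < m" "j < r" for t j
  proof -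
    have "mv n (mtr (ent A)) (nth_col (ent U) j) t
        = (\<Sum>i<n. \<Sum>l<m. (if l < n then S $$ (l, l) * Q $$ (t, l) * (P $$ (i, l) * P $$ (i, j)) else 0))"
    proof -
      have "mv n (mtr (ent A)) (nth_col (ent U) j) t
          = (\<Sum>i<n. (\<Sum>l<m. (if l < n then P $$ (i, l) * S $$ (l, l) else 0) * Q $$ (t, l)) * P $$ (i, j))"
        unfolding mv_def mtr_apply using A_ent[OF _ that(1)] that by (intro sum.cong) (simp_all add: U)
      then show ?thesis
        unfolding sum_distrib_right by (auto intro!: sum.cong)
    qed
    also have "\<dots> = (\<Sum>l<m. if l < n then S $$ (l, l) * Q $$ (t, l) * (\<Sum>i<n. P $$ (i, l) * P $$ (i, j)) else 0)"
      by (subst sum.swap) (auto simp: sum_distrib_left intro!: sum.cong)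
    also have "\<dots> = (\<Sum>l<m. if l = j then S $$ (j, j) * Q $$ (t, j) else 0)"
      using orthogonal_entries(1)[OF P] that rn by (intro sum.cong) auto
    finally show ?thesis
      using that rn by (simp add: V D)
  qed
  \<comment> \<open>Orthogonality removes the first \<open>r - 1\<close> coordinates in the basis
    \<open>Q\<close>. All other singular values, including those dropped by the truncation, are at
    most the one at position \<open>r - 1\<close>.\<close>
  show "nrm n (mv m (ent A) x) \<le> D $$ (r - 1, r - 1) * nrm m x"
    if r: "0 < r" and x: "\<And>k. k < r - 1 \<Longrightarrow> ip m (nth_col (ent V) k) x = 0" for x
  proof -
    define y where "y = mv m (mtr (ent Q)) x"
    define s where "s = S $$ (r - 1, r - 1)"
    define z where "z l = (if l < m then S $$ (l, l) * y l else 0)" for l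
    have y_ip: "y l = ip m (nth_col (ent Q) l) x" for l
      by (simp add: y_def mv_ip mtr_def)
    have s0: "0 \<le> s"
      unfolding s_def by (rule Spos) (use r rn in auto)
    have y_nrm: "nrm m y = nrm m x"
      unfolding y_def using orthogonal_entries(2)[OF Q] by (intro nrm_orthonormal_mv) auto
    have "mv m (ent A) x i = mv n (ent P) z i" if "i < n" for i
    proof -
      have "(\<Sum>l<m. (if l < n then P $$ (i, l) * S $$ (l, l) else 0) * y l)
          = (\<Sum>l\<in>{..<m} \<inter> {..<n}. P $$ (i, l) * S $$ (l, l) * y l)"
        by (simp add: sum.inter_restrict if_distrib if_distribR cong: if_cong)
      also have "\<dots> = (\<Sum>l\<in>{..<n} \<inter> {..<m}. P $$ (i, l) * z l)"
        by (intro sum.cong) (auto simp: z_def)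
      also have "\<dots> = mv n (ent P) z i"
        unfolding mv_def by (intro sum.mono_neutral_left) (auto simp: z_def)
      finally show ?thesis
        unfolding A_mv[OF that] y_ip .
    qed
    then have "nrm n (mv m (ent A) x) = nrm n (mv n (ent P) z)"
      by (intro nrm_cong)
    also have "\<dots> = nrm n z"
      using orthogonal_entries(1)[OF P] by (intro nrm_orthonormal_mv) auto
    also have "\<dots> \<le> nrm m (\<lambda>l. s * y l)"
    proof -
      have "(z l)\<^sup>2 \<le> (s * y l)\<^sup>2" if l: "l < n" "l < m" for l
      proof (cases "l < r - 1")
        case True
        then have "ip m (nth_col (ent Q) l) x = ip m (nth_col (ent V) l) x"
          by (intro ip_cong) (simp_all add: V)
        then show ?thesis
          using x[OF True] by (simp add: z_def y_ip)
      next
        case False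
        then have "S $$ (l, l) \<le> s" "0 \<le> S $$ (l, l)"
          using l Smono[of "r - 1" l] Spos[of l] by (auto simp: s_def)
        then show ?thesis
          using l by (auto simp: z_def power_mult_distrib intro!: mult_right_mono power_mono)
      qed
      then have "(\<Sum>l\<in>{..<n} \<inter> {..<m}. (z l)\<^sup>2) \<le> (\<Sum>l\<in>{..<n} \<inter> {..<m}. (s * y l)\<^sup>2)"
        by (intro sum_mono) auto
      moreover have "(\<Sum>l\<in>{..<n} \<inter> {..<m}. (z l)\<^sup>2) = (\<Sum>l<n. (z l)\<^sup>2)"
        by (intro sum.mono_neutral_left) (auto simp: z_def)
      moreover have "(\<Sum>l\<in>{..<n} \<inter> {..<m}. (s * y l)\<^sup>2) \<le> (\<Sum>l<m. (s * y l)\<^sup>2)"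
        by (intro sum_mono2) auto
      ultimately show ?thesis
        unfolding nrm_def ip_def power2_eq_square[symmetric] by (intro real_sqrt_le_mono) linarith
    qed
    also have "\<dots> = s * nrm m x"
      using s0 by (simp add: nrm_scale y_nrm)
    finally show ?thesis
      using r by (simp add: s_def D)
  qed
qed

text \<open>Some nonzero combination \<open>F y\<close> of the \<open>r\<close> columns of \<open>F\<close> is orthogonal to the first \<open>r - 1\<close>
  right singular vectors.\<close>

lemma singular_value_lower:
  assumes r: "0 < r" and a: "0 < a" and b: "0 < b"
    and L: "\<And>y. a * nrm r y \<le> nrm n (mv r L y)"
    and F: "\<And>y. b * nrm r y \<le> nrm m (mv r F y)"
    and E: "op_bound n m E e"
    and var: "\<And>x. (\<And>k. k < r - 1 \<Longrightarrow> ip m (nth_col V k) x = 0) \<Longrightarrow>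
      nrm n (\<lambda>i. mv r L (mv m (mtr F) x) i + mv m E x i) \<le> s * nrm m x"
  shows "a * b - e \<le> s"
proof -
  \<comment> \<open>The \<open>r - 1\<close> orthogonality conditions are padded by a zero row to a
    square system. Its determinant vanishes, which yields a nonzero coefficient vector.\<close>
  define c where "c k = (if k = r - 1 then 0\<^sub>v r else Matrix.vec r (\<lambda>p. ip m (nth_col V k) (nth_col F p)))" for k
  let ?W = "mat\<^sub>r r r (\<lambda>k. if k = r - 1 then 0\<^sub>v r else c k)"
  have "det ?W = 0"
    by (rule det_row_0) (use r in \<open>auto simp: c_def\<close>)
  then obtain w where w: "w \<in> carrier_vec r" "w \<noteq> 0\<^sub>v r" and Ww: "?W *\<^sub>v w = 0\<^sub>v r"
    using det_0_iff_vec_prod_zero_field[of ?W r] by auto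
  define y where "y = vec_index w"
  define x where "x = mv r F y"
  have "ip m (nth_col V k) x = 0" if k: "k < r - 1" for k
  proof -
    have "vec_index (?W *\<^sub>v w) k = 0"
      unfolding Ww using k by simp
    moreover have "vec_index (?W *\<^sub>v w) k = (\<Sum>p<r. ip m (nth_col V k) (nth_col F p) * y p)"
      using k w by (simp add: scalar_prod_def c_def y_def atLeast0LessThan)
    moreover have "ip m (nth_col V k) x = (\<Sum>p<r. y p * ip m (nth_col V k) (nth_col F p))"
      unfolding x_def using ip_sum_right[of m "nth_col V k" y "nth_col F" "{..<r}"] by (simp add: mv_def mult.commute)
    ultimately show ?thesis
      by (simp add: mult.commute)
  qed
  then have "nrm n (\<lambda>i. mv r L (mv m (mtr F) x) i + mv m E x i) \<le> s * nrm m x"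
    by (rule var)
  moreover have "nrm n (mv r L (mv m (mtr F) x)) - nrm n (mv m E x)
      \<le> nrm n (\<lambda>i. mv r L (mv m (mtr F) x) i + mv m E x i)"
    by (rule nrm_diff_ge)
  moreover have "nrm n (mv m E x) \<le> e * nrm m x"
    by (rule op_boundD[OF E])
  moreover have "a * nrm r (mv m (mtr F) x) \<le> nrm n (mv r L (mv m (mtr F) x))"
    by (rule L)
  ultimately have 1: "a * nrm r (mv m (mtr F) x) \<le> (s + e) * nrm m x"
    by (simp add: distrib_right)
  have "0 < nrm r y"
  proof (rule ccontr)
    assume "\<not> 0 < nrm r y"
    then have "nrm r y = 0"
      using nrm_ge_0[of r y] by linarith
    then have "w = 0\<^sub>v r"
      using w(1) nrm_eq_0 by (intro eq_vecI) (auto simp: y_def)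
    then show False using w(2) by simp
  qed
  then have xpos: "0 < nrm m x"
    using F[of y] b unfolding x_def by (meson less_le_trans mult_pos_pos)
  \<comment> \<open>Since \<open>x\<close> lies in the range of \<open>F\<close>, the lower frame
    bound of \<open>F\<close> gives one for its transpose at \<open>x\<close>.\<close>
  have "(nrm m x)\<^sup>2 = ip r y (mv m (mtr F) x)"
    by (simp add: nrm_sq x_def ip_mv[symmetric])
  also have "\<dots> \<le> nrm r y * nrm r (mv m (mtr F) x)"
    using ip_abs_le[of r y "mv m (mtr F) x"] by linarith
  finally have "b * (nrm m x)\<^sup>2 \<le> (b * nrm r y) * nrm r (mv m (mtr F) x)"
    using b by (simp add: mult.assoc)
  also have "\<dots> \<le> nrm m x * nrm r (mv m (mtr F) x)"
    using F[of y] by (intro mult_right_mono) (simp_all add: x_def)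
  finally have "nrm m x * (b * nrm m x) \<le> nrm m x * nrm r (mv m (mtr F) x)"
    by (simp add: power2_eq_square mult_ac)
  then have "b * nrm m x \<le> nrm r (mv m (mtr F) x)"
    using xpos by simp
  then have "a * (b * nrm m x) \<le> (s + e) * nrm m x"
    using 1 a by (meson mult_left_mono less_imp_le order_trans)
  then have "a * b \<le> s + e"
    using xpos by (simp add: mult.assoc[symmetric])
  then show ?thesis by simp
qed

section \<open>Orthogonal Procrustes problem\<close>

lemma sum_add_split: "(\<Sum>a<n + m. f a) = (\<Sum>a<n. f a) + (\<Sum>b<m. f (n + b))" for f :: "nat \<Rightarrow> real"
  by (induction m) (simp_all add: add.assoc)

lemma append_rows_entry:
  assumes "A \<in> carrier_mat n r" "B \<in> carrier_mat m r" "i < n + m" "j < r"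
  shows "(A @\<^sub>r B) $$ (i, j) = (if i < n then A $$ (i, j) else B $$ (i - n, j))"
  using assms by (auto simp: append_rows_def)

text \<open>An orthogonal factor preserves the norm of every row, so only the cross term depends on
  \<open>R\<close>: least distance means largest trace.\<close>

lemma frob_norm_sq_orthogonal:
  assumes W: "W \<in> carrier_mat n r" and W0: "W0 \<in> carrier_mat n r" and R: "R \<in> orthogonal_matrices r"
  shows "frob_norm_sq (W * R - W0) = (\<Sum>a<n. \<Sum>k<r. (W $$ (a, k))\<^sup>2) + (\<Sum>a<n. \<Sum>k<r. (W0 $$ (a, k))\<^sup>2)
    - 2 * (\<Sum>j<r. \<Sum>k<r. R $$ (j, k) * (\<Sum>a<n. W $$ (a, j) * W0 $$ (a, k)))"
proof -
  have Rc: "R \<in> carrier_mat r r"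
    using R by (simp add: orthogonal_matrices_def)
  define WR where "WR a k = (\<Sum>j<r. W $$ (a, j) * R $$ (j, k))" for a k
  have "(W * R - W0) $$ (a, k) = WR a k - W0 $$ (a, k)" if "a < n" "k < r" for a k
    using mat_mult_entry[OF W Rc that] that W W0 Rc by (simp add: WR_def)
  then have "frob_norm_sq (W * R - W0) = (\<Sum>a<n. \<Sum>k<r. (WR a k - W0 $$ (a, k))\<^sup>2)"
    using W W0 Rc by (simp add: frob_norm_sq_def)
  also have "\<dots> = (\<Sum>a<n. \<Sum>k<r. (WR a k)\<^sup>2) + (\<Sum>a<n. \<Sum>k<r. (W0 $$ (a, k))\<^sup>2)
      - 2 * (\<Sum>a<n. \<Sum>k<r. WR a k * W0 $$ (a, k))"
    by (simp add: power2_diff sum.distrib sum_subtractf sum_distrib_left mult.assoc)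
  also have "(\<Sum>a<n. \<Sum>k<r. (WR a k)\<^sup>2) = (\<Sum>a<n. \<Sum>k<r. (W $$ (a, k))\<^sup>2)"
  proof (rule sum.cong)
    fix a
    have "nrm r (mv r (mtr (ent R)) (\<lambda>j. W $$ (a, j))) = nrm r (\<lambda>j. W $$ (a, j))"
      using orthogonal_entries(2)[OF R] by (intro nrm_orthonormal_mv) auto
    moreover have "mv r (mtr (ent R)) (\<lambda>j. W $$ (a, j)) = WR a"
      by (auto simp: mv_def WR_def mult.commute)
    ultimately have "ip r (WR a) (WR a) = ip r (\<lambda>j. W $$ (a, j)) (\<lambda>j. W $$ (a, j))"
      by (simp add: nrm_def)
    then show "(\<Sum>k<r. (WR a k)\<^sup>2) = (\<Sum>k<r. (W $$ (a, k))\<^sup>2)"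
      by (simp add: ip_def power2_eq_square)
  qed simp
  also have "(\<Sum>a<n. \<Sum>k<r. WR a k * W0 $$ (a, k))
      = (\<Sum>j<r. \<Sum>k<r. R $$ (j, k) * (\<Sum>a<n. W $$ (a, j) * W0 $$ (a, k)))"
  proof -
    have "(\<Sum>a<n. \<Sum>k<r. WR a k * W0 $$ (a, k))
        = (\<Sum>a<n. \<Sum>k<r. \<Sum>j<r. R $$ (j, k) * (W $$ (a, j) * W0 $$ (a, k)))"
      by (simp add: WR_def sum_distrib_right sum_distrib_left mult_ac)
    also have "\<dots> = (\<Sum>a<n. \<Sum>j<r. \<Sum>k<r. R $$ (j, k) * (W $$ (a, j) * W0 $$ (a, k)))"
      by (intro sum.cong refl sum.swap)
    also have "\<dots> = (\<Sum>j<r. \<Sum>a<n. \<Sum>k<r. R $$ (j, k) * (W $$ (a, j) * W0 $$ (a, k)))"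
      by (rule sum.swap)
    also have "\<dots> = (\<Sum>j<r. \<Sum>k<r. \<Sum>a<n. R $$ (j, k) * (W $$ (a, j) * W0 $$ (a, k)))"
      by (intro sum.cong refl sum.swap)
    finally show ?thesis
      by (simp add: sum_distrib_left)
  qed
  finally show ?thesis .
qed

lemma orthogonal_matricesI:
  assumes "\<And>j k. j < r \<Longrightarrow> k < r \<Longrightarrow> (\<Sum>l<r. G j l * G k l) = (if j = k then 1 else 0 :: real)"
  shows "Matrix.mat r r (\<lambda>(j, l). G j l) \<in> orthogonal_matrices r"
proof -
  let ?G = "Matrix.mat r r (\<lambda>(j, l). G j l)"
  have GG: "?G * ?G\<^sup>T = 1\<^sub>m r"
    by (rule eq_matI) (use assms in \<open>auto simp: scalar_prod_def atLeast0LessThan\<close>)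
  then have "?G\<^sup>T * ?G = 1\<^sub>m r"
    by (intro mat_mult_left_right_inverse[where A = ?G]) simp_all
  then show ?thesis
    using GG by (simp add: orthogonal_matrices_def)
qed

lemma orthogonal_matrices_mult:
  assumes "P \<in> orthogonal_matrices r" "Q \<in> orthogonal_matrices r"
  shows "P * Q \<in> orthogonal_matrices r"
proof -
  have P: "P \<in> carrier_mat r r" "P\<^sup>T * P = 1\<^sub>m r" and Q: "Q \<in> carrier_mat r r" "Q\<^sup>T * Q = 1\<^sub>m r"
    using assms by (auto simp: orthogonal_matrices_def)
  have "(P * Q)\<^sup>T * (P * Q) = Q\<^sup>T * (P\<^sup>T * (P * Q))"
    using P(1) Q(1) by (simp add: transpose_mult[OF P(1) Q(1)] assoc_mult_mat[of _ r r _ r _ r])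
  also have "P\<^sup>T * (P * Q) = (P\<^sup>T * P) * Q"
    using P(1) Q(1) by (intro assoc_mult_mat[of _ r r _ r _ r, symmetric]) auto
  finally have PQ: "(P * Q)\<^sup>T * (P * Q) = 1\<^sub>m r"
    using P Q by simp
  then have "(P * Q) * (P * Q)\<^sup>T = 1\<^sub>m r"
    using P(1) Q(1) by (intro mat_mult_left_right_inverse[where A = "(P * Q)\<^sup>T"]) auto
  then show ?thesis
    using PQ P(1) Q(1) by (simp add: orthogonal_matrices_def)
qed

text \<open>Comparing the identity with Householder reflections and Givens rotations.\<close>

lemma trace_maximal_imp_psd:
  fixes S :: "nat \<Rightarrow> nat \<Rightarrow> real"
  assumes max: "\<And>G. (\<And>j k. j < r \<Longrightarrow> k < r \<Longrightarrow> (\<Sum>l<r. G j l * G k l) = (if j = k then 1 else 0)) \<Longrightarrow>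
      (\<Sum>j<r. \<Sum>l<r. G j l * S j l) \<le> (\<Sum>j<r. S j j)"
  shows "0 \<le> ip r x (mv r S x)" "p < r \<Longrightarrow> q < r \<Longrightarrow> S p q = S q p"
proof -
  show "0 \<le> ip r x (mv r S x)"
  proof (cases "ip r x x = 0")
    case True
    then have "nrm r x = 0"
      by (simp add: nrm_def)
    then have "ip r x (mv r S x) = ip r (\<lambda>i. 0) (mv r S x)"
      using nrm_eq_0 by (intro ip_cong) auto
    then show ?thesis by simp
  next
    case False
    \<comment> \<open>With this constant \<open>G\<close> is the reflection along \<open>x\<close>.
      It lowers the trace by \<open>c\<close> times the quadratic form at \<open>x\<close>, which
      maximality forces to be nonnegative.\<close>
    define c where "c = 2 / ip r x x"
    have c: "0 < c" "c * ip r x x = 2"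
      using False ip_ge_0[of r x] by (simp_all add: c_def order_less_le)
    define G where "G j l = (if j = l then 1 else 0) - c * x j * x l" for j l
    have "(\<Sum>j<r. \<Sum>l<r. G j l * S j l) \<le> (\<Sum>j<r. S j j)"
    proof (rule max)
      fix j k assume jk: "j < r" "k < r"
      have "(\<Sum>l<r. G j l * G k l) = (\<Sum>l<r. (if l = j then (if k = j then 1 else 0) else 0)
          - (if l = k then c * x j * x k else 0) - (if l = j then c * x j * x k else 0)
          + c * x j * (c * x k) * (x l * x l))"
        by (intro sum.cong) (auto simp: G_def algebra_simps)
      also have "\<dots> = (if k = j then 1 else 0) - 2 * (c * x j * x k) + c * x j * (c * x k) * ip r x x"
        using jk by (simp add: sum.distrib sum_subtractf ip_def sum_distrib_left)
      also have "c * x j * (c * x k) * ip r x x = 2 * (c * x j * x k)"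
        using c(2) by (simp add: mult_ac)
      finally show "(\<Sum>l<r. G j l * G k l) = (if j = k then 1 else 0)"
        by auto
    qed
    also have "(\<Sum>j<r. \<Sum>l<r. G j l * S j l) = (\<Sum>j<r. S j j) - c * ip r x (mv r S x)"
    proof -
      have "(\<Sum>l<r. G j l * S j l) = S j j - c * (x j * mv r S x j)" if "j < r" for j
      proof -
        have "(\<Sum>l<r. G j l * S j l) = (\<Sum>l<r. (if l = j then S j j else 0) - c * x j * (S j l * x l))"
          by (intro sum.cong) (auto simp: G_def algebra_simps)
        then show ?thesis
          using that by (simp add: sum_subtractf mv_def sum_distrib_left mult.assoc)
      qed
      then show ?thesis
        by (simp add: sum_subtractf ip_def sum_distrib_left)
    qed
    finally show ?thesis
      using c(1) by (simp add: zero_le_mult_iff)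
  qed
  show "S p q = S q p" if pq: "p < r" "q < r"
  proof (cases "p = q")
    case False
    \<comment> \<open>A rotation in the plane of p and q changes the trace by
      \<open>(c - 1) * y + s * z\<close>. The angle with cosine \<open>y / h\<close> and sine
      \<open>z / h\<close> makes this \<open>h - y\<close>, so maximality gives
      \<open>h \<le> y\<close> and therefore \<open>z = 0\<close>.\<close>
    define y where "y = S p p + S q q"
    define z where "z = S p q - S q p"
    define h where "h = sqrt (y\<^sup>2 + z\<^sup>2)"
    have h2: "h * h = y\<^sup>2 + z\<^sup>2"
      by (simp add: h_def)
    show ?thesis
    proof (cases "h = 0")
      case True
      then have "z\<^sup>2 \<le> 0"
        using h2 zero_le_power2[of y] by simp
      then show ?thesis
        by (simp add: z_def)
    next
      case False
      then have h: "0 < h"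
        by (simp add: h_def order_less_le)
      define c s where "c = y / h" and "s = z / h"
      have cs: "c * c + s * s = 1"
      proof -
        have "c * c + s * s = (y\<^sup>2 + z\<^sup>2) / (h * h)"
          by (simp add: c_def s_def power2_eq_square add_divide_distrib)
        then show ?thesis
          using h by (simp add: h2[symmetric])
      qed
      define G where "G j l = (if j = l then 1 else 0)
        + ((if j = p \<and> l = p then c - 1 else 0) + (if j = q \<and> l = q then c - 1 else 0)
        + (if j = p \<and> l = q then s else 0) - (if j = q \<and> l = p then s else 0))" for j l
      have split: "(\<Sum>l<r. f l) = f p + f q + (\<Sum>l\<in>{..<r} - {p, q}. f l)" for f :: "nat \<Rightarrow> real"
      proof -
        have "(\<Sum>l<r. f l) = (\<Sum>l\<in>{..<r} - {p, q}. f l) + (\<Sum>l\<in>{p, q}. f l)"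
          using pq by (intro sum.subset_diff) auto
        then show ?thesis
          using \<open>p \<noteq> q\<close> by simp
      qed
      have "(\<Sum>j<r. \<Sum>l<r. G j l * S j l) \<le> (\<Sum>j<r. S j j)"
      proof (rule max)
        fix j k assume jk: "j < r" "k < r"
        have "(\<Sum>l\<in>{..<r} - {p, q}. G j l * G k l)
            = (\<Sum>l\<in>{..<r} - {p, q}. if l = j then (if j = k then 1 else 0) else 0)"
          by (intro sum.cong) (auto simp: G_def)
        also have "\<dots> = (if j = k \<and> j \<noteq> p \<and> j \<noteq> q then 1 else 0)"
          using jk by auto
        finally show "(\<Sum>l<r. G j l * G k l) = (if j = k then 1 else 0)"
          unfolding split using \<open>p \<noteq> q\<close> cs by (auto simp: G_def mult.commute add.commute)
      qed
      moreover have "(\<Sum>j<r. \<Sum>l<r. G j l * S j l) = (\<Sum>j<r. S j j) + ((c - 1) * y + s * z)"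
      proof -
        have "(\<Sum>l<r. G j l * S j l) = S j j + ((if j = p then (c - 1) * S p p + s * S p q else 0)
            + (if j = q then (c - 1) * S q q - s * S q p else 0))" if "j < r" for j
        proof -
          have "(\<Sum>l\<in>{..<r} - {p, q}. G j l * S j l)
              = (\<Sum>l\<in>{..<r} - {p, q}. if l = j then S j j else 0)"
            by (intro sum.cong) (auto simp: G_def)
          also have "\<dots> = (if j \<noteq> p \<and> j \<noteq> q then S j j else 0)"
            using that by auto
          finally show ?thesis
            unfolding split using \<open>p \<noteq> q\<close> by (auto simp: G_def algebra_simps)
        qed
        then have "(\<Sum>j<r. \<Sum>l<r. G j l * S j l) = (\<Sum>j<r. S j j + ((if j = p then (c - 1) * S p p + s * S p q else 0)
            + (if j = q then (c - 1) * S q q - s * S q p else 0)))"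
          by simp
        also have "\<dots> = (\<Sum>j<r. S j j) + (((c - 1) * S p p + s * S p q) + ((c - 1) * S q q - s * S q p))"
          using pq by (simp add: sum.distrib)
        finally show ?thesis
          by (simp add: y_def z_def algebra_simps)
      qed
      ultimately have "c * y + s * z \<le> y"
        by (simp add: algebra_simps)
      moreover have "c * y + s * z = h"
      proof -
        have "c * y + s * z = (y\<^sup>2 + z\<^sup>2) / h"
          by (simp add: c_def s_def power2_eq_square add_divide_distrib)
        then show ?thesis
          using h by (simp add: h2[symmetric])
      qed
      ultimately have "h * h \<le> y * y"
        using h by (intro mult_mono) auto
      then have "z\<^sup>2 \<le> 0"
        using h2 by (simp add: power2_eq_square)
      then show ?thesis
        by (simp add: z_def)
    qed
  qed simp
qed

text \<open>Competitors of the form \<open>G * R\<close> turn the optimality of \<open>R\<close>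
  into trace maximality of the identity against C R^T.\<close>

lemma
  assumes min: "procrustes_minimizer r Y Z Y0 Z0 R"
    and Y: "Y \<in> carrier_mat n r" and Z: "Z \<in> carrier_mat m r"
    and Y0: "Y0 \<in> carrier_mat n r" and Z0: "Z0 \<in> carrier_mat m r"
  defines "C \<equiv> \<lambda>j k. ip n (nth_col (ent Y) j) (nth_col (ent Y0) k) + ip m (nth_col (ent Z) j) (nth_col (ent Z0) k)"
  shows procrustes_orthogonal: "R \<in> orthogonal_matrices r"
    and procrustes_psd: "0 \<le> ip r x (mv r (\<lambda>j l. \<Sum>k<r. C j k * R $$ (l, k)) x)"
    and procrustes_sym: "p < r \<Longrightarrow> q < r \<Longrightarrow> (\<Sum>k<r. C p k * R $$ (q, k)) = (\<Sum>k<r. C q k * R $$ (p, k))"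
proof -
  let ?W = "Y @\<^sub>r Z" and ?V = "Y0 @\<^sub>r Z0"
  have W: "?W \<in> carrier_mat (n + m) r" and W0: "?V \<in> carrier_mat (n + m) r"
    using Y Z Y0 Z0 by (auto intro: carrier_append_rows)
  show R: "R \<in> orthogonal_matrices r"
    using min by (simp add: procrustes_minimizer_def is_arg_min_def)
  then have Rc: "R \<in> carrier_mat r r"
    by (simp add: orthogonal_matrices_def)
  have C_eq: "(\<Sum>a<n + m. ?W $$ (a, j) * ?V $$ (a, k)) = C j k" if "j < r" "k < r" for j k
    unfolding sum_add_split C_def ip_def using that
    by (simp add: append_rows_entry[OF Y Z] append_rows_entry[OF Y0 Z0])
  have opt: "(\<Sum>j<r. \<Sum>k<r. R' $$ (j, k) * C j k) \<le> (\<Sum>j<r. \<Sum>k<r. R $$ (j, k) * C j k)"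
    if R': "R' \<in> orthogonal_matrices r" for R'
  proof -
    have "frob_norm_sq (?W * R - ?V) \<le> frob_norm_sq (?W * R' - ?V)"
      using min R' by (auto simp: procrustes_minimizer_def is_arg_min_def not_less)
    then show ?thesis
      unfolding frob_norm_sq_orthogonal[OF W W0 R] frob_norm_sq_orthogonal[OF W W0 R']
      by (simp add: C_eq)
  qed
  let ?S = "\<lambda>j l. \<Sum>k<r. C j k * R $$ (l, k)"
  have max: "(\<Sum>j<r. \<Sum>l<r. G j l * ?S j l) \<le> (\<Sum>j<r. ?S j j)"
    if G: "\<And>j k. j < r \<Longrightarrow> k < r \<Longrightarrow> (\<Sum>l<r. G j l * G k l) = (if j = k then 1 else 0)" for G
  proof -
    let ?G = "Matrix.mat r r (\<lambda>(j, l). G j l)"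
    have Go: "?G \<in> orthogonal_matrices r"
      by (rule orthogonal_matricesI[OF G])
    have "?G * R \<in> orthogonal_matrices r"
      by (rule orthogonal_matrices_mult[OF Go R])
    then have "(\<Sum>j<r. \<Sum>k<r. (?G * R) $$ (j, k) * C j k) \<le> (\<Sum>j<r. \<Sum>k<r. R $$ (j, k) * C j k)"
      by (rule opt)
    also have "(\<Sum>j<r. \<Sum>k<r. (?G * R) $$ (j, k) * C j k) = (\<Sum>j<r. \<Sum>k<r. \<Sum>l<r. G j l * (C j k * R $$ (l, k)))"
    proof (intro sum.cong refl)
      fix j k assume "j \<in> {..<r}" "k \<in> {..<r}"
      then have "(?G * R) $$ (j, k) = (\<Sum>l<r. G j l * R $$ (l, k))"
        using Rc by (subst mat_mult_entry[where n = r and k = r and m = r]) auto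
      then show "(?G * R) $$ (j, k) * C j k = (\<Sum>l<r. G j l * (C j k * R $$ (l, k)))"
        by (simp add: sum_distrib_right sum_distrib_left mult_ac)
    qed
    also have "\<dots> = (\<Sum>j<r. \<Sum>l<r. G j l * ?S j l)"
      unfolding sum_distrib_left by (intro sum.cong refl sum.swap)
    finally show ?thesis
      by (simp add: mult.commute)
  qed
  show "0 \<le> ip r x (mv r ?S x)"
    by (rule trace_maximal_imp_psd(1)[OF max])
  show "?S p q = ?S q p" if "p < r" "q < r"
    by (rule trace_maximal_imp_psd(2)[OF max that])
qed

section \<open>Matching matrix and estimation errors\<close>

text \<open>\<open>mat_inv\<close> is \<open>the\<close> of an optional value. A one-sided inverse
  of a square matrix makes it a unit, which excludes \<open>None\<close>, and inverses are
  unique.\<close>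

lemma mat_inv_eq:
  assumes "A \<in> carrier_mat r r" "B \<in> carrier_mat r r" "A * B = 1\<^sub>m r"
  shows "mat_inv A = B"
proof -
  have BA: "B * A = 1\<^sub>m r"
    by (rule mat_mult_left_right_inverse[OF assms])
  have "A \<in> Units (ring_mat TYPE(real) r ())"
    using assms BA by (auto simp: Units_def ring_mat_def)
  then obtain C where C: "mat_inverse A = Some C"
    using mat_inverse(1)[OF assms(1)] by fastforce
  from mat_inverse(2)[OF assms(1) this] have AC: "A * C = 1\<^sub>m r" "C \<in> carrier_mat r r"
    by auto
  have "C = (B * A) * C"
    using AC(2) by (simp add: BA)
  also have "\<dots> = B * (A * C)"
    by (rule assoc_mult_mat[OF assms(2,1) AC(2)])
  also have "\<dots> = B"
    using assms(2) by (simp add: AC(1))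
  finally have "C = B" .
  then show ?thesis
    by (simp add: mat_inv_def C)
qed

lemma diag_sqrt_entry:
  assumes "W \<in> carrier_mat n r" "D \<in> carrier_mat r r"
    and "\<And>j k. j < r \<Longrightarrow> k < r \<Longrightarrow> j \<noteq> k \<Longrightarrow> D $$ (j, k) = 0" and "i < n" "k < r"
  shows "(W * diag_sqrt D) $$ (i, k) = W $$ (i, k) * sqrt (D $$ (k, k))"
proof -
  have "(W * diag_sqrt D) $$ (i, k) = (\<Sum>l<r. W $$ (i, l) * diag_sqrt D $$ (l, k))"
    using assms by (intro mat_mult_entry) auto
  also have "\<dots> = (\<Sum>l<r. if l = k then W $$ (i, k) * sqrt (D $$ (k, k)) else 0)"
    using assms by (intro sum.cong) auto
  finally show ?thesis
    using assms(5) by simp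
qed

lemma vnorm_diff_eq:
  assumes "v \<in> carrier_vec r" "w \<in> carrier_vec r"
  shows "vnorm (v - w) = nrm r (\<lambda>j. vec_index v j - vec_index w j)"
proof -
  have "dim_vec (v - w) = r"
    using assms by simp
  then show ?thesis
    unfolding vnorm_eq_nrm using assms by (auto intro!: nrm_cong)
qed

text \<open>\<open>factor_pert\<close> sees only entries; here the matrices are restored so that
  \<open>balancing_matrix\<close> and \<open>mat_inv\<close> can be evaluated. \<open>m\<close> is
  the number of time points, whence the value of \<open>B\<close>.\<close>

locale factor_mats =
  fixes n m r :: nat and L F E U D V U0 D0 V0 R :: "real mat" and A B e \<kappa> :: real
  assumes pert: "factor_pert n m r (ent L) (ent F) (ent E) (ent U) (ent V) (ent U0) (ent V0)
      (\<lambda>j. D $$ (j, j)) (\<lambda>j. D0 $$ (j, j)) (ent R) A B e \<kappa>"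
    and carrier: "L \<in> carrier_mat n r" "F \<in> carrier_mat m r" "U \<in> carrier_mat n r" "D \<in> carrier_mat r r"
      "V \<in> carrier_mat m r" "U0 \<in> carrier_mat n r" "D0 \<in> carrier_mat r r" "V0 \<in> carrier_mat m r"
    and R: "R \<in> orthogonal_matrices r"
    and diag: "\<And>j k. j < r \<Longrightarrow> k < r \<Longrightarrow> j \<noteq> k \<Longrightarrow> D $$ (j, k) = 0"
      "\<And>j k. j < r \<Longrightarrow> k < r \<Longrightarrow> j \<noteq> k \<Longrightarrow> D0 $$ (j, k) = 0"
    and B_eq: "B = sqrt (real m)"
begin

sublocale factor_pert n m r "ent L" "ent F" "ent E" "ent U" "ent V" "ent U0" "ent V0"
  "\<lambda>j. D $$ (j, j)" "\<lambda>j. D0 $$ (j, j)" "ent R" A B e \<kappa>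
  by (rule pert)

sublocale T: factor_pert m n r "ent F" "ent L" "mtr (ent E)" "ent V" "ent U" "ent V0" "ent U0"
  "\<lambda>j. D $$ (j, j)" "\<lambda>j. D0 $$ (j, j)" "ent R" B A e \<kappa>
  by (rule transposed)

text \<open>D0^(-1/2) V0^T F / B, the only candidate for the balancing matrix: multiply F = B Z0 K
  by V0^T on the left.\<close>

definition K where
  "K = Matrix.mat r r (\<lambda>(k, p). ip m (nth_col (ent V0) k) (nth_col (ent F) p) / (B * sqrt (D0 $$ (k, k))))"

text \<open>B L^T U0 D0^(-1/2), the inverse that the equation for the loadings forces in the same
  way.\<close>

definition J where
  "J = Matrix.mat r r (\<lambda>(p, k). B * ip n (nth_col (ent L) p) (nth_col (ent U0) k) / sqrt (D0 $$ (k, k)))"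

text \<open>By \<open>MU\<close> the middle of the product is V0^T F L^T U0 = D0, and the inverse
  roots on both sides cancel it.\<close>

lemma KJ: "K * J = 1\<^sub>m r"
proof (rule eq_matI)
  fix k l assume "k < dim_row (1\<^sub>m r)" "l < dim_col (1\<^sub>m r)"
  then have kl: "k < r" "l < r" by auto
  have "(K * J) $$ (k, l) = (\<Sum>p<r. mv n (mtr (ent L)) (nth_col (ent U0) l) p * ip m (nth_col (ent V0) k) (nth_col (ent F) p))
      / (sqrt (D0 $$ (k, k)) * sqrt (D0 $$ (l, l)))"
    using kl B by (simp add: K_def J_def scalar_prod_def atLeast0LessThan sum_divide_distrib mv_ip mtr_def mult_ac)
  also have "(\<Sum>p<r. mv n (mtr (ent L)) (nth_col (ent U0) l) p * ip m (nth_col (ent V0) k) (nth_col (ent F) p))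
      = ip m (nth_col (ent V0) k) (mv r (ent F) (mv n (mtr (ent L)) (nth_col (ent U0) l)))"
    by (subst ip_sum_right[symmetric]) (simp add: mv_def[of r] mult.commute)
  also have "\<dots> = ip m (nth_col (ent V0) k) (\<lambda>t. D0 $$ (l, l) * V0 $$ (t, l))"
    using kl by (intro ip_cong) (simp_all add: MU)
  also have "\<dots> = (if k = l then D0 $$ (l, l) else 0)"
    using orthonormalD[OF V0 kl] by (simp add: ip_scale_right)
  finally show "(K * J) $$ (k, l) = 1\<^sub>m r $$ (k, l)"
    using kl dpos(2)[OF kl(2)] by simp
qed (simp_all add: K_def J_def)

lemma JK: "J * K = 1\<^sub>m r"
  by (rule mat_mult_left_right_inverse[OF _ _ KJ]) (simp_all add: K_def J_def)

lemma F_expand: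
  assumes "t < m" "p < r"
  shows "F $$ (t, p) = (\<Sum>k<r. ip m (nth_col (ent V0) k) (nth_col (ent F) p) * V0 $$ (t, k))"
  using T.L_proj[OF assms(1), of "\<lambda>q. if q = p then 1 else 0"] assms(2) by (simp add: mv_unit)

lemma L_expand:
  assumes "i < n" "p < r"
  shows "L $$ (i, p) = (\<Sum>k<r. ip n (nth_col (ent U0) k) (nth_col (ent L) p) * U0 $$ (i, k))"
  using L_proj[OF assms(1), of "\<lambda>q. if q = p then 1 else 0"] assms(2) by (simp add: mv_unit)

text \<open>Expanding \<open>F\<close> and \<open>L\<close> in true singular vectors shows that
  \<open>K\<close> solves both equations. Conversely the equation for \<open>F\<close> determines
  the matrix by pairing with the columns of \<open>V0\<close>; evaluating \<open>THE\<close> takes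
  both halves.\<close>

lemma balancing_matrix_eq:
  "balancing_matrix r m L F (U0 * diag_sqrt D0) (V0 * diag_sqrt D0) = K"
proof -
  let ?Z = "V0 * diag_sqrt D0" and ?Y = "U0 * diag_sqrt D0"
  have Kc: "K \<in> carrier_mat r r" and Jc: "J \<in> carrier_mat r r"
    by (simp_all add: K_def J_def)
  have Zc: "?Z \<in> carrier_mat m r" and Yc: "?Y \<in> carrier_mat n r"
    using carrier by auto
  note Z_ent = diag_sqrt_entry[OF carrier(8,7) diag(2)] and Y_ent = diag_sqrt_entry[OF carrier(6,7) diag(2)]
  have K_inv: "mat_inv K = J"
    by (rule mat_inv_eq[OF Kc Jc KJ])
  have d0: "0 < sqrt (D0 $$ (k, k))" if "k < r" for k
    using dpos(2)[OF that] by simp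
  have ex: "K \<in> carrier_mat r r \<and> invertible_mat K \<and> F = sqrt (real m) \<cdot>\<^sub>m (?Z * K) \<and>
      L = (1 / sqrt (real m)) \<cdot>\<^sub>m (?Y * (mat_inv K)\<^sup>T)"
  proof (intro conjI)
    show "invertible_mat K"
      using KJ JK Kc Jc by (auto simp: invertible_mat_def inverts_mat_def)
    show "F = sqrt (real m) \<cdot>\<^sub>m (?Z * K)"
    proof (rule eq_matI)
      fix t p assume "t < dim_row (sqrt (real m) \<cdot>\<^sub>m (?Z * K))" "p < dim_col (sqrt (real m) \<cdot>\<^sub>m (?Z * K))"
      then have tp: "t < m" "p < r"
        using carrier Kc by auto
      have "(?Z * K) $$ (t, p) = (\<Sum>k<r. ?Z $$ (t, k) * K $$ (k, p))"
        by (rule mat_mult_entry[OF Zc Kc tp])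
      also have "\<dots> = (\<Sum>k<r. ip m (nth_col (ent V0) k) (nth_col (ent F) p) * V0 $$ (t, k) / B)"
      proof (rule sum.cong)
        fix k assume "k \<in> {..<r}"
        then show "?Z $$ (t, k) * K $$ (k, p) = ip m (nth_col (ent V0) k) (nth_col (ent F) p) * V0 $$ (t, k) / B"
          using Z_ent tp d0[of k] by (simp add: K_def)
      qed simp
      also have "\<dots> = F $$ (t, p) / B"
        unfolding F_expand[OF tp] by (simp add: sum_divide_distrib)
      finally show "F $$ (t, p) = (sqrt (real m) \<cdot>\<^sub>m (?Z * K)) $$ (t, p)"
        using tp Zc Kc B carrier by (simp add: B_eq[symmetric])
    qed (use carrier Kc in auto)
    show "L = (1 / sqrt (real m)) \<cdot>\<^sub>m (?Y * (mat_inv K)\<^sup>T)"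
      unfolding K_inv
    proof (rule eq_matI)
      fix i p assume "i < dim_row ((1 / sqrt (real m)) \<cdot>\<^sub>m (?Y * J\<^sup>T))" "p < dim_col ((1 / sqrt (real m)) \<cdot>\<^sub>m (?Y * J\<^sup>T))"
      then have ip: "i < n" "p < r"
        using carrier Jc by auto
      have "(?Y * J\<^sup>T) $$ (i, p) = (\<Sum>k<r. ?Y $$ (i, k) * J\<^sup>T $$ (k, p))"
        by (rule mat_mult_entry[OF Yc _ ip]) (use Jc in simp)
      also have "\<dots> = (\<Sum>k<r. B * (ip n (nth_col (ent U0) k) (nth_col (ent L) p) * U0 $$ (i, k)))"
      proof (rule sum.cong)
        fix k assume "k \<in> {..<r}"
        then show "?Y $$ (i, k) * J\<^sup>T $$ (k, p) = B * (ip n (nth_col (ent U0) k) (nth_col (ent L) p) * U0 $$ (i, k))"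
          using Y_ent ip d0[of k] by (simp add: J_def ip_commute[of n "nth_col (ent L) p"])
      qed simp
      also have "\<dots> = B * L $$ (i, p)"
        unfolding L_expand[OF ip] by (simp add: sum_distrib_left)
      finally show "L $$ (i, p) = ((1 / sqrt (real m)) \<cdot>\<^sub>m (?Y * J\<^sup>T)) $$ (i, p)"
        using ip Yc Jc B carrier by (simp add: B_eq[symmetric])
    qed (use carrier Jc in auto)
  qed (rule Kc)
  show ?thesis
    unfolding balancing_matrix_def
  proof (rule the_equality)
    show "K \<in> carrier_mat r r \<and> invertible_mat K \<and> F = sqrt (real m) \<cdot>\<^sub>m (?Z * K) \<and>
      L = (1 / sqrt (real m)) \<cdot>\<^sub>m (?Y * (mat_inv K)\<^sup>T)"
      by (rule ex)
  next
    fix K' assume K': "K' \<in> carrier_mat r r \<and> invertible_mat K' \<and> F = sqrt (real m) \<cdot>\<^sub>m (?Z * K') \<and>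
      L = (1 / sqrt (real m)) \<cdot>\<^sub>m (?Y * (mat_inv K')\<^sup>T)"
    then have K'c: "K' \<in> carrier_mat r r" and F_eq: "F = sqrt (real m) \<cdot>\<^sub>m (?Z * K')"
      by auto
    show "K' = K"
    proof (rule eq_matI)
      fix k p assume "k < dim_row K" "p < dim_col K"
      then have kp: "k < r" "p < r"
        using Kc by auto
      have "F $$ (t, p) = (\<Sum>l<r. (B * sqrt (D0 $$ (l, l)) * K' $$ (l, p)) * V0 $$ (t, l))" if t: "t < m" for t
      proof -
        have "F $$ (t, p) = B * (?Z * K') $$ (t, p)"
          using t kp Zc K'c carrier by (subst F_eq) (simp add: B_eq)
        then show ?thesis
          unfolding mat_mult_entry[OF Zc K'c t kp(2)] using Z_ent t by (simp add: sum_distrib_left mult_ac)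
      qed
      then have "ip m (nth_col (ent V0) k) (nth_col (ent F) p)
          = ip m (nth_col (ent V0) k) (\<lambda>t. \<Sum>l<r. (B * sqrt (D0 $$ (l, l)) * K' $$ (l, p)) * V0 $$ (t, l))"
        by (intro ip_cong) auto
      also have "\<dots> = (\<Sum>l<r. B * sqrt (D0 $$ (l, l)) * K' $$ (l, p) * ip m (nth_col (ent V0) k) (nth_col (ent V0) l))"
        by (rule ip_sum_right)
      also have "\<dots> = (\<Sum>l<r. if l = k then B * sqrt (D0 $$ (k, k)) * K' $$ (k, p) else 0)"
        using orthonormalD[OF V0] kp by (intro sum.cong) auto
      also have "\<dots> = B * sqrt (D0 $$ (k, k)) * K' $$ (k, p)"
        using kp by simp
      finally show "K' $$ (k, p) = K $$ (k, p)"
        using kp B d0[OF kp(1)] by (simp add: K_def)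
    qed (use K'c Kc in auto)
  qed
qed

text \<open>The inverse of the matching matrix; \<open>Ginv\<close>, the product of the three
  inverses in reverse order, is the matching matrix itself.\<close>

definition G where "G = diag_sqrt D * R * K"

definition Ginv where
  "Ginv = Matrix.mat r r (\<lambda>(p, j). \<Sum>k<r. J $$ (p, k) * R $$ (j, k) / sqrt (D $$ (j, j)))"

lemma G_entry:
  assumes "j < r" "p < r"
  shows "G $$ (j, p) = (\<Sum>k<r. sqrt (D $$ (j, j)) * R $$ (j, k) * K $$ (k, p))"
proof -
  have Rc: "R \<in> carrier_mat r r"
    using R by (simp add: orthogonal_matrices_def)
  have DR: "(diag_sqrt D * R) $$ (j, k) = sqrt (D $$ (j, j)) * R $$ (j, k)" if k: "k < r" for k
  proof -
    have "(diag_sqrt D * R) $$ (j, k) = (\<Sum>l<r. diag_sqrt D $$ (j, l) * R $$ (l, k))"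
      using carrier Rc assms k by (intro mat_mult_entry) auto
    also have "\<dots> = (\<Sum>l<r. if l = j then sqrt (D $$ (j, j)) * R $$ (j, k) else 0)"
      using diag(1)[OF assms(1)] carrier assms by (intro sum.cong) auto
    finally show ?thesis
      using assms by simp
  qed
  have "G $$ (j, p) = (\<Sum>k<r. (diag_sqrt D * R) $$ (j, k) * K $$ (k, p))"
    unfolding G_def using carrier Rc assms by (intro mat_mult_entry) (auto simp: K_def)
  then show ?thesis
    using DR by simp
qed

lemma G_carrier: "G \<in> carrier_mat r r" "Ginv \<in> carrier_mat r r"
  using carrier R by (auto simp: G_def Ginv_def K_def orthogonal_matrices_def)

lemma G_Ginv: "G * Ginv = 1\<^sub>m r"
proof (rule eq_matI)
  fix j l assume "j < dim_row (1\<^sub>m r)" "l < dim_col (1\<^sub>m r)"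
  then have jl: "j < r" "l < r" by auto
  have KJ_ent: "(\<Sum>p<r. K $$ (k, p) * J $$ (p, q)) = (if k = q then 1 else 0)" if "k < r" "q < r" for k q
    using arg_cong[OF KJ, of "\<lambda>M. M $$ (k, q)"] that
    by (subst (asm) mat_mult_entry[where n = r and k = r and m = r]) (simp_all add: K_def J_def)
  have "(G * Ginv) $$ (j, l) = (\<Sum>p<r. G $$ (j, p) * Ginv $$ (p, l))"
    by (rule mat_mult_entry[OF G_carrier jl])
  also have "\<dots> = (\<Sum>p<r. \<Sum>k<r. \<Sum>q<r. sqrt (D $$ (j, j)) * R $$ (j, k) * (R $$ (l, q) / sqrt (D $$ (l, l)))
      * (K $$ (k, p) * J $$ (p, q)))"
    using jl by (simp add: G_entry Ginv_def sum_product mult_ac)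
  also have "\<dots> = (\<Sum>k<r. \<Sum>p<r. \<Sum>q<r. sqrt (D $$ (j, j)) * R $$ (j, k) * (R $$ (l, q) / sqrt (D $$ (l, l)))
      * (K $$ (k, p) * J $$ (p, q)))"
    by (rule sum.swap)
  also have "\<dots> = (\<Sum>k<r. \<Sum>q<r. \<Sum>p<r. sqrt (D $$ (j, j)) * R $$ (j, k) * (R $$ (l, q) / sqrt (D $$ (l, l)))
      * (K $$ (k, p) * J $$ (p, q)))"
    by (intro sum.cong refl sum.swap)
  also have "\<dots> = (\<Sum>k<r. \<Sum>q<r. if q = k then sqrt (D $$ (j, j)) * R $$ (j, k) * (R $$ (l, k) / sqrt (D $$ (l, l))) else 0)"
    unfolding sum_distrib_left[symmetric] by (intro sum.cong refl) (auto simp: KJ_ent)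
  also have "\<dots> = (\<Sum>k<r. sqrt (D $$ (j, j)) / sqrt (D $$ (l, l)) * (R $$ (j, k) * R $$ (l, k)))"
    by (simp add: mult_ac)
  also have "\<dots> = sqrt (D $$ (j, j)) / sqrt (D $$ (l, l)) * (if j = l then 1 else 0)"
    unfolding sum_distrib_left[symmetric] using orthogonal_entries(2)[OF R jl] by simp
  finally show "(G * Ginv) $$ (j, l) = 1\<^sub>m r $$ (j, l)"
    using jl dpos(1)[OF jl(1)] dpos(1)[OF jl(2)] by simp
qed (use G_carrier in auto)

lemma mat_inv_G: "mat_inv G = Ginv" "mat_inv Ginv = G"
  using mat_inv_eq[OF G_carrier G_Ginv]
    mat_inv_eq[OF G_carrier(2,1) mat_mult_left_right_inverse[OF G_carrier G_Ginv]] by auto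

text \<open>This brings the rotated true factor into the form subtracted in
  \<open>right_factor_bound\<close>, times \<open>B\<close>.\<close>

lemma Ginv_T_entry:
  assumes "j < r" "t < m"
  shows "vec_index (Ginv\<^sup>T *\<^sub>v Matrix.row F t) j
    = B * (\<Sum>k<r. R $$ (j, k) * ip n (nth_col (ent U0) k) (mv r (ent L) (ent F t)) / (sqrt (D $$ (j, j)) * sqrt (D0 $$ (k, k))))"
proof -
  have "vec_index (Ginv\<^sup>T *\<^sub>v Matrix.row F t) j = (\<Sum>p<r. Ginv $$ (p, j) * F $$ (t, p))"
    using assms carrier G_carrier(2) by (simp add: scalar_prod_def atLeast0LessThan)
  also have "\<dots> = (\<Sum>p<r. \<Sum>k<r. B * (R $$ (j, k) / (sqrt (D $$ (j, j)) * sqrt (D0 $$ (k, k))))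
      * (F $$ (t, p) * ip n (nth_col (ent L) p) (nth_col (ent U0) k)))"
    using assms by (simp add: Ginv_def J_def sum_distrib_right sum_distrib_left mult_ac)
  also have "\<dots> = (\<Sum>k<r. B * (R $$ (j, k) / (sqrt (D $$ (j, j)) * sqrt (D0 $$ (k, k))))
      * (\<Sum>p<r. F $$ (t, p) * ip n (nth_col (ent L) p) (nth_col (ent U0) k)))"
    by (subst sum.swap) (simp only: sum_distrib_left)
  also have "(\<lambda>k. \<Sum>p<r. F $$ (t, p) * ip n (nth_col (ent L) p) (nth_col (ent U0) k))
      = (\<lambda>k. ip n (nth_col (ent U0) k) (mv r (ent L) (ent F t)))"
    by (subst ip_sum_left[symmetric]) (simp add: mv_def mult.commute ip_commute[of n "nth_col (ent U0) _"])
  finally show ?thesis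
    by (simp add: sum_distrib_left mult_ac)
qed

text \<open>The transposed counterpart. The prefactor is \<open>D $$ (j, j) / B\<close> because
  estimated loadings are the left singular vectors scaled by their singular values over
  \<open>B\<close>.\<close>

lemma G_row_entry:
  assumes "j < r" "i < n"
  shows "vec_index (G *\<^sub>v Matrix.row L i) j
    = D $$ (j, j) / B * (\<Sum>k<r. R $$ (j, k) * ip m (nth_col (ent V0) k) (mv r (ent F) (ent L i)) / (sqrt (D $$ (j, j)) * sqrt (D0 $$ (k, k))))"
proof -
  have "vec_index (G *\<^sub>v Matrix.row L i) j = (\<Sum>p<r. G $$ (j, p) * L $$ (i, p))"
    using assms carrier G_carrier(1) by (simp add: scalar_prod_def atLeast0LessThan)
  also have "\<dots> = (\<Sum>p<r. \<Sum>k<r. sqrt (D $$ (j, j)) * (R $$ (j, k) / (B * sqrt (D0 $$ (k, k))))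
      * (L $$ (i, p) * ip m (nth_col (ent V0) k) (nth_col (ent F) p)))"
    using assms by (simp add: G_entry K_def sum_distrib_right sum_distrib_left mult_ac)
  also have "\<dots> = (\<Sum>k<r. sqrt (D $$ (j, j)) * (R $$ (j, k) / (B * sqrt (D0 $$ (k, k))))
      * (\<Sum>p<r. L $$ (i, p) * ip m (nth_col (ent V0) k) (nth_col (ent F) p)))"
    by (subst sum.swap) (simp only: sum_distrib_left)
  also have "(\<lambda>k. \<Sum>p<r. L $$ (i, p) * ip m (nth_col (ent V0) k) (nth_col (ent F) p))
      = (\<lambda>k. ip m (nth_col (ent V0) k) (mv r (ent F) (ent L i)))"
    by (subst ip_sum_right[symmetric]) (simp add: mv_def mult.commute)
  also have "sqrt (D $$ (j, j)) = D $$ (j, j) / sqrt (D $$ (j, j))"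
    using dpos(1)[OF assms(1)] by (simp add: real_div_sqrt)
  finally show ?thesis
    by (simp add: sum_distrib_left mult_ac)
qed

lemma vnorm_diff_le:
  assumes "dim_vec v = r" "dim_vec w = r" "\<And>j. j < r \<Longrightarrow> \<bar>vec_index v j - vec_index w j\<bar> \<le> c"
  shows "vnorm (v - w) \<le> real r * c"
  unfolding vnorm_eq_nrm using assms by (simp add: nrm_le_const)

lemma R_le: "j < r \<Longrightarrow> k < r \<Longrightarrow> \<bar>R $$ (j, k)\<bar> \<le> 1"
  using comp_le_nrm[of k r "ent R j"] orthogonal_entries(2)[OF R, of j j] by (simp add: nrm_def ip_def)

lemma lo_le_sqrt:
  assumes "j < r" "k < r"
  shows "lo \<le> sqrt (D $$ (j, j)) * sqrt (D0 $$ (k, k))"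
proof -
  have "sqrt lo * sqrt lo \<le> sqrt (D $$ (j, j)) * sqrt (D0 $$ (k, k))"
    using d_lo(1)[OF assms(1)] d0_lo[OF assms(2)] lo0 by (intro mult_mono) (simp_all add: lo_def)
  then show ?thesis
    using lo0 by simp
qed

lemma weighted_sum_le:
  assumes "j < r" and "\<And>k. k < r \<Longrightarrow> \<bar>c k\<bar> \<le> x"
  shows "\<bar>\<Sum>k<r. R $$ (j, k) * c k / (sqrt (D $$ (j, j)) * sqrt (D0 $$ (k, k)))\<bar> \<le> \<kappa> * x / lo"
proof -
  have x: "0 \<le> x"
    using assms(2)[OF r] by linarith
  have "\<bar>\<Sum>k<r. R $$ (j, k) * c k / (sqrt (D $$ (j, j)) * sqrt (D0 $$ (k, k)))\<bar> \<le> (\<Sum>k<r. x / lo)"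
  proof (rule order_trans[OF sum_abs sum_mono])
    fix k assume "k \<in> {..<r}"
    then have k: "k < r" by simp
    have "\<bar>R $$ (j, k) * c k\<bar> \<le> 1 * x"
      unfolding abs_mult using R_le[OF assms(1) k] assms(2)[OF k] by (intro mult_mono) auto
    then have "\<bar>R $$ (j, k) * c k\<bar> / (sqrt (D $$ (j, j)) * sqrt (D0 $$ (k, k))) \<le> x / lo"
      using lo_le_sqrt[OF assms(1) k] lo0 x by (intro frac_le) auto
    moreover have "0 < sqrt (D $$ (j, j)) * sqrt (D0 $$ (k, k))"
      using lo_le_sqrt[OF assms(1) k] lo0 by linarith
    ultimately show "\<bar>R $$ (j, k) * c k / (sqrt (D $$ (j, j)) * sqrt (D0 $$ (k, k)))\<bar> \<le> x / lo"
      by (simp add: abs_divide)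
  qed
  also have "\<dots> \<le> \<kappa> * x / lo"
    using \<kappa> x lo0 by (simp add: divide_right_mono mult_right_mono)
  finally show ?thesis .
qed

end

context factor_mats
begin

text \<open>\<open>P1\<close> to \<open>P4\<close> are the inputs of \<open>leave_one_out\<close>
  for column t of the noise and for column i of its transpose. They hold on the event built in
  \<open>noise_event\<close>.\<close>

context
  fixes i t :: nat
  assumes it: "i < n" "t < m"
    and P1: "\<And>h k. k < r \<Longrightarrow> \<bar>ip n (nth_col (ent E) t) ((gram_op n m (zero_col t (ent E)) ^^ h) (nth_col (ent L) k))\<bar>
        \<le> \<kappa> * A * (2 * e\<^sup>2) ^ h"
    and P2: "\<And>h k. k < r \<Longrightarrow> \<bar>ip n (nth_col (ent E) t)
        ((gram_op n m (zero_col t (ent E)) ^^ h) (mv m (zero_col t (ent E)) (nth_col (ent F) k)))\<bar> \<le> \<kappa> * e * B * (2 * e\<^sup>2) ^ h"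
    and P3: "\<And>h k. k < r \<Longrightarrow> \<bar>ip m (nth_col (mtr (ent E)) i)
        ((gram_op m n (zero_col i (mtr (ent E))) ^^ h) (nth_col (ent F) k))\<bar> \<le> \<kappa> * B * (2 * e\<^sup>2) ^ h"
    and P4: "\<And>h k. k < r \<Longrightarrow> \<bar>ip m (nth_col (mtr (ent E)) i)
        ((gram_op m n (zero_col i (mtr (ent E))) ^^ h) (mv n (zero_col i (mtr (ent E))) (nth_col (ent L) k)))\<bar>
        \<le> \<kappa> * e * A * (2 * e\<^sup>2) ^ h"
begin

abbreviation (input) err where "err \<equiv> 1 / (A * B) + (e / (A * B))\<^sup>2"

abbreviation (input) f where "f \<equiv> nrm r (ent F t)"

abbreviation (input) l where "l \<equiv> nrm r (ent L i)"

text \<open>\<open>right_factor_bound\<close> times \<open>B\<close>; passing from entries to the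
  vector norm costs a factor r, hence one more \<open>\<kappa>\<close>.\<close>

lemma factor_error: "vnorm (Matrix.row (B \<cdot>\<^sub>m V) t - Ginv\<^sup>T *\<^sub>v Matrix.row F t) \<le> \<kappa> ^ 40 * (err * f + 1 / A)"
proof -
  let ?c = "\<kappa> ^ 39 * (err * f + 1 / A)"
  let ?x = "\<lambda>j. V $$ (t, j) - (\<Sum>k<r. R $$ (j, k) * ip n (nth_col (ent U0) k) (mv r (ent L) (ent F t))
        / (sqrt (D $$ (j, j)) * sqrt (D0 $$ (k, k))))"
  have "vnorm (Matrix.row (B \<cdot>\<^sub>m V) t - Ginv\<^sup>T *\<^sub>v Matrix.row F t) \<le> real r * ?c"
  proof (rule vnorm_diff_le)
    fix j assume j: "j < r"
    have "\<bar>V $$ (t, j) - (\<Sum>k<r. R $$ (j, k) * ip n (nth_col (ent U0) k) (mv r (ent L) (ent F t))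
        / (sqrt (D $$ (j, j)) * sqrt (D0 $$ (k, k))))\<bar> \<le> \<kappa> ^ 39 * (err * f / B + 1 / (A * B))"
      using right_factor_bound[OF it(2) j P1 P2] by simp
    then have "B * \<bar>?x j\<bar> \<le> B * (\<kappa> ^ 39 * (err * f / B + 1 / (A * B)))"
      using B by (intro mult_left_mono) simp_all
    also have "\<dots> = ?c"
      using B by (simp add: distrib_left)
    also have "B * \<bar>?x j\<bar> = \<bar>B * ?x j\<bar>"
      using B by (simp only: abs_mult abs_of_pos)
    also have "B * ?x j = vec_index (Matrix.row (B \<cdot>\<^sub>m V) t) j - vec_index (Ginv\<^sup>T *\<^sub>v Matrix.row F t) j"
      unfolding Ginv_T_entry[OF j it(2)] using carrier(5) it j by (simp add: right_diff_distrib)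
    finally show "\<bar>vec_index (Matrix.row (B \<cdot>\<^sub>m V) t) j - vec_index (Ginv\<^sup>T *\<^sub>v Matrix.row F t) j\<bar> \<le> ?c" .
  qed (use carrier G_carrier in auto)
  also have "\<dots> \<le> \<kappa> * ?c"
    using \<kappa> A B e \<kappa>0 by (intro mult_right_mono) simp_all
  finally show ?thesis
    unfolding mult.assoc[symmetric] power_Suc[symmetric] by simp
qed

text \<open>The transposed bound times \<open>D $$ (j, j) / B\<close>, which is at most
  \<open>\<kappa> ^ 3 * A\<close>, and again a factor r: 43 = 39 + 3 + 1.\<close>

lemma loading_error: "vnorm (Matrix.row ((1 / B) \<cdot>\<^sub>m (U * D)) i - G *\<^sub>v Matrix.row L i) \<le> \<kappa> ^ 43 * (err * l + 1 / B)"
proof -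
  let ?c = "\<kappa> ^ 42 * (err * l + 1 / B)"
  have UD: "(U * D) $$ (i, j) = U $$ (i, j) * D $$ (j, j)" if j: "j < r" for j
  proof -
    have "(U * D) $$ (i, j) = (\<Sum>k<r. U $$ (i, k) * D $$ (k, j))"
      by (rule mat_mult_entry[OF carrier(3,4) it(1) j])
    also have "\<dots> = (\<Sum>k<r. if k = j then U $$ (i, j) * D $$ (j, j) else 0)"
      using diag(1) j by (intro sum.cong) auto
    finally show ?thesis
      using j by simp
  qed
  have "vnorm (Matrix.row ((1 / B) \<cdot>\<^sub>m (U * D)) i - G *\<^sub>v Matrix.row L i) \<le> real r * ?c"
  proof (rule vnorm_diff_le)
    fix j assume j: "j < r"
    let ?x = "U $$ (i, j) - (\<Sum>k<r. R $$ (j, k) * ip m (nth_col (ent V0) k) (mv r (ent F) (ent L i))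
        / (sqrt (D $$ (j, j)) * sqrt (D0 $$ (k, k))))"
    have x: "\<bar>?x\<bar> \<le> \<kappa> ^ 39 * (err * l / A + 1 / (A * B))"
      using T.right_factor_bound[OF it(1) j P3 P4] by (simp add: mult.commute[of B A])
    have dB: "D $$ (j, j) / B \<le> \<kappa> ^ 3 * A"
    proof -
      have "D $$ (j, j) / B \<le> \<kappa> ^ 6 * lo / B"
        using d_hi[OF j] B by (simp add: divide_right_mono)
      also have "\<dots> = \<kappa> ^ 3 * A"
        using B \<kappa>0 by (simp add: lo_def power_diff[symmetric] field_simps flip: power_add)
      finally show ?thesis .
    qed
    have "\<bar>vec_index (Matrix.row ((1 / B) \<cdot>\<^sub>m (U * D)) i) j - vec_index (G *\<^sub>v Matrix.row L i) j\<bar>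
        = D $$ (j, j) / B * \<bar>?x\<bar>"
    proof -
      have "vec_index (Matrix.row ((1 / B) \<cdot>\<^sub>m (U * D)) i) j - vec_index (G *\<^sub>v Matrix.row L i) j = D $$ (j, j) / B * ?x"
        unfolding G_row_entry[OF j it(1)] using carrier it j UD[OF j] by (simp add: right_diff_distrib)
      then show ?thesis
        using dpos(1)[OF j] B by (simp only: abs_mult) simp
    qed
    also have "\<dots> \<le> (\<kappa> ^ 3 * A) * (\<kappa> ^ 39 * (err * l / A + 1 / (A * B)))"
      using x dB A \<kappa>0 by (intro mult_mono) auto
    also have "\<dots> = (\<kappa> ^ 3 * \<kappa> ^ 39) * (err * l + 1 / B)"
      using A by (simp add: distrib_left)
    also have "\<dots> = ?c"
      by (simp flip: power_add)
    finally show "\<bar>vec_index (Matrix.row ((1 / B) \<cdot>\<^sub>m (U * D)) i) j - vec_index (G *\<^sub>v Matrix.row L i) j\<bar> \<le> ?c" .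
  qed (use carrier G_carrier in auto)
  also have "\<dots> \<le> \<kappa> * ?c"
    using \<kappa> A B e \<kappa>0 by (intro mult_right_mono) simp_all
  finally show ?thesis
    unfolding mult.assoc[symmetric] power_Suc[symmetric] by simp
qed

lemma rotated_factor_le: "nrm r (vec_index (Ginv\<^sup>T *\<^sub>v Matrix.row F t)) \<le> \<kappa> ^ 6 * f"
proof -
  have "nrm r (vec_index (Ginv\<^sup>T *\<^sub>v Matrix.row F t)) \<le> real r * (B * (\<kappa> * (\<kappa> * A * f) / lo))"
  proof (rule nrm_le_const)
    fix j assume j: "j < r"
    show "\<bar>vec_index (Ginv\<^sup>T *\<^sub>v Matrix.row F t) j\<bar> \<le> B * (\<kappa> * (\<kappa> * A * f) / lo)"
      unfolding Ginv_T_entry[OF j it(2)] abs_mult abs_of_pos[OF B]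
    proof (intro mult_left_mono weighted_sum_le j)
      fix k assume k: "k < r"
      show "\<bar>ip n (nth_col (ent U0) k) (mv r (ent L) (ent F t))\<bar> \<le> \<kappa> * A * f"
        using ip_abs_le[of n "nth_col (ent U0) k" "mv r (ent L) (ent F t)"] Lu[of "ent F t"] orthonormal_nrm[OF U0 k]
        by simp
    qed (use B in simp)
  qed
  also have "\<dots> \<le> \<kappa> * (B * (\<kappa> * (\<kappa> * A * f) / lo))"
    using \<kappa> A B lo0 \<kappa>0 by (intro mult_right_mono) simp_all
  also have "\<dots> = \<kappa> ^ 6 * f"
    using A B by (simp add: lo_def eval_nat_numeral)
  finally show ?thesis .
qed

lemma rotated_loading_le: "nrm r (vec_index (G *\<^sub>v Matrix.row L i)) \<le> \<kappa> ^ 9 * l"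
proof -
  have "nrm r (vec_index (G *\<^sub>v Matrix.row L i)) \<le> real r * ((\<kappa> ^ 6 * lo / B) * (\<kappa> * (\<kappa> * B * l) / lo))"
  proof (rule nrm_le_const)
    fix j assume j: "j < r"
    have "\<bar>D $$ (j, j) / B\<bar> \<le> \<kappa> ^ 6 * lo / B"
      using d_hi[OF j] dpos(1)[OF j] B by (simp add: divide_right_mono)
    moreover have "\<bar>\<Sum>k<r. R $$ (j, k) * ip m (nth_col (ent V0) k) (mv r (ent F) (ent L i))
        / (sqrt (D $$ (j, j)) * sqrt (D0 $$ (k, k)))\<bar> \<le> \<kappa> * (\<kappa> * B * l) / lo"
    proof (intro weighted_sum_le j)
      fix k assume k: "k < r"
      show "\<bar>ip m (nth_col (ent V0) k) (mv r (ent F) (ent L i))\<bar> \<le> \<kappa> * B * l"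
        using ip_abs_le[of m "nth_col (ent V0) k" "mv r (ent F) (ent L i)"] Fu[of "ent L i"] orthonormal_nrm[OF V0 k]
        by simp
    qed
    ultimately show "\<bar>vec_index (G *\<^sub>v Matrix.row L i) j\<bar> \<le> (\<kappa> ^ 6 * lo / B) * (\<kappa> * (\<kappa> * B * l) / lo)"
      unfolding G_row_entry[OF j it(1)] abs_mult using lo0 B \<kappa>0 by (intro mult_mono) simp_all
  qed
  also have "\<dots> \<le> \<kappa> * ((\<kappa> ^ 6 * lo / B) * (\<kappa> * (\<kappa> * B * l) / lo))"
    using \<kappa> A B lo0 \<kappa>0 by (intro mult_right_mono) simp_all
  also have "\<dots> = \<kappa> ^ 9 * l"
    using B lo0 by (simp add: eval_nat_numeral)
  finally show ?thesis .
qed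

text \<open>Rotations cancel in the product of the rotated true vectors, which is therefore the true
  entry. The error is the loading error against the estimated factor plus the rotated loading
  against the factor error.\<close>

lemma common_component_error:
  "\<bar>scalar_prod (Matrix.row ((1 / B) \<cdot>\<^sub>m (U * D)) i) (Matrix.row (B \<cdot>\<^sub>m V) t) - (L * F\<^sup>T) $$ (i, t)\<bar>
    \<le> (\<kappa> ^ 43 * (err * l + 1 / B)) * (\<kappa> ^ 6 * f + \<kappa> ^ 40 * (err * f + 1 / A))
      + (\<kappa> ^ 9 * l) * (\<kappa> ^ 40 * (err * f + 1 / A))"
proof -
  let ?lv = "Matrix.row ((1 / B) \<cdot>\<^sub>m (U * D)) i" and ?fv = "Matrix.row (B \<cdot>\<^sub>m V) t"
  let ?y = "G *\<^sub>v Matrix.row L i" and ?x = "Ginv\<^sup>T *\<^sub>v Matrix.row F t"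
  let ?Lr = "Matrix.row L i" and ?Fr = "Matrix.row F t"
  have dims: "?lv \<in> carrier_vec r" "?fv \<in> carrier_vec r" "?y \<in> carrier_vec r" "?x \<in> carrier_vec r"
    "?Lr \<in> carrier_vec r" "?Fr \<in> carrier_vec r"
    using carrier G_carrier by (auto intro!: carrier_vecI)
  have "ip r (vec_index ?y) (vec_index ?x) = ip r (mv r (ent G) (vec_index ?Lr)) (mv r (mtr (ent Ginv)) (vec_index ?Fr))"
  proof (rule ip_cong)
    fix j assume j: "j < r"
    show "vec_index ?y j = mv r (ent G) (vec_index ?Lr) j"
      by (rule mult_mat_vec_entry[OF G_carrier(1) dims(5) j])
    have "vec_index ?x j = mv r (ent (Ginv\<^sup>T)) (vec_index ?Fr) j"
      using G_carrier(2) by (intro mult_mat_vec_entry[OF _ dims(6) j]) simp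
    also have "\<dots> = mv r (mtr (ent Ginv)) (vec_index ?Fr) j"
      unfolding mv_def using G_carrier(2) j by (intro sum.cong) auto
    finally show "vec_index ?x j = mv r (mtr (ent Ginv)) (vec_index ?Fr) j" .
  qed
  also have "\<dots> = ip r (vec_index ?Lr) (\<lambda>p. mv r (mtr (ent G)) (mv r (mtr (ent Ginv)) (vec_index ?Fr)) p)"
    by (simp add: ip_mv)
  also have "\<dots> = ip r (vec_index ?Lr) (vec_index ?Fr)"
  proof (rule ip_cong)
    fix p assume p: "p < r"
    have "(\<Sum>j<r. ent G j p * ent Ginv q j) = (if p = q then 1 else 0)" if q: "q < r" for q
    proof -
      have "Ginv * G = 1\<^sub>m r"
        by (rule mat_mult_left_right_inverse[OF G_carrier G_Ginv])
      then have "(Ginv * G) $$ (q, p) = (if p = q then 1 else 0)"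
        using p q by auto
      then show ?thesis
        unfolding mat_mult_entry[OF G_carrier(2,1) q p] by (simp add: mult.commute)
    qed
    then have "mv r (mtr (ent G)) (mv r (mtr (ent Ginv)) (vec_index ?Fr)) p = (\<Sum>q<r. if p = q then vec_index ?Fr q else 0)"
      unfolding mv_mv unfolding mv_def by (intro sum.cong) auto
    then show "mv r (mtr (ent G)) (mv r (mtr (ent Ginv)) (vec_index ?Fr)) p = vec_index ?Fr p"
      using p by simp
  qed simp
  also have "\<dots> = (L * F\<^sup>T) $$ (i, t)"
    using it carrier by (simp add: ip_def scalar_prod_def atLeast0LessThan)
  finally have M_eq: "(L * F\<^sup>T) $$ (i, t) = ip r (vec_index ?y) (vec_index ?x)" by simp
  have nl: "nrm r (\<lambda>j. vec_index ?lv j - vec_index ?y j) \<le> \<kappa> ^ 43 * (err * l + 1 / B)"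
    using loading_error unfolding vnorm_diff_eq[OF dims(1,3)] .
  have nf: "nrm r (\<lambda>j. vec_index ?fv j - vec_index ?x j) \<le> \<kappa> ^ 40 * (err * f + 1 / A)"
    using factor_error unfolding vnorm_diff_eq[OF dims(2,4)] .
  have nfv: "nrm r (vec_index ?fv) \<le> \<kappa> ^ 6 * f + \<kappa> ^ 40 * (err * f + 1 / A)"
    using nrm_triangle[of r "vec_index ?x" "\<lambda>j. vec_index ?fv j - vec_index ?x j"] nf rotated_factor_le by simp
  have "scalar_prod ?lv ?fv = ip (dim_vec ?fv) (vec_index ?lv) (vec_index ?fv)"
    by (simp only: ip_def scalar_prod_def atLeast0LessThan)
  then have "scalar_prod ?lv ?fv = ip r (vec_index ?lv) (vec_index ?fv)"
    unfolding carrier_vecD[OF dims(2)] .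
  then have eq: "scalar_prod ?lv ?fv - (L * F\<^sup>T) $$ (i, t)
      = ip r (\<lambda>j. vec_index ?lv j - vec_index ?y j) (vec_index ?fv) + ip r (vec_index ?y) (\<lambda>j. vec_index ?fv j - vec_index ?x j)"
    by (simp add: M_eq ip_diff_left ip_diff_right)
  have "\<bar>scalar_prod ?lv ?fv - (L * F\<^sup>T) $$ (i, t)\<bar>
      \<le> nrm r (\<lambda>j. vec_index ?lv j - vec_index ?y j) * nrm r (vec_index ?fv)
      + nrm r (vec_index ?y) * nrm r (\<lambda>j. vec_index ?fv j - vec_index ?x j)"
    unfolding eq by (rule order_trans[OF abs_triangle_ineq add_mono[OF ip_abs_le ip_abs_le]])
  also have "\<dots> \<le> (\<kappa> ^ 43 * (err * l + 1 / B)) * (\<kappa> ^ 6 * f + \<kappa> ^ 40 * (err * f + 1 / A))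
      + (\<kappa> ^ 9 * l) * (\<kappa> ^ 40 * (err * f + 1 / A))"
    by (intro add_mono mult_mono nl nf nfv rotated_loading_le nrm_ge_0 order_trans[OF nrm_ge_0 nl]
        order_trans[OF nrm_ge_0 rotated_loading_le])
  finally show ?thesis .
qed

end

end

section \<open>Frames from positive definite limits\<close>

text \<open>The two frames put the singular values of the common component above
  \<open>A * sqrt (real m) / \<kappa>\<^sup>2\<close>. The ceiling on \<open>e\<close> is a quarter
  of this, so those of \<open>X\<close> keep at least three quarters, enough for both lower bounds
  in \<open>factor_pert\<close>.\<close>

lemma factor_matsI:
  fixes L F E X U D V U0 D0 V0 R :: "real mat"
  assumes r: "0 < r" and \<kappa>: "2 \<le> \<kappa>" "real r \<le> \<kappa>" and A: "0 < A" and m: "0 < m"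
    and e: "0 \<le> e" "e \<le> A * sqrt (real m) / (4 * \<kappa>\<^sup>2)"
    and carrier: "L \<in> carrier_mat n r" "F \<in> carrier_mat m r" "E \<in> carrier_mat n m"
    and X: "X = L * F\<^sup>T + E"
    and svd: "top_svd n m r X U D V" and svd0: "top_svd n m r (L * F\<^sup>T) U0 D0 V0"
    and min: "procrustes_minimizer r (U * diag_sqrt D) (V * diag_sqrt D) (U0 * diag_sqrt D0) (V0 * diag_sqrt D0) R"
    and L: "\<And>y. A / \<kappa> * nrm r y \<le> nrm n (mv r (ent L) y)" "\<And>y. nrm n (mv r (ent L) y) \<le> \<kappa> * A * nrm r y"
    and F: "\<And>y. sqrt (real m) / \<kappa> * nrm r y \<le> nrm m (mv r (ent F) y)"
      "\<And>y. nrm m (mv r (ent F) y) \<le> \<kappa> * sqrt (real m) * nrm r y"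
    and E: "op_bound n m (ent E) e"
    and LEF: "\<And>p q. p < r \<Longrightarrow> q < r \<Longrightarrow>
      \<bar>ip n (nth_col (ent L) p) (mv m (ent E) (nth_col (ent F) q))\<bar> \<le> \<kappa> * A * sqrt (real m)"
  shows "factor_mats n m r L F E U D V U0 D0 V0 R A (sqrt (real m)) e \<kappa>"
proof -
  let ?B = "sqrt (real m)" and ?M = "L * F\<^sup>T"
  have B: "0 < ?B" and \<kappa>0: "0 < \<kappa>"
    using m \<kappa> by auto
  have Mc: "?M \<in> carrier_mat n m" and Xc: "X \<in> carrier_mat n m"
    using carrier X by auto
  have M_ent: "?M $$ (i, t) = (\<Sum>k<r. L $$ (i, k) * F $$ (t, k))" if "i < n" "t < m" for i t
    using that carrier by (simp add: scalar_prod_def atLeast0LessThan)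
  have M_mv: "mv m (ent ?M) x i = mv r (ent L) (mv m (mtr (ent F)) x) i" if "i < n" for x i
    unfolding mv_mv unfolding mv_def using M_ent that by (intro sum.cong) auto
  have M_tr: "mv n (mtr (ent ?M)) x t = mv r (ent F) (mv n (mtr (ent L)) x) t" if "t < m" for x t
    unfolding mv_mv unfolding mv_def using M_ent that by (intro sum.cong) (auto simp: mult.commute)
  have X_mv: "mv m (ent X) x i = mv r (ent L) (mv m (mtr (ent F)) x) i + mv m (ent E) x i" if "i < n" for x i
  proof -
    have "mv m (ent X) x i = mv m (ent ?M) x i + mv m (ent E) x i"
      unfolding mv_def sum.distrib[symmetric] distrib_right[symmetric]
      using that carrier Mc by (intro sum.cong) (auto simp: X)
    then show ?thesis
      using M_mv[OF that] by simp
  qed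
  have X_tr: "mv n (mtr (ent X)) x t = mv r (ent F) (mv n (mtr (ent L)) x) t + mv n (mtr (ent E)) x t" if "t < m" for x t
  proof -
    have "mv n (mtr (ent X)) x t = mv n (mtr (ent ?M)) x t + mv n (mtr (ent E)) x t"
      unfolding mv_def sum.distrib[symmetric] distrib_right[symmetric]
      using that carrier Mc by (intro sum.cong) (auto simp: X)
    then show ?thesis
      using M_tr[OF that] by simp
  qed
  have A\<kappa>: "0 < A / \<kappa>" "0 < ?B / \<kappa>"
    using A B \<kappa>0 by auto
  define D2 where "D2 = A * ?B / \<kappa>\<^sup>2"
  have D2: "0 < D2" "4 * e \<le> D2" "A * ?B / \<kappa> ^ 3 \<le> D2 / 2"
  proof -
    show "0 < D2" using A B \<kappa>0 by (simp add: D2_def)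
    show "4 * e \<le> D2" using e by (simp add: D2_def)
    have "A * ?B / \<kappa> ^ 3 = D2 / \<kappa>"
      by (simp add: D2_def eval_nat_numeral)
    also have "\<dots> \<le> D2 / 2"
      using \<kappa> \<open>0 < D2\<close> by (intro divide_left_mono) auto
    finally show "A * ?B / \<kappa> ^ 3 \<le> D2 / 2" .
  qed
  have d_low: "D2 - e \<le> D $$ (j, j)" if "j < r" for j
  proof -
    have "A / \<kappa> * (?B / \<kappa>) - e \<le> D $$ (r - 1, r - 1)"
    proof (rule singular_value_lower[OF r A\<kappa> L(1) F(1) E])
      fix x assume "\<And>k. k < r - 1 \<Longrightarrow> ip m (nth_col (ent V) k) x = 0"
      then have "nrm n (mv m (ent X) x) \<le> D $$ (r - 1, r - 1) * nrm m x"
        by (rule top_svd_variational[OF svd Xc r])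
      then show "nrm n (\<lambda>i. mv r (ent L) (mv m (mtr (ent F)) x) i + mv m (ent E) x i) \<le> D $$ (r - 1, r - 1) * nrm m x"
        by (simp add: X_mv cong: nrm_cong)
    qed
    also have "\<dots> \<le> D $$ (j, j)"
      by (rule top_svd_antimono[OF svd Xc that])
    finally show ?thesis
      by (simp add: D2_def power2_eq_square)
  qed
  have d0_low: "D2 \<le> D0 $$ (j, j)" if "j < r" for j
  proof -
    have "A / \<kappa> * (?B / \<kappa>) - 0 \<le> D0 $$ (r - 1, r - 1)"
    proof (rule singular_value_lower[OF r A\<kappa> L(1) F(1)])
      show "op_bound n m (\<lambda>i j. 0) 0"
        by (simp add: op_bound_def mv_def)
      fix x assume "\<And>k. k < r - 1 \<Longrightarrow> ip m (nth_col (ent V0) k) x = 0"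
      then have "nrm n (mv m (ent ?M) x) \<le> D0 $$ (r - 1, r - 1) * nrm m x"
        by (rule top_svd_variational[OF svd0 Mc r])
      then show "nrm n (\<lambda>i. mv r (ent L) (mv m (mtr (ent F)) x) i + mv m (\<lambda>i j. 0) x i) \<le> D0 $$ (r - 1, r - 1) * nrm m x"
        by (simp add: M_mv mv_def[of m "\<lambda>i j. 0"] cong: nrm_cong)
    qed
    also have "\<dots> \<le> D0 $$ (j, j)"
      by (rule top_svd_antimono[OF svd0 Mc that])
    finally show ?thesis
      by (simp add: D2_def power2_eq_square)
  qed
  note c = top_svd_carrier[OF svd Xc] and c0 = top_svd_carrier[OF svd0 Mc]
  note dg = top_svd_diag[OF svd Xc] and dg0 = top_svd_diag[OF svd0 Mc]
  have Yc: "U * diag_sqrt D \<in> carrier_mat n r" "V * diag_sqrt D \<in> carrier_mat m r"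
    "U0 * diag_sqrt D0 \<in> carrier_mat n r" "V0 * diag_sqrt D0 \<in> carrier_mat m r"
    using c c0 by auto
  have R: "R \<in> orthogonal_matrices r"
    by (rule procrustes_orthogonal[OF min Yc])
  let ?C = "\<lambda>j k. ip n (nth_col (ent (U * diag_sqrt D)) j) (nth_col (ent (U0 * diag_sqrt D0)) k)
      + ip m (nth_col (ent (V * diag_sqrt D)) j) (nth_col (ent (V0 * diag_sqrt D0)) k)"
  have C: "?C j k = sqrt (D $$ (j, j)) * (ip n (nth_col (ent U) j) (nth_col (ent U0) k) + ip m (nth_col (ent V) j) (nth_col (ent V0) k))
      * sqrt (D0 $$ (k, k))" if "j < r" "k < r" for j k
  proof -
    have "ip n (nth_col (ent (U * diag_sqrt D)) j) (nth_col (ent (U0 * diag_sqrt D0)) k)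
        = ip n (\<lambda>i. sqrt (D $$ (j, j)) * U $$ (i, j)) (\<lambda>i. sqrt (D0 $$ (k, k)) * U0 $$ (i, k))"
      using that by (intro ip_cong) (simp_all add: diag_sqrt_entry[OF c(1,2) dg] diag_sqrt_entry[OF c0(1,2) dg0])
    moreover have "ip m (nth_col (ent (V * diag_sqrt D)) j) (nth_col (ent (V0 * diag_sqrt D0)) k)
        = ip m (\<lambda>i. sqrt (D $$ (j, j)) * V $$ (i, j)) (\<lambda>i. sqrt (D0 $$ (k, k)) * V0 $$ (i, k))"
      using that by (intro ip_cong) (simp_all add: diag_sqrt_entry[OF c(3,2) dg] diag_sqrt_entry[OF c0(3,2) dg0])
    ultimately show ?thesis
      by (simp only: ip_scale_left ip_scale_right) (simp add: algebra_simps)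
  qed
  have pert: "factor_pert n m r (ent L) (ent F) (ent E) (ent U) (ent V) (ent U0) (ent V0)
      (\<lambda>j. D $$ (j, j)) (\<lambda>j. D0 $$ (j, j)) (ent R) A ?B e \<kappa>"
  proof
    fix i j assume ij: "i < n" "j < r"
    show "mv r (ent L) (mv m (mtr (ent F)) (nth_col (ent V) j)) i + mv m (ent E) (nth_col (ent V) j) i = D $$ (j, j) * U $$ (i, j)"
      using top_svd_right[OF svd Xc ij] X_mv[OF ij(1)] by simp
    show "mv r (ent L) (mv m (mtr (ent F)) (nth_col (ent V0) j)) i = D0 $$ (j, j) * U0 $$ (i, j)"
      using top_svd_right[OF svd0 Mc ij] M_mv[OF ij(1)] by simp
  next
    fix t j assume tj: "t < m" "j < r"
    show "mv r (ent F) (mv n (mtr (ent L)) (nth_col (ent U) j)) t + mv n (mtr (ent E)) (nth_col (ent U) j) t = D $$ (j, j) * V $$ (t, j)"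
      using top_svd_left[OF svd Xc tj] X_tr[OF tj(1)] by simp
    show "mv r (ent F) (mv n (mtr (ent L)) (nth_col (ent U0) j)) t = D0 $$ (j, j) * V0 $$ (t, j)"
      using top_svd_left[OF svd0 Mc tj] M_tr[OF tj(1)] by simp
  next
    fix j assume j: "j < r"
    show "A * ?B / \<kappa> ^ 3 \<le> D $$ (j, j)" "2 * e \<le> D $$ (j, j)" "A * ?B / \<kappa> ^ 3 \<le> D0 $$ (j, j)"
      using d_low[OF j] d0_low[OF j] D2 e(1) by linarith+
  next
    fix j l assume "j < r" "l < r"
    then show "(\<Sum>k<r. R $$ (k, j) * R $$ (k, l)) = (if j = l then 1 else 0)"
      by (rule orthogonal_entries(1)[OF R])
  next
    fix j l assume jl: "j < r" "l < r"
    show "(\<Sum>k<r. sqrt (D $$ (j, j)) * (ip n (nth_col (ent U) j) (nth_col (ent U0) k) + ip m (nth_col (ent V) j) (nth_col (ent V0) k))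
        * sqrt (D0 $$ (k, k)) * R $$ (l, k))
      = (\<Sum>k<r. sqrt (D $$ (l, l)) * (ip n (nth_col (ent U) l) (nth_col (ent U0) k) + ip m (nth_col (ent V) l) (nth_col (ent V0) k))
        * sqrt (D0 $$ (k, k)) * R $$ (j, k))"
      using procrustes_sym[OF min Yc jl] jl by (simp add: C)
  next
    fix x
    have "ip r x (mv r (\<lambda>j l. \<Sum>k<r. ?C j k * R $$ (l, k)) x)
        = ip r x (mv r (\<lambda>j l. \<Sum>k<r. sqrt (D $$ (j, j)) * (ip n (nth_col (ent U) j) (nth_col (ent U0) k)
          + ip m (nth_col (ent V) j) (nth_col (ent V0) k)) * sqrt (D0 $$ (k, k)) * R $$ (l, k)) x)"
      by (intro ip_cong refl) (simp add: mv_def C)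
    then show "0 \<le> ip r x (mv r (\<lambda>j l. \<Sum>k<r. sqrt (D $$ (j, j)) * (ip n (nth_col (ent U) j) (nth_col (ent U0) k)
          + ip m (nth_col (ent V) j) (nth_col (ent V0) k)) * sqrt (D0 $$ (k, k)) * R $$ (l, k)) x)"
      using procrustes_psd[OF min Yc, of x] by simp
  qed (use r \<kappa> A B e(1) L F E LEF top_svd_orthonormal[OF svd Xc] top_svd_orthonormal[OF svd0 Mc] in simp_all)
  show ?thesis
    by (intro factor_mats.intro pert carrier c c0 R dg dg0 refl)
qed

text \<open>Only finiteness matters for its uses, so the crude sum of row norms is enough.\<close>

lemma op_bound_exists: "\<exists>e>0. op_bound n m A e"
proof (intro exI conjI)
  let ?e = "1 + (\<Sum>i<n. nrm m (A i))"
  show "0 < ?e"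
    by (simp add: add_pos_nonneg sum_nonneg)
  have "nrm n (mv m A x) \<le> ?e * nrm m x" for x
  proof -
    have "nrm n (mv m A x) \<le> (\<Sum>i<n. \<bar>mv m A x i\<bar>)"
      by (rule nrm_le_sum)
    also have "\<dots> \<le> (\<Sum>i<n. nrm m (A i) * nrm m x)"
      unfolding mv_ip by (intro sum_mono ip_abs_le)
    also have "\<dots> \<le> ?e * nrm m x"
      by (simp add: sum_distrib_right distrib_right)
    finally show ?thesis .
  qed
  then show "op_bound n m A ?e"
    by (simp add: op_bound_def)
qed

lemma invertible_entries:
  fixes S :: "nat \<Rightarrow> nat \<Rightarrow> real"
  assumes ker: "\<And>y. (\<And>j. j < r \<Longrightarrow> mv r S y j = 0) \<Longrightarrow> nrm r y = 0"
  shows "\<exists>G. \<forall>j<r. \<forall>k<r. (\<Sum>p<r. S j p * G p k) = (if j = k then 1 else 0)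
    \<and> (\<Sum>p<r. G j p * S p k) = (if j = k then 1 else 0)"
proof -
  let ?S = "Matrix.mat r r (\<lambda>(j, k). S j k)"
  have Sc: "?S \<in> carrier_mat r r" by simp
  have "det ?S \<noteq> 0"
  proof
    assume "det ?S = 0"
    then obtain w where w: "w \<in> carrier_vec r" "w \<noteq> 0\<^sub>v r" "?S *\<^sub>v w = 0\<^sub>v r"
      using det_0_iff_vec_prod_zero_field[OF Sc] by auto
    have "mv r S (vec_index w) j = 0" if j: "j < r" for j
    proof -
      have "vec_index (?S *\<^sub>v w) j = mv r (ent ?S) (vec_index w) j"
        by (rule mult_mat_vec_entry[OF Sc w(1) j])
      also have "\<dots> = mv r S (vec_index w) j"
        unfolding mv_def using j by (intro sum.cong) auto
      finally show ?thesis
        using w(3) j by simp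
    qed
    then have "nrm r (vec_index w) = 0"
      by (rule ker)
    then have "w = 0\<^sub>v r"
      using w(1) nrm_eq_0 by (intro eq_vecI) auto
    then show False using w(2) by simp
  qed
  then have "?S \<in> Units (ring_mat TYPE(real) r ())"
    by (rule det_non_zero_imp_unit[OF Sc])
  then obtain G where G: "G \<in> carrier_mat r r" "G * ?S = 1\<^sub>m r" "?S * G = 1\<^sub>m r"
    by (auto simp: Units_def ring_mat_def)
  show ?thesis
  proof (intro exI[of _ "ent G"] allI impI conjI)
    fix j k assume jk: "j < r" "k < r"
    have "(?S * G) $$ (j, k) = (\<Sum>p<r. S j p * G $$ (p, k))"
      unfolding mat_mult_entry[OF Sc G(1) jk] using jk by simp
    then show "(\<Sum>p<r. S j p * G $$ (p, k)) = (if j = k then 1 else 0)"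
      using G(3) jk by simp
    have "(G * ?S) $$ (j, k) = (\<Sum>p<r. G $$ (j, p) * S p k)"
      unfolding mat_mult_entry[OF G(1) Sc jk] using jk by simp
    then show "(\<Sum>p<r. G $$ (j, p) * S p k) = (if j = k then 1 else 0)"
      using G(2) jk by simp
  qed
qed

text \<open>With \<open>G\<close> the inverse of \<open>S\<close>, positivity of the form at \<open>y - \<tau> G y\<close> bounds it below at \<open>y\<close>.\<close>

lemma pos_def_lower:
  assumes S: "pos_def_mat r S"
  shows "\<exists>c>0. \<forall>y. c * (nrm r y)\<^sup>2 \<le> ip r y (mv r (ent S) y)"
proof -
  have Sc: "S \<in> carrier_mat r r" and sym: "S\<^sup>T = S"
    and pos: "\<And>v. v \<in> carrier_vec r \<Longrightarrow> v \<noteq> 0\<^sub>v r \<Longrightarrow> 0 < scalar_prod v (S *\<^sub>v v)"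
    using S by (auto simp: pos_def_mat_def)
  have S_ent: "S $$ (j, k) = S $$ (k, j)" if "j < r" "k < r" for j k
    using arg_cong[OF sym, of "\<lambda>M. M $$ (j, k)"] that Sc by simp
  have form: "0 < ip r y (mv r (ent S) y)" if y: "nrm r y \<noteq> 0" for y
  proof -
    let ?v = "Matrix.vec r y"
    have "?v \<noteq> 0\<^sub>v r"
    proof
      assume v: "?v = 0\<^sub>v r"
      have "y j = 0" if "j < r" for j
        using arg_cong[OF v, of "\<lambda>v. vec_index v j"] that by simp
      then have "nrm r y = nrm r (\<lambda>j. 0)"
        by (intro nrm_cong)
      then show False using y by simp
    qed
    then have "0 < scalar_prod ?v (S *\<^sub>v ?v)"
      by (intro pos) simp_all
    also have "scalar_prod ?v (S *\<^sub>v ?v) = ip r y (mv r (ent S) y)"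
      using Sc by (simp add: scalar_prod_def ip_def mv_def atLeast0LessThan)
    finally show ?thesis .
  qed
  have nonneg: "0 \<le> ip r y (mv r (ent S) y)" for y
  proof (cases "nrm r y = 0")
    case True
    then have "ip r y (mv r (ent S) y) = ip r (\<lambda>j. 0) (mv r (ent S) y)"
      using nrm_eq_0 by (intro ip_cong) auto
    then show ?thesis by simp
  next
    case False
    then show ?thesis using form[of y] by simp
  qed
  have "\<exists>G. \<forall>j<r. \<forall>k<r. (\<Sum>p<r. S $$ (j, p) * G p k) = (if j = k then 1 else 0)
      \<and> (\<Sum>p<r. G j p * S $$ (p, k)) = (if j = k then 1 else 0)"
  proof (rule invertible_entries)
    fix y assume "\<And>j. j < r \<Longrightarrow> mv r (ent S) y j = 0"
    then have "ip r y (mv r (ent S) y) = ip r y (\<lambda>j. 0)"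
      by (intro ip_cong) auto
    then show "nrm r y = 0"
      using form[of y] by fastforce
  qed
  then obtain G where SG: "\<And>j k. j < r \<Longrightarrow> k < r \<Longrightarrow> (\<Sum>p<r. S $$ (j, p) * G p k) = (if j = k then 1 else 0)"
    by meson
  obtain g where g: "0 < g" "op_bound r r G g"
    using op_bound_exists by blast
  have "(1 / g) * (nrm r y)\<^sup>2 \<le> ip r y (mv r (ent S) y)" for y
  proof -
    define z where "z = mv r G y"
    \<comment> \<open>The step \<open>1 / g\<close> balances the linear term \<open>2 / g\<close>
      against the quadratic one, which is at most \<open>1 / g\<close>; the surplus
      \<open>1 / g\<close> is the lower bound.\<close>
    define w where "w = (\<lambda>j. y j + (- 1 / g) * z j)"
    have Sz: "mv r (ent S) z j = y j" if "j < r" for j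
    proof -
      have "mv r (ent S) z j = (\<Sum>k<r. if j = k then y k else 0)"
        unfolding z_def mv_mv unfolding mv_def using SG that by (intro sum.cong) auto
      then show ?thesis using that by simp
    qed
    have "mv r (mtr (ent S)) x j = mv r (ent S) x j" if "j < r" for x j
      unfolding mv_def mtr_apply using S_ent that by (intro sum.cong) auto
    then have zSy: "ip r z (mv r (ent S) y) = ip r y y"
      unfolding ip_commute[of r z] ip_mv using Sz by (intro ip_cong) auto
    have ySz: "ip r y (mv r (ent S) z) = ip r y y" "ip r z (mv r (ent S) z) = ip r z y"
      using Sz by (auto intro: ip_cong)
    have "ip r w (mv r (ent S) w) = ip r y (mv r (ent S) y) - 2 / g * ip r y y + (1 / g) * (1 / g) * ip r z y"
      unfolding w_def mv_add mv_scale ip_add_left ip_add_right ip_scale_left ip_scale_right zSy ySz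
      by (simp add: algebra_simps)
    moreover have "ip r z y \<le> g * (nrm r y)\<^sup>2"
    proof -
      have "ip r z y \<le> nrm r z * nrm r y"
        using ip_abs_le[of r z y] by linarith
      also have "\<dots> \<le> (g * nrm r y) * nrm r y"
        unfolding z_def by (intro mult_right_mono op_boundD[OF g(2)]) simp
      finally show ?thesis by (simp add: power2_eq_square)
    qed
    then have "(1 / g) * (1 / g) * ip r z y \<le> (1 / g) * (1 / g) * (g * (nrm r y)\<^sup>2)"
      using g by (intro mult_left_mono) auto
    moreover have "(1 / g) * (1 / g) * (g * (nrm r y)\<^sup>2) = 1 / g * (nrm r y)\<^sup>2"
      using g by simp
    ultimately show ?thesis
      using nonneg[of w] by (simp add: nrm_sq)
  qed
  then show ?thesis
    using g(1) by (intro exI[of _ "1 / g"]) auto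
qed

lemma quadratic_form_close:
  assumes "\<And>j k. j < r \<Longrightarrow> k < r \<Longrightarrow> \<bar>G j k - S j k\<bar> \<le> \<epsilon>"
  shows "\<bar>ip r y (mv r G y) - ip r y (mv r S y)\<bar> \<le> \<epsilon> * (real r)\<^sup>2 * (nrm r y)\<^sup>2"
proof -
  have "ip r y (mv r G y) - ip r y (mv r S y) = (\<Sum>j<r. \<Sum>k<r. y j * ((G j k - S j k) * y k))"
    by (simp add: ip_def mv_def sum_subtractf[symmetric] sum_distrib_left algebra_simps)
  then have "\<bar>ip r y (mv r G y) - ip r y (mv r S y)\<bar> \<le> (\<Sum>j<r. \<Sum>k<r. \<bar>y j * ((G j k - S j k) * y k)\<bar>)"
    by (simp only:) (intro order_trans[OF sum_abs sum_mono] sum_abs)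
  also have "\<dots> \<le> (\<Sum>j<r. \<Sum>k<r. nrm r y * (\<epsilon> * nrm r y))"
  proof (intro sum_mono)
    fix j k assume "j \<in> {..<r}" "k \<in> {..<r}"
    then have jk: "j < r" "k < r" by auto
    show "\<bar>y j * ((G j k - S j k) * y k)\<bar> \<le> nrm r y * (\<epsilon> * nrm r y)"
      unfolding abs_mult using assms[OF jk] comp_le_nrm[OF jk(1), of y] comp_le_nrm[OF jk(2), of y]
      by (intro mult_mono) auto
  qed
  also have "\<dots> = \<epsilon> * (real r)\<^sup>2 * (nrm r y)\<^sup>2"
    by (simp add: power2_eq_square)
  finally show ?thesis .
qed

text \<open>The scaled Gram matrix of \<open>W\<close> inherits the form bounds of the limit with a
  loss of half the lower one. The constants do not depend on \<open>n\<close>, \<open>W\<close> or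
  \<open>s\<close>, so the statement serves the loadings and every realization of the
  factors.\<close>

lemma pos_def_frame:
  assumes S: "pos_def_mat r S"
  shows "\<exists>\<kappa>0>0. \<exists>\<epsilon>>0. \<forall>\<kappa> n W s y. \<kappa>0 \<le> \<kappa> \<longrightarrow> 0 < s \<longrightarrow>
      (\<forall>j<r. \<forall>k<r. \<bar>(\<Sum>i<n. W i j * W i k) / s - S $$ (j, k)\<bar> \<le> \<epsilon>) \<longrightarrow>
      sqrt s / \<kappa> * nrm r y \<le> nrm n (mv r W y) \<and> nrm n (mv r W y) \<le> \<kappa> * sqrt s * nrm r y"
proof -
  obtain c where c: "0 < c" "\<And>y. c * (nrm r y)\<^sup>2 \<le> ip r y (mv r (ent S) y)"
    using pos_def_lower[OF S] by blast
  obtain g where g: "0 < g" "op_bound r r (ent S) g"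
    using op_bound_exists by blast
  \<comment> \<open>An entrywise error costs the factor r^2 in the quadratic form; the summand 1
    keeps the denominator positive for r = 0.\<close>
  define \<epsilon> where "\<epsilon> = c / (2 * (real r)\<^sup>2 + 1)"
  define \<kappa>0 where "\<kappa>0 = sqrt (2 / c) + sqrt (g + c)"
  have \<epsilon>: "0 < \<epsilon>" "\<epsilon> * (real r)\<^sup>2 \<le> c / 2"
  proof -
    show "0 < \<epsilon>"
      using c(1) unfolding \<epsilon>_def by (intro divide_pos_pos add_nonneg_pos) auto
    have "\<epsilon> * (2 * (real r)\<^sup>2) \<le> \<epsilon> * (2 * (real r)\<^sup>2 + 1)"
      using \<open>0 < \<epsilon>\<close> by simp
    also have "\<dots> = c"
      unfolding \<epsilon>_def by (simp add: add_nonneg_eq_0_iff)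
    finally show "\<epsilon> * (real r)\<^sup>2 \<le> c / 2" by simp
  qed
  have \<kappa>0: "0 < \<kappa>0"
    using c(1) g(1) by (simp add: \<kappa>0_def add_pos_pos)
  have frame: "sqrt s / \<kappa> * nrm r y \<le> nrm n (mv r W y) \<and> nrm n (mv r W y) \<le> \<kappa> * sqrt s * nrm r y"
    if \<kappa>: "\<kappa>0 \<le> \<kappa>" and s: "0 < s"
      and G: "\<And>j k. j < r \<Longrightarrow> k < r \<Longrightarrow> \<bar>(\<Sum>i<n. W i j * W i k) / s - S $$ (j, k)\<bar> \<le> \<epsilon>" for \<kappa> n W s y
  proof -
    let ?G = "\<lambda>j k. (\<Sum>i<n. W i j * W i k) / s"
    have \<kappa>': "0 < \<kappa>" "sqrt (2 / c) \<le> \<kappa>" "sqrt (g + c) \<le> \<kappa>"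
      using \<kappa> \<kappa>0 c(1) g(1) by (auto simp: \<kappa>0_def intro: order_trans[rotated])
    have "(nrm n (mv r W y))\<^sup>2 = ip r y (mv n (mtr W) (mv r W y))"
      by (simp add: nrm_sq ip_mv)
    also have "\<dots> = s * ip r y (mv r ?G y)"
      unfolding ip_scale_right[symmetric] mv_mv
      using s by (intro ip_cong refl) (simp add: mv_mv mv_def sum_distrib_left)
    finally have W_sq: "(nrm n (mv r W y))\<^sup>2 = s * ip r y (mv r ?G y)" .
    have close: "\<bar>ip r y (mv r ?G y) - ip r y (mv r (ent S) y)\<bar> \<le> c / 2 * (nrm r y)\<^sup>2"
      by (rule order_trans[OF quadratic_form_close[OF G] mult_right_mono[OF \<epsilon>(2)]]) simp_all
    have "ip r y (mv r (ent S) y) \<le> g * (nrm r y)\<^sup>2"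
    proof -
      have "ip r y (mv r (ent S) y) \<le> nrm r y * nrm r (mv r (ent S) y)"
        using ip_abs_le[of r y "mv r (ent S) y"] by linarith
      also have "\<dots> \<le> nrm r y * (g * nrm r y)"
        by (intro mult_left_mono op_boundD[OF g(2)]) simp
      finally show ?thesis by (simp add: power2_eq_square mult_ac)
    qed
    moreover have "c / 2 * (nrm r y)\<^sup>2 \<le> c * (nrm r y)\<^sup>2"
      using c(1) by (intro mult_right_mono) simp_all
    ultimately have up: "ip r y (mv r ?G y) \<le> (g + c) * (nrm r y)\<^sup>2"
      using close unfolding distrib_right by linarith
    have low: "c / 2 * (nrm r y)\<^sup>2 \<le> ip r y (mv r ?G y)"
      using close c(2)[of y] by linarith
    have "(sqrt s / \<kappa> * nrm r y)\<^sup>2 \<le> (nrm n (mv r W y))\<^sup>2"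
    proof -
      have "2 / c \<le> \<kappa>\<^sup>2"
        using power_mono[OF \<kappa>'(2), of 2] c(1) by simp
      then have "1 / \<kappa>\<^sup>2 \<le> c / 2"
        using c(1) \<kappa>'(1) by (simp add: field_simps)
      then have "1 / \<kappa>\<^sup>2 * (nrm r y)\<^sup>2 \<le> c / 2 * (nrm r y)\<^sup>2"
        by (rule mult_right_mono) simp
      from mult_left_mono[OF order_trans[OF this low], of s]
      have "s * (1 / \<kappa>\<^sup>2 * (nrm r y)\<^sup>2) \<le> s * ip r y (mv r ?G y)"
        using s by simp
      then show ?thesis
        using s by (simp add: W_sq power_mult_distrib power_divide)
    qed
    moreover have "(nrm n (mv r W y))\<^sup>2 \<le> (\<kappa> * sqrt s * nrm r y)\<^sup>2"
    proof -
      have "g + c \<le> \<kappa>\<^sup>2"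
        using c(1) g(1) power_mono[OF \<kappa>'(3), of 2] by simp
      then have "(g + c) * (nrm r y)\<^sup>2 \<le> \<kappa>\<^sup>2 * (nrm r y)\<^sup>2"
        by (rule mult_right_mono) simp
      from mult_left_mono[OF order_trans[OF up this], of s]
      have "s * ip r y (mv r ?G y) \<le> s * (\<kappa>\<^sup>2 * (nrm r y)\<^sup>2)"
        using s by simp
      then show ?thesis
        using s by (simp add: W_sq power_mult_distrib mult_ac)
    qed
    ultimately show ?thesis
      using \<kappa>'(1) s by (auto intro: power2_le_imp_le)
  qed
  show ?thesis
    by (intro exI[of _ \<kappa>0] exI[of _ \<epsilon>] conjI[OF \<kappa>0] conjI[OF \<epsilon>(1)] allI impI frame) auto
qed

text \<open>(L^T L)^-1 L^T, where the lower frame bound makes the Gram matrix invertible. It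
  recovers the factors from the common component.\<close>

lemma left_inverse_exists:
  assumes a: "0 < a" and L: "\<And>y. a * nrm r y \<le> nrm n (mv r L y)"
  obtains W where "\<And>j k. j < r \<Longrightarrow> k < r \<Longrightarrow> (\<Sum>i<n. W j i * L i k) = (if j = k then 1 else 0)"
proof -
  let ?S = "\<lambda>p k. \<Sum>i<n. L i p * L i k"
  have "\<exists>G. \<forall>j<r. \<forall>k<r. (\<Sum>p<r. ?S j p * G p k) = (if j = k then 1 else 0)
      \<and> (\<Sum>p<r. G j p * ?S p k) = (if j = k then 1 else 0)"
  proof (rule invertible_entries)
    fix y assume y: "\<And>j. j < r \<Longrightarrow> mv r ?S y j = 0"
    have "(nrm n (mv r L y))\<^sup>2 = ip r y (mv n (mtr L) (mv r L y))"
      by (simp add: nrm_sq ip_mv)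
    also have "\<dots> = ip r y (\<lambda>j. 0)"
      using y by (intro ip_cong) (simp_all add: mv_mv)
    finally have "nrm n (mv r L y) = 0"
      by simp
    then show "nrm r y = 0"
      using L[of y] a nrm_ge_0[of r y] by (simp add: mult_le_0_iff)
  qed
  then obtain G where G: "\<And>j k. j < r \<Longrightarrow> k < r \<Longrightarrow> (\<Sum>p<r. G j p * ?S p k) = (if j = k then 1 else 0)"
    by meson
  show thesis
  proof (rule that[of "\<lambda>j i. \<Sum>p<r. G j p * L i p"])
    fix j k assume jk: "j < r" "k < r"
    have "(\<Sum>i<n. (\<Sum>p<r. G j p * L i p) * L i k) = (\<Sum>i<n. \<Sum>p<r. G j p * (L i p * L i k))"
      by (simp add: sum_distrib_right mult.assoc)
    also have "\<dots> = (\<Sum>p<r. G j p * ?S p k)"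
      by (subst sum.swap) (simp add: sum_distrib_left)
    finally show "(\<Sum>i<n. (\<Sum>p<r. G j p * L i p) * L i k) = (if j = k then 1 else 0)"
      using G jk by simp
  qed
qed

section \<open>Conditionally independent noise\<close>

text \<open>Events of \<open>G\<close> intersected with boxes in the variables of \<open>Q\<close>:
  an intersection-stable generator, as the induction in \<open>set_mean\<close> requires.\<close>

definition noise_gen :: "'a measure \<Rightarrow> 'a measure \<Rightarrow> ('i \<Rightarrow> 'a \<Rightarrow> real) \<Rightarrow> 'i set \<Rightarrow> 'a set set" where
  "noise_gen M G X Q =
     {A \<inter> {\<omega>\<in>space M. \<forall>q\<in>Q. X q \<omega> \<in> B q} | A B. A \<in> sets G \<and> (\<forall>q\<in>Q. B q \<in> sets borel)}"

definition noise_algebra :: "'a measure \<Rightarrow> 'a measure \<Rightarrow> ('i \<Rightarrow> 'a \<Rightarrow> real) \<Rightarrow> 'i set \<Rightarrow> 'a measure" where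
  "noise_algebra M G X Q = sigma (space M) (noise_gen M G X Q)"

text \<open>Conditional independence, zero conditional mean and a constant conditional variance
  \<open>v p\<close> make \<open>X p\<close> behave, in first and second moments, as if it were
  independent of \<open>G\<close> and of the other variables.\<close>

locale cond_noise = prob_space M for M :: "'a measure" +
  fixes G :: "'a measure" and X :: "'i \<Rightarrow> 'a \<Rightarrow> real" and I :: "'i set" and v :: "'i \<Rightarrow> real" and C :: real
  assumes sub: "subalgebra M G" and fin: "finite I"
    and indep: "cond_indep_vars M G X I"
    and sq_int: "\<And>p. p \<in> I \<Longrightarrow> integrable M (\<lambda>\<omega>. (X p \<omega>)\<^sup>2)"
    and mean: "\<And>p. p \<in> I \<Longrightarrow> AE \<omega> in M. real_cond_exp M G (X p) \<omega> = 0"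
    and var: "\<And>p. p \<in> I \<Longrightarrow> AE \<omega> in M. real_cond_exp M G (\<lambda>\<omega>. (X p \<omega>)\<^sup>2) \<omega> = v p"
    and v: "\<And>p. p \<in> I \<Longrightarrow> 0 \<le> v p" "\<And>p. p \<in> I \<Longrightarrow> v p \<le> C" and C: "0 \<le> C"
begin

sublocale fms: finite_measure_subalgebra M G
  by unfold_locales (rule sub)

lemma X_meas: "p \<in> I \<Longrightarrow> X p \<in> borel_measurable M"
  using indep by (simp add: cond_indep_vars_def)

lemma X_int: "p \<in> I \<Longrightarrow> integrable M (X p)"
  using square_integrable_imp_integrable[OF X_meas] sq_int by blast

lemma G_sets: "A \<in> sets G \<Longrightarrow> A \<in> sets M" "space G = space M"
  using sub by (auto simp: subalgebra_def)

text \<open>The laws of \<open>X p\<close> under the densities \<open>Q1\<close> and \<open>\<Psi>\<close> agree because of conditional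
  independence, and \<open>\<Psi>\<close> is measurable with respect to \<open>G\<close>.\<close>

lemma cond_mean_on_generator:
  fixes \<phi> :: "real \<Rightarrow> real"
  assumes p: "p \<in> I" "p \<notin> Q" and Q: "Q \<subseteq> I" and A: "A \<in> sets G"
    and B: "\<And>q. q \<in> Q \<Longrightarrow> B q \<in> sets borel"
    and \<phi>: "\<phi> \<in> borel_measurable borel" "integrable M (\<lambda>\<omega>. \<phi> (X p \<omega>))"
    and c: "AE \<omega> in M. real_cond_exp M G (\<lambda>\<omega>. \<phi> (X p \<omega>)) \<omega> = c"
  shows "(\<integral>\<omega>. (indicator A \<omega> * (\<Prod>q\<in>Q. indicator (B q) (X q \<omega>))) * \<phi> (X p \<omega>) \<partial>M)
    = c * (\<integral>\<omega>. indicator A \<omega> * (\<Prod>q\<in>Q. indicator (B q) (X q \<omega>)) \<partial>M)"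
proof -
  have finQ: "finite Q"
    using Q fin finite_subset by blast
  have [measurable]: "\<And>q. q \<in> Q \<Longrightarrow> X q \<in> borel_measurable M" "X p \<in> borel_measurable M"
    using X_meas Q p by auto
  have [measurable]: "\<And>q. q \<in> Q \<Longrightarrow> B q \<in> sets borel" "\<phi> \<in> borel_measurable borel"
    using B \<phi> by auto
  have A_M[measurable]: "A \<in> sets M" and AG[measurable]: "A \<in> sets G"
    using A G_sets by auto
  define Q1 :: "'a \<Rightarrow> real" where "Q1 \<omega> = indicator A \<omega> * (\<Prod>q\<in>Q. indicator (B q) (X q \<omega>))" for \<omega>
  define h :: "'i \<Rightarrow> 'a \<Rightarrow> real" where "h q \<omega> = indicator (B q) (X q \<omega>)" for q \<omega>
  define \<psi> where "\<psi> \<omega> = (\<Prod>q\<in>Q. real_cond_exp M G (h q) \<omega>)" for \<omega>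
  \<comment> \<open>The conditional expectations lie in [0, 1] only almost everywhere; clipping
    yields a bounded nonnegative density at every point.\<close>
  define \<Psi> where "\<Psi> \<omega> = indicator A \<omega> * max 0 (min 1 (\<psi> \<omega>))" for \<omega>
  have h_meas[measurable]: "h q \<in> borel_measurable M" if "q \<in> Q" for q
    using that unfolding h_def by measurable
  have prod_ind: "(\<Prod>q\<in>Q. indicator (B q) (X q \<omega>)) \<in> {0..1::real}" for \<omega>
    by (auto intro!: prod_nonneg prod_le_1 simp: indicator_def)
  have Q1_bound: "0 \<le> Q1 \<omega>" "Q1 \<omega> \<le> 1" "\<bar>Q1 \<omega>\<bar> \<le> 1" for \<omega>
    using prod_ind[of \<omega>] by (auto simp: Q1_def indicator_def)
  have \<Psi>_bound: "0 \<le> \<Psi> \<omega>" "\<Psi> \<omega> \<le> 1" "\<bar>\<Psi> \<omega>\<bar> \<le> 1" for \<omega>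
    by (auto simp: \<Psi>_def indicator_def)
  have Q1_meas[measurable]: "Q1 \<in> borel_measurable M"
    unfolding Q1_def by measurable
  have \<Psi>_G: "\<Psi> \<in> borel_measurable G"
    unfolding \<Psi>_def \<psi>_def by measurable
  have \<Psi>_M[measurable]: "\<Psi> \<in> borel_measurable M"
    by (rule measurable_from_subalg[OF sub \<Psi>_G])
  have h_int: "integrable M (h q)" if "q \<in> Q" for q
    using that by (intro integrable_const_bound[of _ 1]) (auto simp: h_def indicator_def)
  have "AE \<omega> in M. \<forall>q\<in>Q. 0 \<le> real_cond_exp M G (h q) \<omega> \<and> real_cond_exp M G (h q) \<omega> \<le> 1"
  proof (rule AE_finite_allI[OF finQ])
    fix q assume q: "q \<in> Q"
    have "AE \<omega> in M. 0 \<le> real_cond_exp M G (h q) \<omega>" "AE \<omega> in M. real_cond_exp M G (h q) \<omega> \<le> 1"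
      using h_int[OF q] by (auto intro!: fms.real_cond_exp_ge_c fms.real_cond_exp_le_c simp: h_def indicator_def)
    then show "AE \<omega> in M. 0 \<le> real_cond_exp M G (h q) \<omega> \<and> real_cond_exp M G (h q) \<omega> \<le> 1"
      by eventually_elim auto
  qed
  then have \<Psi>_eq: "AE \<omega> in M. \<Psi> \<omega> = indicator A \<omega> * \<psi> \<omega>"
  proof eventually_elim
    case (elim \<omega>)
    then have "0 \<le> \<psi> \<omega>" "\<psi> \<omega> \<le> 1"
      unfolding \<psi>_def by (auto intro!: prod_nonneg prod_le_1)
    then show ?case by (simp add: \<Psi>_def)
  qed
  \<comment> \<open>Conditional independence is applied to the family enlarged by the index
    \<open>p\<close> with the set \<open>S\<close>.\<close>
  have key: "(\<integral>\<omega>. Q1 \<omega> * indicator S (X p \<omega>) \<partial>M) = (\<integral>\<omega>. \<Psi> \<omega> * indicator S (X p \<omega>) \<partial>M)"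
    if S[measurable]: "S \<in> sets borel" for S
  proof -
    define B' where "B' = B(p := S)"
    let ?P = "\<lambda>\<omega>. \<Prod>q\<in>insert p Q. indicator (B' q) (X q \<omega>) :: real"
    let ?hp = "\<lambda>\<omega>. indicator S (X p \<omega>) :: real"
    have B'_sets: "\<forall>q\<in>insert p Q. B' q \<in> sets borel"
      using B S by (auto simp: B'_def)
    have P_eq: "?P \<omega> = ?hp \<omega> * (\<Prod>q\<in>Q. indicator (B q) (X q \<omega>))" for \<omega>
      using finQ p(2) by (auto simp: B'_def intro!: prod.cong)
    have P_meas[measurable]: "?P \<in> borel_measurable M"
      unfolding P_eq by measurable
    have ci: "AE \<omega> in M. real_cond_exp M G ?P \<omega> = (\<Prod>q\<in>insert p Q. real_cond_exp M G (\<lambda>\<omega>. indicator (B' q) (X q \<omega>)) \<omega>)"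
      by (rule mp[OF mp[OF mp[OF spec[OF spec[OF conjunct2[OF indep[unfolded cond_indep_vars_def]], of "insert p Q"], of B']]]])
        (use p Q finQ B'_sets in simp_all)
    have prod_eq: "(\<Prod>q\<in>insert p Q. real_cond_exp M G (\<lambda>\<omega>. indicator (B' q) (X q \<omega>)) \<omega>)
        = real_cond_exp M G ?hp \<omega> * \<psi> \<omega>" for \<omega>
      using finQ p(2) by (auto simp: B'_def \<psi>_def h_def[abs_def] intro!: prod.cong)
    have "(\<integral>\<omega>. Q1 \<omega> * ?hp \<omega> \<partial>M) = (\<integral>\<omega>. indicator A \<omega> * ?P \<omega> \<partial>M)"
      unfolding Q1_def P_eq by (simp add: mult_ac)
    also have "\<dots> = (\<integral>\<omega>. indicator A \<omega> * real_cond_exp M G ?P \<omega> \<partial>M)"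
    proof (rule fms.real_cond_exp_intg(2)[symmetric])
      show "integrable M (\<lambda>\<omega>. indicator A \<omega> * ?P \<omega>)"
      proof (rule integrable_const_bound[of _ 1])
        show "AE \<omega> in M. norm (indicator A \<omega> * ?P \<omega>) \<le> 1"
          unfolding P_eq using prod_ind by (intro AE_I2) (auto simp: indicator_def abs_mult)
      qed measurable
    qed measurable
    also have "\<dots> = (\<integral>\<omega>. \<Psi> \<omega> * real_cond_exp M G ?hp \<omega> \<partial>M)"
    proof (rule integral_cong_AE)
      show "AE \<omega> in M. indicator A \<omega> * real_cond_exp M G ?P \<omega> = \<Psi> \<omega> * real_cond_exp M G ?hp \<omega>"
        using ci \<Psi>_eq unfolding prod_eq by eventually_elim (simp add: mult_ac)
    qed measurable
    also have "\<dots> = (\<integral>\<omega>. \<Psi> \<omega> * ?hp \<omega> \<partial>M)"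
    proof (rule fms.real_cond_exp_intg(2)[OF _ \<Psi>_G])
      show "integrable M (\<lambda>\<omega>. \<Psi> \<omega> * ?hp \<omega>)"
        using \<Psi>_bound by (intro integrable_const_bound[of _ 1] AE_I2) (auto simp: indicator_def)
    qed measurable
    finally show ?thesis .
  qed
  \<comment> \<open>\<open>key\<close> covers indicators only, while \<open>\<phi>\<close> may be
    unbounded; equal laws of \<open>X p\<close> under the two densities carry the identity over to
    \<open>\<phi>\<close>.\<close>
  have law: "emeasure (distr (density M f) borel (X p)) S = ennreal (\<integral>\<omega>. f \<omega> * indicator S (X p \<omega>) \<partial>M)"
    if [measurable]: "f \<in> borel_measurable M" and f: "\<And>\<omega>. 0 \<le> f \<omega>" "\<And>\<omega>. f \<omega> \<le> 1" and S[measurable]: "S \<in> sets borel" for f S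
  proof -
    have "emeasure (distr (density M f) borel (X p)) S = emeasure (density M f) (X p -` S \<inter> space M)"
      by (simp add: emeasure_distr)
    also have "\<dots> = (\<integral>\<^sup>+\<omega>. ennreal (f \<omega>) * indicator (X p -` S \<inter> space M) \<omega> \<partial>M)"
      by (rule emeasure_density) measurable
    also have "\<dots> = (\<integral>\<^sup>+\<omega>. ennreal (f \<omega> * indicator S (X p \<omega>)) \<partial>M)"
      by (intro nn_integral_cong) (auto simp: indicator_def)
    also have "\<dots> = ennreal (\<integral>\<omega>. f \<omega> * indicator S (X p \<omega>) \<partial>M)"
      using f by (intro nn_integral_eq_integral integrable_const_bound[of _ 1] AE_I2) (auto simp: indicator_def)
    finally show ?thesis .
  qed
  have law_eq: "distr (density M Q1) borel (X p) = distr (density M \<Psi>) borel (X p)"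
  proof (rule measure_eqI)
    fix S assume "S \<in> sets (distr (density M Q1) borel (X p))"
    then have S: "S \<in> sets borel" by simp
    show "emeasure (distr (density M Q1) borel (X p)) S = emeasure (distr (density M \<Psi>) borel (X p)) S"
      unfolding law[OF Q1_meas Q1_bound(1,2) S] law[OF \<Psi>_M \<Psi>_bound(1,2) S] key[OF S] ..
  qed simp
  have int_law: "integral\<^sup>L (distr (density M f) borel (X p)) \<phi> = (\<integral>\<omega>. f \<omega> * \<phi> (X p \<omega>) \<partial>M)"
    if [measurable]: "f \<in> borel_measurable M" and f: "\<And>\<omega>. 0 \<le> f \<omega>" for f
    using f by (subst integral_distr) (auto simp: integral_density)
  have "(\<integral>\<omega>. Q1 \<omega> * \<phi> (X p \<omega>) \<partial>M) = (\<integral>\<omega>. \<Psi> \<omega> * \<phi> (X p \<omega>) \<partial>M)"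
    using int_law[OF Q1_meas Q1_bound(1)] int_law[OF \<Psi>_M \<Psi>_bound(1)] law_eq by simp
  also have "\<dots> = (\<integral>\<omega>. \<Psi> \<omega> * real_cond_exp M G (\<lambda>\<omega>. \<phi> (X p \<omega>)) \<omega> \<partial>M)"
  proof (rule fms.real_cond_exp_intg(2)[OF _ \<Psi>_G, symmetric])
    show "integrable M (\<lambda>\<omega>. \<Psi> \<omega> * \<phi> (X p \<omega>))"
    proof (rule Bochner_Integration.integrable_bound[OF \<phi>(2)])
      show "AE \<omega> in M. norm (\<Psi> \<omega> * \<phi> (X p \<omega>)) \<le> norm (\<phi> (X p \<omega>))"
        using \<Psi>_bound by (intro AE_I2) (auto simp: abs_mult intro: mult_left_le_one_le)
    qed measurable
  qed measurable
  also have "\<dots> = (\<integral>\<omega>. c * \<Psi> \<omega> \<partial>M)"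
    using c by (intro integral_cong_AE) auto
  \<comment> \<open>With \<open>S = UNIV\<close>, \<open>key\<close> says that the two densities
    have the same mass.\<close>
  also have "\<dots> = c * (\<integral>\<omega>. Q1 \<omega> \<partial>M)"
    using key[of UNIV] by simp
  finally show ?thesis
    unfolding Q1_def .
qed

abbreviation noise_alg where "noise_alg \<equiv> noise_algebra M G X"

lemma gen_subset:
  assumes "Q \<subseteq> I"
  shows "noise_gen M G X Q \<subseteq> sets M"
  unfolding noise_gen_def
proof safe
  fix A and B :: "'i \<Rightarrow> real set" assume A: "A \<in> sets G" and B: "\<forall>q\<in>Q. B q \<in> sets borel"
  have finQ: "finite Q"
    using assms fin finite_subset by blast
  have "{\<omega>\<in>space M. X q \<omega> \<in> B q} \<in> sets M" if "q \<in> Q" for q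
    using measurable_sets[OF X_meas, of q "B q"] that assms B by (auto simp: vimage_def Int_def conj_commute)
  then have "{\<omega>\<in>space M. \<forall>q\<in>Q. X q \<omega> \<in> B q} \<in> sets M"
    by (rule sets.sets_Collect_finite_All[OF _ finQ])
  then show "A \<inter> {\<omega>\<in>space M. \<forall>q\<in>Q. X q \<omega> \<in> B q} \<in> sets M"
    using G_sets(1)[OF A] by blast
qed

lemma noise_alg_sets: "Q \<subseteq> I \<Longrightarrow> sets (noise_alg Q) = sigma_sets (space M) (noise_gen M G X Q)"
  unfolding noise_algebra_def using gen_subset[of Q] sets.space_closed[of M]
  by (intro sets_measure_of) blast

lemma noise_alg_space: "space (noise_alg Q) = space M"
  unfolding noise_algebra_def by (simp add: space_measure_of_conv)

lemma noise_alg_sub: "Q \<subseteq> I \<Longrightarrow> subalgebra M (noise_alg Q)"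
  unfolding subalgebra_def noise_alg_space
  using sets.sigma_sets_subset[OF gen_subset, of Q] by (simp add: noise_alg_sets)

lemma noise_alg_G:
  fixes f :: "'a \<Rightarrow> real"
  assumes "Q \<subseteq> I" "f \<in> borel_measurable G"
  shows "f \<in> borel_measurable (noise_alg Q)"
proof (rule measurableI)
  fix S :: "real set" assume "S \<in> sets borel"
  then have S: "f -` S \<inter> space M \<in> sets G"
    using measurable_sets[OF assms(2)] by (simp add: G_sets(2))
  have "f -` S \<inter> space M = (f -` S \<inter> space M) \<inter> {\<omega>\<in>space M. \<forall>q\<in>Q. X q \<omega> \<in> UNIV}"
    by auto
  then have "f -` S \<inter> space M \<in> noise_gen M G X Q"
    unfolding noise_gen_def using S by (intro CollectI exI[of _ "f -` S \<inter> space M"] exI[of _ "\<lambda>_. UNIV"]) auto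
  then show "f -` S \<inter> space (noise_alg Q) \<in> sets (noise_alg Q)"
    unfolding noise_alg_sets[OF assms(1)] noise_alg_space by (rule sigma_sets.Basic)
qed simp

lemma noise_alg_X:
  assumes "Q \<subseteq> I" "p \<in> Q"
  shows "X p \<in> borel_measurable (noise_alg Q)"
proof (rule measurableI)
  fix S :: "real set" assume S: "S \<in> sets borel"
  have "X p -` S \<inter> space M = space M \<inter> {\<omega>\<in>space M. \<forall>q\<in>Q. X q \<omega> \<in> (if q = p then S else UNIV)}"
    using assms(2) by auto
  moreover have "space M \<in> sets G"
    using sets.top[of G] by (simp add: G_sets(2))
  ultimately have "X p -` S \<inter> space M \<in> noise_gen M G X Q"
    unfolding noise_gen_def using S
    by (intro CollectI exI[of _ "space M"] exI[of _ "\<lambda>q. if q = p then S else UNIV"]) auto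
  then show "X p -` S \<inter> space (noise_alg Q) \<in> sets (noise_alg Q)"
    unfolding noise_alg_sets[OF assms(1)] noise_alg_space by (rule sigma_sets.Basic)
qed simp

lemma noise_alg_mono:
  assumes QQ: "Q \<subseteq> Q'" "Q' \<subseteq> I"
  shows "subalgebra (noise_alg Q') (noise_alg Q)"
proof -
  have QI: "Q \<subseteq> I" using QQ by auto
  have "noise_gen M G X Q \<subseteq> noise_gen M G X Q'"
  proof
    fix H assume "H \<in> noise_gen M G X Q"
    then obtain A B where H: "H = A \<inter> {\<omega>\<in>space M. \<forall>q\<in>Q. X q \<omega> \<in> B q}"
      and A: "A \<in> sets G" and B: "\<forall>q\<in>Q. B q \<in> sets borel"
      by (auto simp: noise_gen_def)
    have "H = A \<inter> {\<omega>\<in>space M. \<forall>q\<in>Q'. X q \<omega> \<in> (if q \<in> Q then B q else UNIV)}"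
      using QQ by (auto simp: H)
    then show "H \<in> noise_gen M G X Q'"
      unfolding noise_gen_def using A B
      by (intro CollectI exI[of _ A] exI[of _ "\<lambda>q. if q \<in> Q then B q else UNIV"]) auto
  qed
  then show ?thesis
    unfolding subalgebra_def noise_alg_space noise_alg_sets[OF QI] noise_alg_sets[OF QQ(2)]
    by (auto intro: subsetD[OF sigma_sets_mono'])
qed

text \<open>Both sides are countably additive over disjoint sets, so the identity spreads from the
  generator by Dynkin's argument; complements use it for the whole space.\<close>

lemma set_mean:
  fixes \<phi> :: "real \<Rightarrow> real"
  assumes p: "p \<in> I" "p \<notin> Q" and Q: "Q \<subseteq> I" and H: "H \<in> sets (noise_alg Q)"
    and \<phi>: "\<phi> \<in> borel_measurable borel" "integrable M (\<lambda>\<omega>. \<phi> (X p \<omega>))"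
    and c: "AE \<omega> in M. real_cond_exp M G (\<lambda>\<omega>. \<phi> (X p \<omega>)) \<omega> = c"
  shows "(LINT \<omega>:H|M. \<phi> (X p \<omega>)) = c * prob H"
proof -
  let ?E = "noise_gen M G X Q"
  have finQ: "finite Q"
    using Q fin finite_subset by blast
  have [measurable]: "X p \<in> borel_measurable M" "\<phi> \<in> borel_measurable borel"
    using X_meas p \<phi> by auto
  have int: "set_integrable M H (\<lambda>\<omega>. \<phi> (X p \<omega>))" if [measurable]: "H \<in> sets M" for H
    unfolding set_integrable_def
    by (rule Bochner_Integration.integrable_bound[OF \<phi>(2)]) (auto simp: indicator_def)
  have gen: "(LINT \<omega>:H|M. \<phi> (X p \<omega>)) = c * prob H" if H: "H \<in> ?E" for H
  proof -
    from H obtain A B where H_eq: "H = A \<inter> {\<omega>\<in>space M. \<forall>q\<in>Q. X q \<omega> \<in> B q}"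
      and A: "A \<in> sets G" and B: "\<forall>q\<in>Q. B q \<in> sets borel"
      by (auto simp: noise_gen_def)
    have HM: "H \<in> sets M"
      using H gen_subset[OF Q] by blast
    have ind: "(indicator H \<omega> :: real) = indicator A \<omega> * (\<Prod>q\<in>Q. indicator (B q) (X q \<omega>))" if "\<omega> \<in> space M" for \<omega>
    proof (cases "\<forall>q\<in>Q. X q \<omega> \<in> B q")
      case True
      then show ?thesis using that by (simp add: H_eq indicator_def)
    next
      case False
      then have "(\<Prod>q\<in>Q. indicator (B q) (X q \<omega>) :: real) = 0"
        using finQ by (auto simp: prod_zero_iff indicator_def)
      then show ?thesis using False by (simp add: H_eq indicator_def)
    qed
    have "(LINT \<omega>:H|M. \<phi> (X p \<omega>))
        = (\<integral>\<omega>. (indicator A \<omega> * (\<Prod>q\<in>Q. indicator (B q) (X q \<omega>))) * \<phi> (X p \<omega>) \<partial>M)"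
      unfolding set_lebesgue_integral_def
      by (intro Bochner_Integration.integral_cong) (simp_all add: ind)
    also have "\<dots> = c * (\<integral>\<omega>. indicator A \<omega> * (\<Prod>q\<in>Q. indicator (B q) (X q \<omega>)) \<partial>M)"
      using B by (intro cond_mean_on_generator p Q A \<phi> c) auto
    also have "(\<integral>\<omega>. indicator A \<omega> * (\<Prod>q\<in>Q. indicator (B q) (X q \<omega>)) \<partial>M) = (\<integral>\<omega>. (indicator H \<omega> :: real) \<partial>M)"
      by (intro Bochner_Integration.integral_cong refl) (rule ind[symmetric])
    also have "\<dots> = prob H"
      using HM by simp
    finally show ?thesis .
  qed
  have stable: "Int_stable ?E"
  proof (rule Int_stableI)
    fix a b assume "a \<in> ?E" "b \<in> ?E"
    then obtain A B A' B' where ab: "a = A \<inter> {\<omega>\<in>space M. \<forall>q\<in>Q. X q \<omega> \<in> B q}" "b = A' \<inter> {\<omega>\<in>space M. \<forall>q\<in>Q. X q \<omega> \<in> B' q}"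
      and s: "A \<in> sets G" "A' \<in> sets G" "\<forall>q\<in>Q. B q \<in> sets borel" "\<forall>q\<in>Q. B' q \<in> sets borel"
      unfolding noise_gen_def by blast
    have "a \<inter> b = (A \<inter> A') \<inter> {\<omega>\<in>space M. \<forall>q\<in>Q. X q \<omega> \<in> B q \<inter> B' q}"
      by (auto simp: ab)
    then show "a \<inter> b \<in> ?E"
      unfolding noise_gen_def using s by (intro CollectI exI[of _ "A \<inter> A'"] exI[of _ "\<lambda>q. B q \<inter> B' q"]) auto
  qed
  have pow: "?E \<subseteq> Pow (space M)"
    by (auto simp: noise_gen_def)
  have sigM: "sigma_sets (space M) ?E \<subseteq> sets M"
    by (rule sets.sigma_sets_subset[OF gen_subset[OF Q]])
  have "H \<in> sigma_sets (space M) ?E"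
    using H noise_alg_sets[OF Q] by simp
  then show ?thesis
  proof (induct rule: sigma_sets_induct_disjoint[OF stable pow, consumes 1])
    case (1 A)
    then show ?case by (rule gen)
  next
    case 2
    then show ?case by (simp add: set_lebesgue_integral_def)
  next
    case (3 A)
    then have AM[measurable]: "A \<in> sets M"
      using sigM by blast
    have top: "(LINT \<omega>:space M|M. \<phi> (X p \<omega>)) = c"
    proof -
      have "space M \<in> sets G"
        using sets.top[of G] by (simp add: G_sets(2))
      then have "space M \<in> ?E"
        unfolding noise_gen_def by (intro CollectI exI[of _ "space M"] exI[of _ "\<lambda>_. UNIV"]) auto
      from gen[OF this] show ?thesis
        by (simp add: prob_space)
    qed
    have "(LINT \<omega>:space M - A|M. \<phi> (X p \<omega>)) + (LINT \<omega>:A|M. \<phi> (X p \<omega>)) = c"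
      using sets.sets_into_space[OF AM] top
      by (subst set_integral_Un[symmetric]) (auto intro!: int simp: Un_absorb2)
    then show ?case
      using 3 by (simp add: prob_compl[OF AM] algebra_simps)
  next
    case (4 A)
    then have AM: "A i \<in> sets M" for i
      using sigM by blast
    have "(LINT \<omega>:(\<Union>i. A i)|M. \<phi> (X p \<omega>)) = (\<Sum>i. LINT \<omega>:A i|M. \<phi> (X p \<omega>))"
      using AM 4(1) by (intro lebesgue_integral_countable_add int) (auto simp: disjoint_family_on_def)
    also have "\<dots> = (\<Sum>i. c * prob (A i))"
      using 4 by simp
    also have "\<dots> = c * prob (\<Union>i. A i)"
      using AM 4(1) by (intro sums_unique[symmetric] sums_mult finite_measure_UNION) auto
    finally show ?case .
  qed
qed

text \<open>By \<open>set_mean\<close> the conditional expectation given the enlarged algebra is the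
  constant \<open>c\<close>, so a weight measurable there can be pulled out.\<close>

lemma mean_mult:
  fixes \<phi> :: "real \<Rightarrow> real"
  assumes p: "p \<in> I" "p \<notin> Q" and Q: "Q \<subseteq> I"
    and \<phi>: "\<phi> \<in> borel_measurable borel" "integrable M (\<lambda>\<omega>. \<phi> (X p \<omega>))"
    and c: "AE \<omega> in M. real_cond_exp M G (\<lambda>\<omega>. \<phi> (X p \<omega>)) \<omega> = c"
    and w: "w \<in> borel_measurable (noise_alg Q)" "integrable M (\<lambda>\<omega>. w \<omega> * \<phi> (X p \<omega>))"
  shows "(\<integral>\<omega>. w \<omega> * \<phi> (X p \<omega>) \<partial>M) = c * (\<integral>\<omega>. w \<omega> \<partial>M)"
proof -
  interpret N: finite_measure_subalgebra M "noise_alg Q"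
    by unfold_locales (rule noise_alg_sub[OF Q])
  have [measurable]: "(\<lambda>\<omega>. \<phi> (X p \<omega>)) \<in> borel_measurable M"
    using X_meas[OF p(1)] \<phi>(1) by measurable
  have wM[measurable]: "w \<in> borel_measurable M"
    by (rule measurable_from_subalg[OF noise_alg_sub[OF Q] w(1)])
  have "AE \<omega> in M. real_cond_exp M (noise_alg Q) (\<lambda>\<omega>. \<phi> (X p \<omega>)) \<omega> = c"
  proof (rule N.real_cond_exp_charact)
    fix H assume H: "H \<in> sets (noise_alg Q)"
    then have "H \<in> sets M"
      using noise_alg_sub[OF Q] by (auto simp: subalgebra_def)
    then show "(LINT \<omega>:H|M. \<phi> (X p \<omega>)) = (LINT \<omega>:H|M. c)"
      using set_mean[OF p Q H \<phi> c] by (simp add: set_lebesgue_integral_def mult.commute)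
  qed (use \<phi> in auto)
  then have "(\<integral>\<omega>. w \<omega> * real_cond_exp M (noise_alg Q) (\<lambda>\<omega>. \<phi> (X p \<omega>)) \<omega> \<partial>M) = (\<integral>\<omega>. c * w \<omega> \<partial>M)"
    by (intro integral_cong_AE) (auto simp: mult.commute)
  then show ?thesis
    using N.real_cond_exp_intg(2)[OF w(2,1)] by simp
qed

text \<open>The weights may depend on noise outside \<open>J\<close>. Off-diagonal terms vanish by
  conditioning on everything except \<open>X p\<close>, which fixes both weights and
  \<open>X q\<close>; diagonal terms give the conditional variance. The pointwise bound
  \<open>K\<close> makes all products integrable.\<close>

lemma second_moment:
  assumes J: "J \<subseteq> I" and w: "\<And>p. p \<in> J \<Longrightarrow> w p \<in> borel_measurable (noise_alg (I - J))"
    and K: "\<And>\<omega>. \<omega> \<in> space M \<Longrightarrow> (\<Sum>p\<in>J. (w p \<omega>)\<^sup>2) \<le> K\<^sup>2" "0 \<le> K"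
  shows "integrable M (\<lambda>\<omega>. (\<Sum>p\<in>J. w p \<omega> * X p \<omega>)\<^sup>2)"
    "(\<integral>\<omega>. (\<Sum>p\<in>J. w p \<omega> * X p \<omega>)\<^sup>2 \<partial>M) \<le> C * K\<^sup>2"
proof -
  have finJ: "finite J"
    using J fin finite_subset by blast
  have wM[measurable]: "w p \<in> borel_measurable M" if "p \<in> J" for p
    using measurable_from_subalg[OF noise_alg_sub w[OF that]] by auto
  have XM[measurable]: "X p \<in> borel_measurable M" if "p \<in> J" for p
    using X_meas J that by auto
  have w_le: "\<bar>w p \<omega>\<bar> \<le> K" if "p \<in> J" "\<omega> \<in> space M" for p \<omega>
  proof -
    have "(w p \<omega>)\<^sup>2 \<le> (\<Sum>p\<in>J. (w p \<omega>)\<^sup>2)"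
      using finJ that by (intro member_le_sum) auto
    then have "\<bar>w p \<omega>\<bar>\<^sup>2 \<le> K\<^sup>2"
      using K(1)[OF that(2)] by simp
    then show ?thesis
      using K(2) by (rule power2_le_imp_le)
  qed
  define Y where "Y p q \<omega> = w p \<omega> * w q \<omega> * (X p \<omega> * X q \<omega>)" for p q \<omega>
  have Y_int: "integrable M (Y p q)" if pq: "p \<in> J" "q \<in> J" for p q
  proof (rule Bochner_Integration.integrable_bound)
    show "integrable M (\<lambda>\<omega>. K * K * ((X p \<omega>)\<^sup>2 + (X q \<omega>)\<^sup>2))"
      using sq_int J pq by (intro integrable_mult_right Bochner_Integration.integrable_add) auto
    show "AE \<omega> in M. norm (Y p q \<omega>) \<le> norm (K * K * ((X p \<omega>)\<^sup>2 + (X q \<omega>)\<^sup>2))"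
    proof (rule AE_I2)
      fix \<omega> assume \<omega>: "\<omega> \<in> space M"
      have "\<bar>X p \<omega> * X q \<omega>\<bar> \<le> (X p \<omega>)\<^sup>2 + (X q \<omega>)\<^sup>2"
      proof -
        have "0 \<le> (\<bar>X p \<omega>\<bar> - \<bar>X q \<omega>\<bar>)\<^sup>2" "0 \<le> \<bar>X p \<omega> * X q \<omega>\<bar>"
          by simp_all
        then show ?thesis
          unfolding power2_diff abs_mult power2_abs by linarith
      qed
      then have "\<bar>w p \<omega>\<bar> * \<bar>w q \<omega>\<bar> * \<bar>X p \<omega> * X q \<omega>\<bar> \<le> K * K * ((X p \<omega>)\<^sup>2 + (X q \<omega>)\<^sup>2)"
        using w_le pq \<omega> K(2) by (intro mult_mono) auto
      then show "norm (Y p q \<omega>) \<le> norm (K * K * ((X p \<omega>)\<^sup>2 + (X q \<omega>)\<^sup>2))"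
        using K(2) by (simp add: Y_def abs_mult)
    qed
    show "Y p q \<in> borel_measurable M"
      unfolding Y_def using pq by measurable
  qed
  have sq: "(\<Sum>p\<in>J. w p \<omega> * X p \<omega>)\<^sup>2 = (\<Sum>p\<in>J. \<Sum>q\<in>J. Y p q \<omega>)" for \<omega>
    unfolding power2_eq_square sum_product Y_def by (simp add: mult_ac)
  show "integrable M (\<lambda>\<omega>. (\<Sum>p\<in>J. w p \<omega> * X p \<omega>)\<^sup>2)"
    unfolding sq using Y_int by (intro Bochner_Integration.integrable_sum)
  have w2_int: "integrable M (\<lambda>\<omega>. (w p \<omega>)\<^sup>2)" if p: "p \<in> J" for p
  proof (rule integrable_const_bound[of _ "K\<^sup>2"])
    show "AE \<omega> in M. norm ((w p \<omega>)\<^sup>2) \<le> K\<^sup>2"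
      using w_le[OF p] K(2) by (intro AE_I2) (simp add: abs_le_square_iff[symmetric])
  qed (use p in measurable)
  have off: "(\<integral>\<omega>. Y p q \<omega> \<partial>M) = 0" if pq: "p \<in> J" "q \<in> J" "p \<noteq> q" for p q
  proof -
    let ?Q = "I - {p}"
    have m: "w p \<in> borel_measurable (noise_alg ?Q)" "w q \<in> borel_measurable (noise_alg ?Q)"
      using w pq by (auto intro!: measurable_from_subalg[OF noise_alg_mono[of "I - J" ?Q]])
    have mX: "X q \<in> borel_measurable (noise_alg ?Q)"
      using pq J by (intro noise_alg_X) auto
    have "(\<integral>\<omega>. (w p \<omega> * w q \<omega> * X q \<omega>) * X p \<omega> \<partial>M) = 0 * (\<integral>\<omega>. w p \<omega> * w q \<omega> * X q \<omega> \<partial>M)"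
      using pq J m mX X_int mean Y_int[OF pq(1,2)]
      by (intro mean_mult[where \<phi> = "\<lambda>x. x" and Q = ?Q]) (auto simp: Y_def[abs_def] mult_ac)
    then show ?thesis
      by (simp add: Y_def mult_ac)
  qed
  have diag: "(\<integral>\<omega>. Y p p \<omega> \<partial>M) \<le> C * (\<integral>\<omega>. (w p \<omega>)\<^sup>2 \<partial>M)" if p: "p \<in> J" for p
  proof -
    have "(\<integral>\<omega>. (w p \<omega>)\<^sup>2 * (X p \<omega>)\<^sup>2 \<partial>M) = v p * (\<integral>\<omega>. (w p \<omega>)\<^sup>2 \<partial>M)"
      using p J w[OF p] sq_int var Y_int[OF p p]
      by (intro mean_mult[where \<phi> = "\<lambda>x. x\<^sup>2" and Q = "I - J"]) (auto simp: Y_def[abs_def] power2_eq_square mult_ac)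
    also have "\<dots> \<le> C * (\<integral>\<omega>. (w p \<omega>)\<^sup>2 \<partial>M)"
      using v p J by (intro mult_right_mono integral_nonneg_AE) auto
    finally show ?thesis
      by (simp add: Y_def power2_eq_square mult_ac)
  qed
  have "(\<integral>\<omega>. (\<Sum>p\<in>J. w p \<omega> * X p \<omega>)\<^sup>2 \<partial>M) = (\<Sum>p\<in>J. \<Sum>q\<in>J. \<integral>\<omega>. Y p q \<omega> \<partial>M)"
    unfolding sq using Y_int by (simp add: Bochner_Integration.integral_sum)
  also have "\<dots> = (\<Sum>p\<in>J. \<integral>\<omega>. Y p p \<omega> \<partial>M)"
  proof (rule sum.cong)
    fix p assume p: "p \<in> J"
    have "(\<Sum>q\<in>J. \<integral>\<omega>. Y p q \<omega> \<partial>M) = (\<Sum>q\<in>J. if q = p then \<integral>\<omega>. Y p p \<omega> \<partial>M else 0)"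
      using off p by (intro sum.cong) auto
    then show "(\<Sum>q\<in>J. \<integral>\<omega>. Y p q \<omega> \<partial>M) = (\<integral>\<omega>. Y p p \<omega> \<partial>M)"
      using finJ p by simp
  qed simp
  also have "\<dots> \<le> (\<Sum>p\<in>J. C * (\<integral>\<omega>. (w p \<omega>)\<^sup>2 \<partial>M))"
    by (intro sum_mono diag)
  also have "\<dots> = C * (\<integral>\<omega>. (\<Sum>p\<in>J. (w p \<omega>)\<^sup>2) \<partial>M)"
    using w2_int by (simp add: sum_distrib_left Bochner_Integration.integral_sum)
  also have "\<dots> \<le> C * K\<^sup>2"
  proof -
    have "(\<integral>\<omega>. (\<Sum>p\<in>J. (w p \<omega>)\<^sup>2) \<partial>M) \<le> (\<integral>\<omega>. K\<^sup>2 \<partial>M)"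
      using w2_int K(1) by (intro integral_mono Bochner_Integration.integrable_sum) auto
    then show ?thesis
      using C by (simp add: prob_space mult_left_mono)
  qed
  finally show "(\<integral>\<omega>. (\<Sum>p\<in>J. w p \<omega> * X p \<omega>)\<^sup>2 \<partial>M) \<le> C * K\<^sup>2" .
qed

end

section \<open>Tail bounds for the noise\<close>

lemma borel_measurable_mv:
  assumes "\<And>j. j < m \<Longrightarrow> (\<lambda>\<omega>. A \<omega> i j) \<in> borel_measurable S" "\<And>j. j < m \<Longrightarrow> (\<lambda>\<omega>. x \<omega> j) \<in> borel_measurable S"
  shows "(\<lambda>\<omega>. mv m (A \<omega>) (x \<omega>) i) \<in> borel_measurable S"
  unfolding mv_def using assms by (intro borel_measurable_sum borel_measurable_times) auto

lemma borel_measurable_gram_op_pow: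
  assumes A: "\<And>i j. i < n \<Longrightarrow> j < m \<Longrightarrow> (\<lambda>\<omega>. A \<omega> i j) \<in> borel_measurable S"
    and x: "\<And>i. i < n \<Longrightarrow> (\<lambda>\<omega>. x \<omega> i) \<in> borel_measurable S"
  shows "i < n \<Longrightarrow> (\<lambda>\<omega>. (gram_op n m (A \<omega>) ^^ h) (x \<omega>) i) \<in> borel_measurable S"
proof (induction h arbitrary: i)
  case 0
  then show ?case using x by simp
next
  case (Suc h)
  have "(\<lambda>\<omega>. mv n (mtr (A \<omega>)) ((gram_op n m (A \<omega>) ^^ h) (x \<omega>)) j) \<in> borel_measurable S" if "j < m" for j
    using that A Suc.IH by (intro borel_measurable_mv) auto
  then have "(\<lambda>\<omega>. mv m (A \<omega>) (mv n (mtr (A \<omega>)) ((gram_op n m (A \<omega>) ^^ h) (x \<omega>))) i) \<in> borel_measurable S"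
    by (intro borel_measurable_mv[where x = "\<lambda>\<omega>. mv n (mtr (A \<omega>)) ((gram_op n m (A \<omega>) ^^ h) (x \<omega>))"])
      (use Suc.prems A in auto)
  moreover have "(gram_op n m (A \<omega>) ^^ Suc h) (x \<omega>) = mv m (A \<omega>) (mv n (mtr (A \<omega>)) ((gram_op n m (A \<omega>) ^^ h) (x \<omega>)))" for \<omega>
    by (simp add: gram_op_def[of n m "A \<omega>" "(gram_op n m (A \<omega>) ^^ h) (x \<omega>)"])
  ultimately show ?case
    by simp
qed

lemma borel_measurable_ip:
  assumes "\<And>i. i < n \<Longrightarrow> (\<lambda>\<omega>. x \<omega> i) \<in> borel_measurable S" "\<And>i. i < n \<Longrightarrow> (\<lambda>\<omega>. y \<omega> i) \<in> borel_measurable S"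
  shows "(\<lambda>\<omega>. ip n (x \<omega>) (y \<omega>)) \<in> borel_measurable S"
  unfolding ip_def using assms by (intro borel_measurable_sum borel_measurable_times) auto

lemma borel_measurable_nrm:
  assumes "\<And>i. i < n \<Longrightarrow> (\<lambda>\<omega>. x \<omega> i) \<in> borel_measurable S"
  shows "(\<lambda>\<omega>. nrm n (x \<omega>)) \<in> borel_measurable S"
  unfolding nrm_def using borel_measurable_ip[OF assms assms] by measurable

context cond_noise
begin

text \<open>Chebyshev's inequality for truncated weights: they are multiplied by the indicator of
  the set where their squares sum to at most \<open>c\<^sup>2\<close>. That set is determined by the
  weights, so truncation keeps their measurability.\<close>

lemma tail:
  assumes J: "J \<subseteq> I" and w: "\<And>p. p \<in> J \<Longrightarrow> w p \<in> borel_measurable (noise_alg (I - J))"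
    and c: "0 < c" and a: "0 < a"
  defines "B \<equiv> {\<omega>\<in>space M. (\<Sum>p\<in>J. (w p \<omega>)\<^sup>2) \<le> c\<^sup>2 \<and> a * c < \<bar>\<Sum>p\<in>J. w p \<omega> * X p \<omega>\<bar>}"
  shows "B \<in> sets M" "prob B \<le> C / a\<^sup>2"
proof -
  have [measurable]: "w p \<in> borel_measurable M" "X p \<in> borel_measurable M" if "p \<in> J" for p
    using measurable_from_subalg[OF noise_alg_sub w[OF that]] X_meas J that by auto
  show "B \<in> sets M"
    unfolding B_def by measurable
  define T where "T = {\<omega>\<in>space M. (\<Sum>p\<in>J. (w p \<omega>)\<^sup>2) \<le> c\<^sup>2}"
  define w' where "w' p \<omega> = w p \<omega> * indicator T \<omega>" for p \<omega>
  have T: "T \<in> sets (noise_alg (I - J))"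
  proof -
    have [measurable]: "(\<lambda>\<omega>. \<Sum>p\<in>J. (w p \<omega>)\<^sup>2) \<in> borel_measurable (noise_alg (I - J))"
      using w by measurable
    have "{\<omega>\<in>space (noise_alg (I - J)). (\<Sum>p\<in>J. (w p \<omega>)\<^sup>2) \<le> c\<^sup>2} \<in> sets (noise_alg (I - J))"
      by measurable
    then show ?thesis
      by (simp add: T_def noise_alg_space)
  qed
  have w'm: "w' p \<in> borel_measurable (noise_alg (I - J))" if "p \<in> J" for p
    unfolding w'_def using w[OF that] T by measurable
  have w'K: "(\<Sum>p\<in>J. (w' p \<omega>)\<^sup>2) \<le> c\<^sup>2" if "\<omega> \<in> space M" for \<omega>
    using that by (cases "\<omega> \<in> T") (auto simp: w'_def T_def)
  note sm = second_moment[OF J w'm w'K less_imp_le[OF c]]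
  let ?f = "\<lambda>\<omega>. \<Sum>p\<in>J. w' p \<omega> * X p \<omega>"
  have fM[measurable]: "?f \<in> borel_measurable M"
    using measurable_from_subalg[OF noise_alg_sub w'm] by (intro borel_measurable_sum borel_measurable_times) auto
  have "prob B \<le> prob {\<omega>\<in>space M. a * c \<le> \<bar>?f \<omega>\<bar>}"
  proof (rule finite_measure_mono)
    show "B \<subseteq> {\<omega>\<in>space M. a * c \<le> \<bar>?f \<omega>\<bar>}"
      by (auto simp: B_def w'_def T_def indicator_def)
  qed measurable
  also have "\<dots> \<le> (\<integral>\<omega>. (?f \<omega>)\<^sup>2 \<partial>M) / (a * c)\<^sup>2"
    by (rule second_moment_method) (use sm(1) a c in auto)
  also have "\<dots> \<le> C * c\<^sup>2 / (a * c)\<^sup>2"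
    using sm(2) by (intro divide_right_mono) auto
  also have "\<dots> = C / a\<^sup>2"
    using c by (simp add: power_mult_distrib)
  finally show "prob B \<le> C / a\<^sup>2" .
qed

text \<open>The injection \<open>\<iota>\<close> places a line of the noise array in the index set,
  so columns and rows are treated alike.\<close>

lemma column_tail:
  fixes e :: "'a \<Rightarrow> nat \<Rightarrow> nat \<Rightarrow> real" and \<iota> :: "nat \<Rightarrow> 'i"
  assumes \<iota>: "inj_on \<iota> {..<n}" "\<iota> ` {..<n} \<subseteq> I" and e: "\<And>i \<omega>. i < n \<Longrightarrow> \<omega> \<in> space M \<Longrightarrow> X (\<iota> i) \<omega> = e \<omega> i t"
    and z: "\<And>i. i < n \<Longrightarrow> (\<lambda>\<omega>. z \<omega> i) \<in> borel_measurable (noise_alg (I - \<iota> ` {..<n}))"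
    and c: "0 < c" and a: "0 < a"
  defines "B \<equiv> {\<omega>\<in>space M. nrm n (z \<omega>) \<le> c \<and> a * c < \<bar>ip n (nth_col (e \<omega>) t) (z \<omega>)\<bar>}"
  shows "B \<in> sets M" "prob B \<le> C / a\<^sup>2"
proof -
  define w where "w p \<omega> = z \<omega> (inv_into {..<n} \<iota> p)" for p \<omega>
  have w_eq: "w (\<iota> i) \<omega> = z \<omega> i" if "i < n" for i \<omega>
    using that \<iota>(1) by (simp add: w_def)
  have "B = {\<omega>\<in>space M. (\<Sum>p\<in>\<iota> ` {..<n}. (w p \<omega>)\<^sup>2) \<le> c\<^sup>2 \<and> a * c < \<bar>\<Sum>p\<in>\<iota> ` {..<n}. w p \<omega> * X p \<omega>\<bar>}"
  proof -
    have "(nrm n (z \<omega>) \<le> c) = ((\<Sum>p\<in>\<iota> ` {..<n}. (w p \<omega>)\<^sup>2) \<le> c\<^sup>2)" for \<omega>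
    proof -
      have "(\<Sum>p\<in>\<iota> ` {..<n}. (w p \<omega>)\<^sup>2) = (nrm n (z \<omega>))\<^sup>2"
        unfolding nrm_sq using \<iota>(1) by (simp add: sum.reindex w_eq ip_def power2_eq_square)
      then show ?thesis
        using c by (simp add: power_mono_iff)
    qed
    moreover have "(\<Sum>p\<in>\<iota> ` {..<n}. w p \<omega> * X p \<omega>) = ip n (nth_col (e \<omega>) t) (z \<omega>)" if "\<omega> \<in> space M" for \<omega>
      using \<iota>(1) that by (simp add: sum.reindex w_eq e ip_def mult.commute)
    ultimately show ?thesis
      unfolding B_def by auto
  qed
  moreover have "w p \<in> borel_measurable (noise_alg (I - \<iota> ` {..<n}))" if "p \<in> \<iota> ` {..<n}" for p
  proof -
    obtain i where i: "i < n" "p = \<iota> i"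
      using \<open>p \<in> \<iota> ` {..<n}\<close> by auto
    then have "w p = (\<lambda>\<omega>. z \<omega> i)"
      using w_eq by auto
    then show ?thesis
      using z[OF i(1)] by simp
  qed
  ultimately show "B \<in> sets M" "prob B \<le> C / a\<^sup>2"
    using tail[OF \<iota>(2) _ c a, of w] by auto
qed

text \<open>Infinitely many powers must be controlled at once. The level for power h is raised by
  2^h, so its failure probability falls by 4^-h and the union over all h stays small.\<close>

lemma leave_one_out_event:
  fixes e :: "'a \<Rightarrow> nat \<Rightarrow> nat \<Rightarrow> real" and \<iota> :: "nat \<Rightarrow> 'i" and x :: "nat \<Rightarrow> 'a \<Rightarrow> nat \<Rightarrow> real"
  assumes \<iota>: "inj_on \<iota> {..<n}" "\<iota> ` {..<n} \<subseteq> I" and e: "\<And>i \<omega>. i < n \<Longrightarrow> \<omega> \<in> space M \<Longrightarrow> X (\<iota> i) \<omega> = e \<omega> i t"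
    and em: "\<And>i j. i < n \<Longrightarrow> j < m \<Longrightarrow> j \<noteq> t \<Longrightarrow> (\<lambda>\<omega>. e \<omega> i j) \<in> borel_measurable (noise_alg (I - \<iota> ` {..<n}))"
    and x: "\<And>i k. i < n \<Longrightarrow> k < r \<Longrightarrow> (\<lambda>\<omega>. x k \<omega> i) \<in> borel_measurable (noise_alg (I - \<iota> ` {..<n}))"
    and c: "0 < c" and a: "0 < a" and b: "0 < b"
  shows "\<exists>S\<in>sets M. prob S \<le> 2 * real r * (C / a\<^sup>2) \<and> (\<forall>\<omega>\<in>space M - S. op_bound n m (e \<omega>) b \<longrightarrow>
    (\<forall>h. \<forall>k<r. nrm n (x k \<omega>) \<le> c \<longrightarrow>
      \<bar>ip n (nth_col (e \<omega>) t) ((gram_op n m (zero_col t (e \<omega>)) ^^ h) (x k \<omega>))\<bar> \<le> a * c * (2 * b\<^sup>2) ^ h))"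
proof -
  let ?z = "\<lambda>h k \<omega>. (gram_op n m (zero_col t (e \<omega>)) ^^ h) (x k \<omega>)"
  \<comment> \<open>The event restricts the norm of the iterated vector, which is determined by the
    other columns; an operator bound on the full noise would involve column t.\<close>
  define S where "S h k = {\<omega>\<in>space M. nrm n (?z h k \<omega>) \<le> (b\<^sup>2) ^ h * c \<and>
    (a * 2 ^ h) * ((b\<^sup>2) ^ h * c) < \<bar>ip n (nth_col (e \<omega>) t) (?z h k \<omega>)\<bar>}" for h k
  have zm: "(\<lambda>\<omega>. ?z h k \<omega> i) \<in> borel_measurable (noise_alg (I - \<iota> ` {..<n}))" if "k < r" "i < n" for h k i
  proof (rule borel_measurable_gram_op_pow[OF _ _ that(2)])
    fix i j assume "i < n" "j < m"
    then show "(\<lambda>\<omega>. zero_col t (e \<omega>) i j) \<in> borel_measurable (noise_alg (I - \<iota> ` {..<n}))"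
      using em by (cases "j = t") (simp_all add: zero_col_def)
  qed (use x that in auto)
  have S: "S h k \<in> sets M" "prob (S h k) \<le> (C / a\<^sup>2) * (1 / 4) ^ h" if "k < r" for h k
  proof -
    have "0 < (b\<^sup>2) ^ h * c" "0 < a * 2 ^ h"
      using a b c by simp_all
    note * = column_tail[where e = e and t = t and z = "?z h k", OF \<iota> e zm[OF that] this]
    show "S h k \<in> sets M"
      unfolding S_def by (rule *(1)) 
    have "prob (S h k) \<le> C / (a * 2 ^ h)\<^sup>2"
      unfolding S_def by (rule *(2))
    also have "\<dots> = (C / a\<^sup>2) * (1 / 4) ^ h"
    proof -
      have "(2 ^ h)\<^sup>2 = (4 :: real) ^ h"
        by (simp add: power2_eq_square flip: power_mult_distrib)
      then show ?thesis
        by (simp add: power_mult_distrib power_one_over)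
    qed
    finally show "prob (S h k) \<le> (C / a\<^sup>2) * (1 / 4) ^ h" .
  qed
  define U where "U h = (\<Union>k<r. S h k)" for h
  have U: "U h \<in> sets M" "prob (U h) \<le> real r * (C / a\<^sup>2) * (1 / 4) ^ h" for h
  proof -
    show "U h \<in> sets M"
      unfolding U_def using S by blast
    have "prob (U h) \<le> (\<Sum>k<r. prob (S h k))"
      unfolding U_def using S by (intro finite_measure_subadditive_finite) auto
    also have "\<dots> \<le> (\<Sum>k<r. (C / a\<^sup>2) * (1 / 4) ^ h)"
      using S by (intro sum_mono) auto
    finally show "prob (U h) \<le> real r * (C / a\<^sup>2) * (1 / 4) ^ h"
      by simp
  qed
  \<comment> \<open>The geometric sum is 4/3, rounded up to 2 in the statement.\<close>
  have geo: "(\<lambda>h. real r * (C / a\<^sup>2) * (1 / 4) ^ h) sums (real r * (C / a\<^sup>2) * (1 / (1 - 1 / 4)))"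
    by (intro sums_mult geometric_sums) simp
  have summ: "summable (\<lambda>h. prob (U h))"
    by (rule summable_comparison_test'[OF sums_summable[OF geo], of 0]) (use U in simp)
  show ?thesis
  proof (intro bexI[of _ "\<Union>h. U h"] conjI)
    have "prob (\<Union>h. U h) \<le> (\<Sum>h. prob (U h))"
      using U summ by (intro finite_measure_subadditive_countably) auto
    also have "\<dots> \<le> real r * (C / a\<^sup>2) * (1 / (1 - 1 / 4))"
      using suminf_le[OF U(2) summ sums_summable[OF geo]] sums_unique[OF geo] by simp
    also have "\<dots> \<le> real r * (C / a\<^sup>2) * 2"
      using C a by (intro mult_left_mono) auto
    also have "\<dots> = 2 * real r * (C / a\<^sup>2)"
      by simp
    finally show "prob (\<Union>h. U h) \<le> 2 * real r * (C / a\<^sup>2)" .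
    show "(\<Union>h. U h) \<in> sets M"
      using U by blast
    show "\<forall>\<omega>\<in>space M - (\<Union>h. U h). op_bound n m (e \<omega>) b \<longrightarrow> (\<forall>h. \<forall>k<r. nrm n (x k \<omega>) \<le> c \<longrightarrow>
        \<bar>ip n (nth_col (e \<omega>) t) (?z h k \<omega>)\<bar> \<le> a * c * (2 * b\<^sup>2) ^ h)"
    proof (intro ballI impI allI)
      fix \<omega> h k assume \<omega>: "\<omega> \<in> space M - (\<Union>h. U h)" and op_bound: "op_bound n m (e \<omega>) b" and k: "k < r" and xc: "nrm n (x k \<omega>) \<le> c"
      have "op_bound n m (zero_col t (e \<omega>)) b"
        unfolding zero_col_def using op_bound b by (intro op_bound_zero_col) auto
      then have "nrm n (?z h k \<omega>) \<le> (b\<^sup>2) ^ h * nrm n (x k \<omega>)"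
        using b by (intro gram_op_pow_nrm) auto
      also have "\<dots> \<le> (b\<^sup>2) ^ h * c"
        using xc by (intro mult_left_mono) auto
      finally have "nrm n (?z h k \<omega>) \<le> (b\<^sup>2) ^ h * c" .
      moreover have "\<omega> \<notin> S h k"
        using \<omega> k by (auto simp: U_def)
      ultimately have "\<bar>ip n (nth_col (e \<omega>) t) (?z h k \<omega>)\<bar> \<le> (a * 2 ^ h) * ((b\<^sup>2) ^ h * c)"
        using \<omega> by (auto simp: S_def)
      then show "\<bar>ip n (nth_col (e \<omega>) t) (?z h k \<omega>)\<bar> \<le> a * c * (2 * b\<^sup>2) ^ h"
        by (simp add: power_mult_distrib mult_ac)
    qed
  qed
qed

end

text \<open>\<open>F_G\<close> makes the factors known under the conditioning, so that they can
  serve as weights next to the deterministic loadings.\<close>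

locale matrix_noise = cond_noise M G "\<lambda>p \<omega>. E \<omega> $$ p" "{..<n} \<times> {..<m}" v C
  for M :: "'a measure" and G E n m v C +
  fixes L :: "nat \<Rightarrow> nat \<Rightarrow> real" and F :: "'a \<Rightarrow> nat \<Rightarrow> nat \<Rightarrow> real" and r :: nat
  assumes F_G: "\<And>s k. s < m \<Longrightarrow> k < r \<Longrightarrow> (\<lambda>\<omega>. F \<omega> s k) \<in> borel_measurable G"
begin

text \<open>In units of \<open>C / a\<^sup>2\<close>: four uses of
  \<open>leave_one_out_event\<close>, with loadings or factors against column t and against row i,
  cost \<open>2 * real r\<close> each, and each of the r^2 bilinear forms costs one.\<close>

lemma noise_event:
  assumes it: "i < n" "t < m" and pos: "0 < a" "0 < b" "0 < cL" "0 < cF"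
  shows "\<exists>S\<in>sets M. prob S \<le> (8 * real r + (real r)\<^sup>2) * (C / a\<^sup>2) \<and> (\<forall>\<omega>\<in>space M - S. op_bound n m (ent (E \<omega>)) b \<longrightarrow>
    (\<forall>k<r. nrm n (nth_col L k) \<le> cL) \<longrightarrow> (\<forall>k<r. nrm m (nth_col (F \<omega>) k) \<le> cF) \<longrightarrow>
    (\<forall>h. \<forall>k<r. \<bar>ip n (nth_col (ent (E \<omega>)) t) ((gram_op n m (zero_col t (ent (E \<omega>))) ^^ h) (nth_col L k))\<bar> \<le> a * cL * (2 * b\<^sup>2) ^ h) \<and>
    (\<forall>h. \<forall>k<r. \<bar>ip n (nth_col (ent (E \<omega>)) t) ((gram_op n m (zero_col t (ent (E \<omega>))) ^^ h)
        (mv m (zero_col t (ent (E \<omega>))) (nth_col (F \<omega>) k)))\<bar> \<le> a * (b * cF) * (2 * b\<^sup>2) ^ h) \<and>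
    (\<forall>h. \<forall>k<r. \<bar>ip m (nth_col (mtr (ent (E \<omega>))) i) ((gram_op m n (zero_col i (mtr (ent (E \<omega>)))) ^^ h) (nth_col (F \<omega>) k))\<bar>
        \<le> a * cF * (2 * b\<^sup>2) ^ h) \<and>
    (\<forall>h. \<forall>k<r. \<bar>ip m (nth_col (mtr (ent (E \<omega>))) i) ((gram_op m n (zero_col i (mtr (ent (E \<omega>)))) ^^ h)
        (mv n (zero_col i (mtr (ent (E \<omega>)))) (nth_col L k)))\<bar> \<le> a * (b * cL) * (2 * b\<^sup>2) ^ h) \<and>
    (\<forall>k<r. \<forall>q<r. \<bar>ip n (nth_col L k) (mv m (ent (E \<omega>)) (nth_col (F \<omega>) q))\<bar> \<le> a * (cL * cF)))"
proof -
  let ?I = "{..<n} \<times> {..<m}" and ?e = "\<lambda>\<omega>. ent (E \<omega>)" and ?f = "\<lambda>\<omega>. mtr (ent (E \<omega>))"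
  let ?c = "\<lambda>i. (i, t)" and ?r = "\<lambda>s. (i, s)"
  have c: "inj_on ?c {..<n}" "?c ` {..<n} \<subseteq> ?I" and rr: "inj_on ?r {..<m}" "?r ` {..<m} \<subseteq> ?I"
    using it by (auto simp: inj_on_def)
  have em: "(\<lambda>\<omega>. ?e \<omega> l s) \<in> borel_measurable (noise_alg (?I - ?c ` {..<n}))" if "l < n" "s < m" "s \<noteq> t" for l s
    using that by (intro noise_alg_X) auto
  have fm: "(\<lambda>\<omega>. ?f \<omega> s l) \<in> borel_measurable (noise_alg (?I - ?r ` {..<m}))" if "s < m" "l < n" "l \<noteq> i" for l s
    unfolding mtr_apply using that by (intro noise_alg_X) auto
  have Fm: "(\<lambda>\<omega>. F \<omega> s k) \<in> borel_measurable (noise_alg Q)" if "s < m" "k < r" "Q \<subseteq> ?I" for s k Q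
    using that by (intro noise_alg_G F_G) auto
  have zc: "(\<lambda>\<omega>. zero_col t (?e \<omega>) l s) \<in> borel_measurable (noise_alg (?I - ?c ` {..<n}))" if "l < n" "s < m" for l s
    using em[OF that] by (cases "s = t") (simp_all add: zero_col_def)
  have zr: "(\<lambda>\<omega>. zero_col i (?f \<omega>) s l) \<in> borel_measurable (noise_alg (?I - ?r ` {..<m}))" if "s < m" "l < n" for l s
    using fm[OF that] by (cases "l = i") (simp_all add: zero_col_def)
  have xL: "(\<lambda>\<omega>. nth_col L k l) \<in> borel_measurable (noise_alg Q)" for k l Q
    by simp
  have xEF: "(\<lambda>\<omega>. mv m (zero_col t (?e \<omega>)) (nth_col (F \<omega>) k) l) \<in> borel_measurable (noise_alg (?I - ?c ` {..<n}))" if "l < n" "k < r" for l k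
    using that zc Fm by (intro borel_measurable_mv) auto
  have xEL: "(\<lambda>\<omega>. mv n (zero_col i (?f \<omega>)) (nth_col L k) s) \<in> borel_measurable (noise_alg (?I - ?r ` {..<m}))" if "s < m" "k < r" for s k
    using that zr by (intro borel_measurable_mv) auto
  have ec: "E \<omega> $$ ?c l = ?e \<omega> l t" "E \<omega> $$ ?r s = ?f \<omega> s i" for l s \<omega>
    by auto
  let ?G1 = "\<lambda>S. \<forall>\<omega>\<in>space M - S. op_bound n m (?e \<omega>) b \<longrightarrow> (\<forall>h. \<forall>k<r. nrm n (nth_col L k) \<le> cL \<longrightarrow>
      \<bar>ip n (nth_col (?e \<omega>) t) ((gram_op n m (zero_col t (?e \<omega>)) ^^ h) (nth_col L k))\<bar> \<le> a * cL * (2 * b\<^sup>2) ^ h)"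
  have "\<exists>S\<in>sets M. prob S \<le> 2 * real r * (C / a\<^sup>2) \<and> ?G1 S"
    by (rule leave_one_out_event[where e = ?e and t = t and x = "\<lambda>k \<omega>. nth_col L k" and m = m and r = r])
      (use c ec(1) em xL pos(3,1,2) in auto)
  then obtain S1 where S1: "S1 \<in> sets M" "prob S1 \<le> 2 * real r * (C / a\<^sup>2)" "?G1 S1"
    by - (elim bexE conjE, rule that)
  have bF: "0 < b * cF" and bL: "0 < b * cL" using pos by auto
  let ?G2 = "\<lambda>S. \<forall>\<omega>\<in>space M - S. op_bound n m (?e \<omega>) b \<longrightarrow> (\<forall>h. \<forall>k<r. nrm n (mv m (zero_col t (?e \<omega>)) (nth_col (F \<omega>) k)) \<le> b * cF \<longrightarrow>
      \<bar>ip n (nth_col (?e \<omega>) t) ((gram_op n m (zero_col t (?e \<omega>)) ^^ h) (mv m (zero_col t (?e \<omega>)) (nth_col (F \<omega>) k)))\<bar>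
        \<le> a * (b * cF) * (2 * b\<^sup>2) ^ h)"
  have "\<exists>S\<in>sets M. prob S \<le> 2 * real r * (C / a\<^sup>2) \<and> ?G2 S"
    by (rule leave_one_out_event[where e = ?e and t = t and x = "\<lambda>k \<omega>. mv m (zero_col t (?e \<omega>)) (nth_col (F \<omega>) k)" and m = m and r = r])
      (use c ec(1) em xEF bF pos(1,2) in auto)
  then obtain S2 where S2: "S2 \<in> sets M" "prob S2 \<le> 2 * real r * (C / a\<^sup>2)" "?G2 S2"
    by - (elim bexE conjE, rule that)
  let ?G3 = "\<lambda>S. \<forall>\<omega>\<in>space M - S. op_bound m n (?f \<omega>) b \<longrightarrow> (\<forall>h. \<forall>k<r. nrm m (nth_col (F \<omega>) k) \<le> cF \<longrightarrow>
      \<bar>ip m (nth_col (?f \<omega>) i) ((gram_op m n (zero_col i (?f \<omega>)) ^^ h) (nth_col (F \<omega>) k))\<bar> \<le> a * cF * (2 * b\<^sup>2) ^ h)"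
  have "\<exists>S\<in>sets M. prob S \<le> 2 * real r * (C / a\<^sup>2) \<and> ?G3 S"
    by (rule leave_one_out_event[where e = ?f and t = i and x = "\<lambda>k \<omega>. nth_col (F \<omega>) k" and m = n and r = r])
      (use rr ec(2) fm Fm pos(4,1,2) in auto)
  then obtain S3 where S3: "S3 \<in> sets M" "prob S3 \<le> 2 * real r * (C / a\<^sup>2)" "?G3 S3"
    by - (elim bexE conjE, rule that)
  let ?G4 = "\<lambda>S. \<forall>\<omega>\<in>space M - S. op_bound m n (?f \<omega>) b \<longrightarrow> (\<forall>h. \<forall>k<r. nrm m (mv n (zero_col i (?f \<omega>)) (nth_col L k)) \<le> b * cL \<longrightarrow>
      \<bar>ip m (nth_col (?f \<omega>) i) ((gram_op m n (zero_col i (?f \<omega>)) ^^ h) (mv n (zero_col i (?f \<omega>)) (nth_col L k)))\<bar>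
        \<le> a * (b * cL) * (2 * b\<^sup>2) ^ h)"
  have "\<exists>S\<in>sets M. prob S \<le> 2 * real r * (C / a\<^sup>2) \<and> ?G4 S"
    by (rule leave_one_out_event[where e = ?f and t = i and x = "\<lambda>k \<omega>. mv n (zero_col i (?f \<omega>)) (nth_col L k)" and m = n and r = r])
      (use rr ec(2) fm xEL bL pos(1,2) in auto)
  then obtain S4 where S4: "S4 \<in> sets M" "prob S4 \<le> 2 * real r * (C / a\<^sup>2)" "?G4 S4"
    by - (elim bexE conjE, rule that)
  define w where "w k q p \<omega> = L (fst p) k * F \<omega> (snd p) q" for k q p \<omega>
  define S5 where "S5 k q = {\<omega>\<in>space M. (\<Sum>p\<in>?I. (w k q p \<omega>)\<^sup>2) \<le> (cL * cF)\<^sup>2 \<and>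
    a * (cL * cF) < \<bar>\<Sum>p\<in>?I. w k q p \<omega> * E \<omega> $$ p\<bar>}" for k q
  have S5: "S5 k q \<in> sets M" "prob (S5 k q) \<le> C / a\<^sup>2" if "q < r" for k q
  proof -
    \<comment> \<open>All noise variables are summed here, so nothing but \<open>G\<close> is left
      for the weights to depend on.\<close>
    have "w k q p \<in> borel_measurable (noise_alg (?I - ?I))" if "p \<in> ?I" for p
      unfolding w_def using that \<open>q < r\<close> Fm by (intro borel_measurable_times) auto
    note * = tail[where w = "w k q" and c = "cL * cF" and a = a, OF order_refl this]
    show "S5 k q \<in> sets M" "prob (S5 k q) \<le> C / a\<^sup>2"
      unfolding S5_def using * pos by simp_all
  qed
  define S6 where "S6 = (\<Union>k<r. \<Union>q<r. S5 k q)"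
  have S6: "S6 \<in> sets M" "prob S6 \<le> (real r)\<^sup>2 * (C / a\<^sup>2)"
  proof -
    show "S6 \<in> sets M"
      unfolding S6_def using S5 by blast
    have "prob S6 \<le> (\<Sum>k<r. prob (\<Union>q<r. S5 k q))"
      unfolding S6_def using S5 by (intro finite_measure_subadditive_finite) auto
    also have "\<dots> \<le> (\<Sum>k<r. \<Sum>q<r. prob (S5 k q))"
      using S5 by (intro sum_mono finite_measure_subadditive_finite) auto
    also have "\<dots> \<le> (\<Sum>k<r. \<Sum>q<r. C / a\<^sup>2)"
      using S5 by (intro sum_mono) auto
    finally show "prob S6 \<le> (real r)\<^sup>2 * (C / a\<^sup>2)"
      by (simp add: power2_eq_square)
  qed
  show ?thesis
  proof (intro bexI[of _ "S1 \<union> S2 \<union> S3 \<union> S4 \<union> S6"] conjI ballI impI allI)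
    have "prob (S1 \<union> S2 \<union> S3 \<union> S4 \<union> S6) \<le> prob S1 + prob S2 + prob S3 + prob S4 + prob S6"
      using S1(1) S2(1) S3(1) S4(1) S6(1) measure_Un_le[of S1 M S2] measure_Un_le[of "S1 \<union> S2" M S3]
        measure_Un_le[of "S1 \<union> S2 \<union> S3" M S4] measure_Un_le[of "S1 \<union> S2 \<union> S3 \<union> S4" M S6] by simp
    also have "\<dots> \<le> 2 * real r * (C / a\<^sup>2) + 2 * real r * (C / a\<^sup>2) + 2 * real r * (C / a\<^sup>2)
        + 2 * real r * (C / a\<^sup>2) + (real r)\<^sup>2 * (C / a\<^sup>2)"
      by (intro add_mono S1(2) S2(2) S3(2) S4(2) S6(2))
    also have "\<dots> = (8 * real r + (real r)\<^sup>2) * (C / a\<^sup>2)"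
      unfolding distrib_right by simp
    finally show "prob (S1 \<union> S2 \<union> S3 \<union> S4 \<union> S6) \<le> (8 * real r + (real r)\<^sup>2) * (C / a\<^sup>2)" .
    show "S1 \<union> S2 \<union> S3 \<union> S4 \<union> S6 \<in> sets M"
      using S1(1) S2(1) S3(1) S4(1) S6(1) by auto
    fix \<omega> assume \<omega>: "\<omega> \<in> space M - (S1 \<union> S2 \<union> S3 \<union> S4 \<union> S6)" and op_bound: "op_bound n m (?e \<omega>) b"
      and Lc: "\<forall>k<r. nrm n (nth_col L k) \<le> cL" and Fc: "\<forall>k<r. nrm m (nth_col (F \<omega>) k) \<le> cF"
    have op_bound': "op_bound m n (?f \<omega>) b"
      using op_bound pos by (intro op_bound_tr) auto
    fix h k assume k: "k < r"
    show "\<bar>ip n (nth_col (?e \<omega>) t) ((gram_op n m (zero_col t (?e \<omega>)) ^^ h) (nth_col L k))\<bar> \<le> a * cL * (2 * b\<^sup>2) ^ h"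
      by (rule S1(3)[rule_format]) (use \<omega> op_bound k Lc in auto)
    show "\<bar>ip m (nth_col (?f \<omega>) i) ((gram_op m n (zero_col i (?f \<omega>)) ^^ h) (nth_col (F \<omega>) k))\<bar> \<le> a * cF * (2 * b\<^sup>2) ^ h"
      by (rule S3(3)[rule_format]) (use \<omega> op_bound' k Fc in auto)
    have "nrm n (mv m (zero_col t (?e \<omega>)) (nth_col (F \<omega>) k)) \<le> b * nrm m (nth_col (F \<omega>) k)"
      using op_bound_zero_col[OF op_bound, of t] pos by (auto simp: zero_col_def intro: op_boundD)
    also have "\<dots> \<le> b * cF"
      using Fc k pos by (intro mult_left_mono) auto
    finally have le: "nrm n (mv m (zero_col t (?e \<omega>)) (nth_col (F \<omega>) k)) \<le> b * cF" .
    show "\<bar>ip n (nth_col (?e \<omega>) t) ((gram_op n m (zero_col t (?e \<omega>)) ^^ h) (mv m (zero_col t (?e \<omega>)) (nth_col (F \<omega>) k)))\<bar>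
        \<le> a * (b * cF) * (2 * b\<^sup>2) ^ h"
      by (rule S2(3)[rule_format, OF _ _ _ le]) (use \<omega> op_bound k in auto)
    have "nrm m (mv n (zero_col i (?f \<omega>)) (nth_col L k)) \<le> b * nrm n (nth_col L k)"
      using op_bound_zero_col[OF op_bound', of i] pos by (auto simp: zero_col_def intro: op_boundD)
    also have "\<dots> \<le> b * cL"
      using Lc k pos by (intro mult_left_mono) auto
    finally have le': "nrm m (mv n (zero_col i (?f \<omega>)) (nth_col L k)) \<le> b * cL" .
    show "\<bar>ip m (nth_col (?f \<omega>) i) ((gram_op m n (zero_col i (?f \<omega>)) ^^ h) (mv n (zero_col i (?f \<omega>)) (nth_col L k)))\<bar>
        \<le> a * (b * cL) * (2 * b\<^sup>2) ^ h"
      by (rule S4(3)[rule_format, OF _ _ _ le']) (use \<omega> op_bound' k in auto)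
    fix q assume q: "q < r"
    have "(\<Sum>p\<in>?I. (w k q p \<omega>)\<^sup>2) = (nrm n (nth_col L k))\<^sup>2 * (nrm m (nth_col (F \<omega>) q))\<^sup>2"
      unfolding nrm_sq ip_def sum_product sum.cartesian_product w_def
      by (intro sum.cong) (auto simp: power2_eq_square)
    also have "\<dots> \<le> cL\<^sup>2 * cF\<^sup>2"
      using Lc Fc k q by (intro mult_mono power_mono) auto
    finally have "(\<Sum>p\<in>?I. (w k q p \<omega>)\<^sup>2) \<le> (cL * cF)\<^sup>2"
      by (simp add: power_mult_distrib)
    moreover have "\<omega> \<notin> S5 k q"
      using \<omega> k q by (auto simp: S6_def)
    ultimately have "\<bar>\<Sum>p\<in>?I. w k q p \<omega> * E \<omega> $$ p\<bar> \<le> a * (cL * cF)"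
      using \<omega> by (auto simp: S5_def)
    also have "(\<Sum>p\<in>?I. w k q p \<omega> * E \<omega> $$ p) = ip n (nth_col L k) (mv m (?e \<omega>) (nth_col (F \<omega>) q))"
      unfolding ip_def mv_def sum_distrib_left sum.cartesian_product w_def
      by (intro sum.cong) (auto simp: mult_ac)
    finally show "\<bar>ip n (nth_col L k) (mv m (?e \<omega>) (nth_col (F \<omega>) q))\<bar> \<le> a * (cL * cF)" .
  qed
qed

end

section \<open>Assembling the bounds\<close>

lemma row_vnorm: "A \<in> carrier_mat n r \<Longrightarrow> i < n \<Longrightarrow> vnorm (Matrix.row A i) = nrm r (ent A i)"
  unfolding vnorm_eq_nrm by (auto intro!: nrm_cong)

text \<open>A real supremum dominates its members only if the set is bounded above, which
  \<open>op_bound_exists\<close> supplies; homogeneity then leaves the unit ball.\<close>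

lemma op_bound_spectral_norm:
  assumes A: "A \<in> carrier_mat n m" and b: "spectral_norm A \<le> b"
  shows "op_bound n m (ent A) b"
  unfolding op_bound_def
proof
  fix x
  let ?V = "{v \<in> carrier_vec (dim_col A). vnorm v \<le> 1}"
  obtain g where g: "0 < g" "op_bound n m (ent A) g"
    using op_bound_exists by blast
  have vA: "vnorm (A *\<^sub>v v) = nrm n (mv m (ent A) (vec_index v))" if "v \<in> carrier_vec m" for v
    unfolding vnorm_eq_nrm using A mult_mat_vec_entry[OF A that] by (auto intro!: nrm_cong)
  have "bdd_above ((\<lambda>v. vnorm (A *\<^sub>v v)) ` ?V)"
  proof (rule bdd_aboveI2)
    fix v assume v: "v \<in> ?V"
    then have vm: "v \<in> carrier_vec m" "nrm m (vec_index v) \<le> 1"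
      using A by (auto simp: vnorm_eq_nrm)
    have "vnorm (A *\<^sub>v v) \<le> g * nrm m (vec_index v)"
      unfolding vA[OF vm(1)] by (rule op_boundD[OF g(2)])
    also have "\<dots> \<le> g * 1"
      using vm g by (intro mult_left_mono) auto
    finally show "vnorm (A *\<^sub>v v) \<le> g" by simp
  qed
  then have sup: "vnorm (A *\<^sub>v v) \<le> b" if "v \<in> carrier_vec m" "vnorm v \<le> 1" for v
    using cSUP_upper[of v ?V "\<lambda>v. vnorm (A *\<^sub>v v)"] that b A by (simp add: spectral_norm_def)
  show "nrm n (mv m (ent A) x) \<le> b * nrm m x"
  proof (cases "nrm m x = 0")
    case True
    have "nrm n (mv m (ent A) x) \<le> g * nrm m x"
      by (rule op_boundD[OF g(2)])
    then show ?thesis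
      using True by simp
  next
    case False
    then have c: "0 < nrm m x"
      using nrm_ge_0[of m x] by linarith
    define v where "v = Matrix.vec m (\<lambda>j. (1 / nrm m x) * x j)"
    have "nrm m (vec_index v) = nrm m (\<lambda>j. (1 / nrm m x) * x j)"
      by (intro nrm_cong) (simp add: v_def)
    also have "\<dots> = 1"
      unfolding nrm_scale using c by simp
    finally have "vnorm v \<le> 1"
      by (simp add: vnorm_eq_nrm v_def)
    moreover have vc: "v \<in> carrier_vec m"
      by (simp add: v_def)
    ultimately have "vnorm (A *\<^sub>v v) \<le> b"
      by (intro sup)
    also have "vnorm (A *\<^sub>v v) = nrm n (mv m (ent A) (\<lambda>j. (1 / nrm m x) * x j))"
      unfolding vA[OF vc] by (intro arg_cong[where f = "nrm n"] mv_cong) (simp add: v_def)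
    also have "\<dots> = (1 / nrm m x) * nrm n (mv m (ent A) x)"
      unfolding mv_scale nrm_scale using c by simp
    finally show ?thesis
      using c by (simp add: field_simps)
  qed
qed

lemma sigma_of_matrix_entry:
  assumes "i < n" "j < m"
  shows "(\<lambda>\<omega>. A \<omega> $$ (i, j)) \<in> borel_measurable (sigma_of_matrix M n m A)"
proof -
  let ?f = "\<lambda>\<omega>. \<lambda>p\<in>{..<n} \<times> {..<m}. A \<omega> $$ p"
  have "?f \<in> measurable (sigma_of_matrix M n m A) (\<Pi>\<^sub>M p\<in>{..<n} \<times> {..<m}. borel)"
    unfolding sigma_of_matrix_def
    by (rule measurable_vimage_algebra1) (auto simp: space_PiM PiE_def extensional_def)
  then have "(\<lambda>\<omega>. ?f \<omega> (i, j)) \<in> borel_measurable (sigma_of_matrix M n m A)"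
    by (rule measurable_compose[OF _ measurable_component_singleton]) (use assms in auto)
  then show ?thesis
    using assms by simp
qed

lemma sigma_of_matrix_sub:
  assumes "\<And>i j. i < n \<Longrightarrow> j < m \<Longrightarrow> (\<lambda>\<omega>. A \<omega> $$ (i, j)) \<in> borel_measurable M"
  shows "subalgebra M (sigma_of_matrix M n m A)"
proof -
  let ?N = "\<Pi>\<^sub>M p\<in>{..<n} \<times> {..<m}. (borel :: real measure)"
  let ?f = "\<lambda>\<omega>. \<lambda>p\<in>{..<n} \<times> {..<m}. A \<omega> $$ p"
  have f: "?f \<in> measurable M ?N"
    using assms by (intro measurable_restrict) auto
  have "?f \<in> space M \<rightarrow> space ?N"
    by (auto simp: space_PiM PiE_def extensional_def)
  then have "sets (sigma_of_matrix M n m A) = {?f -` S \<inter> space M | S. S \<in> sets ?N}"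
    unfolding sigma_of_matrix_def by (rule sets_vimage_algebra2)
  then show ?thesis
    using measurable_sets[OF f] by (auto simp: subalgebra_def sigma_of_matrix_def)
qed

lemma pointwise_bounds:
  fixes L F E X U D V U0 D0 V0 R :: "real mat"
  assumes mats: "factor_mats n m r L F E U D V U0 D0 V0 R A (sqrt (real m)) e \<kappa>"
    and it: "i < n" "t < m"
    and P1: "\<And>h k. k < r \<Longrightarrow> \<bar>ip n (nth_col (ent E) t) ((gram_op n m (zero_col t (ent E)) ^^ h) (nth_col (ent L) k))\<bar>
        \<le> \<kappa> * A * (2 * e\<^sup>2) ^ h"
    and P2: "\<And>h k. k < r \<Longrightarrow> \<bar>ip n (nth_col (ent E) t)
        ((gram_op n m (zero_col t (ent E)) ^^ h) (mv m (zero_col t (ent E)) (nth_col (ent F) k)))\<bar> \<le> \<kappa> * e * sqrt (real m) * (2 * e\<^sup>2) ^ h"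
    and P3: "\<And>h k. k < r \<Longrightarrow> \<bar>ip m (nth_col (mtr (ent E)) i)
        ((gram_op m n (zero_col i (mtr (ent E))) ^^ h) (nth_col (ent F) k))\<bar> \<le> \<kappa> * sqrt (real m) * (2 * e\<^sup>2) ^ h"
    and P4: "\<And>h k. k < r \<Longrightarrow> \<bar>ip m (nth_col (mtr (ent E)) i)
        ((gram_op m n (zero_col i (mtr (ent E))) ^^ h) (mv n (zero_col i (mtr (ent E))) (nth_col (ent L) k)))\<bar>
        \<le> \<kappa> * e * A * (2 * e\<^sup>2) ^ h"
    and H0: "H0 = balancing_matrix r m L F (U0 * diag_sqrt D0) (V0 * diag_sqrt D0)"
    and H: "H = mat_inv (diag_sqrt D * R * H0)"
  defines "B \<equiv> sqrt (real m)"
  defines "f \<equiv> vnorm (Matrix.row F t)" and "l \<equiv> vnorm (Matrix.row L i)"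
    and "err \<equiv> 1 / (A * B) + (e / (A * B))\<^sup>2"
  shows "vnorm (Matrix.row (B \<cdot>\<^sub>m V) t - H\<^sup>T *\<^sub>v Matrix.row F t) \<le> \<kappa> ^ 40 * (err * f + 1 / A)"
    "vnorm (Matrix.row ((1 / B) \<cdot>\<^sub>m (U * D)) i - mat_inv H *\<^sub>v Matrix.row L i) \<le> \<kappa> ^ 43 * (err * l + 1 / B)"
    "\<bar>scalar_prod (Matrix.row ((1 / B) \<cdot>\<^sub>m (U * D)) i) (Matrix.row (B \<cdot>\<^sub>m V) t) - (L * F\<^sup>T) $$ (i, t)\<bar>
      \<le> (\<kappa> ^ 43 * (err * l + 1 / B)) * (\<kappa> ^ 6 * f + \<kappa> ^ 40 * (err * f + 1 / A)) + (\<kappa> ^ 9 * l) * (\<kappa> ^ 40 * (err * f + 1 / A))"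
proof -
  interpret W: factor_mats n m r L F E U D V U0 D0 V0 R A B e \<kappa>
    unfolding B_def by (rule mats)
  have "H0 = W.K"
    unfolding H0 by (rule W.balancing_matrix_eq)
  then have H_eq: "H = W.Ginv" "mat_inv H = W.G"
    using W.mat_inv_G by (simp_all add: H W.G_def)
  have fl: "f = nrm r (ent F t)" "l = nrm r (ent L i)"
    using it W.carrier by (simp_all add: f_def l_def row_vnorm)
  note P = P1 P2[folded B_def] P3[folded B_def] P4
  show "vnorm (Matrix.row (B \<cdot>\<^sub>m V) t - H\<^sup>T *\<^sub>v Matrix.row F t) \<le> \<kappa> ^ 40 * (err * f + 1 / A)"
    unfolding H_eq(1) fl err_def by (rule W.factor_error[OF it P])
  show "vnorm (Matrix.row ((1 / B) \<cdot>\<^sub>m (U * D)) i - mat_inv H *\<^sub>v Matrix.row L i) \<le> \<kappa> ^ 43 * (err * l + 1 / B)"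
    unfolding H_eq(2) fl err_def by (rule W.loading_error[OF it P])
  show "\<bar>scalar_prod (Matrix.row ((1 / B) \<cdot>\<^sub>m (U * D)) i) (Matrix.row (B \<cdot>\<^sub>m V) t) - (L * F\<^sup>T) $$ (i, t)\<bar>
      \<le> (\<kappa> ^ 43 * (err * l + 1 / B)) * (\<kappa> ^ 6 * f + \<kappa> ^ 40 * (err * f + 1 / A)) + (\<kappa> ^ 9 * l) * (\<kappa> ^ 40 * (err * f + 1 / A))"
    unfolding fl err_def by (rule W.common_component_error[OF it P])
qed

text \<open>\<open>\<delta>\<close> stands for max(N, T) / (N^\<alpha> T) and \<open>w\<close> for
  the decay of the individual loading. The summand \<open>1 / (A * B)\<close> of \<open>err\<close>
  is absorbed by \<open>1 / A\<close> in the first rate and by \<open>1 / B\<close> in the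
  second.\<close>

lemma rates:
  fixes A B b \<delta> f l w \<kappa> c c' :: real
  assumes A: "1 \<le> A" and B: "1 \<le> B" and b: "0 \<le> b" "b \<le> A * B" and c: "0 \<le> c" "0 \<le> c'" and \<kappa>: "1 \<le> \<kappa>"
    and \<delta>: "(b / (A * B))\<^sup>2 = c * \<delta>" "0 \<le> \<delta>" and f: "0 \<le> f" "f \<le> \<kappa>" and l: "0 \<le> l" "l \<le> c' * w" and w: "0 \<le> w" "w \<le> 1"
  defines "err \<equiv> 1 / (A * B) + (b / (A * B))\<^sup>2"
  defines "K1 \<equiv> \<kappa> + \<kappa> * c + 1" and "K2 \<equiv> c' + c' * c + 1"
  shows "err * f + 1 / A \<le> K1 * (1 / A + \<delta>)"
    "err * l + 1 / B \<le> K2 * (1 / B + w * \<delta>)"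
    "(\<kappa> ^ 43 * (err * l + 1 / B)) * (\<kappa> ^ 6 * f + \<kappa> ^ 40 * (err * f + 1 / A)) + (\<kappa> ^ 9 * l) * (\<kappa> ^ 40 * (err * f + 1 / A))
      \<le> (\<kappa> ^ 43 * K2 * (\<kappa> ^ 7 + \<kappa> ^ 40 * (2 * \<kappa> + 1)) + \<kappa> ^ 49 * c' * K1) * (1 / B + w * (1 / A) + w * \<delta>)"
proof -
  have pos: "0 < A" "0 < B" "0 \<le> \<kappa>"
    using A B \<kappa> by auto
  have AB: "1 / (A * B) \<le> 1 / A" "1 / (A * B) \<le> 1 / B" "1 / (A * B) \<le> 1" "1 / A \<le> 1"
    using A B pos mult_mono[of 1 A 1 B] by (auto intro!: divide_left_mono simp: mult_le_cancel_left1 mult_le_cancel_right1)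
  have err0: "0 \<le> err"
    using pos by (simp add: err_def)
  show e1: "err * f + 1 / A \<le> K1 * (1 / A + \<delta>)"
  proof -
    have "err * f \<le> err * \<kappa>"
      by (rule mult_left_mono[OF f(2) err0])
    also have "\<dots> \<le> (1 / A + c * \<delta>) * \<kappa>"
      using AB(1) pos by (intro mult_right_mono) (auto simp: err_def \<delta>)
    finally have "err * f + 1 / A \<le> (1 / A + c * \<delta>) * \<kappa> + 1 / A" by simp
    also have "\<dots> = (\<kappa> + 1) * (1 / A) + (\<kappa> * c) * \<delta>"
      by (simp add: algebra_simps add_divide_distrib)
    also have "\<dots> \<le> K1 * (1 / A) + K1 * \<delta>"
      using pos c \<delta>(2) unfolding K1_def by (intro add_mono mult_right_mono) auto
    finally show ?thesis by (simp add: distrib_left)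
  qed
  show e2: "err * l + 1 / B \<le> K2 * (1 / B + w * \<delta>)"
  proof -
    have "err * l \<le> err * (c' * w)"
      by (rule mult_left_mono[OF l(2) err0])
    also have "\<dots> = (1 / (A * B)) * c' * w + (c * \<delta>) * c' * w"
      by (simp add: err_def \<delta>(1) algebra_simps)
    also have "\<dots> \<le> (1 / B) * c' * 1 + (c * \<delta>) * c' * w"
      using AB(2) c w pos by (intro add_mono mult_mono order_refl) auto
    finally have "err * l + 1 / B \<le> (c' + 1) * (1 / B) + (c' * c) * (w * \<delta>)"
      by (simp add: algebra_simps add_divide_distrib)
    also have "\<dots> \<le> K2 * (1 / B) + K2 * (w * \<delta>)"
      using pos c \<delta>(2) w unfolding K2_def by (intro add_mono mult_right_mono) auto
    finally show ?thesis by (simp add: distrib_left)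
  qed
  \<comment> \<open>In the error of the common component, one factor of each product carries the
    rate and the other only has to be bounded.\<close>
  have err2: "err \<le> 2"
  proof -
    have "b / (A * B) \<le> 1" "0 \<le> b / (A * B)"
      using b pos by (simp_all add: divide_le_eq)
    then have "(b / (A * B))\<^sup>2 \<le> 1"
      by (simp add: power_le_one)
    then show ?thesis
      using AB(3) by (simp add: err_def)
  qed
  have f1: "err * f + 1 / A \<le> 2 * \<kappa> + 1"
    by (rule add_mono[OF mult_mono[OF err2 f(2)] AB(4)]) (use f in simp_all)
  have K: "0 \<le> K1" "0 \<le> K2"
    using c pos by (simp_all add: K1_def K2_def)
  let ?t = "1 / B + w * (1 / A) + w * \<delta>"
  have "K2 * (1 / B + w * \<delta>) \<le> K2 * ?t"
    using K pos w by (intro mult_left_mono) auto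
  then have X1: "err * l + 1 / B \<le> K2 * ?t"
    using e2 by linarith
  have X2: "\<kappa> ^ 6 * f + \<kappa> ^ 40 * (err * f + 1 / A) \<le> \<kappa> ^ 6 * \<kappa> + \<kappa> ^ 40 * (2 * \<kappa> + 1)"
    by (rule add_mono[OF mult_left_mono[OF f(2)] mult_left_mono[OF f1]]) (use pos in simp_all)
  have "(\<kappa> ^ 43 * (err * l + 1 / B)) * (\<kappa> ^ 6 * f + \<kappa> ^ 40 * (err * f + 1 / A))
      \<le> (\<kappa> ^ 43 * (K2 * ?t)) * (\<kappa> ^ 6 * \<kappa> + \<kappa> ^ 40 * (2 * \<kappa> + 1))"
    by (rule mult_mono[OF mult_left_mono[OF X1] X2]) (use pos K w \<delta> f err0 in simp_all)
  moreover have "(\<kappa> ^ 9 * l) * (\<kappa> ^ 40 * (err * f + 1 / A)) \<le> (\<kappa> ^ 9 * (c' * w)) * (\<kappa> ^ 40 * (K1 * (1 / A + \<delta>)))"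
    using pos e1 l f err0 w c by (intro mult_mono mult_left_mono) auto
  moreover have "(\<kappa> ^ 9 * (c' * w)) * (\<kappa> ^ 40 * (K1 * (1 / A + \<delta>))) \<le> (\<kappa> ^ 49 * c' * K1) * ?t"
  proof -
    have "(\<kappa> ^ 9 * (c' * w)) * (\<kappa> ^ 40 * (K1 * (1 / A + \<delta>))) = (\<kappa> ^ 9 * \<kappa> ^ 40) * c' * K1 * (w * (1 / A) + w * \<delta>)"
      by (simp add: algebra_simps)
    also have "\<kappa> ^ 9 * \<kappa> ^ 40 = \<kappa> ^ 49"
      by (simp flip: power_add)
    also have "\<kappa> ^ 49 * c' * K1 * (w * (1 / A) + w * \<delta>) \<le> (\<kappa> ^ 49 * c' * K1) * ?t"
      using pos c K by (intro mult_left_mono) auto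
    finally show ?thesis .
  qed
  moreover have "\<kappa> ^ 6 * \<kappa> = \<kappa> ^ 7"
    by (simp flip: power_Suc2)
  ultimately show "(\<kappa> ^ 43 * (err * l + 1 / B)) * (\<kappa> ^ 6 * f + \<kappa> ^ 40 * (err * f + 1 / A)) + (\<kappa> ^ 9 * l) * (\<kappa> ^ 40 * (err * f + 1 / A))
      \<le> (\<kappa> ^ 43 * K2 * (\<kappa> ^ 7 + \<kappa> ^ 40 * (2 * \<kappa> + 1)) + \<kappa> ^ 49 * c' * K1) * ?t"
    unfolding distrib_right[of "\<kappa> ^ 43 * K2 * (\<kappa> ^ 7 + \<kappa> ^ 40 * (2 * \<kappa> + 1))"] by (simp add: mult_ac)
qed

text \<open>The noise norm and the frame of the factors remain premises inside the event, so
  \<open>S\<close> collects only the tail events of the noise; the probabilities of the premises are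
  added in the final proof. \<open>\<kappa>0\<close> is the frame constant, and
  \<open>\<kappa>\<close> is larger so as to dominate the deviation levels as well.\<close>

lemma good_event:
  fixes M :: "'a measure" and L :: "real mat" and F E U D V U0 D0 V0 R H0 H :: "'a \<Rightarrow> real mat"
  assumes "prob_space M" and r: "0 < r" and n: "i < n" and t: "t < m"
    and L: "L \<in> carrier_mat n r" and F: "random_matrix M m r F" and E: "random_matrix M n m E"
    and svd: "\<And>\<omega>. \<omega> \<in> space M \<Longrightarrow> top_svd n m r (L * (F \<omega>)\<^sup>T + E \<omega>) (U \<omega>) (D \<omega>) (V \<omega>)"
    and svd0: "\<And>\<omega>. \<omega> \<in> space M \<Longrightarrow> top_svd n m r (L * (F \<omega>)\<^sup>T) (U0 \<omega>) (D0 \<omega>) (V0 \<omega>)"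
    and min: "\<And>\<omega>. \<omega> \<in> space M \<Longrightarrow> procrustes_minimizer r (U \<omega> * diag_sqrt (D \<omega>)) (V \<omega> * diag_sqrt (D \<omega>))
      (U0 \<omega> * diag_sqrt (D0 \<omega>)) (V0 \<omega> * diag_sqrt (D0 \<omega>)) (R \<omega>)"
    and H0: "\<And>\<omega>. H0 \<omega> = balancing_matrix r m L (F \<omega>) (U0 \<omega> * diag_sqrt (D0 \<omega>)) (V0 \<omega> * diag_sqrt (D0 \<omega>))"
    and H: "\<And>\<omega>. H \<omega> = mat_inv (diag_sqrt (D \<omega>) * R \<omega> * H0 \<omega>)"
    and sq_int: "\<And>l s. l < n \<Longrightarrow> s < m \<Longrightarrow> integrable M (\<lambda>\<omega>. (E \<omega> $$ (l, s))\<^sup>2)"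
    and mean: "\<And>l s. l < n \<Longrightarrow> s < m \<Longrightarrow>
      AE \<omega> in M. real_cond_exp M (sigma_of_matrix M n m (\<lambda>\<omega>. L * (F \<omega>)\<^sup>T)) (\<lambda>\<omega>. E \<omega> $$ (l, s)) \<omega> = 0"
    and var: "\<And>l s. l < n \<Longrightarrow> s < m \<Longrightarrow>
      AE \<omega> in M. real_cond_exp M (sigma_of_matrix M n m (\<lambda>\<omega>. L * (F \<omega>)\<^sup>T)) (\<lambda>\<omega>. (E \<omega> $$ (l, s))\<^sup>2) \<omega>
        = (\<integral>\<omega>. (E \<omega> $$ (l, s))\<^sup>2 \<partial>M)"
    and C: "\<And>l s. l < n \<Longrightarrow> s < m \<Longrightarrow> (\<integral>\<omega>. (E \<omega> $$ (l, s))\<^sup>2 \<partial>M) \<le> C" "0 \<le> C"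
    and indep: "cond_indep_vars M (sigma_of_matrix M n m (\<lambda>\<omega>. L * (F \<omega>)\<^sup>T)) (\<lambda>p \<omega>. E \<omega> $$ p) ({..<n} \<times> {..<m})"
    and A: "0 < A" and b: "0 < b" "b \<le> A * sqrt (real m) / (4 * \<kappa>\<^sup>2)" and a: "0 < a"
    and \<kappa>0: "1 \<le> \<kappa>0" and \<kappa>: "2 \<le> \<kappa>" "real r \<le> \<kappa>" "\<kappa>0 \<le> \<kappa>" "a * \<kappa>0\<^sup>2 \<le> \<kappa>"
    and Lf: "\<And>y. A / \<kappa>0 * nrm r y \<le> nrm n (mv r (ent L) y)" "\<And>y. nrm n (mv r (ent L) y) \<le> \<kappa>0 * A * nrm r y"
  defines "B \<equiv> sqrt (real m)"
  defines "err \<equiv> 1 / (A * B) + (b / (A * B))\<^sup>2"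
  shows "\<exists>S\<in>sets M. measure M S \<le> (8 * real r + (real r)\<^sup>2) * (C / a\<^sup>2) \<and> (\<forall>\<omega>\<in>space M - S.
    spectral_norm (E \<omega>) \<le> b \<longrightarrow>
    (\<forall>y. B / \<kappa>0 * nrm r y \<le> nrm m (mv r (ent (F \<omega>)) y) \<and> nrm m (mv r (ent (F \<omega>)) y) \<le> \<kappa>0 * B * nrm r y) \<longrightarrow>
    vnorm (Matrix.row (B \<cdot>\<^sub>m V \<omega>) t - (H \<omega>)\<^sup>T *\<^sub>v Matrix.row (F \<omega>) t) \<le> \<kappa> ^ 40 * (err * vnorm (Matrix.row (F \<omega>) t) + 1 / A) \<and>
    vnorm (Matrix.row ((1 / B) \<cdot>\<^sub>m (U \<omega> * D \<omega>)) i - mat_inv (H \<omega>) *\<^sub>v Matrix.row L i)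
      \<le> \<kappa> ^ 43 * (err * vnorm (Matrix.row L i) + 1 / B) \<and>
    \<bar>scalar_prod (Matrix.row ((1 / B) \<cdot>\<^sub>m (U \<omega> * D \<omega>)) i) (Matrix.row (B \<cdot>\<^sub>m V \<omega>) t) - (L * (F \<omega>)\<^sup>T) $$ (i, t)\<bar>
      \<le> (\<kappa> ^ 43 * (err * vnorm (Matrix.row L i) + 1 / B))
          * (\<kappa> ^ 6 * vnorm (Matrix.row (F \<omega>) t) + \<kappa> ^ 40 * (err * vnorm (Matrix.row (F \<omega>) t) + 1 / A))
        + (\<kappa> ^ 9 * vnorm (Matrix.row L i)) * (\<kappa> ^ 40 * (err * vnorm (Matrix.row (F \<omega>) t) + 1 / A)))"
proof -
  interpret prob_space M by fact
  let ?M0 = "\<lambda>\<omega>. L * (F \<omega>)\<^sup>T" and ?G = "sigma_of_matrix M n m (\<lambda>\<omega>. L * (F \<omega>)\<^sup>T)"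
  have Fc: "F \<omega> \<in> carrier_mat m r" and Ec: "E \<omega> \<in> carrier_mat n m" if "\<omega> \<in> space M" for \<omega>
    using F E that by (auto simp: random_matrix_def)
  have Fm: "(\<lambda>\<omega>. F \<omega> $$ (s, k)) \<in> borel_measurable M" if "s < m" "k < r" for s k
    using F that by (auto simp: random_matrix_def)
  have M0_ent: "?M0 \<omega> $$ (l, s) = (\<Sum>k<r. L $$ (l, k) * F \<omega> $$ (s, k))" if "\<omega> \<in> space M" "l < n" "s < m" for \<omega> l s
    using that Fc[OF that(1)] L by (simp add: scalar_prod_def atLeast0LessThan)
  have sub: "subalgebra M ?G"
  proof (rule sigma_of_matrix_sub)
    fix l s assume ls: "l < n" "s < m"
    have "(\<lambda>\<omega>. \<Sum>k<r. L $$ (l, k) * F \<omega> $$ (s, k)) \<in> borel_measurable M"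
      using Fm ls by (intro borel_measurable_sum borel_measurable_times) auto
    then show "(\<lambda>\<omega>. ?M0 \<omega> $$ (l, s)) \<in> borel_measurable M"
      using M0_ent ls by (subst measurable_cong) auto
  qed
  have AB: "0 < A / \<kappa>0" "0 < B"
    using A \<kappa>0 t by (simp_all add: B_def)
  \<comment> \<open>The left inverse expresses each factor entry as a fixed linear combination of
    entries of the common component, which makes it measurable under the conditioning.\<close>
  obtain W where W: "\<And>j k. j < r \<Longrightarrow> k < r \<Longrightarrow> (\<Sum>l<n. W j l * L $$ (l, k)) = (if j = k then 1 else 0)"
    using left_inverse_exists[OF AB(1) Lf(1)] by blast
  have F_G: "(\<lambda>\<omega>. F \<omega> $$ (s, k)) \<in> borel_measurable ?G" if sk: "s < m" "k < r" for s k
  proof -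
    have "(\<lambda>\<omega>. \<Sum>l<n. W k l * ?M0 \<omega> $$ (l, s)) \<in> borel_measurable ?G"
      using sk by (intro borel_measurable_sum borel_measurable_times sigma_of_matrix_entry) auto
    moreover have "(\<Sum>l<n. W k l * ?M0 \<omega> $$ (l, s)) = F \<omega> $$ (s, k)" if \<omega>: "\<omega> \<in> space ?G" for \<omega>
    proof -
      have \<omega>M: "\<omega> \<in> space M"
        using \<omega> sub by (simp add: subalgebra_def)
      have "(\<Sum>l<n. W k l * ?M0 \<omega> $$ (l, s)) = (\<Sum>l<n. \<Sum>q<r. F \<omega> $$ (s, q) * (W k l * L $$ (l, q)))"
        using M0_ent[OF \<omega>M] sk by (simp add: sum_distrib_left mult_ac)
      also have "\<dots> = (\<Sum>q<r. F \<omega> $$ (s, q) * (\<Sum>l<n. W k l * L $$ (l, q)))"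
        by (subst sum.swap) (simp add: sum_distrib_left)
      also have "\<dots> = (\<Sum>q<r. if k = q then F \<omega> $$ (s, q) else 0)"
        using W sk by (intro sum.cong) auto
      finally show ?thesis
        using sk by simp
    qed
    ultimately show ?thesis
      by (subst measurable_cong[where g = "\<lambda>\<omega>. \<Sum>l<n. W k l * ?M0 \<omega> $$ (l, s)"]) auto
  qed
  interpret matrix_noise M ?G E n m "\<lambda>p. \<integral>\<omega>. (E \<omega> $$ p)\<^sup>2 \<partial>M" C "ent L" "\<lambda>\<omega>. ent (F \<omega>)" r
    by unfold_locales (use sub indep sq_int mean var C F_G in auto)
  have cpos: "0 < \<kappa>0 * A" "0 < \<kappa>0 * B"
    using A AB \<kappa>0 by auto
  obtain S where S: "S \<in> sets M" "prob S \<le> (8 * real r + (real r)\<^sup>2) * (C / a\<^sup>2)"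
    and ev: "\<forall>\<omega>\<in>space M - S. op_bound n m (ent (E \<omega>)) b \<longrightarrow>
    (\<forall>k<r. nrm n (nth_col (ent L) k) \<le> \<kappa>0 * A) \<longrightarrow> (\<forall>k<r. nrm m (nth_col (ent (F \<omega>)) k) \<le> \<kappa>0 * B) \<longrightarrow>
    (\<forall>h. \<forall>k<r. \<bar>ip n (nth_col (ent (E \<omega>)) t) ((gram_op n m (zero_col t (ent (E \<omega>))) ^^ h) (nth_col (ent L) k))\<bar> \<le> a * (\<kappa>0 * A) * (2 * b\<^sup>2) ^ h) \<and>
    (\<forall>h. \<forall>k<r. \<bar>ip n (nth_col (ent (E \<omega>)) t) ((gram_op n m (zero_col t (ent (E \<omega>))) ^^ h)
        (mv m (zero_col t (ent (E \<omega>))) (nth_col (ent (F \<omega>)) k)))\<bar> \<le> a * (b * (\<kappa>0 * B)) * (2 * b\<^sup>2) ^ h) \<and>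
    (\<forall>h. \<forall>k<r. \<bar>ip m (nth_col (mtr (ent (E \<omega>))) i) ((gram_op m n (zero_col i (mtr (ent (E \<omega>)))) ^^ h) (nth_col (ent (F \<omega>)) k))\<bar>
        \<le> a * (\<kappa>0 * B) * (2 * b\<^sup>2) ^ h) \<and>
    (\<forall>h. \<forall>k<r. \<bar>ip m (nth_col (mtr (ent (E \<omega>))) i) ((gram_op m n (zero_col i (mtr (ent (E \<omega>)))) ^^ h)
        (mv n (zero_col i (mtr (ent (E \<omega>)))) (nth_col (ent L) k)))\<bar> \<le> a * (b * (\<kappa>0 * A)) * (2 * b\<^sup>2) ^ h) \<and>
    (\<forall>k<r. \<forall>q<r. \<bar>ip n (nth_col (ent L) k) (mv m (ent (E \<omega>)) (nth_col (ent (F \<omega>)) q))\<bar> \<le> a * (\<kappa>0 * A * (\<kappa>0 * B)))"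
    using noise_event[OF n t a b(1) cpos] by - (elim bexE conjE, rule that)
  show ?thesis
  proof (intro bexI[OF _ S(1)] conjI S(2) ballI impI)
    fix \<omega> assume \<omega>: "\<omega> \<in> space M - S" and sp: "spectral_norm (E \<omega>) \<le> b"
      and Ff: "\<forall>y. B / \<kappa>0 * nrm r y \<le> nrm m (mv r (ent (F \<omega>)) y) \<and> nrm m (mv r (ent (F \<omega>)) y) \<le> \<kappa>0 * B * nrm r y"
    have \<omega>M: "\<omega> \<in> space M" using \<omega> by simp
    have op_bound: "op_bound n m (ent (E \<omega>)) b"
      by (rule op_bound_spectral_norm[OF Ec[OF \<omega>M] sp])
    have Lc: "\<forall>k<r. nrm n (nth_col (ent L) k) \<le> \<kappa>0 * A"
      using frame_col_le[OF Lf(2)] by blast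
    have Fcol: "\<forall>k<r. nrm m (nth_col (ent (F \<omega>)) k) \<le> \<kappa>0 * B"
      using frame_col_le[of m r "ent (F \<omega>)" "\<kappa>0 * B"] Ff by blast
    note ev' = ev[rule_format, OF \<omega> op_bound Lc[rule_format] Fcol[rule_format]]
    \<comment> \<open>The products with one column carry \<open>\<kappa>0\<close> once, the bilinear
      forms twice; since \<open>\<kappa>0\<close> is at least 1, the hypothesis on the square covers
      both.\<close>
    have a\<kappa>0: "a * \<kappa>0 \<le> \<kappa>"
    proof -
      have "a * \<kappa>0 \<le> a * \<kappa>0\<^sup>2"
        using a \<kappa>0 by (intro mult_left_mono) (simp_all add: power2_eq_square)
      then show ?thesis using \<kappa>(4) by linarith
    qed
    have \<kappa>pos: "0 < \<kappa>" using \<kappa> by linarith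
    have down: "x / \<kappa> * nrm r y \<le> x / \<kappa>0 * nrm r y" and up: "\<kappa>0 * x * nrm r y \<le> \<kappa> * x * nrm r y" if "0 < x" for x y
      using that \<kappa>(3) \<kappa>0 by (intro mult_right_mono divide_left_mono; simp)+
    have mats: "factor_mats n m r L (F \<omega>) (E \<omega>) (U \<omega>) (D \<omega>) (V \<omega>) (U0 \<omega>) (D0 \<omega>) (V0 \<omega>) (R \<omega>) A (sqrt (real m)) b \<kappa>"
    proof (rule factor_matsI[OF r \<kappa>(1,2) A _ less_imp_le[OF b(1)] b(2) L Fc[OF \<omega>M] Ec[OF \<omega>M] refl svd[OF \<omega>M] svd0[OF \<omega>M] min[OF \<omega>M]
          _ _ _ _ op_bound])
      show "0 < m" using t by simp
      show "A / \<kappa> * nrm r y \<le> nrm n (mv r (ent L) y)" "nrm n (mv r (ent L) y) \<le> \<kappa> * A * nrm r y" for y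
        using order_trans[OF down[OF A] Lf(1)] order_trans[OF Lf(2) up[OF A]] by auto
      show "sqrt (real m) / \<kappa> * nrm r y \<le> nrm m (mv r (ent (F \<omega>)) y)" "nrm m (mv r (ent (F \<omega>)) y) \<le> \<kappa> * sqrt (real m) * nrm r y" for y
        using order_trans[OF down[OF AB(2)] conjunct1[OF spec[OF Ff]]] order_trans[OF conjunct2[OF spec[OF Ff]] up[OF AB(2)]]
        unfolding B_def by auto
      fix p q assume "p < r" "q < r"
      then have "\<bar>ip n (nth_col (ent L) p) (mv m (ent (E \<omega>)) (nth_col (ent (F \<omega>)) q))\<bar> \<le> (a * \<kappa>0\<^sup>2) * (A * B)"
        using ev' by (simp add: power2_eq_square mult_ac)
      also have "\<dots> \<le> \<kappa> * (A * B)"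
        using \<kappa>(4) A AB by (intro mult_right_mono) auto
      finally show "\<bar>ip n (nth_col (ent L) p) (mv m (ent (E \<omega>)) (nth_col (ent (F \<omega>)) q))\<bar> \<le> \<kappa> * A * sqrt (real m)"
        by (simp add: B_def mult.assoc)
    qed
    have scale: "a * (\<kappa>0 * x) * (2 * b\<^sup>2) ^ h \<le> \<kappa> * x * (2 * b\<^sup>2) ^ h" if "0 \<le> x" for x h
      using mult_right_mono[OF a\<kappa>0 that] by (intro mult_right_mono) (simp_all add: mult.assoc)
    have scale': "a * (b * (\<kappa>0 * x)) * (2 * b\<^sup>2) ^ h \<le> \<kappa> * b * x * (2 * b\<^sup>2) ^ h" if "0 \<le> x" for x h
      using scale[of "b * x" h] that b by (simp add: mult_ac)
    have B0: "0 \<le> sqrt (real m)" by simp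
    have ev1: "\<bar>ip n (nth_col (ent (E \<omega>)) t) ((gram_op n m (zero_col t (ent (E \<omega>))) ^^ h) (nth_col (ent L) k))\<bar> \<le> \<kappa> * A * (2 * b\<^sup>2) ^ h"
      if "k < r" for h k
      using ev' that scale[of A h] A by (meson less_imp_le order_trans)
    have ev2: "\<bar>ip n (nth_col (ent (E \<omega>)) t) ((gram_op n m (zero_col t (ent (E \<omega>))) ^^ h)
        (mv m (zero_col t (ent (E \<omega>))) (nth_col (ent (F \<omega>)) k)))\<bar> \<le> \<kappa> * b * sqrt (real m) * (2 * b\<^sup>2) ^ h" if "k < r" for h k
      using ev' that scale'[OF B0, of h] unfolding B_def by (meson order_trans)
    have ev3: "\<bar>ip m (nth_col (mtr (ent (E \<omega>))) i) ((gram_op m n (zero_col i (mtr (ent (E \<omega>)))) ^^ h) (nth_col (ent (F \<omega>)) k))\<bar>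
        \<le> \<kappa> * sqrt (real m) * (2 * b\<^sup>2) ^ h" if "k < r" for h k
      using ev' that scale[OF B0, of h] unfolding B_def by (meson order_trans)
    have ev4: "\<bar>ip m (nth_col (mtr (ent (E \<omega>))) i) ((gram_op m n (zero_col i (mtr (ent (E \<omega>)))) ^^ h)
        (mv n (zero_col i (mtr (ent (E \<omega>)))) (nth_col (ent L) k)))\<bar> \<le> \<kappa> * b * A * (2 * b\<^sup>2) ^ h" if "k < r" for h k
      using ev' that scale'[of A h] A by (meson less_imp_le order_trans)
    note bounds = pointwise_bounds[OF mats n t ev1 ev2 ev3 ev4 H0 H, folded B_def, folded err_def]
    show "vnorm (Matrix.row (B \<cdot>\<^sub>m V \<omega>) t - (H \<omega>)\<^sup>T *\<^sub>v Matrix.row (F \<omega>) t) \<le> \<kappa> ^ 40 * (err * vnorm (Matrix.row (F \<omega>) t) + 1 / A)"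
      by (rule bounds(1))
    show "vnorm (Matrix.row ((1 / B) \<cdot>\<^sub>m (U \<omega> * D \<omega>)) i - mat_inv (H \<omega>) *\<^sub>v Matrix.row L i)
      \<le> \<kappa> ^ 43 * (err * vnorm (Matrix.row L i) + 1 / B)"
      by (rule bounds(2))
    show "\<bar>scalar_prod (Matrix.row ((1 / B) \<cdot>\<^sub>m (U \<omega> * D \<omega>)) i) (Matrix.row (B \<cdot>\<^sub>m V \<omega>) t) - (L * (F \<omega>)\<^sup>T) $$ (i, t)\<bar>
      \<le> (\<kappa> ^ 43 * (err * vnorm (Matrix.row L i) + 1 / B))
          * (\<kappa> ^ 6 * vnorm (Matrix.row (F \<omega>) t) + \<kappa> ^ 40 * (err * vnorm (Matrix.row (F \<omega>) t) + 1 / A))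
        + (\<kappa> ^ 9 * vnorm (Matrix.row L i)) * (\<kappa> ^ 40 * (err * vnorm (Matrix.row (F \<omega>) t) + 1 / A))"
      by (rule bounds(3))
  qed
qed

lemma max_sqrt: "0 \<le> x \<Longrightarrow> 0 \<le> y \<Longrightarrow> (max (sqrt x) (sqrt y))\<^sup>2 = max x y"
  by (auto simp: max_def)

theorem theorem3p1:
  fixes M :: "'a measure"
    and r :: nat
    and N T :: "nat \<Rightarrow> nat"
    and L :: "nat \<Rightarrow> real mat"
    and F E M0 X :: "nat \<Rightarrow> 'a \<Rightarrow> real mat"
    and U D V U0 D0 V0 R :: "nat \<Rightarrow> 'a \<Rightarrow> real mat"
    and Y Z Y0 Z0 H0 Lhat Fhat H :: "nat \<Rightarrow> 'a \<Rightarrow> real mat"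
    and SigmaF SigmaL :: "real mat"
    and \<alpha> :: real and \<alpha>i :: "nat \<Rightarrow> real"
    and i t :: nat
  assumes prob: "prob_space M"
    and r_pos: "0 < r"
    and r_le: "\<And>n. r \<le> N n \<and> r \<le> T n"
    and N_lim: "filterlim N at_top sequentially"
    and T_lim: "filterlim T at_top sequentially"
    and L_dim: "\<And>n. L n \<in> carrier_mat (N n) r"
    and F_rand: "\<And>n. random_matrix M (T n) r (F n)"
    and E_rand: "\<And>n. random_matrix M (N n) (T n) (E n)"
    and M0_def: "\<And>n \<omega>. M0 n \<omega> = L n * (F n \<omega>)\<^sup>T"
    and X_def: "\<And>n \<omega>. X n \<omega> = M0 n \<omega> + E n \<omega>"
    and svd_X: "\<And>n \<omega>. \<omega> \<in> space M \<Longrightarrow> top_svd (N n) (T n) r (X n \<omega>) (U n \<omega>) (D n \<omega>) (V n \<omega>)"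
    and Lhat_def: "\<And>n \<omega>. Lhat n \<omega> = (1 / sqrt (real (T n))) \<cdot>\<^sub>m (U n \<omega> * D n \<omega>)"
    and Fhat_def: "\<And>n \<omega>. Fhat n \<omega> = sqrt (real (T n)) \<cdot>\<^sub>m V n \<omega>"
    and Y_def: "\<And>n \<omega>. Y n \<omega> = U n \<omega> * diag_sqrt (D n \<omega>)"
    and Z_def: "\<And>n \<omega>. Z n \<omega> = V n \<omega> * diag_sqrt (D n \<omega>)"
    and svd_M0: "\<And>n \<omega>. \<omega> \<in> space M \<Longrightarrow>
                   top_svd (N n) (T n) r (M0 n \<omega>) (U0 n \<omega>) (D0 n \<omega>) (V0 n \<omega>)"
    and Y0_def: "\<And>n \<omega>. Y0 n \<omega> = U0 n \<omega> * diag_sqrt (D0 n \<omega>)"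
    and Z0_def: "\<And>n \<omega>. Z0 n \<omega> = V0 n \<omega> * diag_sqrt (D0 n \<omega>)"
    and H0_def: "\<And>n \<omega>. H0 n \<omega> = balancing_matrix r (T n) (L n) (F n \<omega>) (Y0 n \<omega>) (Z0 n \<omega>)"
    and R_min: "\<And>n \<omega>. \<omega> \<in> space M \<Longrightarrow>
                  procrustes_minimizer r (Y n \<omega>) (Z n \<omega>) (Y0 n \<omega>) (Z0 n \<omega>) (R n \<omega>)"
    and H_def: "\<And>n \<omega>. H n \<omega> = mat_inv (diag_sqrt (D n \<omega>) * R n \<omega> * H0 n \<omega>)"
    and A1_pd: "pos_def_mat r SigmaF"
    and A1_lim: "\<And>j k. j < r \<Longrightarrow> k < r \<Longrightarrow>
           tendsto_in_prob M
             (\<lambda>n \<omega>. (1 / real (T n)) * (\<Sum>s<T n. F n \<omega> $$ (s, j) * F n \<omega> $$ (s, k)))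
             (SigmaF $$ (j, k))"
    and \<alpha>_range: "0 < \<alpha>" "\<alpha> \<le> 1"
    and A2_pd: "pos_def_mat r SigmaL"
    and A2_lim: "\<And>j k. j < r \<Longrightarrow> k < r \<Longrightarrow>
           (\<lambda>n. real (N n) powr (- \<alpha>) * (\<Sum>l<N n. L n $$ (l, j) * L n $$ (l, k)))
             \<longlonglongrightarrow> SigmaL $$ (j, k)"
    and A3: "card {x. eigenvalue (SigmaL * SigmaF) x} = r"
    and A4_F: "\<exists>C>0. \<forall>n. \<forall>s<T n.
           integrable M (\<lambda>\<omega>. (vnorm (Matrix.row (F n \<omega>) s))\<^sup>2) \<and>
           (\<integral>\<omega>. (vnorm (Matrix.row (F n \<omega>) s))\<^sup>2 \<partial>M) \<le> C"
    and A4_\<alpha>i: "\<And>l. \<alpha>i l \<le> 1"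
    and A4_L: "\<exists>C>0. \<forall>n. \<forall>l<N n.
           vnorm (Matrix.row (L n) l) \<le> C * real (N n) powr ((\<alpha>i l - 1) / 2)"
    and B1_integrable: "\<And>n l s. l < N n \<Longrightarrow> s < T n \<Longrightarrow> integrable M (\<lambda>\<omega>. (E n \<omega> $$ (l, s))\<^sup>2)"
    and B1_mean: "\<And>n l s. l < N n \<Longrightarrow> s < T n \<Longrightarrow>
           AE \<omega> in M. real_cond_exp M (sigma_of_matrix M (N n) (T n) (M0 n))
                        (\<lambda>\<omega>. E n \<omega> $$ (l, s)) \<omega> = 0"
    and B1_var: "\<And>n l s. l < N n \<Longrightarrow> s < T n \<Longrightarrow>
           AE \<omega> in M. real_cond_exp M (sigma_of_matrix M (N n) (T n) (M0 n))
                        (\<lambda>\<omega>. (E n \<omega> $$ (l, s))\<^sup>2) \<omega> = (\<integral>\<omega>. (E n \<omega> $$ (l, s))\<^sup>2 \<partial>M)"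
    and B1_bound: "\<exists>C>0. \<forall>n. \<forall>l<N n. \<forall>s<T n. (\<integral>\<omega>. (E n \<omega> $$ (l, s))\<^sup>2 \<partial>M) \<le> C"
    and B1_indep: "\<And>n. cond_indep_vars M (sigma_of_matrix M (N n) (T n) (M0 n))
           (\<lambda>p \<omega>. E n \<omega> $$ p) ({..<N n} \<times> {..<T n})"
    and B2: "\<exists>C>0. (\<lambda>n. measure M {\<omega> \<in> space M.
           spectral_norm (E n \<omega>) \<le> C * max (sqrt (real (N n))) (sqrt (real (T n)))}) \<longlonglongrightarrow> 1"
    and rate: "(\<lambda>n. max (real (N n)) (real (T n))) \<in> o(\<lambda>n. real (N n) powr \<alpha> * real (T n))"
  shows "bigO_in_prob M
           (\<lambda>n \<omega>. vnorm (Matrix.row (Fhat n \<omega>) t - (H n \<omega>)\<^sup>T *\<^sub>v Matrix.row (F n \<omega>) t))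
           (\<lambda>n. 1 / sqrt (real (N n) powr \<alpha>)
                + max (real (N n)) (real (T n)) / (real (N n) powr \<alpha> * real (T n))) \<and>
         bigO_in_prob M
           (\<lambda>n \<omega>. vnorm (Matrix.row (Lhat n \<omega>) i - mat_inv (H n \<omega>) *\<^sub>v Matrix.row (L n) i))
           (\<lambda>n. 1 / sqrt (real (T n))
                + sqrt (real (N n) powr \<alpha>i i / real (N n))
                  * (max (real (N n)) (real (T n)) / (real (N n) powr \<alpha> * real (T n)))) \<and>
         bigO_in_prob M
           (\<lambda>n \<omega>. scalar_prod (Matrix.row (Lhat n \<omega>) i) (Matrix.row (Fhat n \<omega>) t) - M0 n \<omega> $$ (i, t))
           (\<lambda>n. 1 / sqrt (real (T n))
                + sqrt (real (N n) powr \<alpha>i i / real (N n)) * (1 / sqrt (real (N n) powr \<alpha>))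
                + sqrt (real (N n) powr \<alpha>i i / real (N n))
                  * (max (real (N n)) (real (T n)) / (real (N n) powr \<alpha> * real (T n)))
                + max (sqrt (real (N n))) (sqrt (real (T n)))
                  / (sqrt (real (N n) powr \<alpha>) * real (T n)))"
proof -
  interpret prob_space M by fact

  \<comment> \<open>Constants provided by the assumptions\<close>
  obtain \<kappa>F \<epsilon>F where \<kappa>F: "0 < \<kappa>F" and \<epsilon>F: "0 < \<epsilon>F"
    and frameF: "\<forall>\<kappa> n W s y. \<kappa>F \<le> \<kappa> \<longrightarrow> 0 < s \<longrightarrow>
      (\<forall>j<r. \<forall>k<r. \<bar>(\<Sum>i<n. W i j * W i k) / s - SigmaF $$ (j, k)\<bar> \<le> \<epsilon>F) \<longrightarrow>
      sqrt s / \<kappa> * nrm r y \<le> nrm n (mv r W y) \<and> nrm n (mv r W y) \<le> \<kappa> * sqrt s * nrm r y"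
    using pos_def_frame[OF A1_pd] by - (elim exE conjE, rule that)
  obtain \<kappa>L \<epsilon>L where \<kappa>L: "0 < \<kappa>L" and \<epsilon>L: "0 < \<epsilon>L"
    and frameL: "\<forall>\<kappa> n W s y. \<kappa>L \<le> \<kappa> \<longrightarrow> 0 < s \<longrightarrow>
      (\<forall>j<r. \<forall>k<r. \<bar>(\<Sum>i<n. W i j * W i k) / s - SigmaL $$ (j, k)\<bar> \<le> \<epsilon>L) \<longrightarrow>
      sqrt s / \<kappa> * nrm r y \<le> nrm n (mv r W y) \<and> nrm n (mv r W y) \<le> \<kappa> * sqrt s * nrm r y"
    using pos_def_frame[OF A2_pd] by - (elim exE conjE, rule that)
  obtain CF where CF: "0 < CF" "\<And>n s. s < T n \<Longrightarrow> integrable M (\<lambda>\<omega>. (vnorm (Matrix.row (F n \<omega>) s))\<^sup>2)"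
    "\<And>n s. s < T n \<Longrightarrow> (\<integral>\<omega>. (vnorm (Matrix.row (F n \<omega>) s))\<^sup>2 \<partial>M) \<le> CF"
    using A4_F by blast
  obtain CL where CL: "0 < CL" "\<And>n l. l < N n \<Longrightarrow> vnorm (Matrix.row (L n) l) \<le> CL * real (N n) powr ((\<alpha>i l - 1) / 2)"
    using A4_L by blast
  obtain CE where CE: "0 < CE" "\<And>n l s. l < N n \<Longrightarrow> s < T n \<Longrightarrow> (\<integral>\<omega>. (E n \<omega> $$ (l, s))\<^sup>2 \<partial>M) \<le> CE"
    using B1_bound by blast
  obtain C0 where C0: "0 < C0" and spec: "(\<lambda>n. measure M {\<omega> \<in> space M.
      spectral_norm (E n \<omega>) \<le> C0 * max (sqrt (real (N n))) (sqrt (real (T n)))}) \<longlonglongrightarrow> 1"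
    using B2 by blast

  \<comment> \<open>Scales of signal, noise and loadings\<close>
  define s where "s n = real (N n) powr \<alpha>" for n
  define A where "A n = sqrt (s n)" for n
  define B where "B n = sqrt (real (T n))" for n
  define b where "b n = C0 * max (sqrt (real (N n))) (sqrt (real (T n)))" for n
  define \<delta> where "\<delta> n = max (real (N n)) (real (T n)) / (s n * real (T n))" for n
  define err where "err n = 1 / (A n * B n) + (b n / (A n * B n))\<^sup>2" for n
  define lam where "lam n = sqrt (real (N n) powr \<alpha>i i / real (N n))" for n
  define l where "l n = vnorm (Matrix.row (L n) i)" for n
  define f where "f n \<omega> = vnorm (Matrix.row (F n \<omega>) t)" for n \<omega>
  have NT: "1 \<le> real (N n)" "1 \<le> real (T n)" for n
    using r_le[of n] r_pos by auto
  have s1: "1 \<le> s n" for n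
    unfolding s_def using NT(1)[of n] \<alpha>_range by (intro ge_one_powr_ge_zero) auto
  have A1: "1 \<le> A n" and B1: "1 \<le> B n" and b0: "0 < b n" and \<delta>0: "0 \<le> \<delta> n" for n
    using s1[of n] NT[of n] C0 by (auto simp: A_def B_def b_def \<delta>_def less_max_iff_disj)
  have bsq: "(b n)\<^sup>2 = C0\<^sup>2 * max (real (N n)) (real (T n))" for n
    by (simp add: b_def power_mult_distrib max_sqrt)
  have ABsq: "(A n * B n)\<^sup>2 = s n * real (T n)" for n
    using s1[of n] by (simp add: A_def B_def power_mult_distrib)
  have \<delta>_eq: "(b n / (A n * B n))\<^sup>2 = C0\<^sup>2 * \<delta> n" for n
    by (simp add: power_divide bsq ABsq \<delta>_def)
  have lam: "0 \<le> lam n" "lam n \<le> 1" for n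
  proof -
    have "real (N n) powr \<alpha>i i \<le> real (N n) powr 1"
      using NT(1)[of n] A4_\<alpha>i by (intro powr_mono) auto
    then show "lam n \<le> 1" "0 \<le> lam n"
      using NT(1)[of n] by (simp_all add: lam_def)
  qed
  have l_le: "l n \<le> CL * lam n" if "i < N n" for n
  proof -
    have "real (N n) powr ((\<alpha>i i - 1) / 2) = sqrt (real (N n) powr (\<alpha>i i - 1))"
      by (simp add: powr_half_sqrt[symmetric] powr_powr)
    also have "\<dots> = lam n"
      using NT(1)[of n] by (simp add: lam_def powr_diff)
    finally show ?thesis
      using CL(2)[OF that] by (simp add: l_def)
  qed
  \<comment> \<open>The rate condition concerns max(N, T), which is the squared noise level up to a
    constant; taking roots gives \<open>b n = o(A n * B n)\<close>.\<close>
  have b_small: "\<forall>\<^sub>F n in sequentially. b n \<le> c * (A n * B n)" if c: "0 < c" for c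
  proof -
    have "0 < (c / C0)\<^sup>2"
      using c C0 by simp
    from landau_o.smallD[OF rate this] show ?thesis
    proof eventually_elim
      case (elim n)
      have "(b n)\<^sup>2 \<le> C0\<^sup>2 * ((c / C0)\<^sup>2 * (s n * real (T n)))"
        unfolding bsq using elim s1[of n] by (intro mult_left_mono) (auto simp: s_def)
      also have "\<dots> = (c * (A n * B n))\<^sup>2"
        using C0 by (simp add: power_mult_distrib[of c] ABsq power_divide)
      finally show ?case
        using c A1[of n] B1[of n] by (intro power2_le_imp_le[of "b n"]) auto
    qed
  qed

  \<comment> \<open>One event of probability at least 1 - d for all estimates\<close>
  define bnd where "bnd n \<kappa> \<omega> \<longleftrightarrow> f n \<omega> \<le> \<kappa> \<and>
      vnorm (Matrix.row (Fhat n \<omega>) t - (H n \<omega>)\<^sup>T *\<^sub>v Matrix.row (F n \<omega>) t) \<le> \<kappa> ^ 40 * (err n * f n \<omega> + 1 / A n) \<and>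
      vnorm (Matrix.row (Lhat n \<omega>) i - mat_inv (H n \<omega>) *\<^sub>v Matrix.row (L n) i) \<le> \<kappa> ^ 43 * (err n * l n + 1 / B n) \<and>
      \<bar>scalar_prod (Matrix.row (Lhat n \<omega>) i) (Matrix.row (Fhat n \<omega>) t) - M0 n \<omega> $$ (i, t)\<bar>
        \<le> (\<kappa> ^ 43 * (err n * l n + 1 / B n)) * (\<kappa> ^ 6 * f n \<omega> + \<kappa> ^ 40 * (err n * f n \<omega> + 1 / A n))
          + (\<kappa> ^ 9 * l n) * (\<kappa> ^ 40 * (err n * f n \<omega> + 1 / A n))" for n \<kappa> \<omega>
  have ev_it: "\<forall>\<^sub>F n in sequentially. i < N n \<and> t < T n"
    using eventually_compose_filterlim[OF eventually_gt_at_top N_lim, of i]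
      eventually_compose_filterlim[OF eventually_gt_at_top T_lim, of t] by eventually_elim simp
  have main: "\<exists>\<kappa>\<ge>1. \<forall>\<^sub>F n in sequentially. \<exists>S\<in>sets M. 1 - d \<le> measure M S \<and> (\<forall>\<omega>\<in>S. bnd n \<kappa> \<omega>)" if d: "0 < d" for d
  proof -
    \<comment> \<open>Four failures are budgeted at \<open>c0\<close> each: noise tails, Gram matrix
      of the factors, size of the factor row, and noise norm. \<open>c0 < 1\<close> keeps the
      probability of \<open>SE n\<close> positive.\<close>
    define c0 where "c0 = min d 1 / 8"
    define a where "a = 1 + (8 * real r + (real r)\<^sup>2) * CE / c0"
    define Kf where "Kf = 1 + CF / c0"
    define \<kappa>0 where "\<kappa>0 = 1 + \<kappa>L + \<kappa>F"
    define \<kappa> where "\<kappa> = 2 + real r + \<kappa>0 + a * \<kappa>0\<^sup>2 + Kf"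
    have c0: "0 < c0" "4 * c0 \<le> d" "c0 < 1"
      using d by (auto simp: c0_def min_def)
    \<comment> \<open>The failure probabilities have the form \<open>x / a\<^sup>2\<close>; the
      level \<open>1 + x / c0\<close> brings them down to \<open>c0\<close>, which is the shape of
      \<open>a\<close> and \<open>Kf\<close>.\<close>
    have quot: "1 \<le> 1 + x / c0" "x / (1 + x / c0)\<^sup>2 \<le> c0" if "0 \<le> x" for x
    proof -
      let ?z = "1 + x / c0"
      show z: "1 \<le> ?z"
        using that c0 by simp
      have "x = c0 * (x / c0)"
        using c0 by simp
      also have "\<dots> \<le> c0 * ?z\<^sup>2"
        using c0 self_le_power[OF z, of 2] by (intro mult_left_mono) auto
      finally show "x / ?z\<^sup>2 \<le> c0"
        using z by (simp add: divide_le_eq)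
    qed
    have a: "1 \<le> a" "(8 * real r + (real r)\<^sup>2) * (CE / a\<^sup>2) \<le> c0"
      using quot[of "(8 * real r + (real r)\<^sup>2) * CE"] CE(1) by (simp_all add: a_def)
    have Kf: "1 \<le> Kf" "CF / Kf\<^sup>2 \<le> c0"
      using quot[of CF] CF(1) by (simp_all add: Kf_def)
    have \<kappa>0: "1 \<le> \<kappa>0" "\<kappa>L \<le> \<kappa>0" "\<kappa>F \<le> \<kappa>0"
      using \<kappa>L \<kappa>F by (auto simp: \<kappa>0_def)
    have ak: "0 \<le> a * \<kappa>0\<^sup>2"
      using a by simp
    have \<kappa>: "2 \<le> \<kappa>" "real r \<le> \<kappa>" "\<kappa>0 \<le> \<kappa>" "a * \<kappa>0\<^sup>2 \<le> \<kappa>" "Kf \<le> \<kappa>"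
      using ak \<kappa>0(1) Kf(1) by (auto simp: \<kappa>_def)
    have ev_L: "\<forall>\<^sub>F n in sequentially. \<forall>j\<in>{..<r}. \<forall>k\<in>{..<r}.
        \<bar>(\<Sum>l<N n. L n $$ (l, j) * L n $$ (l, k)) / s n - SigmaL $$ (j, k)\<bar> \<le> \<epsilon>L"
    proof (intro eventually_ball_finite ballI finite_lessThan)
      fix j k assume "j \<in> {..<r}" "k \<in> {..<r}"
      then have "\<forall>\<^sub>F n in sequentially. dist (real (N n) powr (- \<alpha>) * (\<Sum>l<N n. L n $$ (l, j) * L n $$ (l, k))) (SigmaL $$ (j, k)) < \<epsilon>L"
        using A2_lim[of j k] \<epsilon>L by (intro tendstoD) auto
      then show "\<forall>\<^sub>F n in sequentially. \<bar>(\<Sum>l<N n. L n $$ (l, j) * L n $$ (l, k)) / s n - SigmaL $$ (j, k)\<bar> \<le> \<epsilon>L"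
        by eventually_elim (simp add: dist_real_def s_def powr_minus_divide)
    qed
    define SF where "SF n j k = {\<omega>\<in>space M. \<epsilon>F < \<bar>(1 / real (T n)) * (\<Sum>s<T n. F n \<omega> $$ (s, j) * F n \<omega> $$ (s, k)) - SigmaF $$ (j, k)\<bar>}" for n j k
    \<comment> \<open>Each of the r^2 Gram entries gets an equal share of the budget.\<close>
    have ev_F: "\<forall>\<^sub>F n in sequentially. \<forall>j\<in>{..<r}. \<forall>k\<in>{..<r}. prob (SF n j k) < c0 / (real r)\<^sup>2"
    proof (intro eventually_ball_finite ballI finite_lessThan)
      fix j k assume "j \<in> {..<r}" "k \<in> {..<r}"
      then have "(\<lambda>n. prob (SF n j k)) \<longlonglongrightarrow> 0"
        using A1_lim[of j k] \<epsilon>F by (simp add: tendsto_in_prob_def SF_def)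
      then show "\<forall>\<^sub>F n in sequentially. prob (SF n j k) < c0 / (real r)\<^sup>2"
        by (rule order_tendstoD) (use c0 r_pos in simp)
    qed
    define SE where "SE n = {\<omega>\<in>space M. spectral_norm (E n \<omega>) \<le> b n}" for n
    have ev_E: "\<forall>\<^sub>F n in sequentially. 1 - c0 < prob (SE n)"
      using spec c0 unfolding SE_def b_def by (intro order_tendstoD) auto
    have ev_b: "\<forall>\<^sub>F n in sequentially. b n \<le> 1 / (4 * \<kappa>\<^sup>2) * (A n * B n)"
      using \<kappa> by (intro b_small) simp
    have "\<forall>\<^sub>F n in sequentially. \<exists>S\<in>sets M. 1 - d \<le> prob S \<and> (\<forall>\<omega>\<in>S. bnd n \<kappa> \<omega>)"
      using ev_it ev_L ev_F ev_E ev_b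
    proof eventually_elim
      case (elim n)
      then have it: "i < N n" "t < T n" by auto
      have Lf: "A n / \<kappa>0 * nrm r y \<le> nrm (N n) (mv r (ent (L n)) y) \<and> nrm (N n) (mv r (ent (L n)) y) \<le> \<kappa>0 * A n * nrm r y" for y
        unfolding A_def by (rule frameL[rule_format, OF \<kappa>0(2)]) (use s1[of n] elim(2) in auto)
      have Fc: "F n \<omega> \<in> carrier_mat (T n) r" if "\<omega> \<in> space M" for \<omega>
        using F_rand[of n] that by (auto simp: random_matrix_def)
      have Fm[measurable]: "(\<lambda>\<omega>. F n \<omega> $$ (s, k)) \<in> borel_measurable M" if "s < T n" "k < r" for s k
        using F_rand[of n] that by (auto simp: random_matrix_def)
      \<comment> \<open>Measurability of the spectral norm is bypassed: \<open>measure\<close> is 0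
        outside the measurable sets, and this one has positive measure.\<close>
      have SE: "SE n \<in> sets M"
        using elim(4) c0 by (metis measure_notin_sets diff_gt_0_iff_gt less_asym)
      have SFm: "SF n j k \<in> sets M" if "j < r" "k < r" for j k
      proof -
        have [measurable]: "(\<lambda>\<omega>. \<Sum>s<T n. F n \<omega> $$ (s, j) * F n \<omega> $$ (s, k)) \<in> borel_measurable M"
          using Fm that by (intro borel_measurable_sum borel_measurable_times) auto
        show ?thesis
          unfolding SF_def by measurable
      qed
      define SF' where "SF' = (\<Union>j<r. \<Union>k<r. SF n j k)"
      have SF': "SF' \<in> sets M" "prob SF' \<le> c0"
      proof -
        show "SF' \<in> sets M"
          unfolding SF'_def using SFm by blast
        have "prob SF' \<le> (\<Sum>j<r. prob (\<Union>k<r. SF n j k))"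
          unfolding SF'_def using SFm by (intro finite_measure_subadditive_finite) auto
        also have "\<dots> \<le> (\<Sum>j<r. \<Sum>k<r. prob (SF n j k))"
          using SFm by (intro sum_mono finite_measure_subadditive_finite) auto
        also have "\<dots> \<le> (\<Sum>j<r. \<Sum>k<r. c0 / (real r)\<^sup>2)"
          using elim(3) by (intro sum_mono) (auto intro: less_imp_le)
        also have "\<dots> = c0"
          using r_pos by (simp add: power2_eq_square)
        finally show "prob SF' \<le> c0" .
      qed
      have fm[measurable]: "f n \<in> borel_measurable M"
      proof -
        have "(\<lambda>\<omega>. nrm r (ent (F n \<omega>) t)) \<in> borel_measurable M"
          using Fm it by (intro borel_measurable_nrm) auto
        then show ?thesis
          unfolding f_def using row_vnorm[OF Fc it(2)] by (subst measurable_cong) auto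
      qed
      \<comment> \<open>The bounded second moment of the factor row keeps its norm below the
        constant \<open>Kf\<close> with high probability, for all n alike.\<close>
      define Sf where "Sf = {\<omega>\<in>space M. Kf \<le> \<bar>f n \<omega>\<bar>}"
      have Sf: "Sf \<in> sets M" "prob Sf \<le> c0"
      proof -
        show "Sf \<in> sets M"
          unfolding Sf_def by measurable
        have "prob Sf \<le> (\<integral>\<omega>. (f n \<omega>)\<^sup>2 \<partial>M) / Kf\<^sup>2"
          unfolding Sf_def by (rule second_moment_method[OF fm]) (use CF(2)[OF it(2)] Kf(1) in \<open>auto simp: f_def\<close>)
        also have "\<dots> \<le> CF / Kf\<^sup>2"
          using CF(3)[OF it(2)] by (intro divide_right_mono) (auto simp: f_def)
        finally show "prob Sf \<le> c0"
          using Kf(2) by linarith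
      qed
      have b_le: "b n \<le> A n * sqrt (real (T n)) / (4 * \<kappa>\<^sup>2)"
        using elim(5) by (simp add: B_def mult.commute)
      have M0_eq: "M0 n = (\<lambda>\<omega>. L n * (F n \<omega>)\<^sup>T)"
        using M0_def by auto
      have a0: "0 < a" and A0: "0 < A n" and CE0: "0 \<le> CE"
        using a(1) A1[of n] CE(1) by auto
      have "\<exists>S\<in>sets M. prob S \<le> (8 * real r + (real r)\<^sup>2) * (CE / a\<^sup>2) \<and> (\<forall>\<omega>\<in>space M - S.
        spectral_norm (E n \<omega>) \<le> b n \<longrightarrow>
        (\<forall>y. B n / \<kappa>0 * nrm r y \<le> nrm (T n) (mv r (ent (F n \<omega>)) y) \<and> nrm (T n) (mv r (ent (F n \<omega>)) y) \<le> \<kappa>0 * B n * nrm r y) \<longrightarrow>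
        vnorm (Matrix.row (B n \<cdot>\<^sub>m V n \<omega>) t - (H n \<omega>)\<^sup>T *\<^sub>v Matrix.row (F n \<omega>) t) \<le> \<kappa> ^ 40 * (err n * f n \<omega> + 1 / A n) \<and>
        vnorm (Matrix.row ((1 / B n) \<cdot>\<^sub>m (U n \<omega> * D n \<omega>)) i - mat_inv (H n \<omega>) *\<^sub>v Matrix.row (L n) i)
          \<le> \<kappa> ^ 43 * (err n * l n + 1 / B n) \<and>
        \<bar>scalar_prod (Matrix.row ((1 / B n) \<cdot>\<^sub>m (U n \<omega> * D n \<omega>)) i) (Matrix.row (B n \<cdot>\<^sub>m V n \<omega>) t) - (L n * (F n \<omega>)\<^sup>T) $$ (i, t)\<bar>
          \<le> (\<kappa> ^ 43 * (err n * l n + 1 / B n)) * (\<kappa> ^ 6 * f n \<omega> + \<kappa> ^ 40 * (err n * f n \<omega> + 1 / A n))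
            + (\<kappa> ^ 9 * l n) * (\<kappa> ^ 40 * (err n * f n \<omega> + 1 / A n)))"
        unfolding err_def f_def l_def B_def
        by (rule good_event[where R = "R n" and ?U0.0 = "U0 n" and ?V0.0 = "V0 n" and ?D0.0 = "D0 n" and ?H0.0 = "H0 n",
            OF prob r_pos it L_dim F_rand E_rand _ _ _ _ _ B1_integrable _ _ _ CE0 _ A0 b0 b_le a0 \<kappa>0(1) \<kappa>(1-4)])
          (use svd_X[of _ n] svd_M0[of _ n] R_min[of _ n] B1_mean[of _ n] B1_var[of _ n] B1_indep[of n] CE(2) Lf in
            \<open>auto simp: X_def M0_def Y_def Z_def Y0_def Z0_def H0_def H_def M0_eq\<close>)
      then obtain S where S: "S \<in> sets M" "prob S \<le> (8 * real r + (real r)\<^sup>2) * (CE / a\<^sup>2)"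
        and S': "\<And>\<omega>. \<omega> \<in> space M - S \<Longrightarrow> spectral_norm (E n \<omega>) \<le> b n \<Longrightarrow>
        (\<forall>y. B n / \<kappa>0 * nrm r y \<le> nrm (T n) (mv r (ent (F n \<omega>)) y) \<and> nrm (T n) (mv r (ent (F n \<omega>)) y) \<le> \<kappa>0 * B n * nrm r y) \<Longrightarrow>
        vnorm (Matrix.row (B n \<cdot>\<^sub>m V n \<omega>) t - (H n \<omega>)\<^sup>T *\<^sub>v Matrix.row (F n \<omega>) t) \<le> \<kappa> ^ 40 * (err n * f n \<omega> + 1 / A n) \<and>
        vnorm (Matrix.row ((1 / B n) \<cdot>\<^sub>m (U n \<omega> * D n \<omega>)) i - mat_inv (H n \<omega>) *\<^sub>v Matrix.row (L n) i)
          \<le> \<kappa> ^ 43 * (err n * l n + 1 / B n) \<and>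
        \<bar>scalar_prod (Matrix.row ((1 / B n) \<cdot>\<^sub>m (U n \<omega> * D n \<omega>)) i) (Matrix.row (B n \<cdot>\<^sub>m V n \<omega>) t) - (L n * (F n \<omega>)\<^sup>T) $$ (i, t)\<bar>
          \<le> (\<kappa> ^ 43 * (err n * l n + 1 / B n)) * (\<kappa> ^ 6 * f n \<omega> + \<kappa> ^ 40 * (err n * f n \<omega> + 1 / A n))
            + (\<kappa> ^ 9 * l n) * (\<kappa> ^ 40 * (err n * f n \<omega> + 1 / A n))"
        by meson
      let ?X = "S \<union> SF' \<union> Sf"
      show ?case
      proof (intro bexI[of _ "SE n - ?X"] conjI ballI)
        show "SE n - ?X \<in> sets M"
          using SE S(1) SF'(1) Sf(1) by auto
        have "prob ?X \<le> 3 * c0"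
          using measure_Un_le[of "S \<union> SF'" M Sf] measure_Un_le[of S M SF'] S SF' Sf a(2) by simp
        moreover have "prob (SE n) \<le> prob ((SE n - ?X) \<union> ?X)"
          using SE S(1) SF'(1) Sf(1) by (intro finite_measure_mono) auto
        moreover have "prob ((SE n - ?X) \<union> ?X) \<le> prob (SE n - ?X) + prob ?X"
          using SE S(1) SF'(1) Sf(1) by (intro measure_Un_le) auto
        ultimately show "1 - d \<le> prob (SE n - ?X)"
          using elim(4) c0(2) by linarith
        fix \<omega> assume \<omega>: "\<omega> \<in> SE n - ?X"
        then have \<omega>S: "\<omega> \<in> space M - S" and sp: "spectral_norm (E n \<omega>) \<le> b n"
          by (auto simp: SE_def)
        have close: "\<bar>(\<Sum>s<T n. F n \<omega> $$ (s, j) * F n \<omega> $$ (s, k)) / real (T n) - SigmaF $$ (j, k)\<bar> \<le> \<epsilon>F" if jk: "j < r" "k < r" for j k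
        proof -
          have "\<omega> \<notin> SF n j k"
            using \<omega> jk by (auto simp: SF'_def)
          then show ?thesis
            using \<omega>S by (auto simp: SF_def not_less)
        qed
        have "\<forall>y. B n / \<kappa>0 * nrm r y \<le> nrm (T n) (mv r (ent (F n \<omega>)) y) \<and> nrm (T n) (mv r (ent (F n \<omega>)) y) \<le> \<kappa>0 * B n * nrm r y"
          unfolding B_def by (intro allI frameF[rule_format, OF \<kappa>0(3)] close) (use NT(2)[of n] in auto)
        moreover have "f n \<omega> \<le> \<kappa>"
          using \<omega> \<omega>S \<kappa>(5) by (auto simp: Sf_def)
        ultimately show "bnd n \<kappa> \<omega>"
          unfolding bnd_def Fhat_def Lhat_def M0_def B_def[symmetric] using S'[OF \<omega>S sp] by blast
      qed
    qed
    then show ?thesis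
      using \<kappa>(1) by (intro exI[of _ \<kappa>]) auto
  qed

  \<comment> \<open>From pointwise bounds to stochastic orders\<close>
  have bigO: "bigO_in_prob M Z g"
    if Z: "\<And>\<kappa>. 1 \<le> \<kappa> \<Longrightarrow> \<exists>K>0. \<forall>\<^sub>F n in sequentially. \<forall>\<omega>. bnd n \<kappa> \<omega> \<longrightarrow> \<bar>Z n \<omega>\<bar> \<le> K * g n" for Z g
    unfolding bigO_in_prob_def
  proof (intro allI impI)
    fix d :: real assume "0 < d"
    from main[OF this] obtain \<kappa> where \<kappa>: "1 \<le> \<kappa>"
      and ev: "\<forall>\<^sub>F n in sequentially. \<exists>S\<in>sets M. 1 - d \<le> prob S \<and> (\<forall>\<omega>\<in>S. bnd n \<kappa> \<omega>)"
      by blast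
    from Z[OF \<kappa>] obtain K where K: "0 < K" "\<forall>\<^sub>F n in sequentially. \<forall>\<omega>. bnd n \<kappa> \<omega> \<longrightarrow> \<bar>Z n \<omega>\<bar> \<le> K * g n"
      by blast
    have "\<forall>\<^sub>F n in sequentially. \<exists>S\<in>sets M. 1 - d \<le> prob S \<and> (\<forall>\<omega>\<in>S. \<bar>Z n \<omega>\<bar> \<le> K * g n)"
      using ev K(2) by eventually_elim blast
    then show "\<exists>K>0. \<forall>\<^sub>F n in sequentially. \<exists>S\<in>sets M. 1 - d \<le> prob S \<and> (\<forall>\<omega>\<in>S. \<bar>Z n \<omega>\<bar> \<le> K * g n)"
      using K(1) by blast
  qed
  have ev_ok: "\<forall>\<^sub>F n in sequentially. i < N n \<and> b n \<le> A n * B n"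
    using ev_it b_small[of 1] by (auto elim: eventually_elim2)
  have vnorm0: "0 \<le> vnorm v" for v
    by (simp add: vnorm_eq_nrm)
  let ?K1 = "\<lambda>\<kappa>. \<kappa> + \<kappa> * C0\<^sup>2 + 1" and ?K2 = "CL + CL * C0\<^sup>2 + 1"
  have K1: "0 < ?K1 \<kappa>" if "1 \<le> \<kappa>" for \<kappa>
    using that by (intro add_pos_nonneg add_nonneg_pos) auto
  have K2: "0 < ?K2"
    using CL(1) by (simp add: add_pos_nonneg)
  have rates': "err n * f n \<omega> + 1 / A n \<le> ?K1 \<kappa> * (1 / A n + \<delta> n)"
      "err n * l n + 1 / B n \<le> ?K2 * (1 / B n + lam n * \<delta> n)"
      "(\<kappa> ^ 43 * (err n * l n + 1 / B n)) * (\<kappa> ^ 6 * f n \<omega> + \<kappa> ^ 40 * (err n * f n \<omega> + 1 / A n))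
          + (\<kappa> ^ 9 * l n) * (\<kappa> ^ 40 * (err n * f n \<omega> + 1 / A n))
      \<le> (\<kappa> ^ 43 * ?K2 * (\<kappa> ^ 7 + \<kappa> ^ 40 * (2 * \<kappa> + 1)) + \<kappa> ^ 49 * CL * ?K1 \<kappa>)
        * (1 / B n + lam n * (1 / A n) + lam n * \<delta> n)"
    if \<kappa>: "1 \<le> \<kappa>" and n: "i < N n" "b n \<le> A n * B n" and bnd: "bnd n \<kappa> \<omega>" for n \<kappa> \<omega>
  proof -
    have f: "0 \<le> f n \<omega>" "f n \<omega> \<le> \<kappa>" and l: "0 \<le> l n"
      using bnd vnorm0 by (auto simp: bnd_def f_def l_def)
    note R = rates[OF A1 B1 less_imp_le[OF b0] n(2) _ less_imp_le[OF CL(1)] \<kappa> \<delta>_eq \<delta>0 f l l_le[OF n(1)] lam, folded err_def]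
    show "err n * f n \<omega> + 1 / A n \<le> ?K1 \<kappa> * (1 / A n + \<delta> n)"
      by (rule R(1)) simp
    show "err n * l n + 1 / B n \<le> ?K2 * (1 / B n + lam n * \<delta> n)"
      by (rule R(2)) simp
    show "(\<kappa> ^ 43 * (err n * l n + 1 / B n)) * (\<kappa> ^ 6 * f n \<omega> + \<kappa> ^ 40 * (err n * f n \<omega> + 1 / A n))
          + (\<kappa> ^ 9 * l n) * (\<kappa> ^ 40 * (err n * f n \<omega> + 1 / A n))
      \<le> (\<kappa> ^ 43 * ?K2 * (\<kappa> ^ 7 + \<kappa> ^ 40 * (2 * \<kappa> + 1)) + \<kappa> ^ 49 * CL * ?K1 \<kappa>)
        * (1 / B n + lam n * (1 / A n) + lam n * \<delta> n)"
      by (rule R(3)) simp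
  qed

  \<comment> \<open>The three rates\<close>
  show ?thesis
  proof (intro conjI bigO)
    fix \<kappa> :: real assume \<kappa>: "1 \<le> \<kappa>"
    show "\<exists>K>0. \<forall>\<^sub>F n in sequentially. \<forall>\<omega>. bnd n \<kappa> \<omega> \<longrightarrow>
        \<bar>vnorm (Matrix.row (Fhat n \<omega>) t - (H n \<omega>)\<^sup>T *\<^sub>v Matrix.row (F n \<omega>) t)\<bar>
        \<le> K * (1 / sqrt (real (N n) powr \<alpha>) + max (real (N n)) (real (T n)) / (real (N n) powr \<alpha> * real (T n)))"
    proof (intro exI[of _ "\<kappa> ^ 40 * ?K1 \<kappa>"] conjI)
      show "0 < \<kappa> ^ 40 * ?K1 \<kappa>"
        using K1[OF \<kappa>] \<kappa> by simp
      show "\<forall>\<^sub>F n in sequentially. \<forall>\<omega>. bnd n \<kappa> \<omega> \<longrightarrow>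
        \<bar>vnorm (Matrix.row (Fhat n \<omega>) t - (H n \<omega>)\<^sup>T *\<^sub>v Matrix.row (F n \<omega>) t)\<bar>
        \<le> \<kappa> ^ 40 * ?K1 \<kappa> * (1 / sqrt (real (N n) powr \<alpha>) + max (real (N n)) (real (T n)) / (real (N n) powr \<alpha> * real (T n)))"
        using ev_ok
      proof (eventually_elim, intro allI impI)
        fix n \<omega> assume n: "i < N n \<and> b n \<le> A n * B n" and bnd: "bnd n \<kappa> \<omega>"
        have "vnorm (Matrix.row (Fhat n \<omega>) t - (H n \<omega>)\<^sup>T *\<^sub>v Matrix.row (F n \<omega>) t) \<le> \<kappa> ^ 40 * (err n * f n \<omega> + 1 / A n)"
          using bnd by (simp add: bnd_def)
        also have "\<dots> \<le> \<kappa> ^ 40 * (?K1 \<kappa> * (1 / A n + \<delta> n))"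
          using rates'(1)[OF \<kappa> _ _ bnd] n \<kappa> by (intro mult_left_mono) auto
        finally show "\<bar>vnorm (Matrix.row (Fhat n \<omega>) t - (H n \<omega>)\<^sup>T *\<^sub>v Matrix.row (F n \<omega>) t)\<bar>
          \<le> \<kappa> ^ 40 * ?K1 \<kappa> * (1 / sqrt (real (N n) powr \<alpha>) + max (real (N n)) (real (T n)) / (real (N n) powr \<alpha> * real (T n)))"
          unfolding A_def \<delta>_def s_def abs_of_nonneg[OF vnorm0] by (simp only: mult.assoc)
      qed
    qed
    show "\<exists>K>0. \<forall>\<^sub>F n in sequentially. \<forall>\<omega>. bnd n \<kappa> \<omega> \<longrightarrow>
        \<bar>vnorm (Matrix.row (Lhat n \<omega>) i - mat_inv (H n \<omega>) *\<^sub>v Matrix.row (L n) i)\<bar>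
        \<le> K * (1 / sqrt (real (T n)) + sqrt (real (N n) powr \<alpha>i i / real (N n))
                  * (max (real (N n)) (real (T n)) / (real (N n) powr \<alpha> * real (T n))))"
    proof (intro exI[of _ "\<kappa> ^ 43 * ?K2"] conjI)
      show "0 < \<kappa> ^ 43 * ?K2"
        using K2 \<kappa> by simp
      show "\<forall>\<^sub>F n in sequentially. \<forall>\<omega>. bnd n \<kappa> \<omega> \<longrightarrow>
        \<bar>vnorm (Matrix.row (Lhat n \<omega>) i - mat_inv (H n \<omega>) *\<^sub>v Matrix.row (L n) i)\<bar>
        \<le> \<kappa> ^ 43 * ?K2 * (1 / sqrt (real (T n)) + sqrt (real (N n) powr \<alpha>i i / real (N n))
                  * (max (real (N n)) (real (T n)) / (real (N n) powr \<alpha> * real (T n))))"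
        using ev_ok
      proof (eventually_elim, intro allI impI)
        fix n \<omega> assume n: "i < N n \<and> b n \<le> A n * B n" and bnd: "bnd n \<kappa> \<omega>"
        have "vnorm (Matrix.row (Lhat n \<omega>) i - mat_inv (H n \<omega>) *\<^sub>v Matrix.row (L n) i) \<le> \<kappa> ^ 43 * (err n * l n + 1 / B n)"
          using bnd by (simp add: bnd_def)
        also have "\<dots> \<le> \<kappa> ^ 43 * (?K2 * (1 / B n + lam n * \<delta> n))"
          using rates'(2)[OF \<kappa> _ _ bnd] n \<kappa> by (intro mult_left_mono) auto
        finally show "\<bar>vnorm (Matrix.row (Lhat n \<omega>) i - mat_inv (H n \<omega>) *\<^sub>v Matrix.row (L n) i)\<bar>
          \<le> \<kappa> ^ 43 * ?K2 * (1 / sqrt (real (T n)) + sqrt (real (N n) powr \<alpha>i i / real (N n))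
                  * (max (real (N n)) (real (T n)) / (real (N n) powr \<alpha> * real (T n))))"
          unfolding B_def lam_def \<delta>_def s_def abs_of_nonneg[OF vnorm0] by (simp only: mult.assoc)
      qed
    qed
    let ?K3 = "\<kappa> ^ 43 * ?K2 * (\<kappa> ^ 7 + \<kappa> ^ 40 * (2 * \<kappa> + 1)) + \<kappa> ^ 49 * CL * ?K1 \<kappa>"
    have K3: "0 < ?K3"
      using K1[OF \<kappa>] K2 \<kappa> CL(1) C0 by (intro add_pos_pos mult_pos_pos) auto
    show "\<exists>K>0. \<forall>\<^sub>F n in sequentially. \<forall>\<omega>. bnd n \<kappa> \<omega> \<longrightarrow>
        \<bar>scalar_prod (Matrix.row (Lhat n \<omega>) i) (Matrix.row (Fhat n \<omega>) t) - M0 n \<omega> $$ (i, t)\<bar>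
        \<le> K * (1 / sqrt (real (T n))
                + sqrt (real (N n) powr \<alpha>i i / real (N n)) * (1 / sqrt (real (N n) powr \<alpha>))
                + sqrt (real (N n) powr \<alpha>i i / real (N n))
                  * (max (real (N n)) (real (T n)) / (real (N n) powr \<alpha> * real (T n)))
                + max (sqrt (real (N n))) (sqrt (real (T n)))
                  / (sqrt (real (N n) powr \<alpha>) * real (T n)))"
    proof (intro exI[of _ ?K3] conjI K3)
      show "\<forall>\<^sub>F n in sequentially. \<forall>\<omega>. bnd n \<kappa> \<omega> \<longrightarrow>
        \<bar>scalar_prod (Matrix.row (Lhat n \<omega>) i) (Matrix.row (Fhat n \<omega>) t) - M0 n \<omega> $$ (i, t)\<bar>
        \<le> ?K3 * (1 / sqrt (real (T n))
                + sqrt (real (N n) powr \<alpha>i i / real (N n)) * (1 / sqrt (real (N n) powr \<alpha>))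
                + sqrt (real (N n) powr \<alpha>i i / real (N n))
                  * (max (real (N n)) (real (T n)) / (real (N n) powr \<alpha> * real (T n)))
                + max (sqrt (real (N n))) (sqrt (real (T n)))
                  / (sqrt (real (N n) powr \<alpha>) * real (T n)))"
        using ev_ok
      proof (eventually_elim, intro allI impI)
        fix n \<omega> assume n: "i < N n \<and> b n \<le> A n * B n" and bnd: "bnd n \<kappa> \<omega>"
        let ?x = "1 / B n + lam n * (1 / A n) + lam n * \<delta> n"
        \<comment> \<open>\<open>?y\<close> is nonnegative, so adding it to the bound only enlarges
          it.\<close>
        let ?y = "max (sqrt (real (N n))) (sqrt (real (T n))) / (A n * real (T n))"
        have "\<bar>scalar_prod (Matrix.row (Lhat n \<omega>) i) (Matrix.row (Fhat n \<omega>) t) - M0 n \<omega> $$ (i, t)\<bar>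
          \<le> (\<kappa> ^ 43 * (err n * l n + 1 / B n)) * (\<kappa> ^ 6 * f n \<omega> + \<kappa> ^ 40 * (err n * f n \<omega> + 1 / A n))
          + (\<kappa> ^ 9 * l n) * (\<kappa> ^ 40 * (err n * f n \<omega> + 1 / A n))"
          using bnd by (simp add: bnd_def)
        also have "\<dots> \<le> ?K3 * ?x"
          using n by (intro rates'(3)[OF \<kappa> _ _ bnd]) auto
        also have "\<dots> \<le> ?K3 * (?x + ?y)"
        proof (rule mult_left_mono[OF _ less_imp_le[OF K3]])
          have "0 \<le> ?y"
            using A1[of n] by (intro divide_nonneg_nonneg mult_nonneg_nonneg) (auto simp: le_max_iff_disj)
          then show "?x \<le> ?x + ?y" by simp
        qed
        finally show "\<bar>scalar_prod (Matrix.row (Lhat n \<omega>) i) (Matrix.row (Fhat n \<omega>) t) - M0 n \<omega> $$ (i, t)\<bar>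
          \<le> ?K3 * (1 / sqrt (real (T n))
                + sqrt (real (N n) powr \<alpha>i i / real (N n)) * (1 / sqrt (real (N n) powr \<alpha>))
                + sqrt (real (N n) powr \<alpha>i i / real (N n))
                  * (max (real (N n)) (real (T n)) / (real (N n) powr \<alpha> * real (T n)))
                + max (sqrt (real (N n))) (sqrt (real (T n)))
                  / (sqrt (real (N n) powr \<alpha>) * real (T n)))"
          unfolding A_def B_def lam_def \<delta>_def s_def .
      qed
    qed
  qed
qed

end
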